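(* The endofunctor $\mathbf{Fa\grave{a}}$ on the category $\mathbf{cartCat}$ of Cartesian categories has the structure of a comonad, with counit $\epsilon: \mathbf{Fa\grave{a}}(\mathbb{X}) \to \mathbb{X}$ given by $$\epsilon((A,+,0),X) = X,\qquad \epsilon(f_*,f_1,f_2,\ldots) = f_*,$$ and comultiplication $\delta: \mathbf{Fa\grave{a}}(\mathbb{X}) \to \mathbf{Fa\grave{a}}^2(\mathbb{X})$ given on objects by $$\delta((A,+,0),X) = \Big(\big(((A,+,0),A),\,(+,\pi_0+,0,0,\ldots),\,(0,\pi_0 0,0,0,\ldots)\big),\ ((A,+,0),X)\Big)$$ and on arrows by the formula for $\delta(f)$ recalled in the context.
   Context: Composition is diagrammatic: $fg$ means first $f$, then $g$. A Cartesian category is a category with chosen finite products (including a chosen terminal object $1$). $\mathbf{cartCat}$ is the category whose objects are Cartesian categories and whose arrows are functors preserving the chosen finite products exactly. For a commutative monoid $(A,+,0)$ in $\mathbb{X}$ and maps $f,g:X\to A$, $f+g := \langle f,g\rangle +$ and $0: X\to A$ denotes $!\,0$. In $A^n\times X$, $\pi_0,\ldots,\pi_{n-1}$ are the projections to the copies of $A$ and $\pi_n$ the projection to $X$. We write $h(z_1,\ldots,z_k)$ for $\langle z_1,\ldots,z_k\rangle h$. The category $\mathbf{Fa\grave{a}}(\mathbb{X})$. Objects: pairs $((A,+,0),X)$, abbreviated $(A,X)$, with $(A,+,0)$ a commutative monoid in $\mathbb{X}$ and $X$ an object of $\mathbb{X}$. A morphism $(A,X)\to(B,Y)$ is a sequence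 $f=(f_*,f_1,f_2,\ldots)$ with $f_*: X\to Y$ a map of $\mathbb{X}$ and, for $n\ge 1$, $f_n: A^n\times X\to B$ a map that is symmetric in its first $n$ arguments and additive (preserves $+$ and $0$) in each of them. Identities: $(1_X,\pi_0,0,0,\ldots)$. Composition of $f:(A,X)\to(B,Y)$ and $g:(B,Y)\to(C,Z)$: $(fg)_*=f_*g_*$ and $$(fg)_n(a_1,\ldots,a_n,x)=\sum_{\{B_1,\ldots,B_k\}} g_k\big(f_{|B_1|}(a_{B_1},x),\ldots,f_{|B_k|}(a_{B_k},x),f_*(x)\big),$$ the sum being over all partitions of $\{1,\ldots,n\}$ into nonempty blocks, with $f_m(a_{B},x)=f_m(a_{i_1},\ldots,a_{i_m},x)$ for $B=\{i_1<\cdots<i_m\}$, and $a_1,\ldots,a_n,x$ the projections from $A^n\times X$. Chosen products: $(A,X)\times(B,Y)=(A\times B, X\times Y)$ with the product monoid structure on $A\times B$, and projections $(\pi_i,\pi_0\pi_i,0,0,\ldots)$, $i=0,1$; the terminal object is $(1,1)$. On a functor $F$ in $\mathbf{cartCat}$: $\mathbf{Fa\grave{a}}(F)((A,+,0),X)=((FA,F+,F0),FX)$ and $\mathbf{Fa\grave{a}}(F)(f_*,f_1,\ldots)=(F(f_* ),F(f_1),\ldots)$. The functor $\delta$ on arrows. For $f:(A,X)\to(B,Y)$, $\delta(f)$ is the arrow of $\mathbf{Fa\grave{a}}^2(\mathbb{X})=\mathbf{Fa\grave{a}}(\mathbf{Fa\grave{a}}(\mathbb{X}))$ with $\delta(f)_*=f$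 and, for $n\geq 1$, $\delta(f)_n: (A,A)^n\times(A,X)=(A^n\times A,\,A^n\times X)\to(B,B)$ the arrow of $\mathbf{Fa\grave{a}}(\mathbb{X})$ with $(\delta(f)_n)_*=f_n$ and, for $r\ge1$, writing the variables of $(A^n\times A)^r\times(A^n\times X)$ as $v^j=(v^j_1,\ldots,v^j_n,w^j)$ for $1\le j\le r$ and $(a_1,\ldots,a_n,x)$, $$(\delta(f)_n)_r = \sum_{(S,\varphi)} f_{n+r-|S|}\big(a^{\varphi}_1,\ldots,a^{\varphi}_n,(w^j)_{j\notin S},x\big),$$ the sum being over all subsets $S\subseteq\{1,\ldots,r\}$ and injections $\varphi:S\to\{1,\ldots,n\}$, where $a^\varphi_i=v^j_i$ if $i=\varphi(j)$ for some $j\in S$ and $a^\varphi_i=a_i$ otherwise. *)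

theory Defs
  imports "HOL-Algebra.FiniteProduct" "HOL-Library.Disjoint_Sets" "HOL-Library.Multiset"
begin

section \<open>Cartesian categories and the functors preserving their chosen products\<close>

text \<open>
  The chosen finite products are given by a chosen terminal object and chosen binary products.
  Composition is diagrammatic: \<open>f \<cdot> g\<close> is first \<open>f\<close>, then \<open>g\<close>.
\<close>

record ('o, 'm) ccat =
  Obj :: "'o set"
  Arr :: "'m set"
  Dom :: "'m \<Rightarrow> 'o"
  Cod :: "'m \<Rightarrow> 'o"
  Ide :: "'o \<Rightarrow> 'm"
  Cmp :: "'m \<Rightarrow> 'm \<Rightarrow> 'm"  (infixl "\<cdot>\<index>" 70)
  One :: "'o"
  Prd :: "'o \<Rightarrow> 'o \<Rightarrow> 'o"
  Pr0 :: "'o \<Rightarrow> 'o \<Rightarrow> 'm"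
  Pr1 :: "'o \<Rightarrow> 'o \<Rightarrow> 'm"

definition Hom :: "('o, 'm) ccat \<Rightarrow> 'o \<Rightarrow> 'o \<Rightarrow> 'm set" where
  "Hom X A B = {f \<in> Arr X. Dom X f = A \<and> Cod X f = B}"

locale cartesian_category =
  fixes X :: "('o, 'm) ccat" (structure)
  assumes Dom_Obj: "f \<in> Arr X \<Longrightarrow> Dom X f \<in> Obj X"
    and Cod_Obj: "f \<in> Arr X \<Longrightarrow> Cod X f \<in> Obj X"
    and Ide_Hom: "A \<in> Obj X \<Longrightarrow> Ide X A \<in> Hom X A A"
    and Cmp_Hom: "f \<in> Hom X A B \<Longrightarrow> g \<in> Hom X B C \<Longrightarrow> f \<cdot> g \<in> Hom X A C"
    and Ide_Cmp: "f \<in> Hom X A B \<Longrightarrow> Ide X A \<cdot> f = f"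
    and Cmp_Ide: "f \<in> Hom X A B \<Longrightarrow> f \<cdot> Ide X B = f"
    and Cmp_assoc: "f \<in> Hom X A B \<Longrightarrow> g \<in> Hom X B C \<Longrightarrow> h \<in> Hom X C D \<Longrightarrow>
          (f \<cdot> g) \<cdot> h = f \<cdot> (g \<cdot> h)"
    and One_Obj: "One X \<in> Obj X"
    and One_universal: "A \<in> Obj X \<Longrightarrow> \<exists>!h. h \<in> Hom X A (One X)"
    and Prd_Obj: "A \<in> Obj X \<Longrightarrow> B \<in> Obj X \<Longrightarrow> Prd X A B \<in> Obj X"
    and Pr0_Hom: "A \<in> Obj X \<Longrightarrow> B \<in> Obj X \<Longrightarrow> Pr0 X A B \<in> Hom X (Prd X A B) A"
    and Pr1_Hom: "A \<in> Obj X \<Longrightarrow> B \<in> Obj X \<Longrightarrow> Pr1 X A B \<in> Hom X (Prd X A B) B"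
    and Prd_universal: "f \<in> Hom X W A \<Longrightarrow> g \<in> Hom X W B \<Longrightarrow>
          \<exists>!h. h \<in> Hom X W (Prd X A B) \<and> h \<cdot> Pr0 X A B = f \<and> h \<cdot> Pr1 X A B = g"

definition pair :: "('o, 'm) ccat \<Rightarrow> 'm \<Rightarrow> 'm \<Rightarrow> 'm" where
  "pair X f g = (THE h. h \<in> Hom X (Dom X f) (Prd X (Cod X f) (Cod X g)) \<and>
      h \<cdot>\<^bsub>X\<^esub> Pr0 X (Cod X f) (Cod X g) = f \<and> h \<cdot>\<^bsub>X\<^esub> Pr1 X (Cod X f) (Cod X g) = g)"

definition bang :: "('o, 'm) ccat \<Rightarrow> 'o \<Rightarrow> 'm" where
  "bang X A = (THE h. h \<in> Hom X A (One X))"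

record ('o, 'm, 'p, 'n) func =
  on_obj :: "'o \<Rightarrow> 'p"
  on_arr :: "'m \<Rightarrow> 'n"

locale cartesian_functor =
  source: cartesian_category X + target: cartesian_category Y
  for X :: "('o, 'm) ccat" and Y :: "('p, 'n) ccat" and F :: "('o, 'm, 'p, 'n) func" +
  assumes on_obj_Obj: "A \<in> Obj X \<Longrightarrow> on_obj F A \<in> Obj Y"
    and on_arr_Hom: "f \<in> Hom X A B \<Longrightarrow> on_arr F f \<in> Hom Y (on_obj F A) (on_obj F B)"
    and on_arr_Ide: "A \<in> Obj X \<Longrightarrow> on_arr F (Ide X A) = Ide Y (on_obj F A)"
    and on_arr_Cmp: "f \<in> Hom X A B \<Longrightarrow> g \<in> Hom X B C \<Longrightarrow>
          on_arr F (f \<cdot>\<^bsub>X\<^esub> g) = on_arr F f \<cdot>\<^bsub>Y\<^esub> on_arr F g"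
    and on_obj_One: "on_obj F (One X) = One Y"
    and on_obj_Prd: "A \<in> Obj X \<Longrightarrow> B \<in> Obj X \<Longrightarrow>
          on_obj F (Prd X A B) = Prd Y (on_obj F A) (on_obj F B)"
    and on_arr_Pr0: "A \<in> Obj X \<Longrightarrow> B \<in> Obj X \<Longrightarrow>
          on_arr F (Pr0 X A B) = Pr0 Y (on_obj F A) (on_obj F B)"
    and on_arr_Pr1: "A \<in> Obj X \<Longrightarrow> B \<in> Obj X \<Longrightarrow>
          on_arr F (Pr1 X A B) = Pr1 Y (on_obj F A) (on_obj F B)"

text \<open>
  The functions underlying a functor are total on their types, so two functors out of \<open>X\<close> are the
  same arrow of the category of Cartesian categories when they agree on the objects and arrows of
  \<open>X\<close>.
\<close>

definition func_eq ::
    "('o, 'm) ccat \<Rightarrow> ('o, 'm, 'p, 'n) func \<Rightarrow> ('o, 'm, 'p, 'n) func \<Rightarrow> bool" where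
  "func_eq X F G \<longleftrightarrow>
     (\<forall>A \<in> Obj X. on_obj F A = on_obj G A) \<and> (\<forall>f \<in> Arr X. on_arr F f = on_arr G f)"

definition id_func :: "('o, 'm, 'o, 'm) func" where
  "id_func = \<lparr>on_obj = \<lambda>A. A, on_arr = \<lambda>f. f\<rparr>"

definition comp_func ::
    "('o, 'm, 'p, 'n) func \<Rightarrow> ('p, 'n, 'q, 'l) func \<Rightarrow> ('o, 'm, 'q, 'l) func"  (infixl "\<Zsemi>" 55)
  where
  "F \<Zsemi> G = \<lparr>on_obj = \<lambda>A. on_obj G (on_obj F A), on_arr = \<lambda>f. on_arr G (on_arr F f)\<rparr>"


section \<open>Commutative monoids in a Cartesian category\<close>

type_synonym ('o, 'm) cmon = "'o \<times> 'm \<times> 'm"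

abbreviation carr :: "('o, 'm) cmon \<Rightarrow> 'o" where
  "carr M \<equiv> fst M"

fun madd :: "('o, 'm) ccat \<Rightarrow> ('o, 'm) cmon \<Rightarrow> 'm \<Rightarrow> 'm \<Rightarrow> 'm" where
  "madd X (A, p, z) f g = pair X f g \<cdot>\<^bsub>X\<^esub> p"

fun mzero :: "('o, 'm) ccat \<Rightarrow> ('o, 'm) cmon \<Rightarrow> 'o \<Rightarrow> 'm" where
  "mzero X (A, p, z) W = bang X W \<cdot>\<^bsub>X\<^esub> z"

fun cmon_in :: "('o, 'm) ccat \<Rightarrow> ('o, 'm) cmon \<Rightarrow> bool" where
  "cmon_in X (A, p, z) \<longleftrightarrow>
     A \<in> Obj X \<and> p \<in> Hom X (Prd X A A) A \<and> z \<in> Hom X (One X) A \<and>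
     (let M = (A, p, z);
          a = Pr0 X A (Prd X A A);
          b = Pr1 X A (Prd X A A) \<cdot>\<^bsub>X\<^esub> Pr0 X A A;
          c = Pr1 X A (Prd X A A) \<cdot>\<^bsub>X\<^esub> Pr1 X A A
      in madd X M (madd X M a b) c = madd X M a (madd X M b c)) \<and>
     pair X (Pr1 X A A) (Pr0 X A A) \<cdot>\<^bsub>X\<^esub> p = p \<and>
     pair X (mzero X (A, p, z) A) (Ide X A) \<cdot>\<^bsub>X\<^esub> p = Ide X A \<and>
     pair X (Ide X A) (mzero X (A, p, z) A) \<cdot>\<^bsub>X\<^esub> p = Ide X A"

definition hom_monoid :: "('o, 'm) ccat \<Rightarrow> 'o \<Rightarrow> ('o, 'm) cmon \<Rightarrow> 'm monoid" where
  "hom_monoid X W M = \<lparr>carrier = Hom X W (carr M), monoid.mult = madd X M, one = mzero X M W\<rparr>"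

definition msum :: "('o, 'm) ccat \<Rightarrow> 'o \<Rightarrow> ('o, 'm) cmon \<Rightarrow> ('i \<Rightarrow> 'm) \<Rightarrow> 'i set \<Rightarrow> 'm" where
  "msum X W M t I = finprod (hom_monoid X W M) t I"

fun prod_cmon :: "('o, 'm) ccat \<Rightarrow> ('o, 'm) cmon \<Rightarrow> ('o, 'm) cmon \<Rightarrow> ('o, 'm) cmon" where
  "prod_cmon X (A, p, z) (B, q, w) =
     (let P = Prd X A B; l = Pr0 X P P; r = Pr1 X P P in
       (P,
        pair X (madd X (A, p, z) (l \<cdot>\<^bsub>X\<^esub> Pr0 X A B) (r \<cdot>\<^bsub>X\<^esub> Pr0 X A B))
               (madd X (B, q, w) (l \<cdot>\<^bsub>X\<^esub> Pr1 X A B) (r \<cdot>\<^bsub>X\<^esub> Pr1 X A B)),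
        pair X z w))"

definition one_cmon :: "('o, 'm) ccat \<Rightarrow> ('o, 'm) cmon" where
  "one_cmon X = (One X, bang X (Prd X (One X) (One X)), bang X (One X))"


section \<open>The category of Faa di Bruno sequences\<close>

text \<open>
  \<open>A\<^sup>n \<times> Y\<close> is bracketed as \<open>A \<times> (A \<times> \<dots> (A \<times> Y))\<close>, so that \<open>A\<^sup>0 \<times> Y\<close> is \<open>Y\<close>, and so that
  \<open>(A, A)\<^sup>n \<times> (A, X)\<close> is exactly \<open>(A\<^sup>n \<times> A, A\<^sup>n \<times> X)\<close>.
\<close>

definition powprd :: "('o, 'm) ccat \<Rightarrow> 'o \<Rightarrow> nat \<Rightarrow> 'o \<Rightarrow> 'o" where
  "powprd X A n Y = (Prd X A ^^ n) Y"

text \<open>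
  The projections \<open>\<pi>\<^sub>0, \<dots>, \<pi>\<^sub>n\<close> of \<open>A\<^sup>n \<times> Y\<close>; the last one, of index \<open>n\<close>, goes to \<open>Y\<close>.
\<close>

fun proj :: "('o, 'm) ccat \<Rightarrow> 'o \<Rightarrow> nat \<Rightarrow> 'o \<Rightarrow> nat \<Rightarrow> 'm" where
  "proj X A 0 Y i = Ide X Y"
| "proj X A (Suc n) Y 0 = Pr0 X A (powprd X A n Y)"
| "proj X A (Suc n) Y (Suc i) = Pr1 X A (powprd X A n Y) \<cdot>\<^bsub>X\<^esub> proj X A n Y i"

text \<open>The map \<open>h(z\<^sub>1, \<dots>, z\<^sub>k, y) = \<langle>z\<^sub>1, \<dots>, z\<^sub>k, y\<rangle> h\<close>.\<close>

definition app :: "('o, 'm) ccat \<Rightarrow> 'm \<Rightarrow> 'm list \<Rightarrow> 'm \<Rightarrow> 'm" where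
  "app X h zs y = foldr (pair X) zs y \<cdot>\<^bsub>X\<^esub> h"

definition sym_map :: "('o, 'm) ccat \<Rightarrow> 'o \<Rightarrow> nat \<Rightarrow> 'o \<Rightarrow> 'm \<Rightarrow> bool" where
  "sym_map X A n Y h \<longleftrightarrow>
     (\<forall>W \<in> Obj X. \<forall>y \<in> Hom X W Y. \<forall>as bs.
        length as = n \<and> set as \<subseteq> Hom X W A \<and> mset bs = mset as \<longrightarrow> app X h bs y = app X h as y)"

definition multiadditive ::
    "('o, 'm) ccat \<Rightarrow> ('o, 'm) cmon \<Rightarrow> nat \<Rightarrow> 'o \<Rightarrow> ('o, 'm) cmon \<Rightarrow> 'm \<Rightarrow> bool" where
  "multiadditive X M n Y N h \<longleftrightarrow>
     (\<forall>W \<in> Obj X. \<forall>y \<in> Hom X W Y. \<forall>as. length as = n \<and> set as \<subseteq> Hom X W (carr M) \<longrightarrow>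
        (\<forall>i < n.
           (\<forall>b \<in> Hom X W (carr M). \<forall>c \<in> Hom X W (carr M).
              app X h (as[i := madd X M b c]) y =
              madd X N (app X h (as[i := b]) y) (app X h (as[i := c]) y)) \<and>
           app X h (as[i := mzero X M W]) y = mzero X N W))"

type_synonym ('o, 'm) faa_obj = "('o, 'm) cmon \<times> 'o"

text \<open>
  The sequence \<open>(f\<^sub>*, f\<^sub>1, f\<^sub>2, \<dots>)\<close> is a function on \<open>nat\<close>, with \<open>f\<^sub>*\<close> at index \<open>0\<close>.
\<close>

datatype ('o, 'm) faa_arr =
  FArr (fdom: "('o, 'm) faa_obj") (fcod: "('o, 'm) faa_obj") (fseq: "nat \<Rightarrow> 'm")

fun faa_ob :: "('o, 'm) ccat \<Rightarrow> ('o, 'm) faa_obj \<Rightarrow> bool" where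
  "faa_ob X (M, U) \<longleftrightarrow> cmon_in X M \<and> U \<in> Obj X"

fun faa_ar :: "('o, 'm) ccat \<Rightarrow> ('o, 'm) faa_arr \<Rightarrow> bool" where
  "faa_ar X (FArr (M, U) (N, V) f) \<longleftrightarrow>
     faa_ob X (M, U) \<and> faa_ob X (N, V) \<and> f 0 \<in> Hom X U V \<and>
     (\<forall>n \<ge> 1. f n \<in> Hom X (powprd X (carr M) n U) (carr N) \<and>
        sym_map X (carr M) n U (f n) \<and> multiadditive X M n U N (f n))"

text \<open>The sequence \<open>(h, k, 0, 0, \<dots>)\<close>.\<close>

fun first_order ::
    "('o, 'm) ccat \<Rightarrow> ('o, 'm) faa_obj \<Rightarrow> ('o, 'm) faa_obj \<Rightarrow> 'm \<Rightarrow> 'm \<Rightarrow> ('o, 'm) faa_arr" where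
  "first_order X (M, U) (N, V) h k =
     FArr (M, U) (N, V)
       (\<lambda>n. if n = 0 then h else if n = 1 then k else mzero X N (powprd X (carr M) n U))"

fun faa_ide :: "('o, 'm) ccat \<Rightarrow> ('o, 'm) faa_obj \<Rightarrow> ('o, 'm) faa_arr" where
  "faa_ide X (M, U) = first_order X (M, U) (M, U) (Ide X U) (Pr0 X (carr M) U)"

text \<open>
  In the composite, the blocks of a partition may be listed in any order, as the components of the
  second arrow are symmetric. The arguments are indexed from \<open>0\<close>, so the sum is over the partitions
  of \<open>{..<n}\<close>.
\<close>

definition blocks :: "nat set set \<Rightarrow> nat set list" where
  "blocks P = (SOME Bs. distinct Bs \<and> set Bs = P)"

fun faa_cmp :: "('o, 'm) ccat \<Rightarrow> ('o, 'm) faa_arr \<Rightarrow> ('o, 'm) faa_arr \<Rightarrow> ('o, 'm) faa_arr" where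
  "faa_cmp X (FArr (M, U) NV f) (FArr NV' (L, T) g) =
     FArr (M, U) (L, T)
       (\<lambda>n. if n = 0 then f 0 \<cdot>\<^bsub>X\<^esub> g 0
         else
           let a = proj X (carr M) n U; x = proj X (carr M) n U n in
           msum X (powprd X (carr M) n U) L
             (\<lambda>P. app X (g (card P))
                (map (\<lambda>B. app X (f (card B)) (map a (sorted_list_of_set B)) x) (blocks P))
                (x \<cdot>\<^bsub>X\<^esub> f 0))
             {P. partition_on {..<n} P})"

fun faa_prd :: "('o, 'm) ccat \<Rightarrow> ('o, 'm) faa_obj \<Rightarrow> ('o, 'm) faa_obj \<Rightarrow> ('o, 'm) faa_obj" where
  "faa_prd X (M, U) (N, V) = (prod_cmon X M N, Prd X U V)"

fun faa_pr0 :: "('o, 'm) ccat \<Rightarrow> ('o, 'm) faa_obj \<Rightarrow> ('o, 'm) faa_obj \<Rightarrow> ('o, 'm) faa_arr" where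
  "faa_pr0 X (M, U) (N, V) =
     first_order X (faa_prd X (M, U) (N, V)) (M, U) (Pr0 X U V)
       (Pr0 X (Prd X (carr M) (carr N)) (Prd X U V) \<cdot>\<^bsub>X\<^esub> Pr0 X (carr M) (carr N))"

fun faa_pr1 :: "('o, 'm) ccat \<Rightarrow> ('o, 'm) faa_obj \<Rightarrow> ('o, 'm) faa_obj \<Rightarrow> ('o, 'm) faa_arr" where
  "faa_pr1 X (M, U) (N, V) =
     first_order X (faa_prd X (M, U) (N, V)) (N, V) (Pr1 X U V)
       (Pr0 X (Prd X (carr M) (carr N)) (Prd X U V) \<cdot>\<^bsub>X\<^esub> Pr1 X (carr M) (carr N))"

definition Faa :: "('o, 'm) ccat \<Rightarrow> (('o, 'm) faa_obj, ('o, 'm) faa_arr) ccat" where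
  "Faa X =
     \<lparr>Obj = {P. faa_ob X P},
      Arr = {f. faa_ar X f},
      Dom = fdom,
      Cod = fcod,
      Ide = faa_ide X,
      Cmp = faa_cmp X,
      One = (one_cmon X, One X),
      Prd = faa_prd X,
      Pr0 = faa_pr0 X,
      Pr1 = faa_pr1 X\<rparr>"

fun Faa_func_obj :: "('o, 'm, 'p, 'n) func \<Rightarrow> ('o, 'm) faa_obj \<Rightarrow> ('p, 'n) faa_obj" where
  "Faa_func_obj F ((A, p, z), U) = ((on_obj F A, on_arr F p, on_arr F z), on_obj F U)"

fun Faa_func_arr :: "('o, 'm, 'p, 'n) func \<Rightarrow> ('o, 'm) faa_arr \<Rightarrow> ('p, 'n) faa_arr" where
  "Faa_func_arr F (FArr P Q f) =
     FArr (Faa_func_obj F P) (Faa_func_obj F Q) (\<lambda>n. on_arr F (f n))"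

definition Faa_func :: "('o, 'm, 'p, 'n) func \<Rightarrow>
    (('o, 'm) faa_obj, ('o, 'm) faa_arr, ('p, 'n) faa_obj, ('p, 'n) faa_arr) func" where
  "Faa_func F = \<lparr>on_obj = Faa_func_obj F, on_arr = Faa_func_arr F\<rparr>"


section \<open>Counit and comultiplication\<close>

definition counit :: "('o, 'm) ccat \<Rightarrow> (('o, 'm) faa_obj, ('o, 'm) faa_arr, 'o, 'm) func" where
  "counit X = \<lparr>on_obj = snd, on_arr = \<lambda>f. fseq f 0\<rparr>"

fun delta_obj ::
    "('o, 'm) ccat \<Rightarrow> ('o, 'm) faa_obj \<Rightarrow> (('o, 'm) faa_obj, ('o, 'm) faa_arr) faa_obj" where
  "delta_obj X ((A, p, z), U) =
     (let AA = ((A, p, z), A) in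
       ((AA,
         first_order X (Prd (Faa X) AA AA) AA p (Pr0 X (Prd X A A) (Prd X A A) \<cdot>\<^bsub>X\<^esub> p),
         first_order X (One (Faa X)) AA z (Pr0 X (One X) (One X) \<cdot>\<^bsub>X\<^esub> z)),
        ((A, p, z), U)))"

definition partial_injections :: "nat \<Rightarrow> nat \<Rightarrow> (nat set \<times> (nat \<Rightarrow> nat)) set" where
  "partial_injections r n = (SIGMA S : Pow {..<r}. {\<phi> \<in> S \<rightarrow>\<^sub>E {..<n}. inj_on \<phi> S})"

text \<open>
  The map \<open>(\<delta>(f)\<^sub>n)\<^sub>r\<close> for \<open>n, r \<ge> 1\<close>, on \<open>(A\<^sup>n \<times> A)\<^sup>r \<times> (A\<^sup>n \<times> U)\<close>. All arguments are indexed from \<open>0\<close>: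
  \<open>v j i\<close> with \<open>i < n\<close> and \<open>w j\<close> are the components of the \<open>j\<close>-th copy of \<open>A\<^sup>n \<times> A\<close>, for \<open>j < r\<close>, and
  \<open>a i\<close> with \<open>i < n\<close> and \<open>x\<close> are those of \<open>A\<^sup>n \<times> U\<close>.
\<close>

fun delta_comp :: "('o, 'm) ccat \<Rightarrow> ('o, 'm) faa_arr \<Rightarrow> nat \<Rightarrow> nat \<Rightarrow> 'm" where
  "delta_comp X (FArr (M, U) (N, V) f) n r =
     (let A = carr M;
          D = powprd X A n A;
          E = powprd X A n U;
          v = (\<lambda>j i. proj X D r E j \<cdot>\<^bsub>X\<^esub> proj X A n A i);
          w = (\<lambda>j. proj X D r E j \<cdot>\<^bsub>X\<^esub> proj X A n A n);
          a = (\<lambda>i. proj X D r E r \<cdot>\<^bsub>X\<^esub> proj X A n U i);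
          x = proj X D r E r \<cdot>\<^bsub>X\<^esub> proj X A n U n
      in msum X (powprd X D r E) N
           (\<lambda>(S, \<phi>). app X (f (n + r - card S))
              (map (\<lambda>i. if i \<in> \<phi> ` S then v (the_inv_into S \<phi> i) i else a i) [0..<n] @
               map w (filter (\<lambda>j. j \<notin> S) [0..<r]))
              x)
           (partial_injections r n))"

fun delta_arr ::
    "('o, 'm) ccat \<Rightarrow> ('o, 'm) faa_arr \<Rightarrow> (('o, 'm) faa_obj, ('o, 'm) faa_arr) faa_arr" where
  "delta_arr X (FArr (M, U) (N, V) f) =
     FArr (delta_obj X (M, U)) (delta_obj X (N, V))
       (\<lambda>n. if n = 0 then FArr (M, U) (N, V) f
         else
           FArr (powprd (Faa X) (M, carr M) n (M, U)) (N, carr N)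
             (\<lambda>r. if r = 0 then f n else delta_comp X (FArr (M, U) (N, V) f) n r))"

definition comult :: "('o, 'm) ccat \<Rightarrow>
    (('o, 'm) faa_obj, ('o, 'm) faa_arr,
     (('o, 'm) faa_obj, ('o, 'm) faa_arr) faa_obj,
     (('o, 'm) faa_obj, ('o, 'm) faa_arr) faa_arr) func" where
  "comult X = \<lparr>on_obj = delta_obj X, on_arr = delta_arr X\<rparr>"

end

theory Submission
  imports Defs "HOL-Combinatorics.Permutations"
begin

text \<open>
  A Cartesian category is studied through its models, the product-preserving functors to sets;
  equations between arrows may be checked on the points of a jointly faithful family of models, such
  as the representable ones. A model \<open>G\<close> of \<open>X\<close> and a finite set \<open>J\<close> give a model of \<open>Faa X\<close>, whose
  points over \<open>(A, U)\<close> are the families indexed by the subsets of \<open>J\<close>, with values in \<open>A\<close> except at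
  the empty set, where the value is in \<open>U\<close>; a sequence \<open>f\<close> acts by
  \<open>S \<mapsto> \<Sum>\<^bsub>P partition of S\<^esub> f\<^bsub>|P|\<^esub>((a\<^sub>B)\<^bsub>B \<in> P\<^esub>, a\<^bsub>{}\<^esub>)\<close>. The formula of Faa di Bruno says that this action is
  functorial, because a refinement of a partition is a partition of the set of blocks of the finer
  one; and these models are again jointly faithful. Prolonging by \<open>J\<close> and then by a disjoint set \<open>I\<close>
  gives a model of \<open>Faa (Faa X)\<close> in which \<open>\<delta>(f)\<close> acts as \<open>f\<close> does in the prolongation by \<open>I \<union> J\<close>: the
  sum over partial injections in \<open>\<delta>(f)\<close> counts the ways to glue partitions of subsets of \<open>I\<close> and \<open>J\<close>
  to a partition of their union. The functoriality of \<open>\<delta>\<close> is then that of a single prolongation, and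
  both composites in the coassociativity law act as \<open>f\<close> in the prolongation by a union of three sets.
\<close>


section \<open>Sums in commutative monoids\<close>

text \<open>The defining formulas list arguments in a fixed order and reach them through nested
  projections, so a direct calculation would renumber blocks at every step. On the points of a model
  the arguments form a family over any finite set, a symmetric component depends only on a multiset,
  and an identity of sums becomes a bijection of index sets. \<open>Faa X\<close> is recognised as a
  category in the same way: \<open>set_model\<close> presupposes none of the category laws, so
  prolongations are available while these laws are still open, and joint faithfulness reflects the
  laws from functions. The type of points changes with every prolongation, so one cannot quantify
  over all models at once; the locale \<open>separated\<close> carries a chosen jointly faithful
  set, and \<open>Faa\<close> passes such a set on. Index sets of prolongations are finite sets of
  natural numbers. Replacing pairs of subsets of \<open>I\<close> and \<open>J\<close> by subsets of
  \<open>I \<union> J\<close> loses nothing when \<open>I\<close> and \<open>J\<close> are disjoint,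
  and joint faithfulness survives this restriction because recovering a component depends only on
  the cardinality of the index set.\<close>

lemma (in comm_monoid) finprod_mult_eq:
  assumes "\<And>i. i \<in> I \<Longrightarrow> f i \<in> carrier G" "\<And>i. i \<in> I \<Longrightarrow> g i \<in> carrier G"
    and "\<And>i. i \<in> I \<Longrightarrow> h i = f i \<otimes> g i"
  shows "finprod G h I = finprod G f I \<otimes> finprod G g I"
proof -
  have "finprod G h I = finprod G (\<lambda>i. f i \<otimes> g i) I"
    by (rule finprod_cong') (use assms in auto)
  then show ?thesis using assms by simp
qed

lemma (in comm_monoid) finprod_bij_betw:
  assumes "bij_betw h A B" and "g \<in> B \<rightarrow> carrier G" and "\<And>a. a \<in> A \<Longrightarrow> f a = g (h a)"
  shows "finprod G f A = finprod G g B"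
proof -
  have B: "B = h ` A" and inj: "inj_on h A"
    using assms(1) by (auto simp: bij_betw_def)
  have "finprod G g B = finprod G (\<lambda>x. g (h x)) A"
    unfolding B by (rule finprod_reindex) (use assms(2) B inj in auto)
  also have "\<dots> = finprod G f A"
    by (rule finprod_cong') (use assms(2,3) B in auto)
  finally show ?thesis by simp
qed

lemma (in comm_monoid) finprod_Sigma:
  assumes "finite I" and "\<And>i. i \<in> I \<Longrightarrow> finite (J i)"
    and "\<And>i j. i \<in> I \<Longrightarrow> j \<in> J i \<Longrightarrow> f i j \<in> carrier G"
  shows "finprod G (\<lambda>i. finprod G (f i) (J i)) I = finprod G (\<lambda>(i, j). f i j) (Sigma I J)"
  using assms
proof (induction I rule: finite_induct)
  case empty
  then show ?case by simp
next
  case (insert i I)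
  have S: "Sigma (insert i I) J = Pair i ` J i \<union> Sigma I J"
    by auto
  have "finprod G (\<lambda>(i, j). f i j) (Sigma (insert i I) J) =
      finprod G (\<lambda>(i, j). f i j) (Pair i ` J i) \<otimes> finprod G (\<lambda>(i, j). f i j) (Sigma I J)"
    unfolding S by (rule finprod_Un_disjoint) (use insert in auto)
  also have "finprod G (\<lambda>(i, j). f i j) (Pair i ` J i) = finprod G (f i) (J i)"
    by (subst finprod_reindex) (use insert in \<open>auto simp: inj_on_def\<close>)
  finally show ?case
    using insert by (subst finprod_insert) auto
qed

text \<open>For infinite \<open>I\<close> both products are the unit by convention, which
  \<open>one\<close> covers, so no finiteness is assumed. The homomorphisms in view are evaluation
  of arrows at a point, a multiadditive map in one argument, and evaluation of a family at a
  subset.\<close>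

lemma finprod_hom:
  assumes "comm_monoid G" "comm_monoid H"
    and clo: "\<And>a. a \<in> carrier G \<Longrightarrow> h a \<in> carrier H"
    and mult: "\<And>a b. a \<in> carrier G \<Longrightarrow> b \<in> carrier G \<Longrightarrow> h (a \<otimes>\<^bsub>G\<^esub> b) = h a \<otimes>\<^bsub>H\<^esub> h b"
    and one: "h \<one>\<^bsub>G\<^esub> = \<one>\<^bsub>H\<^esub>"
    and f: "f \<in> I \<rightarrow> carrier G"
  shows "h (finprod G f I) = finprod H (\<lambda>i. h (f i)) I"
proof -
  interpret G: comm_monoid G by fact
  interpret H: comm_monoid H by fact
  show ?thesis
    using f
  proof (induction I rule: infinite_finite_induct)
    case (insert i I)
    have "(\<lambda>i. h (f i)) \<in> I \<rightarrow> carrier H"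
      using insert clo by auto
    then show ?case
      using insert clo mult by (simp add: Pi_iff)
  qed (use one in auto)
qed

lemma (in comm_monoid) finprod_eq_single:
  assumes "finite I" "i \<in> I" "\<And>j. j \<in> I \<Longrightarrow> j \<noteq> i \<Longrightarrow> f j = \<one>" "f i \<in> carrier G"
  shows "finprod G f I = f i"
proof -
  have "finprod G f {i} = finprod G f I"
    by (rule finprod_mono_neutral_cong_left) (use assms in \<open>auto simp: Pi_iff, metis one_closed\<close>)
  then show ?thesis using assms by simp
qed


section \<open>Partitions\<close>

abbreviation partitions :: "'a set \<Rightarrow> 'a set set set" where
  "partitions S \<equiv> {P. partition_on S P}"

lemma partition_block: "partition_on S P \<Longrightarrow> B \<in> P \<Longrightarrow> B \<subseteq> S \<and> B \<noteq> {}"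
  by (auto simp: partition_on_def)

lemma partition_unique: "partition_on S P \<Longrightarrow> B \<in> P \<Longrightarrow> C \<in> P \<Longrightarrow> x \<in> B \<Longrightarrow> x \<in> C \<Longrightarrow> B = C"
  by (auto simp: partition_on_def disjoint_def)

lemma partition_image:
  assumes "inj_on h K" "partition_on K P"
  shows "partition_on (h ` K) ((`) h ` P)"
proof -
  have "{} \<notin> (`) h ` P" using assms(2) by (auto simp: partition_on_def)
  then show ?thesis
    using partition_on_inj_image[OF assms(2,1)] by simp
qed

text \<open>Composition sums over the partitions of \<open>{..<n}\<close>, whereas in iterated sums
  the indices are the blocks of another partition; this transports the one to the other. The inverse
  is the double image under the inverse of \<open>h\<close>.\<close>

lemma bij_betw_partitions:
  assumes "bij_betw h K K'"
  shows "bij_betw ((`) ((`) h)) (partitions K) (partitions K')"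
proof -
  have inj: "inj_on h K" and K': "K' = h ` K" using assms by (auto simp: bij_betw_def)
  let ?g = "the_inv_into K h"
  have injg: "inj_on ?g K'" and K: "K = ?g ` K'"
    using inj K' by (auto simp: inj_on_the_inv_into the_inv_into_onto)
  have gh: "(`) ?g ` ((`) h ` P) = P" if "partition_on K P" for P
  proof -
    have "?g ` (h ` B) = B" if "B \<in> P" for B
    proof -
      have "B \<subseteq> K" using \<open>partition_on K P\<close> that partition_block by blast
      then have "x \<in> B \<Longrightarrow> ?g (h x) = x" for x
        using inj by (meson the_inv_into_f_f subsetD)
      then show ?thesis by (force simp: image_iff)
    qed
    then show ?thesis by (simp add: image_image)
  qed
  have hg: "(`) h ` ((`) ?g ` P) = P" if "partition_on K' P" for P
  proof -
    have "h ` (?g ` B) = B" if "B \<in> P" for B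
    proof -
      have "B \<subseteq> h ` K" using \<open>partition_on K' P\<close> that partition_block K' by blast
      then have "x \<in> B \<Longrightarrow> h (?g x) = x" for x
        using inj by (meson f_the_inv_into_f subsetD)
      then show ?thesis by (force simp: image_iff)
    qed
    then show ?thesis by (simp add: image_image)
  qed
  show ?thesis
    by (rule bij_betw_byWitness[where f' = "(`) ((`) ?g)"])
      (use gh hg partition_image[OF inj] partition_image[OF injg] K K' in auto)
qed

text \<open>
  Refining each block of \<open>Q\<close> by a partition \<open>s B\<close> is the same as giving the refined partition
  \<open>P\<close> together with a partition of the set \<open>P\<close> of its blocks.
\<close>

lemma bij_betw_refinements:
  "bij_betw (\<lambda>(Q, s). (\<Union>(s ` Q), s ` Q))
     (SIGMA Q : partitions S. Pi\<^sub>E Q partitions) (SIGMA P : partitions S. partitions P)"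
  (is "bij_betw ?f ?A ?B")
proof -
  \<comment> \<open>A partition determines the set it partitions, so both \<open>Q\<close> and
    \<open>s\<close> can be read off from the image of \<open>Q\<close> under
    \<open>s\<close>.\<close>
  have inv: "\<Union>(s B) = B" if "s \<in> Pi\<^sub>E Q partitions" "B \<in> Q" for Q and s :: "'a set \<Rightarrow> 'a set set" and B
    using that by (auto simp: PiE_iff partition_on_def)
  have UQ: "Union ` (s ` Q) = Q" if "s \<in> Pi\<^sub>E Q partitions" for Q and s :: "'a set \<Rightarrow> 'a set set"
    using inv[OF that] by (force simp: image_image)
  have inj: "inj_on ?f ?A"
  proof (rule inj_onI, clarify)
    fix Q Q' and s s' :: "'a set \<Rightarrow> 'a set set"
    assume s: "s \<in> Pi\<^sub>E Q partitions" and s': "s' \<in> Pi\<^sub>E Q' partitions" and eq: "s ` Q = s' ` Q'"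
    have QQ: "Q = Q'" by (rule trans[OF UQ[OF s, symmetric, unfolded eq] UQ[OF s']])
    have "s B = s' B" if "B \<in> Q" for B
    proof -
      have "s B \<in> s' ` Q'" unfolding eq[symmetric] using that by (rule imageI)
      then obtain B' where B': "B' \<in> Q'" "s B = s' B'" by (auto simp only: image_iff)
      have "B = B'"
        by (rule trans[OF inv[OF s that, symmetric, unfolded B'(2)] inv[OF s' B'(1)]])
      then show ?thesis using B' by simp
    qed
    then show "Q = Q' \<and> s = s'"
      using QQ PiE_ext[OF s] s' by blast
  qed
  moreover have "?f ` ?A = ?B"
  proof (intro equalityI subsetI)
    fix z assume "z \<in> ?f ` ?A"
    then obtain Q s where z: "z = (\<Union>(s ` Q), s ` Q)" and Q: "partition_on S Q"
      and s: "s \<in> Pi\<^sub>E Q partitions" by auto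
    have sB: "partition_on B (s B)" if "B \<in> Q" for B
      using s that by (auto simp: PiE_iff)
    have "partition_on S (\<Union>(s ` Q))"
    proof (rule partition_onI)
      have "\<Union>(\<Union>(s ` Q)) = (\<Union>B \<in> Q. \<Union>(s B))" by blast
      then show "\<Union>(\<Union>(s ` Q)) = S"
        using inv[OF s] Q by (simp add: partition_on_def)
      show "{} \<notin> \<Union>(s ` Q)" using sB by (auto simp: partition_on_def)
      fix p q assume "p \<in> \<Union>(s ` Q)" "q \<in> \<Union>(s ` Q)" "p \<noteq> q"
      then obtain B C where BC: "B \<in> Q" "C \<in> Q" "p \<in> s B" "q \<in> s C" by blast
      then show "disjnt p q"
        using \<open>p \<noteq> q\<close> partition_unique[OF Q BC(1,2)] partition_unique[OF sB[OF BC(1)]]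
          partition_block[OF sB[OF BC(1)]] partition_block[OF sB[OF BC(2)]]
        unfolding disjnt_iff by (metis subsetD)
    qed
    moreover have "partition_on (\<Union>(s ` Q)) (s ` Q)"
    proof (rule partition_onI)
      show "{} \<notin> s ` Q"
        using inv[OF s] Q by (metis Sup_empty imageE partition_onD3)
      fix p q assume "p \<in> s ` Q" "q \<in> s ` Q" "p \<noteq> q"
      then obtain B C where BC: "B \<in> Q" "C \<in> Q" "p = s B" "q = s C" by blast
      have "r \<in> p \<Longrightarrow> r \<in> q \<Longrightarrow> False" for r
      proof -
        assume "r \<in> p" "r \<in> q"
        then have "r \<subseteq> B" "r \<subseteq> C" "r \<noteq> {}"
          using BC partition_block[OF sB[OF BC(1)]] partition_block[OF sB[OF BC(2)]] by auto
        then have "B = C" using partition_unique[OF Q BC(1,2)] by blast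
        then show False using BC \<open>p \<noteq> q\<close> by simp
      qed
      then show "disjnt p q" by (auto simp: disjnt_iff)
    qed simp
    ultimately show "z \<in> ?B" using z by simp
  next
    fix z assume "z \<in> ?B"
    then obtain P R where z: "z = (P, R)" and P: "partition_on S P" and R: "partition_on P R" by auto
    have uni: "C = C'" if "C \<in> R" "C' \<in> R" "x \<in> \<Union>C" "x \<in> \<Union>C'" for C C' x
    proof -
      obtain p p' where "p \<in> C" "p' \<in> C'" "x \<in> p" "x \<in> p'" using \<open>x \<in> \<Union>C\<close> \<open>x \<in> \<Union>C'\<close> by blast
      moreover then have "p = p'"
        using partition_unique[OF P, of p p' x] R that partition_onD1 by blast
      ultimately show ?thesis using partition_unique[OF R that(1,2)] by blast
    qed
    have ne: "\<Union>C \<noteq> {}" if "C \<in> R" for C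
      using that P R unfolding partition_on_def
      by (metis Sup_empty Union_empty_conv UnionI equals0I)
    have injU: "inj_on Union R"
    proof (rule inj_onI)
      fix C C' assume C: "C \<in> R" "C' \<in> R" "\<Union>C = \<Union>C'"
      obtain x where "x \<in> \<Union>C" using ne[OF C(1)] by blast
      then show "C = C'" using uni[OF C(1,2)] C(3) by simp
    qed
    \<comment> \<open>Conversely \<open>R\<close> coarsens \<open>P\<close>: the blocks of
      \<open>Q\<close> are the unions of the members of \<open>R\<close>, and \<open>s\<close> sends
      each union back to the member it came from.\<close>
    define Q where "Q = Union ` R"
    define s where "s = restrict (the_inv_into R Union) Q"
    have sU: "s (\<Union>C) = C" if "C \<in> R" for C
      using that injU by (simp add: s_def Q_def the_inv_into_f_f)
    have "partition_on S Q"
    proof (rule partition_onI)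
      show "\<Union>Q = S" using P R by (auto simp: Q_def partition_on_def)
      show "{} \<notin> Q" using ne by (auto simp: Q_def)
      show "disjnt p q" if "p \<in> Q" "q \<in> Q" "p \<noteq> q" for p q
        using that uni unfolding disjnt_iff Q_def by blast
    qed
    moreover have "partition_on B (s B)" if "B \<in> Q" for B
    proof -
      obtain C where C: "C \<in> R" "B = \<Union>C" using \<open>B \<in> Q\<close> by (auto simp: Q_def)
      then have "C \<subseteq> P" using R partition_block by blast
      then have "partition_on (\<Union>C) C"
        using P by (auto simp: partition_on_def disjoint_def)
      then show ?thesis using C sU by simp
    qed
    moreover have "s \<in> extensional Q" by (simp add: s_def)
    moreover have "s ` Q = R" using sU by (force simp: Q_def image_image)
    moreover have "\<Union>R = P" using R by (auto simp: partition_on_def)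
    ultimately show "z \<in> ?f ` ?A"
      unfolding z by (intro image_eqI[where x = "(Q, s)"]) (auto simp: PiE_iff)
  qed
  ultimately show ?thesis by (simp add: bij_betw_def)
qed

text \<open>A multiset indexed by \<open>Q\<close> through \<open>s\<close> has the same
  multiplicities as one indexed by the image of \<open>s\<close>; this is what
  \<open>bij_betw_refinements\<close> needs in order to match summands.\<close>

lemma inj_on_refinement:
  assumes "s \<in> Pi\<^sub>E Q partitions" shows "inj_on s Q"
proof (rule inj_onI)
  fix B C assume "B \<in> Q" "C \<in> Q" "s B = s C"
  moreover have "\<Union>(s D) = D" if "D \<in> Q" for D
    using assms that by (auto simp: PiE_iff partition_on_def)
  ultimately show "B = C" by metis
qed

text \<open>
  The pairs \<open>(S, \<phi>)\<close> of the formula for \<open>\<delta>(f)\<close> are encoded by the graphs of the injections \<open>\<phi>\<close>,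
  which makes the roles of the two sets symmetric.
\<close>

definition matchings :: "'p set \<Rightarrow> 'k set \<Rightarrow> ('p \<times> 'k) set set" where
  "matchings P K = {R. R \<subseteq> P \<times> K \<and> inj_on fst R \<and> inj_on snd R}"

lemma finite_matchings: "finite P \<Longrightarrow> finite K \<Longrightarrow> finite (matchings P K)"
  by (rule finite_subset[of _ "Pow (P \<times> K)"]) (auto simp: matchings_def)

lemma matchings_empty: "matchings {} K = {{}}"
  by (auto simp: matchings_def)

lemma finite_matching: "R \<in> matchings P K \<Longrightarrow> finite P \<Longrightarrow> finite K \<Longrightarrow> finite R"
  by (auto simp: matchings_def intro: finite_subset)

lemma matching_fst: "R \<in> matchings P K \<Longrightarrow> (p, k) \<in> R \<Longrightarrow> (p, k') \<in> R \<Longrightarrow> k = k'"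
  unfolding matchings_def inj_on_def by fastforce

lemma matching_snd: "R \<in> matchings P K \<Longrightarrow> (p, k) \<in> R \<Longrightarrow> (p', k) \<in> R \<Longrightarrow> p = p'"
  unfolding matchings_def inj_on_def by fastforce

lemma matching_sub: "R \<in> matchings P K \<Longrightarrow> (p, k) \<in> R \<Longrightarrow> p \<in> P \<and> k \<in> K"
  by (auto simp: matchings_def)

text \<open>The arguments of \<open>f\<close> in the summand of
  \<open>(\<delta>(f)\<^sub>n)\<^sub>r\<close> belonging to the injection with graph
  \<open>R\<close>: \<open>K\<close> labels the \<open>n\<close> slots and \<open>P\<close> the
  \<open>r\<close> vectors substituted into them or appended.\<close>

definition match_mset ::
  "('p \<Rightarrow> 'k \<Rightarrow> 'e) \<Rightarrow> ('k \<Rightarrow> 'e) \<Rightarrow> ('p \<Rightarrow> 'e) \<Rightarrow> 'p set \<Rightarrow> 'k set \<Rightarrow> ('p \<times> 'k) set \<Rightarrow> 'e multiset" where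
  "match_mset v a w P K R =
     image_mset (\<lambda>(p, k). v p k) (mset_set R) + image_mset a (mset_set (K - snd ` R)) +
     image_mset w (mset_set (P - fst ` R))"

section \<open>Gluing partitions of two disjoint sets along a matching of their blocks\<close>

definition glue :: "'a set set \<Rightarrow> 'a set set \<Rightarrow> ('a set \<times> 'a set) set \<Rightarrow> 'a set set" where
  "glue P K R = (\<lambda>(p, k). p \<union> k) ` R \<union> (K - snd ` R) \<union> (P - fst ` R)"

definition crossing :: "'a set \<Rightarrow> 'a set \<Rightarrow> 'a set set \<Rightarrow> ('a set \<times> 'a set) set" where
  "crossing S T Q = {(q \<inter> T, q \<inter> S) | q. q \<in> Q \<and> q \<inter> T \<noteq> {} \<and> q \<inter> S \<noteq> {}}"

context
  fixes S T :: "'a set" and K P :: "'a set set" and R :: "('a set \<times> 'a set) set"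
  assumes disj: "S \<inter> T = {}" and K: "partition_on S K" and P: "partition_on T P"
    and R: "R \<in> matchings P K"
begin

lemma block_K: "k \<in> K \<Longrightarrow> k \<subseteq> S \<and> k \<noteq> {} \<and> k \<inter> T = {} \<and> k \<inter> S = k"
  using partition_block[OF K, of k] disj by auto

lemma block_P: "p \<in> P \<Longrightarrow> p \<subseteq> T \<and> p \<noteq> {} \<and> p \<inter> S = {} \<and> p \<inter> T = p"
  using partition_block[OF P, of p] disj by auto

lemma glue_matched:
  assumes "(p, k) \<in> R" shows "(p \<union> k) \<inter> S = k" "(p \<union> k) \<inter> T = p"
  using matching_sub[OF R assms] block_K[of k] block_P[of p] by auto

text \<open>The traces of \<open>q\<close> on \<open>S\<close> and \<open>T\<close> are part of each
  case, as they tell the three kinds of blocks apart and are what the reconstruction of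
  \<open>K\<close>, \<open>P\<close> and \<open>R\<close> uses.\<close>

lemma glue_cases:
  assumes "q \<in> glue P K R"
  obtains (1) p k where "(p, k) \<in> R" "q = p \<union> k" "q \<inter> T = p" "q \<inter> S = k" "p \<in> P" "k \<in> K"
  | (2) "q \<in> K" "q \<notin> snd ` R" "q \<inter> T = {}" "q \<inter> S = q"
  | (3) "q \<in> P" "q \<notin> fst ` R" "q \<inter> S = {}" "q \<inter> T = q"
proof -
  consider (1) p k where "(p, k) \<in> R" "q = p \<union> k" | (2) "q \<in> K" "q \<notin> snd ` R" | (3) "q \<in> P" "q \<notin> fst ` R"
    using assms by (auto simp: glue_def)
  then show thesis
  proof cases
    case 1
    then show ?thesis using that(1)[of p k] glue_matched[of p k] matching_sub[OF R, of p k] by simp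
  next
    case 2
    then show ?thesis using that(2) block_K by blast
  next
    case 3
    then show ?thesis using that(3) block_P by blast
  qed
qed

lemma glue_matched_in: "(p, k) \<in> R \<Longrightarrow> p \<union> k \<in> glue P K R"
  by (force simp: glue_def)

lemma glue_K: "k \<in> K \<Longrightarrow> \<exists>q \<in> glue P K R. q \<inter> S = k"
proof (cases "k \<in> snd ` R")
  case True
  then obtain p where "(p, k) \<in> R" by force
  then show ?thesis by (intro bexI[of _ "p \<union> k"] glue_matched glue_matched_in)
next
  case False
  assume "k \<in> K"
  then show ?thesis using False block_K by (intro bexI[of _ k]) (auto simp: glue_def)
qed

lemma glue_P: "p \<in> P \<Longrightarrow> \<exists>q \<in> glue P K R. q \<inter> T = p"
proof (cases "p \<in> fst ` R")
  case True
  then obtain k where "(p, k) \<in> R" by force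
  then show ?thesis by (intro bexI[of _ "p \<union> k"] glue_matched glue_matched_in)
next
  case False
  assume "p \<in> P"
  then show ?thesis using False block_P by (intro bexI[of _ p]) (auto simp: glue_def)
qed

text \<open>These are the inverse formulas for gluing. A block that has not been merged misses one
  of the two sets, so the empty trace has to be discarded.\<close>

lemma glue_traces: "(\<lambda>q. q \<inter> S) ` glue P K R - {{}} = K" "(\<lambda>q. q \<inter> T) ` glue P K R - {{}} = P"
  "crossing S T (glue P K R) = R"
proof -
  have q: "(q \<inter> S \<in> K \<or> q \<inter> S = {}) \<and> (q \<inter> T \<in> P \<or> q \<inter> T = {})" if "q \<in> glue P K R" for q
    using that by (cases rule: glue_cases) auto
  show "(\<lambda>q. q \<inter> S) ` glue P K R - {{}} = K"
  proof (intro equalityI subsetI)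
    fix k assume "k \<in> K"
    then show "k \<in> (\<lambda>q. q \<inter> S) ` glue P K R - {{}}" using glue_K[of k] block_K[of k] by blast
  qed (use q in blast)
  show "(\<lambda>q. q \<inter> T) ` glue P K R - {{}} = P"
  proof (intro equalityI subsetI)
    fix p assume "p \<in> P"
    then show "p \<in> (\<lambda>q. q \<inter> T) ` glue P K R - {{}}" using glue_P[of p] block_P[of p] by blast
  qed (use q in blast)
  show "crossing S T (glue P K R) = R"
  proof (intro equalityI subsetI)
    fix z assume "z \<in> crossing S T (glue P K R)"
    then obtain q where q: "z = (q \<inter> T, q \<inter> S)" "q \<in> glue P K R" "q \<inter> T \<noteq> {}" "q \<inter> S \<noteq> {}"
      by (auto simp: crossing_def)
    from q(2) show "z \<in> R" by (cases rule: glue_cases) (use q in auto)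
  next
    fix z assume z: "z \<in> R"
    obtain p k where pk: "z = (p, k)" by (cases z)
    have e: "(p \<union> k) \<inter> S = k" "(p \<union> k) \<inter> T = p"
      using glue_matched[of p k] z pk by auto
    moreover have "p \<noteq> {}" "k \<noteq> {}"
      using matching_sub[OF R, of p k] z pk block_K[of k] block_P[of p] by auto
    ultimately show "z \<in> crossing S T (glue P K R)"
      unfolding crossing_def pk using glue_matched_in[of p k] z pk
      by (intro CollectI exI[of _ "p \<union> k"]) simp
  qed
qed

text \<open>The glued block through a point of \<open>k\<close> is given by a formula in
  \<open>k\<close> alone, hence is unique; disjointness of distinct glued blocks follows. The union
  over partners has at most one member and serves the matched and the unmatched case
  together.\<close>

lemma glue_block_S:
  assumes "q \<in> glue P K R" "x \<in> q" "k \<in> K" "x \<in> k" shows "q = k \<union> \<Union>{p. (p, k) \<in> R}"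
  using assms(1)
proof (cases rule: glue_cases)
  case (1 p' k')
  have "x \<in> S" using assms block_K by blast
  then have "x \<in> k'" using 1(4) assms(2) by blast
  then have k: "k' = k" using partition_unique[OF K 1(6) assms(3)] assms(4) by blast
  then have "{p. (p, k) \<in> R} = {p'}" using 1(1) matching_snd[OF R] by blast
  then show ?thesis using 1(2) k by auto
next
  case 2
  then have k: "q = k" using partition_unique[OF K 2(1) assms(3,2,4)] by simp
  then have "{p. (p, k) \<in> R} = {}" using 2(2) by force
  then show ?thesis using k by simp
next
  case 3
  then show ?thesis using assms block_K[of k] block_P[of q] by blast
qed

lemma glue_block_T:
  assumes "q \<in> glue P K R" "x \<in> q" "p \<in> P" "x \<in> p" shows "q = p \<union> \<Union>{k. (p, k) \<in> R}"
  using assms(1)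
proof (cases rule: glue_cases)
  case (1 p' k')
  have "x \<in> T" using assms block_P by blast
  then have "x \<in> p'" using 1(3) assms(2) by blast
  then have p: "p' = p" using partition_unique[OF P 1(5) assms(3)] assms(4) by blast
  then have "{k. (p, k) \<in> R} = {k'}" using 1(1) matching_fst[OF R] by blast
  then show ?thesis using 1(2) p by auto
next
  case 2
  then show ?thesis using assms block_K[of q] block_P[of p] by blast
next
  case 3
  then have p: "q = p" using partition_unique[OF P 3(1) assms(3,2,4)] by simp
  then have "{k. (p, k) \<in> R} = {}" using 3(2) by force
  then show ?thesis using p by simp
qed

lemma partition_glue: "partition_on (S \<union> T) (glue P K R)"
proof (rule partition_onI)
  have sub: "q \<subseteq> S \<union> T" if "q \<in> glue P K R" for q
    using that by (cases rule: glue_cases) (use block_K block_P in blast)+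
  moreover have "S \<subseteq> \<Union>(glue P K R)"
    using glue_traces(1) partition_onD1[OF K] by blast
  moreover have "T \<subseteq> \<Union>(glue P K R)"
    using glue_traces(2) partition_onD1[OF P] by blast
  ultimately show "\<Union>(glue P K R) = S \<union> T" by blast
  show "{} \<notin> glue P K R"
  proof
    assume "{} \<in> glue P K R"
    then show False
      by (cases rule: glue_cases) (use block_K block_P in auto)
  qed
  fix q q' assume q: "q \<in> glue P K R" "q' \<in> glue P K R" "q \<noteq> q'"
  have "x \<notin> q'" if x: "x \<in> q" for x
  proof
    assume x': "x \<in> q'"
    have "x \<in> S \<or> x \<in> T" using sub[OF q(1)] x by blast
    then consider k where "k \<in> K" "x \<in> k" | p where "p \<in> P" "x \<in> p"
      using partition_onD1[OF K] partition_onD1[OF P] by blast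
    then show False
      by cases (use glue_block_S[OF q(1) x] glue_block_S[OF q(2) x'] glue_block_T[OF q(1) x]
          glue_block_T[OF q(2) x'] q(3) in metis)+
  qed
  then show "disjnt q q'" by (auto simp: disjnt_iff)
qed

text \<open>The three constituents of \<open>glue\<close> are disjoint and merging is injective on
  \<open>R\<close>, so no multiplicity is lost. The result has the shape of a summand of
  \<open>\<delta>(f)\<close>, with all three kinds of arguments supplied by a single function
  \<open>f\<close> on blocks.\<close>

lemma image_mset_glue:
  assumes "finite S" "finite T"
  shows "image_mset f (mset_set (glue P K R)) = match_mset (\<lambda>p k. f (p \<union> k)) f f P K R"
proof -
  have fin: "finite K" "finite P" "finite R"
    using assms finite_elements K P finite_matching[OF R] by blast+
  have inj: "inj_on (\<lambda>(p, k). p \<union> k) R"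
    by (rule inj_onI) (use glue_matched in \<open>metis (mono_tags, lifting) old.prod.case surj_pair\<close>)
  have d1: "(\<lambda>(p, k). p \<union> k) ` R \<inter> (K - snd ` R) = {}"
    using glue_matched block_K block_P matching_sub[OF R] by fastforce
  have d2: "((\<lambda>(p, k). p \<union> k) ` R \<union> (K - snd ` R)) \<inter> (P - fst ` R) = {}"
    using glue_matched block_K block_P matching_sub[OF R] by fastforce
  have "mset_set (glue P K R) =
      image_mset (\<lambda>(p, k). p \<union> k) (mset_set R) + mset_set (K - snd ` R) + mset_set (P - fst ` R)"
    unfolding glue_def using fin d1 d2 by (simp add: mset_set_Union image_mset_mset_set[OF inj])
  then show ?thesis
    by (simp add: match_mset_def multiset.map_comp comp_def case_prod_unfold)
qed

end

text \<open>A block of a partition of \<open>S \<union> T\<close> lies in \<open>S\<close>, lies in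
  \<open>T\<close>, or meets both. The traces on \<open>S\<close> and on \<open>T\<close> are
  partitions, and the blocks that meet both sets match their traces. This is the identity of index
  sets behind the formula for \<open>\<delta>(f)\<close>.\<close>

lemma bij_betw_glue:
  assumes disj: "S \<inter> T = {}"
  shows "bij_betw (\<lambda>(K, P, R). glue P K R)
    (SIGMA K : partitions S. SIGMA P : partitions T. matchings P K) (partitions (S \<union> T))"
proof (rule bij_betw_byWitness[where f' = "\<lambda>Q. ((\<lambda>q. q \<inter> S) ` Q - {{}}, (\<lambda>q. q \<inter> T) ` Q - {{}},
      crossing S T Q)"])
  let ?A = "SIGMA K : partitions S. SIGMA P : partitions T. matchings P K"
  let ?K = "\<lambda>Q. (\<lambda>q. q \<inter> S) ` Q - {{}}" and ?P = "\<lambda>Q. (\<lambda>q. q \<inter> T) ` Q - {{}}"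
  let ?g = "\<lambda>Q. (?K Q, ?P Q, crossing S T Q)"
  show "\<forall>z \<in> ?A. ?g ((\<lambda>(K, P, R). glue P K R) z) = z"
    using glue_traces[OF disj] by auto
  show "(\<lambda>(K, P, R). glue P K R) ` ?A \<subseteq> partitions (S \<union> T)"
    using partition_glue[OF disj] by auto
  have Q1: "?g Q \<in> ?A" and Q2: "glue (?P Q) (?K Q) (crossing S T Q) = Q"
    if Q: "partition_on (S \<union> T) Q" for Q
  proof -
    have "(S \<union> T) \<inter> S = S" "(S \<union> T) \<inter> T = T" by auto
    then have "partition_on S (?K Q)" "partition_on T (?P Q)"
      using partition_on_restrict[OF Q, of S] partition_on_restrict[OF Q, of T]
      by (simp_all add: Int_commute)
    \<comment> \<open>A nonempty trace determines its block. Both injectivity conditions of a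
      matching are instances of this.\<close>
    moreover have eq: "q = q'" if "q \<in> Q" "q' \<in> Q" "q \<inter> A = q' \<inter> A" "q \<inter> A \<noteq> {}" for q q' A
      using partition_unique[OF Q that(1,2)] that(3,4) by blast
    have "crossing S T Q \<in> matchings (?P Q) (?K Q)"
      unfolding matchings_def
    proof (intro CollectI conjI inj_onI)
      show "crossing S T Q \<subseteq> ?P Q \<times> ?K Q" by (auto simp: crossing_def)
      show "z = z'" if "z \<in> crossing S T Q" "z' \<in> crossing S T Q" "fst z = fst z'" for z z'
      proof -
        obtain q q' where "q \<in> Q" "z = (q \<inter> T, q \<inter> S)" "q \<inter> T \<noteq> {}" "q' \<in> Q" "z' = (q' \<inter> T, q' \<inter> S)"
          using \<open>z \<in> _\<close> \<open>z' \<in> _\<close> unfolding crossing_def by auto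
        then show ?thesis using eq[of q q' T] that(3) by simp
      qed
      show "z = z'" if "z \<in> crossing S T Q" "z' \<in> crossing S T Q" "snd z = snd z'" for z z'
      proof -
        obtain q q' where "q \<in> Q" "z = (q \<inter> T, q \<inter> S)" "q \<inter> S \<noteq> {}" "q' \<in> Q" "z' = (q' \<inter> T, q' \<inter> S)"
          using \<open>z \<in> _\<close> \<open>z' \<in> _\<close> unfolding crossing_def by auto
        then show ?thesis using eq[of q q' S] that(3) by simp
      qed
    qed
    ultimately show "?g Q \<in> ?A" by simp
    have sub: "q \<subseteq> S \<union> T \<and> q \<noteq> {}" if "q \<in> Q" for q using partition_block[OF Q that] by auto
    have split: "(q \<inter> T) \<union> (q \<inter> S) = q" if "q \<in> Q" for q using sub[OF that] by blast
    \<comment> \<open>A trace on \<open>S\<close> without a partner can only come from a block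
      contained in \<open>S\<close>, so it is already a whole block.\<close>
    have cr: "q \<inter> T = {}" if "q \<in> Q" "q \<inter> S \<noteq> {}" "q \<inter> S \<notin> snd ` crossing S T Q" for q
    proof (rule ccontr)
      assume "q \<inter> T \<noteq> {}"
      then have "(q \<inter> T, q \<inter> S) \<in> crossing S T Q" using that by (auto simp: crossing_def)
      then show False using that(3) by force
    qed
    have cr': "q \<inter> S = {}" if "q \<in> Q" "q \<inter> T \<noteq> {}" "q \<inter> T \<notin> fst ` crossing S T Q" for q
    proof (rule ccontr)
      assume "q \<inter> S \<noteq> {}"
      then have "(q \<inter> T, q \<inter> S) \<in> crossing S T Q" using that by (auto simp: crossing_def)
      then show False using that(3) by force
    qed
    show "glue (?P Q) (?K Q) (crossing S T Q) = Q"
    proof (intro equalityI subsetI)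
      fix r assume "r \<in> glue (?P Q) (?K Q) (crossing S T Q)"
      then consider (1) "r \<in> (\<lambda>(p, k). p \<union> k) ` crossing S T Q"
        | (2) "r \<in> ?K Q" "r \<notin> snd ` crossing S T Q" | (3) "r \<in> ?P Q" "r \<notin> fst ` crossing S T Q"
        unfolding glue_def by blast
      then show "r \<in> Q"
      proof cases
        case 1
        then obtain q where "q \<in> Q" "r = (q \<inter> T) \<union> (q \<inter> S)" by (auto simp: crossing_def)
        then show ?thesis using split by simp
      next
        case 2
        then obtain q where q: "q \<in> Q" "r = q \<inter> S" "q \<inter> S \<noteq> {}" by blast
        then have "r = q" using cr[of q] 2 split[of q] by simp
        then show ?thesis using q by simp
      next
        case 3
        then obtain q where q: "q \<in> Q" "r = q \<inter> T" "q \<inter> T \<noteq> {}" by blast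
        then have "r = q" using cr'[of q] 3 split[of q] by simp
        then show ?thesis using q by simp
      qed
    next
      fix q assume q: "q \<in> Q"
      show "q \<in> glue (?P Q) (?K Q) (crossing S T Q)"
      proof (cases "q \<inter> T = {} \<or> q \<inter> S = {}")
        case False
        then have "(q \<inter> T, q \<inter> S) \<in> crossing S T Q" using q by (auto simp: crossing_def)
        then have "(q \<inter> T) \<union> (q \<inter> S) \<in> glue (?P Q) (?K Q) (crossing S T Q)"
          unfolding glue_def by force
        then show ?thesis using split[OF q] by simp
      next
        case True
        have nT: "q \<notin> snd ` crossing S T Q" if "q \<inter> T = {}"
        proof
          assume "q \<in> snd ` crossing S T Q"
          then obtain q' where q': "q' \<in> Q" "q = q' \<inter> S" "q' \<inter> T \<noteq> {}"
            unfolding crossing_def by force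
          then have "q = q'" using eq[of q q' S] q sub[OF q] by (simp add: Int_assoc)
          then show False using that q' by blast
        qed
        have nS: "q \<notin> fst ` crossing S T Q" if "q \<inter> S = {}"
        proof
          assume "q \<in> fst ` crossing S T Q"
          then obtain q' where q': "q' \<in> Q" "q = q' \<inter> T" "q' \<inter> S \<noteq> {}"
            unfolding crossing_def by force
          then have "q = q'" using eq[of q q' T] q sub[OF q] by (simp add: Int_assoc)
          then show False using that q' by blast
        qed
        from True show ?thesis
        proof
          assume e: "q \<inter> T = {}"
          then have "q = q \<inter> S" using split[OF q] by simp
          then have "q \<in> ?K Q" using q sub[OF q] by blast
          then show ?thesis using nT[OF e] unfolding glue_def by blast
        next
          assume e: "q \<inter> S = {}"
          then have "q = q \<inter> T" using split[OF q] by simp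
          then have "q \<in> ?P Q" using q sub[OF q] by blast
          then show ?thesis using nS[OF e] unfolding glue_def by blast
        qed
      qed
    qed
  qed
  show "\<forall>Q \<in> partitions (S \<union> T). (\<lambda>(K, P, R). glue P K R) (?g Q) = Q"
    using Q2 by simp
  show "?g ` partitions (S \<union> T) \<subseteq> ?A"
    using Q1 by blast
qed

section \<open>Set-valued models of a Cartesian category\<close>

lemma HomI: "f \<in> Arr X \<Longrightarrow> Dom X f = A \<Longrightarrow> Cod X f = B \<Longrightarrow> f \<in> Hom X A B"
  by (simp add: Hom_def)

context cartesian_category
begin

lemma Hom_Obj: "f \<in> Hom X A B \<Longrightarrow> A \<in> Obj X \<and> B \<in> Obj X"
  using Dom_Obj Cod_Obj by (auto simp: Hom_def)

lemma Hom_DomCod: "f \<in> Hom X A B \<Longrightarrow> Dom X f = A \<and> Cod X f = B"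
  by (auto simp: Hom_def)

lemma pair_universal:
  assumes "f \<in> Hom X W A" "g \<in> Hom X W B"
  shows "pair X f g \<in> Hom X W (Prd X A B) \<and> pair X f g \<cdot> Pr0 X A B = f \<and> pair X f g \<cdot> Pr1 X A B = g"
  using theI'[OF Prd_universal[OF assms]] Hom_DomCod[OF assms(1)] Hom_DomCod[OF assms(2)]
  by (simp add: pair_def)

lemma pair_Hom: "f \<in> Hom X W A \<Longrightarrow> g \<in> Hom X W B \<Longrightarrow> pair X f g \<in> Hom X W (Prd X A B)"
  using pair_universal by blast

lemma pair_unique:
  assumes "h \<in> Hom X W (Prd X A B)" "A \<in> Obj X" "B \<in> Obj X"
    and "h \<cdot> Pr0 X A B = f" "h \<cdot> Pr1 X A B = g"
  shows "h = pair X f g"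
proof -
  have f: "f \<in> Hom X W A" and g: "g \<in> Hom X W B"
    using Cmp_Hom[OF assms(1) Pr0_Hom] Cmp_Hom[OF assms(1) Pr1_Hom] assms by auto
  show ?thesis
    using Prd_universal[OF f g] pair_universal[OF f g] assms by auto
qed

lemma bang_Hom: "A \<in> Obj X \<Longrightarrow> bang X A \<in> Hom X A (One X)"
  unfolding bang_def by (rule theI'[OF One_universal])

lemma bang_unique: "h \<in> Hom X A (One X) \<Longrightarrow> h = bang X A"
  using One_universal bang_Hom Hom_Obj by blast

end

text \<open>
  A model is a functor to sets that preserves finite products: \<open>pts A\<close> is the set of points of
  \<open>A\<close>, \<open>act f\<close> the action of \<open>f\<close> on points, and \<open>tup\<close>, \<open>pt\<close> form the points of the chosen products.
\<close>

record ('o, 'm, 'e) interp =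
  pts :: "'o \<Rightarrow> 'e set"
  act :: "'m \<Rightarrow> 'e \<Rightarrow> 'e"
  tup :: "'e \<Rightarrow> 'e \<Rightarrow> 'e"
  pt :: "'e"

locale set_model =
  fixes X :: "('o, 'm) ccat" (structure) and G :: "('o, 'm, 'e) interp"
  assumes act_pts: "f \<in> Hom X A B \<Longrightarrow> e \<in> pts G A \<Longrightarrow> act G f e \<in> pts G B"
    and act_Ide: "A \<in> Obj X \<Longrightarrow> e \<in> pts G A \<Longrightarrow> act G (Ide X A) e = e"
    and act_Cmp: "f \<in> Hom X A B \<Longrightarrow> g \<in> Hom X B C \<Longrightarrow> e \<in> pts G A \<Longrightarrow>
          act G (f \<cdot> g) e = act G g (act G f e)"
    and pts_One: "pts G (One X) = {pt G}"
    and tup_pts: "A \<in> Obj X \<Longrightarrow> B \<in> Obj X \<Longrightarrow> a \<in> pts G A \<Longrightarrow> b \<in> pts G B \<Longrightarrow>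
          tup G a b \<in> pts G (Prd X A B)"
    and act_Pr0: "A \<in> Obj X \<Longrightarrow> B \<in> Obj X \<Longrightarrow> a \<in> pts G A \<Longrightarrow> b \<in> pts G B \<Longrightarrow>
          act G (Pr0 X A B) (tup G a b) = a"
    and act_Pr1: "A \<in> Obj X \<Longrightarrow> B \<in> Obj X \<Longrightarrow> a \<in> pts G A \<Longrightarrow> b \<in> pts G B \<Longrightarrow>
          act G (Pr1 X A B) (tup G a b) = b"
    and tup_eta: "A \<in> Obj X \<Longrightarrow> B \<in> Obj X \<Longrightarrow> e \<in> pts G (Prd X A B) \<Longrightarrow>
          tup G (act G (Pr0 X A B) e) (act G (Pr1 X A B) e) = e"

text \<open>Joint faithfulness. It is relative to a set of models because points of a prolongation
  have a new type, so the family has to be chosen anew at each level.\<close>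

definition separating :: "('o, 'm) ccat \<Rightarrow> ('o, 'm, 'e) interp set \<Rightarrow> bool" where
  "separating X \<M> \<longleftrightarrow>
     (\<forall>A B. \<forall>f \<in> Hom X A B. \<forall>g \<in> Hom X A B.
        (\<forall>G \<in> \<M>. \<forall>e \<in> pts G A. act G f e = act G g e) \<longrightarrow> f = g)"

lemma separatingD:
  "separating X \<M> \<Longrightarrow> f \<in> Hom X A B \<Longrightarrow> g \<in> Hom X A B \<Longrightarrow>
    (\<And>G e. G \<in> \<M> \<Longrightarrow> e \<in> pts G A \<Longrightarrow> act G f e = act G g e) \<Longrightarrow> f = g"
  unfolding separating_def by blast

text \<open>The laws hold for functions and a jointly faithful family reflects them. For the
  universal properties only existence has to be supplied: uniqueness holds in each model, where the
  terminal object has one point and \<open>tup_eta\<close> recovers a point of a product from its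
  projections. As \<open>set_model\<close> does not presuppose a category, nothing is
  circular.\<close>

lemma cartesian_category_if_separating:
  fixes X (structure)
  assumes Dom_Obj: "\<And>f. f \<in> Arr X \<Longrightarrow> Dom X f \<in> Obj X"
    and Cod_Obj: "\<And>f. f \<in> Arr X \<Longrightarrow> Cod X f \<in> Obj X"
    and Ide_Hom: "\<And>A. A \<in> Obj X \<Longrightarrow> Ide X A \<in> Hom X A A"
    and Cmp_Hom: "\<And>f g A B C. f \<in> Hom X A B \<Longrightarrow> g \<in> Hom X B C \<Longrightarrow> f \<cdot> g \<in> Hom X A C"
    and One_Obj: "One X \<in> Obj X"
    and Prd_Obj: "\<And>A B. A \<in> Obj X \<Longrightarrow> B \<in> Obj X \<Longrightarrow> Prd X A B \<in> Obj X"
    and Pr0_Hom: "\<And>A B. A \<in> Obj X \<Longrightarrow> B \<in> Obj X \<Longrightarrow> Pr0 X A B \<in> Hom X (Prd X A B) A"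
    and Pr1_Hom: "\<And>A B. A \<in> Obj X \<Longrightarrow> B \<in> Obj X \<Longrightarrow> Pr1 X A B \<in> Hom X (Prd X A B) B"
    and models: "\<And>G. G \<in> \<M> \<Longrightarrow> set_model X G" and sep: "separating X \<M>"
    and to_One: "\<And>A. A \<in> Obj X \<Longrightarrow> \<exists>h. h \<in> Hom X A (One X)"
    and pairing: "\<And>f g W A B. f \<in> Hom X W A \<Longrightarrow> g \<in> Hom X W B \<Longrightarrow>
          \<exists>h \<in> Hom X W (Prd X A B). \<forall>G \<in> \<M>. \<forall>e \<in> pts G W. act G h e = tup G (act G f e) (act G g e)"
  shows "cartesian_category X"
proof -
  have Hom_Obj: "A \<in> Obj X \<and> B \<in> Obj X" if "f \<in> Hom X A B" for f A B
    using that Dom_Obj Cod_Obj by (auto simp: Hom_def)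
  note act_Cmp = set_model.act_Cmp[OF models] and act_Ide = set_model.act_Ide[OF models]
    and act_pts = set_model.act_pts[OF models]
  show ?thesis
  proof
    fix f g h A B C D
    assume f: "f \<in> Hom X A B"
    note AB = Hom_Obj[OF f]
    show "Ide X A \<cdot> f = f"
      by (rule separatingD[OF sep Cmp_Hom[OF Ide_Hom f] f])
        (use AB f in \<open>simp_all add: act_Cmp[OF _ Ide_Hom f] act_Ide\<close>)
    show "f \<cdot> Ide X B = f"
      by (rule separatingD[OF sep Cmp_Hom[OF f Ide_Hom] f])
        (use AB f in \<open>simp_all add: act_Cmp[OF _ f Ide_Hom] act_Ide act_pts[OF _ f]\<close>)
    assume g: "g \<in> Hom X B C" and h: "h \<in> Hom X C D"
    show "f \<cdot> g \<cdot> h = f \<cdot> (g \<cdot> h)"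
      by (rule separatingD[OF sep Cmp_Hom[OF Cmp_Hom[OF f g] h] Cmp_Hom[OF f Cmp_Hom[OF g h]]])
        (simp add: act_Cmp[OF _ Cmp_Hom[OF f g] h] act_Cmp[OF _ f Cmp_Hom[OF g h]]
          act_Cmp[OF _ f g] act_Cmp[OF _ g h] act_pts[OF _ f])
  next
    fix A assume A: "A \<in> Obj X"
    then obtain h where h: "h \<in> Hom X A (One X)" using to_One by blast
    show "\<exists>!h. h \<in> Hom X A (One X)"
    proof (rule ex1I[of _ h], rule h)
      fix h' assume h': "h' \<in> Hom X A (One X)"
      show "h' = h"
      proof (rule separatingD[OF sep h' h])
        fix G e assume G: "G \<in> \<M>" and e: "e \<in> pts G A"
        have "act G h' e \<in> {pt G}" "act G h e \<in> {pt G}"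
          using act_pts[OF G h' e] act_pts[OF G h e] set_model.pts_One[OF models[OF G]] by auto
        then show "act G h' e = act G h e" by simp
      qed
    qed
  next
    fix f g W A B assume f: "f \<in> Hom X W A" and g: "g \<in> Hom X W B"
    then obtain h where h: "h \<in> Hom X W (Prd X A B)"
      and act_h: "\<And>G e. G \<in> \<M> \<Longrightarrow> e \<in> pts G W \<Longrightarrow> act G h e = tup G (act G f e) (act G g e)"
      using pairing by blast
    have A: "A \<in> Obj X" and B: "B \<in> Obj X" using f g Hom_Obj by auto
    note P0 = Pr0_Hom[OF A B] and P1 = Pr1_Hom[OF A B]
    show "\<exists>!h. h \<in> Hom X W (Prd X A B) \<and> h \<cdot> Pr0 X A B = f \<and> h \<cdot> Pr1 X A B = g"
    proof (rule ex1I)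
      show "h \<in> Hom X W (Prd X A B) \<and> h \<cdot> Pr0 X A B = f \<and> h \<cdot> Pr1 X A B = g"
      proof (intro conjI h)
        show "h \<cdot> Pr0 X A B = f"
          by (rule separatingD[OF sep Cmp_Hom[OF h P0] f])
            (simp add: act_Cmp[OF _ h P0] act_h set_model.act_Pr0[OF models] A B act_pts[OF _ f] act_pts[OF _ g])
        show "h \<cdot> Pr1 X A B = g"
          by (rule separatingD[OF sep Cmp_Hom[OF h P1] g])
            (simp add: act_Cmp[OF _ h P1] act_h set_model.act_Pr1[OF models] A B act_pts[OF _ f] act_pts[OF _ g])
      qed
      fix h' assume h': "h' \<in> Hom X W (Prd X A B) \<and> h' \<cdot> Pr0 X A B = f \<and> h' \<cdot> Pr1 X A B = g"
      then have h'H: "h' \<in> Hom X W (Prd X A B)" by simp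
      show "h' = h"
      proof (rule separatingD[OF sep h'H h])
        fix G e assume G: "G \<in> \<M>" and e: "e \<in> pts G W"
        have "tup G (act G (Pr0 X A B) (act G h' e)) (act G (Pr1 X A B) (act G h' e)) = act G h' e"
          by (rule set_model.tup_eta[OF models[OF G] A B act_pts[OF G h'H e]])
        then show "act G h' e = act G h e"
          using h' act_h[OF G e] act_Cmp[OF G h'H P0 e] act_Cmp[OF G h'H P1 e] by simp
      qed
    qed
  qed (use assms in auto)
qed

definition hom_interp :: "('o, 'm) ccat \<Rightarrow> 'o \<Rightarrow> ('o, 'm, 'm) interp" where
  "hom_interp X W = \<lparr>pts = Hom X W, act = \<lambda>f e. e \<cdot>\<^bsub>X\<^esub> f, tup = pair X, pt = bang X W\<rparr>"

lemma hom_interp_simps [simp]: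
  "pts (hom_interp X W) = Hom X W" "act (hom_interp X W) f e = e \<cdot>\<^bsub>X\<^esub> f"
  "tup (hom_interp X W) = pair X" "pt (hom_interp X W) = bang X W"
  by (simp_all add: hom_interp_def)

context cartesian_category
begin

lemma set_model_hom_interp: "W \<in> Obj X \<Longrightarrow> set_model X (hom_interp X W)"
  by unfold_locales
    (auto simp: Cmp_Hom Cmp_Ide Cmp_assoc pair_Hom pair_universal bang_Hom bang_unique Pr0_Hom Pr1_Hom
      intro!: pair_unique[symmetric] dest: bang_unique)

text \<open>Yoneda: the identity of the domain is a generic point, and two arrows that agree on it
  are equal.\<close>

lemma separating_hom_interp: "separating X (hom_interp X ` Obj X)"
  unfolding separating_def
proof (intro allI ballI impI)
  fix A B f g assume f: "f \<in> Hom X A B" and g: "g \<in> Hom X A B"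
    and eq: "\<forall>G \<in> hom_interp X ` Obj X. \<forall>e \<in> pts G A. act G f e = act G g e"
  have "A \<in> Obj X" using Hom_Obj f by blast
  then have "Ide X A \<cdot> f = Ide X A \<cdot> g" using eq Ide_Hom by force
  then show "f = g" using f g by (simp add: Ide_Cmp)
qed

end

definition pmon :: "('o, 'm, 'e) interp \<Rightarrow> ('o, 'm) cmon \<Rightarrow> 'e monoid" where
  "pmon G M = \<lparr>carrier = pts G (carr M), monoid.mult = (\<lambda>b c. act G (fst (snd M)) (tup G b c)),
     one = act G (snd (snd M)) (pt G)\<rparr>"

lemma pmon_simps [simp]:
  "carrier (pmon G (A, p, z)) = pts G A"
  "b \<otimes>\<^bsub>pmon G (A, p, z)\<^esub> c = act G p (tup G b c)"
  "\<one>\<^bsub>pmon G (A, p, z)\<^esub> = act G z (pt G)"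
  by (simp_all add: pmon_def)

lemma carrier_pmon: "carrier (pmon G M) = pts G (carr M)"
  by (cases M) simp

text \<open>Sums of arrows in a hom-set are thereby sums of points in a representable model, and the
  facts about \<open>pmon\<close> yield those about \<open>msum\<close>.\<close>

lemma hom_monoid_eq: "hom_monoid X W M = pmon (hom_interp X W) M"
  by (cases M) (auto simp: hom_monoid_def pmon_def fun_eq_iff)

lemma cmon_in_Hom:
  assumes "cmon_in X (A, p, z)"
  shows "A \<in> Obj X" "p \<in> Hom X (Prd X A A) A" "z \<in> Hom X (One X) A"
  using assms by auto

declare cmon_in.simps [simp del]

lemma carr_Obj: "cmon_in X M \<Longrightarrow> carr M \<in> Obj X"
  by (cases M) (auto dest: cmon_in_Hom)

locale cat_model = cartesian_category X + set_model X G
  for X :: "('o, 'm) ccat" (structure) and G :: "('o, 'm, 'e) interp"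
begin

lemma pt_pts: "pt G \<in> pts G (One X)"
  by (simp add: pts_One)

lemma act_pair:
  assumes "f \<in> Hom X W A" "g \<in> Hom X W B" "e \<in> pts G W"
  shows "act G (pair X f g) e = tup G (act G f e) (act G g e)"
proof -
  have A: "A \<in> Obj X" and B: "B \<in> Obj X" using Hom_Obj assms by auto
  note p = pair_universal[OF assms(1,2)]
  have "tup G (act G (Pr0 X A B) (act G (pair X f g) e)) (act G (Pr1 X A B) (act G (pair X f g) e))
      = act G (pair X f g) e"
    by (rule tup_eta[OF A B]) (use p act_pts assms in blast)
  then show ?thesis
    using act_Cmp[OF conjunct1[OF p] Pr0_Hom[OF A B] assms(3)]
      act_Cmp[OF conjunct1[OF p] Pr1_Hom[OF A B] assms(3)] p by simp
qed

lemma act_bang: "W \<in> Obj X \<Longrightarrow> e \<in> pts G W \<Longrightarrow> act G (bang X W) e = pt G"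
  using act_pts[OF bang_Hom] pts_One by blast

lemma madd_Hom:
  "cmon_in X M \<Longrightarrow> f \<in> Hom X W (carr M) \<Longrightarrow> g \<in> Hom X W (carr M) \<Longrightarrow> madd X M f g \<in> Hom X W (carr M)"
  by (cases M) (auto intro: Cmp_Hom pair_Hom dest: cmon_in_Hom)

lemma mzero_Hom: "cmon_in X M \<Longrightarrow> W \<in> Obj X \<Longrightarrow> mzero X M W \<in> Hom X W (carr M)"
  by (cases M) (auto intro: Cmp_Hom bang_Hom dest: cmon_in_Hom)

lemma act_madd:
  assumes "cmon_in X M" "f \<in> Hom X W (carr M)" "g \<in> Hom X W (carr M)" "e \<in> pts G W"
  shows "act G (madd X M f g) e = act G f e \<otimes>\<^bsub>pmon G M\<^esub> act G g e"
proof -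
  obtain A p z where M: "M = (A, p, z)" by (metis prod_cases3)
  show ?thesis using assms unfolding M
    by (simp add: act_Cmp[OF pair_Hom cmon_in_Hom(2)] act_pair)
qed

lemma act_mzero:
  assumes "cmon_in X M" "W \<in> Obj X" "e \<in> pts G W"
  shows "act G (mzero X M W) e = \<one>\<^bsub>pmon G M\<^esub>"
proof -
  obtain A p z where M: "M = (A, p, z)" by (metis prod_cases3)
  show ?thesis using assms unfolding M
    by (simp add: act_Cmp[OF bang_Hom cmon_in_Hom(3)] act_bang)
qed

text \<open>The axioms in \<open>cmon_in\<close> are equations between arrows out of powers of
  \<open>A\<close>; evaluating them at tuples of arbitrary points gives the axioms for the operation
  on points.\<close>

lemma comm_monoid_pmon:
  assumes M: "cmon_in X M" shows "comm_monoid (pmon G M)"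
proof -
  obtain A p z where Meq: "M = (A, p, z)" by (metis prod_cases3)
  have A: "A \<in> Obj X" and p: "p \<in> Hom X (Prd X A A) A" and z: "z \<in> Hom X (One X) A"
    using cmon_in_Hom[OF M[unfolded Meq]] by auto
  have AA: "Prd X A A \<in> Obj X" and AAA: "Prd X A (Prd X A A) \<in> Obj X" using A Prd_Obj by auto
  let ?M = "pmon G M"
  have clo: "b \<otimes>\<^bsub>?M\<^esub> c \<in> pts G A" if "b \<in> pts G A" "c \<in> pts G A" for b c
    using that act_pts[OF p tup_pts[OF A A]] by (simp add: Meq)
  have zc: "\<one>\<^bsub>?M\<^esub> \<in> pts G A" using act_pts[OF z pt_pts] by (simp add: Meq)
  note [simp] = act_Pr0 act_Pr1 A AA
  have assoc: "b \<otimes>\<^bsub>?M\<^esub> c \<otimes>\<^bsub>?M\<^esub> d = b \<otimes>\<^bsub>?M\<^esub> (c \<otimes>\<^bsub>?M\<^esub> d)"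
    if bcd: "b \<in> pts G A" "c \<in> pts G A" "d \<in> pts G A" for b c d
  proof -
    let ?a = "Pr0 X A (Prd X A A)"
    let ?b = "Pr1 X A (Prd X A A) \<cdot> Pr0 X A A"
    let ?c = "Pr1 X A (Prd X A A) \<cdot> Pr1 X A A"
    let ?W = "Prd X A (Prd X A A)"
    have cd: "tup G c d \<in> pts G (Prd X A A)" using bcd A by (simp add: tup_pts)
    have e: "tup G b (tup G c d) \<in> pts G ?W" using bcd A cd AA by (simp add: tup_pts)
    have h: "?a \<in> Hom X ?W (carr M)" "?b \<in> Hom X ?W (carr M)" "?c \<in> Hom X ?W (carr M)"
      using A AA by (auto simp: Meq intro: Pr0_Hom Cmp_Hom[OF Pr1_Hom Pr0_Hom] Cmp_Hom[OF Pr1_Hom Pr1_Hom])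
    have "madd X M (madd X M ?a ?b) ?c = madd X M ?a (madd X M ?b ?c)"
      using M unfolding Meq by (simp add: cmon_in.simps Let_def)
    then have "act G (madd X M (madd X M ?a ?b) ?c) (tup G b (tup G c d)) =
        act G (madd X M ?a (madd X M ?b ?c)) (tup G b (tup G c d))" by simp
    then have eq: "(act G ?a (tup G b (tup G c d)) \<otimes>\<^bsub>?M\<^esub> act G ?b (tup G b (tup G c d))) \<otimes>\<^bsub>?M\<^esub> act G ?c (tup G b (tup G c d)) =
      act G ?a (tup G b (tup G c d)) \<otimes>\<^bsub>?M\<^esub> (act G ?b (tup G b (tup G c d)) \<otimes>\<^bsub>?M\<^esub> act G ?c (tup G b (tup G c d)))"
      using h by (simp only: act_madd[OF M _ _ e] madd_Hom[OF M])
    have 1: "act G ?a (tup G b (tup G c d)) = b" using bcd cd by simp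
    have 2: "act G ?b (tup G b (tup G c d)) = c"
      using bcd cd e by (simp add: act_Cmp[OF Pr1_Hom Pr0_Hom])
    have 3: "act G ?c (tup G b (tup G c d)) = d"
      using bcd cd e by (simp add: act_Cmp[OF Pr1_Hom Pr1_Hom])
    show ?thesis using eq unfolding 1 2 3 .
  qed
  have comm: "b \<otimes>\<^bsub>?M\<^esub> c = c \<otimes>\<^bsub>?M\<^esub> b" if bc: "b \<in> pts G A" "c \<in> pts G A" for b c
  proof -
    have e: "tup G b c \<in> pts G (Prd X A A)" using bc A by (simp add: tup_pts)
    have "pair X (Pr1 X A A) (Pr0 X A A) \<cdot> p = p" using M unfolding Meq by (simp add: cmon_in.simps)
    then have "act G (pair X (Pr1 X A A) (Pr0 X A A) \<cdot> p) (tup G b c) = act G p (tup G b c)" by simp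
    then have "act G p (tup G c b) = act G p (tup G b c)"
      using bc e A by (simp add: act_Cmp[OF pair_Hom[OF Pr1_Hom Pr0_Hom] p] act_pair[OF Pr1_Hom Pr0_Hom])
    then show ?thesis by (simp add: Meq)
  qed
  have unit: "\<one>\<^bsub>?M\<^esub> \<otimes>\<^bsub>?M\<^esub> b = b" if b: "b \<in> pts G A" for b
  proof -
    have "pair X (mzero X M A) (Ide X A) \<cdot> p = Ide X A" using M unfolding Meq by (simp add: cmon_in.simps)
    then have "act G (madd X M (mzero X M A) (Ide X A)) b = act G (Ide X A) b" by (simp add: Meq)
    then show ?thesis
      using b A act_madd[OF M mzero_Hom[OF M A] _ b, of "Ide X A"] Ide_Hom[OF A] act_mzero[OF M A b]
      by (simp add: act_Ide Meq)
  qed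
  show ?thesis
    by (rule comm_monoidI) (use clo zc assoc comm unit in \<open>simp_all add: carrier_pmon Meq\<close>)
qed

end

text \<open>The converse of \<open>comm_monoid_pmon\<close> for a jointly faithful family. Through
  it products, the terminal monoid, images under functors and the monoid of \<open>\<delta>\<close>
  are recognised as commutative monoids.\<close>

lemma cmon_inI:
  fixes X (structure)
  assumes "cartesian_category X" and models: "\<And>G. G \<in> \<M> \<Longrightarrow> set_model X G" and sep: "separating X \<M>"
    and A: "A \<in> Obj X" and p: "p \<in> Hom X (Prd X A A) A" and z: "z \<in> Hom X (One X) A"
    and pmon: "\<And>G. G \<in> \<M> \<Longrightarrow> comm_monoid (pmon G (A, p, z))"
  shows "cmon_in X (A, p, z)"
proof -
  interpret cartesian_category X by fact
  have AA: "Prd X A A \<in> Obj X" using A Prd_Obj by auto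
  let ?M = "(A, p, z)"
  have mH: "madd X ?M f g \<in> Hom X W A" if "f \<in> Hom X W A" "g \<in> Hom X W A" for f g W
    using that p by (auto intro: Cmp_Hom pair_Hom)
  have zH: "mzero X ?M W \<in> Hom X W A" if "W \<in> Obj X" for W
    using that z by (auto intro: Cmp_Hom bang_Hom)
  have act_m: "act G (madd X ?M f g) e = act G f e \<otimes>\<^bsub>pmon G ?M\<^esub> act G g e"
    if "G \<in> \<M>" "f \<in> Hom X W A" "g \<in> Hom X W A" "e \<in> pts G W" for G f g W e
  proof -
    interpret cat_model X G using models[OF that(1)] by (simp add: cat_model_def cartesian_category_axioms)
    show ?thesis using that p by (simp add: act_Cmp[OF pair_Hom] act_pair)
  qed
  have act_z: "act G (mzero X ?M W) e = \<one>\<^bsub>pmon G ?M\<^esub>"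
    if "G \<in> \<M>" "W \<in> Obj X" "e \<in> pts G W" for G W e
  proof -
    interpret cat_model X G using models[OF that(1)] by (simp add: cat_model_def cartesian_category_axioms)
    show ?thesis using that z by (simp add: act_Cmp[OF bang_Hom] act_bang)
  qed
  note act_pts = set_model.act_pts[OF models] and act_Ide = set_model.act_Ide[OF models]
  let ?W = "Prd X A (Prd X A A)"
  let ?a = "Pr0 X A (Prd X A A)" and ?b = "Pr1 X A (Prd X A A) \<cdot> Pr0 X A A"
    and ?c = "Pr1 X A (Prd X A A) \<cdot> Pr1 X A A"
  have h: "?a \<in> Hom X ?W A" "?b \<in> Hom X ?W A" "?c \<in> Hom X ?W A"
    using A AA by (auto intro: Pr0_Hom Cmp_Hom[OF Pr1_Hom Pr0_Hom] Cmp_Hom[OF Pr1_Hom Pr1_Hom])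
  have assoc: "madd X ?M (madd X ?M ?a ?b) ?c = madd X ?M ?a (madd X ?M ?b ?c)"
  proof (rule separatingD[OF sep mH[OF mH[OF h(1,2)] h(3)] mH[OF h(1) mH[OF h(2,3)]]])
    fix G e assume G: "G \<in> \<M>" and e: "e \<in> pts G ?W"
    interpret M: comm_monoid "pmon G ?M" using pmon G by simp
    show "act G (madd X ?M (madd X ?M ?a ?b) ?c) e = act G (madd X ?M ?a (madd X ?M ?b ?c)) e"
      using M.m_assoc act_pts[OF G h(1) e] act_pts[OF G h(2) e] act_pts[OF G h(3) e]
      by (simp only: act_m[OF G _ _ e] mH h carrier_pmon fst_conv)
  qed
  have comm: "madd X ?M (Pr1 X A A) (Pr0 X A A) = p"
  proof (rule separatingD[OF sep mH[OF Pr1_Hom[OF A A] Pr0_Hom[OF A A]] p])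
    fix G e assume G: "G \<in> \<M>" and e: "e \<in> pts G (Prd X A A)"
    interpret M: comm_monoid "pmon G ?M" using pmon G by simp
    have "act G (madd X ?M (Pr1 X A A) (Pr0 X A A)) e =
        act G (Pr0 X A A) e \<otimes>\<^bsub>pmon G ?M\<^esub> act G (Pr1 X A A) e"
      using M.m_comm act_pts[OF G Pr0_Hom[OF A A] e] act_pts[OF G Pr1_Hom[OF A A] e]
      by (simp only: act_m[OF G Pr1_Hom[OF A A] Pr0_Hom[OF A A] e] carrier_pmon fst_conv)
    also have "\<dots> = act G p e"
      using set_model.tup_eta[OF models[OF G] A A e] by simp
    finally show "act G (madd X ?M (Pr1 X A A) (Pr0 X A A)) e = act G p e" .
  qed
  have unit: "madd X ?M (mzero X ?M A) (Ide X A) = Ide X A" "madd X ?M (Ide X A) (mzero X ?M A) = Ide X A"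
    by (rule separatingD[OF sep mH Ide_Hom[OF A]]; (intro zH A Ide_Hom)?;
        simp only: act_m[OF _ zH Ide_Hom] act_m[OF _ Ide_Hom zH] A act_z act_Ide
          monoid.l_one[OF comm_monoid.axioms(1)[OF pmon]] monoid.r_one[OF comm_monoid.axioms(1)[OF pmon]]
          carrier_pmon fst_conv)+
  show ?thesis using A p z assoc comm unit by (simp add: cmon_in.simps Let_def)
qed

section \<open>Tuples and sums of points\<close>

lemma powprd_simps [simp]:
  "powprd X A 0 Y = Y" "powprd X A (Suc n) Y = Prd X A (powprd X A n Y)"
  by (simp_all add: powprd_def)

lemma (in cartesian_category) powprd_Obj: "A \<in> Obj X \<Longrightarrow> Y \<in> Obj X \<Longrightarrow> powprd X A n Y \<in> Obj X"
  by (induction n) (auto intro: Prd_Obj)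

lemma (in cartesian_category) proj_Hom:
  assumes "A \<in> Obj X" "Y \<in> Obj X" "i \<le> n"
  shows "proj X A n Y i \<in> Hom X (powprd X A n Y) (if i < n then A else Y)"
  using assms(3)
proof (induction n arbitrary: i)
  case 0
  then show ?case using assms by (simp add: Ide_Hom)
next
  case (Suc n)
  then show ?case
    using Cmp_Hom[OF Pr1_Hom[OF assms(1) powprd_Obj[OF assms(1,2)]] Suc.IH] Pr0_Hom powprd_Obj assms
    by (cases i) auto
qed

lemma (in cartesian_category) proj_Hom_arg:
  "A \<in> Obj X \<Longrightarrow> Y \<in> Obj X \<Longrightarrow> i < n \<Longrightarrow> proj X A n Y i \<in> Hom X (powprd X A n Y) A"
  using proj_Hom[of A Y i n] by simp

lemma (in cartesian_category) proj_Hom_last: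
  "A \<in> Obj X \<Longrightarrow> Y \<in> Obj X \<Longrightarrow> proj X A n Y n \<in> Hom X (powprd X A n Y) Y"
  using proj_Hom[of A Y n n] by simp

lemma (in cartesian_category) foldr_pair_Hom:
  "set zs \<subseteq> Hom X W A \<Longrightarrow> y \<in> Hom X W Y \<Longrightarrow> foldr (pair X) zs y \<in> Hom X W (powprd X A (length zs) Y)"
  by (induction zs) (auto intro: pair_Hom)

lemma (in cartesian_category) app_Hom:
  "h \<in> Hom X (powprd X A (length zs) Y) B \<Longrightarrow> set zs \<subseteq> Hom X W A \<Longrightarrow> y \<in> Hom X W Y \<Longrightarrow>
    app X h zs y \<in> Hom X W B"
  unfolding app_def by (rule Cmp_Hom[OF foldr_pair_Hom])

lemma (in cartesian_category) comm_monoid_hom: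
  assumes "W \<in> Obj X" "cmon_in X M" shows "comm_monoid (hom_monoid X W M)"
proof -
  interpret cat_model X "hom_interp X W"
    using set_model_hom_interp[OF assms(1)] by (simp add: cat_model_def cartesian_category_axioms)
  show ?thesis using comm_monoid_pmon[OF assms(2)] by (simp add: hom_monoid_eq)
qed

lemma (in cartesian_category) msum_Hom:
  assumes "W \<in> Obj X" "cmon_in X M" "\<And>i. i \<in> I \<Longrightarrow> t i \<in> Hom X W (carr M)"
  shows "msum X W M t I \<in> Hom X W (carr M)"
proof -
  interpret comm_monoid "hom_monoid X W M" by (rule comm_monoid_hom) fact+
  have "finprod (hom_monoid X W M) t I \<in> carrier (hom_monoid X W M)"
    using assms(3) by (intro finprod_closed) (simp add: hom_monoid_eq carrier_pmon)
  then show ?thesis by (simp add: msum_def hom_monoid_eq carrier_pmon)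
qed

context cat_model
begin

lemma tuple_pts:
  "A \<in> Obj X \<Longrightarrow> Y \<in> Obj X \<Longrightarrow> set l \<subseteq> pts G A \<Longrightarrow> y \<in> pts G Y \<Longrightarrow>
    foldr (tup G) l y \<in> pts G (powprd X A (length l) Y)"
  by (induction l) (auto intro: tup_pts powprd_Obj)

lemma act_proj:
  assumes "A \<in> Obj X" "Y \<in> Obj X" "set l \<subseteq> pts G A" "y \<in> pts G Y" "i \<le> length l"
  shows "act G (proj X A (length l) Y i) (foldr (tup G) l y) = (if i < length l then l ! i else y)"
  using assms(3,5)
proof (induction l arbitrary: i)
  case Nil
  then show ?case using assms by (simp add: act_Ide)
next
  case (Cons b l)
  have P: "powprd X A (length l) Y \<in> Obj X" using assms powprd_Obj by blast
  have t: "foldr (tup G) l y \<in> pts G (powprd X A (length l) Y)"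
    using Cons assms by (auto intro: tuple_pts)
  have bt: "tup G b (foldr (tup G) l y) \<in> pts G (Prd X A (powprd X A (length l) Y))"
    using Cons assms P t by (auto intro: tup_pts)
  show ?case
  proof (cases i)
    case 0
    then show ?thesis using Cons assms P t by (simp add: act_Pr0)
  next
    case (Suc j)
    then have "j \<le> length l" using Cons by simp
    then show ?thesis
      using Suc Cons assms P t bt
      by (simp add: act_Cmp[OF Pr1_Hom[OF assms(1) P] proj_Hom[OF assms(1,2)]] act_Pr1)
  qed
qed

lemma act_proj_arg:
  "A \<in> Obj X \<Longrightarrow> Y \<in> Obj X \<Longrightarrow> set l \<subseteq> pts G A \<Longrightarrow> y \<in> pts G Y \<Longrightarrow> n = length l \<Longrightarrow> i < n \<Longrightarrow>
    act G (proj X A n Y i) (foldr (tup G) l y) = l ! i"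
  using act_proj[of A Y l y i] by simp

lemma act_proj_last:
  "A \<in> Obj X \<Longrightarrow> Y \<in> Obj X \<Longrightarrow> set l \<subseteq> pts G A \<Longrightarrow> y \<in> pts G Y \<Longrightarrow> n = length l \<Longrightarrow>
    act G (proj X A n Y n) (foldr (tup G) l y) = y"
  using act_proj[of A Y l y n] by simp

lemma tuple_cases:
  assumes "A \<in> Obj X" "Y \<in> Obj X" "e \<in> pts G (powprd X A n Y)"
  obtains l y where "length l = n" "set l \<subseteq> pts G A" "y \<in> pts G Y" "e = foldr (tup G) l y"
  using assms(3)
proof (induction n arbitrary: e thesis)
  case 0
  show ?case by (rule "0.prems"(1)[of "[]" e]) (use 0 in auto)
next
  case (Suc n)
  have P: "powprd X A n Y \<in> Obj X" using assms powprd_Obj by blast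
  have e: "e \<in> pts G (Prd X A (powprd X A n Y))" using Suc.prems by simp
  have "act G (Pr1 X A (powprd X A n Y)) e \<in> pts G (powprd X A n Y)"
    by (rule act_pts[OF Pr1_Hom[OF assms(1) P] e])
  then obtain l y where l: "length l = n" "set l \<subseteq> pts G A" "y \<in> pts G Y"
    "act G (Pr1 X A (powprd X A n Y)) e = foldr (tup G) l y" using Suc.IH by blast
  show ?case
    by (rule Suc.prems(1)[of "act G (Pr0 X A (powprd X A n Y)) e # l" y])
      (use l act_pts[OF Pr0_Hom[OF assms(1) P] e] tup_eta[OF assms(1) P e] in auto)
qed

lemma act_foldr_pair:
  "set zs \<subseteq> Hom X W A \<Longrightarrow> y \<in> Hom X W Y \<Longrightarrow> e \<in> pts G W \<Longrightarrow>
    act G (foldr (pair X) zs y) e = foldr (tup G) (map (\<lambda>z. act G z e) zs) (act G y e)"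
  by (induction zs) (auto simp: act_pair[OF _ foldr_pair_Hom])

lemma act_app:
  assumes "h \<in> Hom X (powprd X A (length zs) Y) B" "set zs \<subseteq> Hom X W A" "y \<in> Hom X W Y" "e \<in> pts G W"
  shows "act G (app X h zs y) e = act G h (foldr (tup G) (map (\<lambda>z. act G z e) zs) (act G y e))"
  unfolding app_def using assms by (simp add: act_Cmp[OF foldr_pair_Hom assms(1)] act_foldr_pair)

lemma act_msum:
  assumes M: "cmon_in X M" and W: "W \<in> Obj X" and t: "\<And>i. i \<in> I \<Longrightarrow> t i \<in> Hom X W (carr M)"
    and e: "e \<in> pts G W"
  shows "act G (msum X W M t I) e = finprod (pmon G M) (\<lambda>i. act G (t i) e) I"
  unfolding msum_def
proof (rule finprod_hom)
  show "act G (a \<otimes>\<^bsub>hom_monoid X W M\<^esub> b) e = act G a e \<otimes>\<^bsub>pmon G M\<^esub> act G b e"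
    if "a \<in> carrier (hom_monoid X W M)" "b \<in> carrier (hom_monoid X W M)" for a b
    using that act_madd[OF M, of a W b e] e by (simp add: hom_monoid_def)
  show "act G \<one>\<^bsub>hom_monoid X W M\<^esub> e = \<one>\<^bsub>pmon G M\<^esub>"
    using act_mzero[OF M W e] by (simp add: hom_monoid_def)
qed (use comm_monoid_hom[OF W M] comm_monoid_pmon[OF M] t e act_pts in
    \<open>auto simp: hom_monoid_eq carrier_pmon\<close>)

text \<open>\<open>sym_map\<close> is a statement about arrows. It is applied to the generic
  arguments, the projections out of \<open>powprd X A n Y\<close> itself, and the resulting equation
  is evaluated at the given tuple of points.\<close>

lemma sym_map_act:
  assumes A: "A \<in> Obj X" and Y: "Y \<in> Obj X" and h: "h \<in> Hom X (powprd X A n Y) B"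
    and s: "sym_map X A n Y h"
    and l: "set l \<subseteq> pts G A" "length l = n" "mset l' = mset l" and y: "y \<in> pts G Y"
  shows "act G h (foldr (tup G) l' y) = act G h (foldr (tup G) l y)"
proof -
  obtain p where p: "p permutes {..<length l}" and l': "permute_list p l = l'"
    using mset_eq_permutation[OF l(3)] by blast
  let ?W = "powprd X A n Y" and ?as = "map (proj X A n Y) [0..<n]"
  let ?bs = "permute_list p ?as" and ?y = "proj X A n Y n" and ?e = "foldr (tup G) l y"
  have W: "?W \<in> Obj X" using A Y powprd_Obj by blast
  have as: "set ?as \<subseteq> Hom X ?W A" using proj_Hom_arg[OF A Y] by auto
  have p': "p permutes {..<length ?as}" using p l(2) by simp
  then have bs: "set ?bs \<subseteq> Hom X ?W A" "mset ?bs = mset ?as" using as by simp_all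
  have yH: "?y \<in> Hom X ?W Y" using proj_Hom_last[OF A Y] .
  have e: "?e \<in> pts G ?W" using tuple_pts[OF A Y l(1) y] l(2) by simp
  have eq: "app X h ?bs ?y = app X h ?as ?y"
    using s W yH as bs unfolding sym_map_def by auto
  have m: "map (\<lambda>z. act G z ?e) ?as = l"
    using l act_proj_arg[OF A Y l(1) y] by (auto intro: nth_equalityI)
  have "map (\<lambda>z. act G z ?e) ?bs = l'"
    unfolding permute_list_map[OF p', symmetric] m l' ..
  moreover have "act G ?y ?e = y" using act_proj_last[OF A Y l(1) y] l(2) by simp
  ultimately show ?thesis
    using arg_cong[OF eq, of "\<lambda>f. act G f ?e"] m h
      act_app[OF _ as yH e, of h B] act_app[OF _ bs(1) yH e, of h B] by simp
qed

lemma multiadditive_act: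
  assumes M: "cmon_in X M" and N: "cmon_in X N" and Y: "Y \<in> Obj X"
    and h: "h \<in> Hom X (powprd X (carr M) n Y) (carr N)" and s: "multiadditive X M n Y N h"
    and l: "set l \<subseteq> pts G (carr M)" "length l = n" "i < n" and y: "y \<in> pts G Y"
  shows "b \<in> pts G (carr M) \<Longrightarrow> c \<in> pts G (carr M) \<Longrightarrow>
      act G h (foldr (tup G) (l[i := b \<otimes>\<^bsub>pmon G M\<^esub> c]) y) =
      act G h (foldr (tup G) (l[i := b]) y) \<otimes>\<^bsub>pmon G N\<^esub> act G h (foldr (tup G) (l[i := c]) y)" (is "_ \<Longrightarrow> _ \<Longrightarrow> ?add")
    and "act G h (foldr (tup G) (l[i := \<one>\<^bsub>pmon G M\<^esub>]) y) = \<one>\<^bsub>pmon G N\<^esub>" (is ?zero)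
proof -
  let ?A = "carr M"
  have A: "?A \<in> Obj X" using carr_Obj M by blast
  have AA: "Prd X ?A ?A \<in> Obj X" using A Prd_Obj by blast
  let ?Q = "powprd X ?A n Y"
  have Q: "?Q \<in> Obj X" using A Y powprd_Obj by blast
  \<comment> \<open>The generic situation for additivity: the two summands sit next to a full tuple,
    one entry of which is going to be replaced.\<close>
  let ?W = "Prd X (Prd X ?A ?A) ?Q"
  have W: "?W \<in> Obj X" using AA Q Prd_Obj by blast
  let ?q = "Pr1 X (Prd X ?A ?A) ?Q" and ?d = "Pr0 X (Prd X ?A ?A) ?Q"
  have q: "?q \<in> Hom X ?W ?Q" and d: "?d \<in> Hom X ?W (Prd X ?A ?A)" using Pr0_Hom Pr1_Hom AA Q by auto
  let ?as = "map (\<lambda>i. ?q \<cdot> proj X ?A n Y i) [0..<n]" and ?y = "?q \<cdot> proj X ?A n Y n"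
  let ?b = "?d \<cdot> Pr0 X ?A ?A" and ?c = "?d \<cdot> Pr1 X ?A ?A"
  have as: "set ?as \<subseteq> Hom X ?W ?A" using Cmp_Hom[OF q proj_Hom_arg[OF A Y]] by auto
  have yH: "?y \<in> Hom X ?W Y" by (rule Cmp_Hom[OF q proj_Hom_last[OF A Y]])
  have bH: "?b \<in> Hom X ?W ?A" and cH: "?c \<in> Hom X ?W ?A"
    using Cmp_Hom[OF d] Pr0_Hom Pr1_Hom A by auto
  have add: "app X h (?as[i := madd X M ?b ?c]) ?y =
      madd X N (app X h (?as[i := ?b]) ?y) (app X h (?as[i := ?c]) ?y)"
    and zero: "app X h (?as[i := mzero X M ?W]) ?y = mzero X N ?W"
    using s W yH as bH cH l unfolding multiadditive_def by auto
  have up: "set (?as[i := f]) \<subseteq> Hom X ?W ?A" if "f \<in> Hom X ?W ?A" for f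
    using as that by (meson insert_subset order_trans set_update_subset_insert)
  have h': "h \<in> Hom X (powprd X ?A (length (?as[i := f])) Y) (carr N)" for f using h by simp
  let ?e = "\<lambda>b c. tup G (tup G b c) (foldr (tup G) l y)"
  have t: "foldr (tup G) l y \<in> pts G ?Q" using tuple_pts[OF A Y l(1) y] l(2) by simp
  have e: "?e b c \<in> pts G ?W" if "b \<in> pts G ?A" "c \<in> pts G ?A" for b c
    using that A AA Q t by (auto intro: tup_pts)
  have eq: "act G ?q (?e b c) = foldr (tup G) l y" if "b \<in> pts G ?A" "c \<in> pts G ?A" for b c
    using that A AA Q t by (simp add: act_Pr1 tup_pts)
  have m: "map (\<lambda>z. act G z (?e b c)) (?as[i := f]) = l[i := act G f (?e b c)]"
    if "b \<in> pts G ?A" "c \<in> pts G ?A" for b c f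
  proof -
    have "act G (?q \<cdot> proj X ?A n Y j) (?e b c) = l ! j" if j: "j < n" for j
      using l(2) j eq[OF \<open>b \<in> _\<close> \<open>c \<in> _\<close>] act_proj_arg[OF A Y l(1) y, of n j]
      by (simp only: act_Cmp[OF q proj_Hom_arg[OF A Y j] e[OF \<open>b \<in> _\<close> \<open>c \<in> _\<close>]])
    then have "map (\<lambda>z. act G z (?e b c)) ?as = l"
      using l(2) by (intro nth_equalityI) simp_all
    then show ?thesis by (simp add: map_update)
  qed
  have ye: "act G ?y (?e b c) = y" if "b \<in> pts G ?A" "c \<in> pts G ?A" for b c
    using eq[OF that] act_proj_last[OF A Y l(1) y] l(2)
    by (simp add: act_Cmp[OF q proj_Hom_last[OF A Y] e[OF that]])
  have app: "act G (app X h (?as[i := f]) ?y) (?e b c) = act G h (foldr (tup G) (l[i := act G f (?e b c)]) y)"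
    if "b \<in> pts G ?A" "c \<in> pts G ?A" "f \<in> Hom X ?W ?A" for b c f
    using act_app[OF h' up[OF that(3)] yH e[OF that(1,2)]] m[OF that(1,2)] ye[OF that(1,2)] by simp
  have be: "act G ?b (?e b c) = b" "act G ?c (?e b c) = c" if "b \<in> pts G ?A" "c \<in> pts G ?A" for b c
    using that e[OF that] A AA Q t
    by (simp_all add: act_Cmp[OF d Pr0_Hom] act_Cmp[OF d Pr1_Hom] act_Pr0 act_Pr1 tup_pts)
  have aH: "app X h (?as[i := f]) ?y \<in> Hom X ?W (carr N)" if "f \<in> Hom X ?W ?A" for f
    by (rule app_Hom[OF h' up[OF that] yH])
  show ?add if b: "b \<in> pts G ?A" and c: "c \<in> pts G ?A"
  proof -
    have "act G (app X h (?as[i := madd X M ?b ?c]) ?y) (?e b c) =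
        act G (madd X N (app X h (?as[i := ?b]) ?y) (app X h (?as[i := ?c]) ?y)) (?e b c)"
      by (rule arg_cong[OF add])
    then show ?thesis
      by (simp only: app[OF b c madd_Hom[OF M bH cH]] act_madd[OF N aH[OF bH] aH[OF cH] e[OF b c]]
          app[OF b c bH] app[OF b c cH] act_madd[OF M bH cH e[OF b c]] be[OF b c])
  qed
  have z: "\<one>\<^bsub>pmon G M\<^esub> \<in> pts G ?A"
    using comm_monoid.axioms(1)[OF comm_monoid_pmon[OF M]] monoid.one_closed carrier_pmon by metis
  \<comment> \<open>The factor for the two summands must be filled with some points of the carrier;
    the zeros are at hand.\<close>
  have "act G (app X h (?as[i := mzero X M ?W]) ?y) (?e \<one>\<^bsub>pmon G M\<^esub> \<one>\<^bsub>pmon G M\<^esub>) =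
      act G (mzero X N ?W) (?e \<one>\<^bsub>pmon G M\<^esub> \<one>\<^bsub>pmon G M\<^esub>)"
    by (rule arg_cong[OF zero])
  then show ?zero
    by (simp only: app[OF z z mzero_Hom[OF M W]] act_mzero[OF N W e[OF z z]] act_mzero[OF M W e[OF z z]])
qed

end


section \<open>The action of Faa di Bruno sequences on multisets\<close>

text \<open>The choice of the list is immaterial, as the components of a sequence are symmetric.\<close>

definition dm :: "('o, 'm, 'e) interp \<Rightarrow> (nat \<Rightarrow> 'm) \<Rightarrow> 'e multiset \<Rightarrow> 'e \<Rightarrow> 'e" where
  "dm G s M x = act G (s (size M)) (foldr (tup G) (SOME l. mset l = M) x)"

lemma some_mset: "mset (SOME l. mset l = M) = M"
  by (rule someI_ex) (rule ex_mset)

lemma dm_empty [simp]: "dm G s {#} x = act G (s 0) x"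
  by (simp add: dm_def)

lemma faa_arD:
  assumes "faa_ar X (FArr (M, U) (N, V) s)"
  shows "cmon_in X M" "cmon_in X N" "U \<in> Obj X" "V \<in> Obj X" "s 0 \<in> Hom X U V"
    and "n \<noteq> 0 \<Longrightarrow> s n \<in> Hom X (powprd X (carr M) n U) (carr N)"
    and "n \<noteq> 0 \<Longrightarrow> sym_map X (carr M) n U (s n)"
    and "n \<noteq> 0 \<Longrightarrow> multiadditive X M n U N (s n)"
  using assms by auto

context cat_model
begin

lemma dm_list:
  assumes f: "faa_ar X (FArr (M, U) (N, V) s)" and l: "set l \<subseteq> pts G (carr M)" and x: "x \<in> pts G U"
  shows "act G (s (length l)) (foldr (tup G) l x) = dm G s (mset l) x"
proof (cases "l = []")
  case False
  let ?l = "SOME l'. mset l' = mset l"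
  have "mset ?l = mset l" by (rule some_mset)
  then show ?thesis
    unfolding dm_def
    using sym_map_act[OF carr_Obj[OF faa_arD(1)[OF f]] faa_arD(3)[OF f] faa_arD(6)[OF f] faa_arD(7)[OF f] l _ _ x,
        of "length l" ?l] False by simp
qed simp

text \<open>On the empty multiset \<open>dm\<close> is the component of index \<open>0\<close>, with
  values in \<open>V\<close> instead of the carrier of \<open>N\<close>. Hence the nonemptiness
  required here and in \<open>dm_finprod_PiE\<close>.\<close>

lemma dm_closed:
  assumes f: "faa_ar X (FArr (M, U) (N, V) s)" and m: "set_mset m \<subseteq> pts G (carr M)" "m \<noteq> {#}"
    and x: "x \<in> pts G U"
  shows "dm G s m x \<in> pts G (carr N)"
proof -
  obtain l where l: "mset l = m" using ex_mset by blast
  then have l': "length l \<noteq> 0" "set l \<subseteq> pts G (carr M)" using m by auto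
  then have "act G (s (length l)) (foldr (tup G) l x) \<in> pts G (carr N)"
    using faa_arD(6)[OF f] tuple_pts[OF carr_Obj[OF faa_arD(1)[OF f]] faa_arD(3)[OF f]] x act_pts by blast
  then show ?thesis using dm_list[OF f l'(2) x] l by simp
qed

text \<open>By symmetry any argument may be listed in front, so additivity at position
  \<open>0\<close> is additivity in every argument.\<close>

lemma dm_mult:
  assumes f: "faa_ar X (FArr (M, U) (N, V) s)" and m: "set_mset m \<subseteq> pts G (carr M)"
    and x: "x \<in> pts G U" and b: "b \<in> pts G (carr M)" and c: "c \<in> pts G (carr M)"
  shows "dm G s (add_mset (b \<otimes>\<^bsub>pmon G M\<^esub> c) m) x =
    dm G s (add_mset b m) x \<otimes>\<^bsub>pmon G N\<^esub> dm G s (add_mset c m) x"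
proof -
  obtain l where l: "mset l = m" using ex_mset by blast
  then have l': "set l \<subseteq> pts G (carr M)" using m by auto
  have bc: "b \<otimes>\<^bsub>pmon G M\<^esub> c \<in> pts G (carr M)"
    using comm_monoid_pmon[OF faa_arD(1)[OF f]] b c
    by (metis carrier_pmon comm_monoid.axioms(1) monoid.m_closed)
  have "act G (s (length (d # l))) (foldr (tup G) (d # l) x) = dm G s (add_mset d m) x"
    if "d \<in> pts G (carr M)" for d
    using dm_list[OF f, of "d # l" x] l l' that x by simp
  then show ?thesis
    using multiadditive_act(1)[OF faa_arD(1,2,3)[OF f] faa_arD(6)[OF f] faa_arD(8)[OF f], of "length (b # l)" "b # l" 0 x b c]
      l' b c x bc by simp
qed

lemma dm_one:
  assumes f: "faa_ar X (FArr (M, U) (N, V) s)" and m: "set_mset m \<subseteq> pts G (carr M)"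
    and x: "x \<in> pts G U"
  shows "dm G s (add_mset \<one>\<^bsub>pmon G M\<^esub> m) x = \<one>\<^bsub>pmon G N\<^esub>"
proof -
  let ?z = "\<one>\<^bsub>pmon G M\<^esub>"
  obtain l where l: "mset l = m" using ex_mset by blast
  then have l': "set l \<subseteq> pts G (carr M)" using m by auto
  have z: "?z \<in> pts G (carr M)"
    using comm_monoid_pmon[OF faa_arD(1)[OF f]]
    by (metis carrier_pmon comm_monoid.axioms(1) monoid.one_closed)
  have "act G (s (length (?z # l))) (foldr (tup G) (?z # l) x) = dm G s (add_mset ?z m) x"
    using dm_list[OF f, of "?z # l" x] l l' z x by simp
  then show ?thesis
    using multiadditive_act(2)[OF faa_arD(1,2,3)[OF f] faa_arD(6)[OF f] faa_arD(8)[OF f], of "length (?z # l)" "?z # l" 0 x]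
      l' z x by simp
qed

lemma dm_finprod:
  assumes f: "faa_ar X (FArr (M, U) (N, V) s)" and m: "set_mset m \<subseteq> pts G (carr M)"
    and x: "x \<in> pts G U" and b: "\<And>i. i \<in> I \<Longrightarrow> b i \<in> pts G (carr M)"
  shows "dm G s (add_mset (finprod (pmon G M) b I) m) x =
    finprod (pmon G N) (\<lambda>i. dm G s (add_mset (b i) m) x) I"
  by (rule finprod_hom)
    (use dm_mult[OF f m x] dm_one[OF f m x] dm_closed[OF f _ _ x] m b
      comm_monoid_pmon[OF faa_arD(1)[OF f]] comm_monoid_pmon[OF faa_arD(2)[OF f]] in \<open>auto simp: carrier_pmon\<close>)

lemma finprod_pts:
  assumes "cmon_in X M" "\<And>i. i \<in> I \<Longrightarrow> t i \<in> pts G (carr M)"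
  shows "finprod (pmon G M) t I \<in> pts G (carr M)"
  using comm_monoid.finprod_closed[OF comm_monoid_pmon[OF assms(1)], of t I] assms(2)
  by (auto simp: carrier_pmon)

text \<open>Multilinear expansion: a multiadditive map applied to sums is the sum over all choice
  functions \<open>\<phi>\<close>. The multiset \<open>m\<close> holds the arguments that have
  already been expanded and is generalised in the induction on \<open>K\<close>.\<close>

lemma dm_finprod_PiE:
  assumes f: "faa_ar X (FArr (M, U) (N, V) s)" and m: "set_mset m \<subseteq> pts G (carr M)"
    and x: "x \<in> pts G U" and K: "finite K" "\<And>k. k \<in> K \<Longrightarrow> finite (T k)"
    and b: "\<And>k i. k \<in> K \<Longrightarrow> i \<in> T k \<Longrightarrow> b k i \<in> pts G (carr M)" and ne: "K \<noteq> {} \<or> m \<noteq> {#}"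
  shows "dm G s (m + image_mset (\<lambda>k. finprod (pmon G M) (b k) (T k)) (mset_set K)) x =
    finprod (pmon G N) (\<lambda>\<phi>. dm G s (m + image_mset (\<lambda>k. b k (\<phi> k)) (mset_set K)) x) (Pi\<^sub>E K T)"
  using K b m ne
proof (induction K arbitrary: m rule: finite_induct)
  case empty
  interpret N: comm_monoid "pmon G N" by (rule comm_monoid_pmon[OF faa_arD(2)[OF f]])
  have "dm G s m x \<in> pts G (carr N)" using dm_closed[OF f _ _ x] empty by simp
  then show ?case by (simp add: carrier_pmon)
next
  case (insert k K)
  interpret N: comm_monoid "pmon G N" by (rule comm_monoid_pmon[OF faa_arD(2)[OF f]])
  let ?S = "\<lambda>k. finprod (pmon G M) (b k) (T k)"
  have S: "?S k' \<in> pts G (carr M)" if "k' \<in> insert k K" for k'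
    using insert that by (intro finprod_pts[OF faa_arD(1)[OF f]]) auto
  have "dm G s (m + image_mset ?S (mset_set (insert k K))) x =
      dm G s (add_mset (?S k) (m + image_mset ?S (mset_set K))) x"
    using insert by simp
  also have "\<dots> = finprod (pmon G N) (\<lambda>i. dm G s (add_mset (b k i) (m + image_mset ?S (mset_set K))) x) (T k)"
    by (rule dm_finprod[OF f _ x]) (use insert S in auto)
  also have "\<dots> = finprod (pmon G N) (\<lambda>i. finprod (pmon G N)
      (\<lambda>\<phi>. dm G s (add_mset (b k i) m + image_mset (\<lambda>k. b k (\<phi> k)) (mset_set K)) x) (Pi\<^sub>E K T)) (T k)"
  proof (rule N.finprod_cong')
    fix i assume i: "i \<in> T k"
    show "dm G s (add_mset (b k i) (m + image_mset ?S (mset_set K))) x = finprod (pmon G N)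
      (\<lambda>\<phi>. dm G s (add_mset (b k i) m + image_mset (\<lambda>k. b k (\<phi> k)) (mset_set K)) x) (Pi\<^sub>E K T)"
      using insert.IH[of "add_mset (b k i) m"] insert.prems i by simp
  next
    show "(\<lambda>i. finprod (pmon G N) (\<lambda>\<phi>. dm G s (add_mset (b k i) m + image_mset (\<lambda>k. b k (\<phi> k)) (mset_set K)) x) (Pi\<^sub>E K T))
      \<in> T k \<rightarrow> carrier (pmon G N)"
      using insert.prems insert.hyps
      by (intro funcsetI N.finprod_closed) (auto simp: carrier_pmon PiE_iff intro!: dm_closed[OF f _ _ x])
  qed simp
  also have "\<dots> = finprod (pmon G N)
      (\<lambda>(i, \<phi>). dm G s (add_mset (b k i) m + image_mset (\<lambda>k. b k (\<phi> k)) (mset_set K)) x) (T k \<times> Pi\<^sub>E K T)"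
    by (rule N.finprod_Sigma)
      (use insert.prems insert.hyps in \<open>auto simp: carrier_pmon PiE_iff intro!: finite_PiE dm_closed[OF f _ _ x]\<close>)
  also have "\<dots> = finprod (pmon G N)
      (\<lambda>\<phi>. dm G s (m + image_mset (\<lambda>k. b k (\<phi> k)) (mset_set (insert k K))) x) (Pi\<^sub>E (insert k K) T)"
  proof (rule N.finprod_bij_betw)
    show "bij_betw (\<lambda>(i, \<phi>). \<phi>(k := i)) (T k \<times> Pi\<^sub>E K T) (Pi\<^sub>E (insert k K) T)"
      using inj_combinator[OF insert.hyps(2), of T] by (simp add: bij_betw_def PiE_insert_eq case_prod_unfold)
    show "(\<lambda>\<phi>. dm G s (m + image_mset (\<lambda>k. b k (\<phi> k)) (mset_set (insert k K))) x)
      \<in> Pi\<^sub>E (insert k K) T \<rightarrow> carrier (pmon G N)"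
      using insert.prems insert.hyps by (auto simp: carrier_pmon PiE_iff intro!: dm_closed[OF f _ _ x])
    fix z assume "z \<in> T k \<times> Pi\<^sub>E K T"
    then obtain i \<phi> where z: "z = (i, \<phi>)" by auto
    have "image_mset (\<lambda>k'. b k' ((\<phi>(k := i)) k')) (mset_set K) = image_mset (\<lambda>k. b k (\<phi> k)) (mset_set K)"
      by (rule image_mset_cong) (use insert.hyps in auto)
    then show "(case z of (i, \<phi>) \<Rightarrow> dm G s (add_mset (b k i) m + image_mset (\<lambda>k. b k (\<phi> k)) (mset_set K)) x) =
      dm G s (m + image_mset (\<lambda>k'. b k' ((case z of (i, \<phi>) \<Rightarrow> \<phi>(k := i)) k')) (mset_set (insert k K))) x"
      using insert.hyps by (simp add: z)
  qed
  finally show ?case .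
qed

end

text \<open>The standing situation, reproduced for \<open>Faa X\<close> by
  \<open>separated_Faa\<close>; every statement proved here therefore applies again to
  \<open>Faa X\<close> and \<open>Faa (Faa X)\<close>.\<close>

locale separated = cartesian_category X
  for X :: "('o, 'm) ccat" (structure) +
  fixes \<M> :: "('o, 'm, 'e) interp set"
  assumes models: "G \<in> \<M> \<Longrightarrow> set_model X G"
    and sep: "separating X \<M>"
begin

lemma cat_models: "G \<in> \<M> \<Longrightarrow> cat_model X G"
  by (simp add: cat_model_def models cartesian_category_axioms)

lemma arr_eqI:
  "f \<in> Hom X A B \<Longrightarrow> g \<in> Hom X A B \<Longrightarrow>
    (\<And>G e. G \<in> \<M> \<Longrightarrow> e \<in> pts G A \<Longrightarrow> act G f e = act G g e) \<Longrightarrow> f = g"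
  by (rule separatingD[OF sep])

text \<open>
  An intrinsic function \<open>\<Phi>\<close> of the set of indices and the family of arguments is symmetric by
  construction.
\<close>

lemma faa_arI:
  fixes \<Phi> :: "('o, 'm, 'e) interp \<Rightarrow> nat set \<Rightarrow> (nat \<Rightarrow> 'e) \<Rightarrow> 'e \<Rightarrow> 'e"
  assumes M: "cmon_in X M" and U: "U \<in> Obj X" and N: "cmon_in X N" and V: "V \<in> Obj X"
    and s0: "s 0 \<in> Hom X U V"
    and sn: "\<And>n. n \<noteq> 0 \<Longrightarrow> s n \<in> Hom X (powprd X (carr M) n U) (carr N)"
    and \<Phi>: "\<And>G ks a x. G \<in> \<M> \<Longrightarrow> ks \<noteq> [] \<Longrightarrow> distinct ks \<Longrightarrow> (\<And>k. k \<in> set ks \<Longrightarrow> a k \<in> pts G (carr M)) \<Longrightarrow>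
        x \<in> pts G U \<Longrightarrow> act G (s (length ks)) (foldr (tup G) (map a ks) x) = \<Phi> G (set ks) a x"
    and add: "\<And>G K a x k b c. G \<in> \<M> \<Longrightarrow> finite K \<Longrightarrow> k \<in> K \<Longrightarrow> (\<And>k. k \<in> K \<Longrightarrow> a k \<in> pts G (carr M)) \<Longrightarrow>
        x \<in> pts G U \<Longrightarrow> b \<in> pts G (carr M) \<Longrightarrow> c \<in> pts G (carr M) \<Longrightarrow>
        \<Phi> G K (a(k := b \<otimes>\<^bsub>pmon G M\<^esub> c)) x = \<Phi> G K (a(k := b)) x \<otimes>\<^bsub>pmon G N\<^esub> \<Phi> G K (a(k := c)) x"
    and zero: "\<And>G K a x k. G \<in> \<M> \<Longrightarrow> finite K \<Longrightarrow> k \<in> K \<Longrightarrow> (\<And>k. k \<in> K \<Longrightarrow> a k \<in> pts G (carr M)) \<Longrightarrow>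
        x \<in> pts G U \<Longrightarrow> \<Phi> G K (a(k := \<one>\<^bsub>pmon G M\<^esub>)) x = \<one>\<^bsub>pmon G N\<^esub>"
  shows "faa_ar X (FArr (M, U) (N, V) (s :: nat \<Rightarrow> 'm))"
proof -
  let ?A = "carr M"
  have A: "?A \<in> Obj X" using M carr_Obj by blast
  have val: "act G (s n) (foldr (tup G) l x) = \<Phi> G {..<n} ((!) l) x"
    if "G \<in> \<M>" "n \<noteq> 0" "length l = n" "set l \<subseteq> pts G ?A" "x \<in> pts G U" for G n l x
  proof -
    have "map ((!) l) [0..<n] = l" using that(3) map_nth[of l] by simp
    moreover have "set [0..<n] = {..<n}" by auto
    ultimately show ?thesis
      using \<Phi>[OF that(1), of "[0..<n]" "(!) l" x] that by (auto simp: subset_iff)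
  qed
  have "sym_map X ?A n U (s n)" if n: "n \<noteq> 0" for n
    unfolding sym_map_def
  proof (intro ballI allI impI)
    fix W y as bs
    assume W: "W \<in> Obj X" and y: "y \<in> Hom X W U"
      and as: "length as = n \<and> set as \<subseteq> Hom X W ?A \<and> mset bs = mset as"
    have lb: "length bs = n" using as mset_eq_length by metis
    have sb: "set bs \<subseteq> Hom X W ?A" using as set_mset_mset by metis
    have h: "s n \<in> Hom X (powprd X ?A (length as) U) (carr N)" "s n \<in> Hom X (powprd X ?A (length bs) U) (carr N)"
      using sn[OF n] as lb by auto
    have asH: "set as \<subseteq> Hom X W ?A" using as by simp
    show "app X (s n) bs y = app X (s n) as y"
    proof (rule arr_eqI[OF app_Hom[OF h(2) sb y] app_Hom[OF h(1) asH y]])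
      fix G e assume G: "G \<in> \<M>" and e: "e \<in> pts G W"
      interpret cat_model X G by (rule cat_models[OF G])
      let ?l = "map (\<lambda>z. act G z e) as" and ?l' = "map (\<lambda>z. act G z e) bs"
      have ye: "act G y e \<in> pts G U" by (rule act_pts[OF y e])
      have sl: "set ?l \<subseteq> pts G ?A" "set ?l' \<subseteq> pts G ?A" using act_pts[OF _ e] asH sb by auto
      have "mset ?l' = mset ?l" using as by simp
      then obtain p where p: "p permutes {..<length ?l}" "permute_list p ?l = ?l'"
        using mset_eq_permutation by blast
      \<comment> \<open>The permuted tuple is the same family listed along
        \<open>map p [0..<n]\<close>, and \<open>\<Phi>\<close> sees only the set of indices and the
        family.\<close>
      have "act G (s n) (foldr (tup G) ?l' (act G y e)) = \<Phi> G {..<n} ((!) ?l) (act G y e)"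
      proof -
        have ln: "length ?l = n" using as by simp
        have "?l' = map ((!) ?l) (map p [0..<n])"
          unfolding p(2)[symmetric] permute_list_def ln by (simp add: comp_def)
        moreover have pb: "p ` {..<n} = {..<n}" using p(1) ln permutes_image by metis
        then have "set (map p [0..<n]) = {..<n}" by (simp add: atLeast0LessThan)
        moreover have "distinct (map p [0..<n])"
          using p(1) by (simp add: distinct_map permutes_inj_on)
        ultimately show ?thesis
          using \<Phi>[OF G, of "map p [0..<n]" "(!) ?l" "act G y e"] n ye sl(1) ln
          by (auto simp: subset_iff simp del: map_map)
      qed
      also have "\<dots> = act G (s n) (foldr (tup G) ?l (act G y e))"
        using val[OF G n _ sl(1) ye] as by simp
      finally show "act G (app X (s n) bs y) e = act G (app X (s n) as y) e"
        using act_app[OF h(2) sb y e] act_app[OF h(1) asH y e] by simp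
    qed
  qed
  moreover have "multiadditive X M n U N (s n)" if n: "n \<noteq> 0" for n
    unfolding multiadditive_def
  proof (intro ballI allI impI)
    fix W y as i
    assume W: "W \<in> Obj X" and y: "y \<in> Hom X W U"
      and as: "length as = n \<and> set as \<subseteq> Hom X W ?A" and i: "i < n"
    have asH: "as ! k \<in> Hom X W ?A" if "k < n" for k using as that by auto
    have H: "app X (s n) (as[i := f]) y \<in> Hom X W (carr N)" if "f \<in> Hom X W ?A" for f
      by (rule app_Hom[of _ ?A _ U]) (use sn[OF n] as that y set_update_subsetI[of as "Hom X W ?A" f i] in auto)
    \<comment> \<open>Replacing the entry \<open>i\<close> of the list is an update of the family at
      \<open>i\<close>, so additivity of \<open>\<Phi>\<close> in a single index suffices.\<close>
    have ev: "act G (app X (s n) (as[i := f]) y) e =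
        \<Phi> G {..<n} (((!) (map (\<lambda>z. act G z e) as))(i := act G f e)) (act G y e)"
      if G: "G \<in> \<M>" and e: "e \<in> pts G W" and f: "f \<in> Hom X W ?A" for G e f
    proof -
      interpret cat_model X G by (rule cat_models[OF G])
      let ?l = "map (\<lambda>z. act G z e) as"
      have ye: "act G y e \<in> pts G U" by (rule act_pts[OF y e])
      have sub: "set (as[i := f]) \<subseteq> Hom X W ?A" using as f set_update_subsetI by metis
      have "act G (app X (s n) (as[i := f]) y) e = act G (s n) (foldr (tup G) (?l[i := act G f e]) (act G y e))"
        using act_app[OF _ sub y e, of "s n" "carr N"] sn[OF n] as by (simp add: map_update)
      also have "\<dots> = act G (s (length [0..<n])) (foldr (tup G) (map (((!) ?l)(i := act G f e)) [0..<n]) (act G y e))"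
      proof -
        have "?l[i := act G f e] = map (((!) ?l)(i := act G f e)) [0..<n]"
          using as by (auto intro!: nth_equalityI simp: nth_list_update)
        then show ?thesis by simp
      qed
      also have "\<dots> = \<Phi> G (set [0..<n]) (((!) ?l)(i := act G f e)) (act G y e)"
        by (rule \<Phi>[OF G]) (use n ye as act_pts[OF asH e] act_pts[OF f e] in auto)
      finally show ?thesis by (simp add: atLeast0LessThan)
    qed
    have pa: "\<And>k. k \<in> {..<n} \<Longrightarrow> (!) (map (\<lambda>z. act G z e) as) k \<in> pts G ?A"
      if G: "G \<in> \<M>" and e: "e \<in> pts G W" for G e
      using as set_model.act_pts[OF models[OF G] asH e] by auto
    have z: "mzero X M W \<in> Hom X W ?A" using M W by (cases M) (auto intro: Cmp_Hom bang_Hom dest: cmon_in_Hom)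
    have zN: "mzero X N W \<in> Hom X W (carr N)" using N W by (cases N) (auto intro: Cmp_Hom bang_Hom dest: cmon_in_Hom)
    show "(\<forall>b \<in> Hom X W ?A. \<forall>c \<in> Hom X W ?A. app X (s n) (as[i := madd X M b c]) y =
        madd X N (app X (s n) (as[i := b]) y) (app X (s n) (as[i := c]) y)) \<and>
      app X (s n) (as[i := mzero X M W]) y = mzero X N W"
    proof (intro conjI ballI)
      fix b c assume b: "b \<in> Hom X W ?A" and c: "c \<in> Hom X W ?A"
      have bc: "madd X M b c \<in> Hom X W ?A" using M b c by (cases M) (auto intro: Cmp_Hom pair_Hom dest: cmon_in_Hom)
      have mN: "madd X N f g \<in> Hom X W (carr N)" if "f \<in> Hom X W (carr N)" "g \<in> Hom X W (carr N)" for f g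
        using N that by (cases N) (auto intro: Cmp_Hom pair_Hom dest: cmon_in_Hom)
      show "app X (s n) (as[i := madd X M b c]) y =
        madd X N (app X (s n) (as[i := b]) y) (app X (s n) (as[i := c]) y)"
      proof (rule arr_eqI[OF H[OF bc] mN[OF H[OF b] H[OF c]]])
        fix G e assume G: "G \<in> \<M>" and e: "e \<in> pts G W"
        interpret cat_model X G by (rule cat_models[OF G])
        show "act G (app X (s n) (as[i := madd X M b c]) y) e =
          act G (madd X N (app X (s n) (as[i := b]) y) (app X (s n) (as[i := c]) y)) e"
          unfolding act_madd[OF N H[OF b] H[OF c] e] ev[OF G e bc] ev[OF G e b] ev[OF G e c] act_madd[OF M b c e]
          by (rule add[OF G]) (use i act_pts[OF b e] act_pts[OF c e] act_pts[OF y e] pa[OF G e] in auto)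
      qed
    next
      show "app X (s n) (as[i := mzero X M W]) y = mzero X N W"
      proof (rule arr_eqI[OF H[OF z] zN])
        fix G e assume G: "G \<in> \<M>" and e: "e \<in> pts G W"
        interpret cat_model X G by (rule cat_models[OF G])
        show "act G (app X (s n) (as[i := mzero X M W]) y) e = act G (mzero X N W) e"
          unfolding act_mzero[OF N W e] ev[OF G e z] act_mzero[OF M W e]
          by (rule zero[OF G]) (use i act_pts[OF y e] pa[OF G e] in auto)
      qed
    qed
  qed
  ultimately show ?thesis using assms by simp
qed

end


section \<open>Prolongations\<close>

text \<open>
  A point of the prolongation is a family indexed by the subsets of \<open>J\<close>, read as the coefficients
  of the square-free monomials in infinitesimals \<open>\<epsilon>\<^sub>j\<close>, \<open>j \<in> J\<close>, of square zero. A sequence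
  acts by Taylor expansion, and its composition becomes the composition of functions.
\<close>

definition prol :: "nat set \<Rightarrow> ('o, 'm, 'e) interp \<Rightarrow>
    (('o, 'm) faa_obj, ('o, 'm) faa_arr, nat set \<Rightarrow> 'e) interp" where
  "prol J G =
     \<lparr>pts = \<lambda>(M, U). {a \<in> extensional (Pow J). \<forall>S \<subseteq> J. a S \<in> pts G (if S = {} then U else carr M)},
      act = \<lambda>f a. \<lambda>S \<in> Pow J. if S = {} then act G (fseq f 0) (a {})
        else finprod (pmon G (fst (fcod f)))
          (\<lambda>P. dm G (fseq f) (image_mset a (mset_set P)) (a {})) (partitions S),
      tup = \<lambda>a b. \<lambda>S \<in> Pow J. tup G (a S) (b S),
      pt = \<lambda>S \<in> Pow J. pt G\<rparr>"

lemma prol_pts_iff: "a \<in> pts (prol J G) (M, U) \<longleftrightarrow>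
    a \<in> extensional (Pow J) \<and> (\<forall>S \<subseteq> J. a S \<in> pts G (if S = {} then U else carr M))"
  by (simp add: prol_def)

lemma prol_ext: "a \<in> pts (prol J G) P \<Longrightarrow> a \<in> extensional (Pow J)"
  by (cases P) (simp add: prol_pts_iff)

lemma prol_eqI:
  assumes "a \<in> extensional (Pow J)" "b \<in> extensional (Pow J)" "\<And>S. S \<subseteq> J \<Longrightarrow> a S = b S"
  shows "a = b"
  by (rule extensionalityI[OF assms(1,2)]) (use assms(3) in auto)

lemma prol_pts_base: "a \<in> pts (prol J G) (M, U) \<Longrightarrow> a {} \<in> pts G U"
  by (auto simp: prol_pts_iff)

lemma prol_pts_fibre: "a \<in> pts (prol J G) (M, U) \<Longrightarrow> S \<subseteq> J \<Longrightarrow> S \<noteq> {} \<Longrightarrow> a S \<in> pts G (carr M)"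
  unfolding prol_pts_iff by (elim conjE) (drule spec[of _ S], simp)

lemma prol_blocks_pts:
  assumes a: "a \<in> pts (prol J G) (M, U)" and "finite S" "S \<subseteq> J" and P: "partition_on S P"
  shows "set_mset (image_mset a (mset_set P)) \<subseteq> pts G (carr M)"
proof -
  have "finite P" using finite_elements assms by blast
  moreover have "a B \<in> pts G (carr M)" if "B \<in> P" for B
    using partition_block[OF P that] assms(3) by (intro prol_pts_fibre[OF a]) auto
  ultimately show ?thesis by auto
qed

lemma blocks_mset_nonempty:
  assumes "partition_on S P" "S \<noteq> {}" "finite S" shows "image_mset a (mset_set P) \<noteq> {#}"
  using assms finite_elements[of S P] by (auto simp: mset_set_empty_iff partition_on_def)

lemma prol_tup [simp]: "tup (prol J G) a b = (\<lambda>S \<in> Pow J. tup G (a S) (b S))"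
  by (simp add: prol_def)

lemma prol_pt [simp]: "pt (prol J G) = (\<lambda>S \<in> Pow J. pt G)"
  by (simp add: prol_def)

lemma act_prol: "act (prol J G) f a = (\<lambda>S \<in> Pow J. if S = {} then act G (fseq f 0) (a {})
    else finprod (pmon G (fst (fcod f)))
      (\<lambda>P. dm G (fseq f) (image_mset a (mset_set P)) (a {})) (partitions S))"
  by (simp add: prol_def)

lemma act_prol_base [simp]: "act (prol J G) f a {} = act G (fseq f 0) (a {})"
  by (simp add: act_prol)

lemma act_prol_fibre:
  "S \<subseteq> J \<Longrightarrow> S \<noteq> {} \<Longrightarrow> act (prol J G) f a S = finprod (pmon G (fst (fcod f)))
    (\<lambda>P. dm G (fseq f) (image_mset a (mset_set P)) (a {})) (partitions S)"
  by (simp add: act_prol)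

lemma Faa_simps [simp]:
  "Obj (Faa X) = {P. faa_ob X P}" "Arr (Faa X) = {f. faa_ar X f}" "Dom (Faa X) = fdom"
  "Cod (Faa X) = fcod" "Ide (Faa X) = faa_ide X" "Cmp (Faa X) = faa_cmp X"
  "One (Faa X) = (one_cmon X, One X)" "Prd (Faa X) = faa_prd X" "Pr0 (Faa X) = faa_pr0 X"
  "Pr1 (Faa X) = faa_pr1 X"
  by (simp_all add: Faa_def)

lemma Hom_Faa_iff: "FArr P Q s \<in> Hom (Faa X) P' Q' \<longleftrightarrow> P' = P \<and> Q' = Q \<and> faa_ar X (FArr P Q s)"
  by (auto simp: Hom_def)

lemma Hom_FaaE:
  assumes "f \<in> Hom (Faa X) (M, U) (N, V)"
  obtains s where "f = FArr (M, U) (N, V) s" "faa_ar X (FArr (M, U) (N, V) s)"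
  using assms by (cases f) (auto simp: Hom_def)

lemma mset_map_distinct: "distinct ks \<Longrightarrow> mset (map a ks) = image_mset a (mset_set (set ks))"
  by (simp add: mset_set_set)

lemma image_mset_upd:
  assumes "finite C"
  shows "k \<in> C \<Longrightarrow> image_mset (a(k := v)) (mset_set C) = add_mset v (image_mset a (mset_set (C - {k})))"
    and "k \<notin> C \<Longrightarrow> image_mset (a(k := v)) (mset_set C) = image_mset a (mset_set C)"
proof -
  have *: "image_mset (a(k := v)) (mset_set D) = image_mset a (mset_set D)" if "k \<notin> D" "finite D" for D
    by (rule image_mset_cong) (use that in auto)
  then show "k \<notin> C \<Longrightarrow> image_mset (a(k := v)) (mset_set C) = image_mset a (mset_set C)"
    using assms by blast
  show "image_mset (a(k := v)) (mset_set C) = add_mset v (image_mset a (mset_set (C - {k})))" if "k \<in> C"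
    using mset_set.remove[OF assms that] *[of "C - {k}"] assms by simp
qed

lemma partition_finite:
  assumes "finite S" "partition_on S P"
  shows "finite P" "B \<in> P \<Longrightarrow> finite B"
  using assms finite_elements partition_block by (blast, metis finite_subset)

section \<open>Composites of sequences, evaluated at points\<close>

lemma blocks: "finite P \<Longrightarrow> distinct (blocks P) \<and> set (blocks P) = P"
  unfolding blocks_def by (rule someI_ex) (use finite_distinct_list in blast)

text \<open>The component of a composite written for a family \<open>b\<close> over an arbitrary
  index set \<open>K\<close>, free of any enumeration of arguments or blocks.\<close>

definition comp_sum :: "('o, 'm, 'e) interp \<Rightarrow> ('o, 'm) cmon \<Rightarrow> (nat \<Rightarrow> 'm) \<Rightarrow> (nat \<Rightarrow> 'm) \<Rightarrow>
    'k set \<Rightarrow> ('k \<Rightarrow> 'e) \<Rightarrow> 'e \<Rightarrow> 'e" where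
  "comp_sum G L s t K b u = finprod (pmon G L)
     (\<lambda>R. dm G t (image_mset (\<lambda>C. dm G s (image_mset b (mset_set C)) u) (mset_set R)) (act G (s 0) u))
     (partitions K)"

context cartesian_category
begin

lemma cmp_term_Hom:
  assumes f: "faa_ar X (FArr (M, U) (N, V) s)" and g: "faa_ar X (FArr (N, V) (L, T) t)"
    and P: "partition_on {..<n} P" and n: "n \<noteq> 0"
  defines "a \<equiv> proj X (carr M) n U"
  shows "B \<in> P \<Longrightarrow> app X (s (card B)) (map a (sorted_list_of_set B)) (a n) \<in> Hom X (powprd X (carr M) n U) (carr N)"
    and "app X (t (card P)) (map (\<lambda>B. app X (s (card B)) (map a (sorted_list_of_set B)) (a n)) (blocks P))
      (a n \<cdot> s 0) \<in> Hom X (powprd X (carr M) n U) (carr L)"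
proof -
  have A: "carr M \<in> Obj X" and U: "U \<in> Obj X" using faa_arD(3)[OF f] carr_Obj[OF faa_arD(1)[OF f]] by auto
  have x: "a n \<in> Hom X (powprd X (carr M) n U) U" unfolding a_def by (rule proj_Hom_last[OF A U])
  have fin: "finite P" and finB: "\<And>B. B \<in> P \<Longrightarrow> finite B" using partition_finite[OF _ P] by auto
  show 1: "app X (s (card B)) (map a (sorted_list_of_set B)) (a n) \<in> Hom X (powprd X (carr M) n U) (carr N)"
    if B: "B \<in> P" for B
  proof (rule app_Hom[OF _ _ x])
    have "card B \<noteq> 0" using partition_block[OF P B] finB[OF B] by simp
    then show "s (card B) \<in> Hom X (powprd X (carr M) (length (map a (sorted_list_of_set B))) U) (carr N)"
      using faa_arD(6)[OF f] by simp
    show "set (map a (sorted_list_of_set B)) \<subseteq> Hom X (powprd X (carr M) n U) (carr M)"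
      using partition_block[OF P B] finB[OF B] proj_Hom_arg[OF A U] unfolding a_def by auto
  qed
  have "P \<noteq> {}" using P n by (auto simp: partition_on_def)
  then have "card P \<noteq> 0" using fin by simp
  moreover have "length (blocks P) = card P" using blocks[OF fin] distinct_card by metis
  ultimately show "app X (t (card P)) (map (\<lambda>B. app X (s (card B)) (map a (sorted_list_of_set B)) (a n)) (blocks P))
      (a n \<cdot> s 0) \<in> Hom X (powprd X (carr M) n U) (carr L)"
    by (intro app_Hom[OF _ _ Cmp_Hom[OF x faa_arD(5)[OF f]]])
      (use faa_arD(6)[OF g] 1 blocks[OF fin] in auto)
qed

lemma faa_cmp_Hom:
  assumes f: "faa_ar X (FArr (M, U) (N, V) s)" and g: "faa_ar X (FArr (N, V) (L, T) t)" and n: "n \<noteq> 0"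
  shows "fseq (faa_cmp X (FArr (M, U) (N, V) s) (FArr (N, V) (L, T) t)) n
    \<in> Hom X (powprd X (carr M) n U) (carr L)"
  using n cmp_term_Hom(2)[OF f g _ n] faa_arD[OF f] faa_arD(2)[OF g]
  by (auto simp: Let_def intro!: msum_Hom powprd_Obj dest: carr_Obj)

end

context cat_model
begin

text \<open>The orders chosen by \<open>sorted_list_of_set\<close> and \<open>blocks\<close>
  disappear in multisets, and the enumeration \<open>ks\<close> carries partitions of positions to
  partitions of labels. The labels are arbitrary because later they are themselves blocks of a
  partition.\<close>

lemma act_faa_cmp:
  fixes b :: "'k \<Rightarrow> 'e"
  assumes f: "faa_ar X (FArr (M, U) (N, V) s)" and g: "faa_ar X (FArr (N, V) (L, T) t)"
    and ks: "ks \<noteq> []" "distinct ks" and b: "\<And>k. k \<in> set ks \<Longrightarrow> b k \<in> pts G (carr M)" and u: "u \<in> pts G U"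
  shows "act G (fseq (faa_cmp X (FArr (M, U) (N, V) s) (FArr (N, V) (L, T) t)) (length ks))
      (foldr (tup G) (map b ks) u) = comp_sum G L s t (set ks) b u"
proof -
  let ?n = "length ks" and ?A = "carr M"
  let ?e = "foldr (tup G) (map b ks) u"
  let ?a = "proj X ?A ?n U" and ?W = "powprd X ?A ?n U"
  interpret L: comm_monoid "pmon G L" by (rule comm_monoid_pmon[OF faa_arD(2)[OF g]])
  have n: "?n \<noteq> 0" using ks by simp
  have A: "?A \<in> Obj X" and U: "U \<in> Obj X" using faa_arD(3)[OF f] carr_Obj[OF faa_arD(1)[OF f]] by auto
  have W: "?W \<in> Obj X" using powprd_Obj[OF A U] .
  have sb: "set (map b ks) \<subseteq> pts G ?A" using b by auto
  have e: "?e \<in> pts G ?W" using tuple_pts[OF A U sb u] by simp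
  have x: "?a ?n \<in> Hom X ?W U" by (rule proj_Hom_last[OF A U])
  have ae: "act G (?a i) ?e = b (ks ! i)" if "i < ?n" for i
    using act_proj_arg[OF A U sb u, of ?n i] that by simp
  have xe: "act G (?a ?n) ?e = u" using act_proj_last[OF A U sb u, of ?n] by simp
  have inner: "act G (app X (s (card B)) (map ?a (sorted_list_of_set B)) (?a ?n)) ?e =
      dm G s (image_mset (\<lambda>i. b (ks ! i)) (mset_set B)) u" if P: "partition_on {..<?n} P" and B: "B \<in> P" for P B
  proof -
    have finB: "finite B" "B \<subseteq> {..<?n}" "B \<noteq> {}" using partition_block[OF P B] finite_subset by auto
    have 1: "set (map ?a (sorted_list_of_set B)) \<subseteq> Hom X ?W ?A"
      using finB proj_Hom_arg[OF A U] by auto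
    have 2: "s (card B) \<in> Hom X (powprd X ?A (length (map ?a (sorted_list_of_set B))) U) (carr N)"
      using faa_arD(6)[OF f, of "card B"] finB by simp
    have 3: "map (\<lambda>z. act G z ?e) (map ?a (sorted_list_of_set B)) = map (\<lambda>i. b (ks ! i)) (sorted_list_of_set B)"
      using finB ae by auto
    have "set (map (\<lambda>i. b (ks ! i)) (sorted_list_of_set B)) \<subseteq> pts G ?A"
      using finB b by auto
    from dm_list[OF f this u] show ?thesis
      unfolding act_app[OF 2 1 x e] 3 xe using finB
      by (simp add: mset_map_distinct[OF distinct_sorted_list_of_set] del: mset_map)
  qed
  have outer: "act G (app X (t (card P)) (map (\<lambda>B. app X (s (card B)) (map ?a (sorted_list_of_set B)) (?a ?n)) (blocks P))
      (?a ?n \<cdot> s 0)) ?e = dm G t (image_mset (\<lambda>B. dm G s (image_mset (\<lambda>i. b (ks ! i)) (mset_set B)) u) (mset_set P)) (act G (s 0) u)"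
    if P: "partition_on {..<?n} P" for P
  proof -
    have fin: "finite P" using partition_finite[OF _ P] by auto
    note bl = blocks[OF fin]
    have len: "length (blocks P) = card P" using bl distinct_card by metis
    have "P \<noteq> {}" using P n by (auto simp: partition_on_def)
    then have c: "card P \<noteq> 0" using fin by simp
    let ?zs = "map (\<lambda>B. app X (s (card B)) (map ?a (sorted_list_of_set B)) (?a ?n)) (blocks P)"
    have 1: "set ?zs \<subseteq> Hom X ?W (carr N)" using cmp_term_Hom(1)[OF f g P n] bl by auto
    have 2: "t (card P) \<in> Hom X (powprd X (carr N) (length ?zs) V) (carr L)"
      using faa_arD(6)[OF g c] len by simp
    have x0: "?a ?n \<cdot> s 0 \<in> Hom X ?W V" by (rule Cmp_Hom[OF x faa_arD(5)[OF f]])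
    have 3: "map (\<lambda>z. act G z ?e) ?zs = map (\<lambda>B. dm G s (image_mset (\<lambda>i. b (ks ! i)) (mset_set B)) u) (blocks P)"
      using inner[OF P] bl by auto
    have x0e: "act G (?a ?n \<cdot> s 0) ?e = act G (s 0) u"
      using act_Cmp[OF x faa_arD(5)[OF f] e] xe by simp
    have u0: "act G (s 0) u \<in> pts G V" by (rule act_pts[OF faa_arD(5)[OF f] u])
    have "set (map (\<lambda>z. act G z ?e) ?zs) \<subseteq> pts G (carr N)" using 1 act_pts[OF _ e] by auto
    from dm_list[OF g this[unfolded 3] u0] show ?thesis
      unfolding act_app[OF 2 1 x0 e] 3 x0e using len bl by (simp add: mset_map_distinct del: mset_map)
  qed
  let ?F = "\<lambda>P. app X (t (card P)) (map (\<lambda>B. app X (s (card B)) (map ?a (sorted_list_of_set B)) (?a ?n)) (blocks P)) (?a ?n \<cdot> s 0)"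
  have "act G (fseq (faa_cmp X (FArr (M, U) (N, V) s) (FArr (N, V) (L, T) t)) ?n) ?e =
      act G (msum X ?W L ?F (partitions {..<?n})) ?e"
    using n by (simp add: Let_def)
  also have "\<dots> = finprod (pmon G L) (\<lambda>P. act G (?F P) ?e) (partitions {..<?n})"
    by (rule act_msum[OF faa_arD(2)[OF g] W _ e]) (use cmp_term_Hom(2)[OF f g _ n] in auto)
  also have "\<dots> = comp_sum G L s t (set ks) b u"
    unfolding comp_sum_def
  proof (rule L.finprod_bij_betw)
    have nth: "bij_betw ((!) ks) {..<?n} (set ks)" using ks bij_betw_nth by blast
    show bij: "bij_betw ((`) ((`) ((!) ks))) (partitions {..<?n}) (partitions (set ks))"
      by (rule bij_betw_partitions[OF nth])
    have eq: "act G (?F P) ?e = dm G t (image_mset (\<lambda>C. dm G s (image_mset b (mset_set C)) u)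
        (mset_set ((`) ((!) ks) ` P))) (act G (s 0) u)" if "P \<in> partitions {..<?n}" for P
    proof -
      have P: "partition_on {..<?n} P" using that by simp
      have inj: "inj_on ((!) ks) {..<?n}" using nth by (simp add: bij_betw_def)
      have sub: "B \<subseteq> {..<?n}" if "B \<in> P" for B using partition_block[OF P that] by simp
      have injP: "inj_on ((`) ((!) ks)) P"
        using inj sub by (meson inj_onI inj_on_image_eq_iff)
      have "image_mset (\<lambda>C. dm G s (image_mset b (mset_set C)) u) (mset_set ((`) ((!) ks) ` P)) =
          image_mset (\<lambda>B. dm G s (image_mset b (mset_set ((!) ks ` B))) u) (mset_set P)"
        by (simp add: image_mset_mset_set[OF injP, symmetric] multiset.map_comp comp_def)
      also have "\<dots> = image_mset (\<lambda>B. dm G s (image_mset (\<lambda>i. b (ks ! i)) (mset_set B)) u) (mset_set P)"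
      proof (rule image_mset_cong)
        fix B assume "B \<in># mset_set P"
        then have "B \<in> P" using partition_finite[OF _ P] by simp
        then have "inj_on ((!) ks) B" using inj sub inj_on_subset by blast
        then show "dm G s (image_mset b (mset_set ((!) ks ` B))) u = dm G s (image_mset (\<lambda>i. b (ks ! i)) (mset_set B)) u"
          by (simp add: image_mset_mset_set[symmetric] multiset.map_comp comp_def)
      qed
      finally show ?thesis using outer[OF P] by simp
    qed
    then show "\<And>P. P \<in> partitions {..<?n} \<Longrightarrow> act G (?F P) ?e = dm G t (image_mset (\<lambda>C. dm G s (image_mset b (mset_set C)) u)
        (mset_set ((`) ((!) ks) ` P))) (act G (s 0) u)" .
    show "(\<lambda>R. dm G t (image_mset (\<lambda>C. dm G s (image_mset b (mset_set C)) u) (mset_set R)) (act G (s 0) u))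
        \<in> partitions (set ks) \<rightarrow> carrier (pmon G L)"
    proof
      fix R assume "R \<in> partitions (set ks)"
      then have "R \<in> (`) ((`) ((!) ks)) ` partitions {..<?n}"
        using bij_betw_imp_surj_on[OF bij] by simp
      then obtain P where P: "R = (`) ((!) ks) ` P" "P \<in> partitions {..<?n}" by (rule imageE)
      have "act G (?F P) ?e \<in> pts G (carr L)"
        using act_pts[OF cmp_term_Hom(2)[OF f g _ n] e] P(2) by simp
      then show "dm G t (image_mset (\<lambda>C. dm G s (image_mset b (mset_set C)) u) (mset_set R)) (act G (s 0) u) \<in> carrier (pmon G L)"
        unfolding eq[OF P(2)] P(1) carrier_pmon .
    qed
  qed
  finally show ?thesis .
qed

text \<open>The index \<open>k\<close> lies in exactly one block \<open>C0\<close> of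
  \<open>R\<close>, so the varied argument occurs in exactly one inner factor. Additivity of the
  components of \<open>s\<close> and then of those of \<open>t\<close> carries the sum
  outside.\<close>

lemma comp_sum_term:
  assumes f: "faa_ar X (FArr (M, U) (N, V) s)" and g: "faa_ar X (FArr (N, V) (L, T) t)"
    and K: "finite K" "k \<in> K" and a: "\<And>k. k \<in> K \<Longrightarrow> a k \<in> pts G (carr M)" and u: "u \<in> pts G U"
    and R: "partition_on K R"
  defines "F \<equiv> \<lambda>v. dm G t (image_mset (\<lambda>C. dm G s (image_mset (a(k := v)) (mset_set C)) u) (mset_set R)) (act G (s 0) u)"
  shows "v \<in> pts G (carr M) \<Longrightarrow> F v \<in> pts G (carr L)"
    and "b \<in> pts G (carr M) \<Longrightarrow> c \<in> pts G (carr M) \<Longrightarrow> F (b \<otimes>\<^bsub>pmon G M\<^esub> c) = F b \<otimes>\<^bsub>pmon G L\<^esub> F c"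
    and "F \<one>\<^bsub>pmon G M\<^esub> = \<one>\<^bsub>pmon G L\<^esub>"
proof -
  obtain C0 where C0: "C0 \<in> R" "k \<in> C0" using K(2) partition_onD1[OF R] by blast
  have fin: "finite R" "\<And>C. C \<in> R \<Longrightarrow> finite C" using partition_finite[OF K(1) R] by auto
  have kC: "k \<notin> C" if "C \<in> R - {C0}" for C
    using that C0 partition_unique[OF R, of C C0 k] by blast
  let ?d = "\<lambda>C. dm G s (image_mset a (mset_set C)) u"
  let ?mA = "image_mset a (mset_set (C0 - {k}))" and ?mB = "image_mset ?d (mset_set (R - {C0}))"
  have Fv: "F v = dm G t (add_mset (dm G s (add_mset v ?mA) u) ?mB) (act G (s 0) u)" for v
  proof -
    have "image_mset (\<lambda>C. dm G s (image_mset (a(k := v)) (mset_set C)) u) (mset_set (R - {C0})) = ?mB"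
      by (rule image_mset_cong) (use fin kC in \<open>auto simp: image_mset_upd(2)\<close>)
    then show ?thesis
      unfolding F_def using mset_set.remove[OF fin(1) C0(1)] fin C0 by (simp add: image_mset_upd(1))
  qed
  have m0: "set_mset ?mA \<subseteq> pts G (carr M)"
    using a partition_block[OF R C0(1)] fin C0 by auto
  have m: "set_mset ?mB \<subseteq> pts G (carr N)"
  proof -
    have "?d C \<in> pts G (carr N)" if "C \<in> R" for C
      using dm_closed[OF f _ _ u, of "image_mset a (mset_set C)"] partition_block[OF R that] fin(2)[OF that] a
      by (auto simp: mset_set_empty_iff)
    then show ?thesis using fin by auto
  qed
  have u0: "act G (s 0) u \<in> pts G V" by (rule act_pts[OF faa_arD(5)[OF f] u])
  have dc: "dm G s (add_mset v ?mA) u \<in> pts G (carr N)" if "v \<in> pts G (carr M)" for v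
    using dm_closed[OF f _ _ u] m0 that by simp
  show "F v \<in> pts G (carr L)" if "v \<in> pts G (carr M)" for v
    unfolding Fv using dm_closed[OF g _ _ u0] dc[OF that] m by simp
  show "F (b \<otimes>\<^bsub>pmon G M\<^esub> c) = F b \<otimes>\<^bsub>pmon G L\<^esub> F c" if "b \<in> pts G (carr M)" "c \<in> pts G (carr M)" for b c
    unfolding Fv dm_mult[OF f m0 u that] by (rule dm_mult[OF g m u0 dc[OF that(1)] dc[OF that(2)]])
  show "F \<one>\<^bsub>pmon G M\<^esub> = \<one>\<^bsub>pmon G L\<^esub>"
    unfolding Fv dm_one[OF f m0 u] by (rule dm_one[OF g m u0])
qed

end

lemma (in separated) faa_cmp_ar:
  assumes f: "faa_ar X (FArr (M, U) (N, V) s)" and g: "faa_ar X (FArr (N, V) (L, T) t)"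
  shows "faa_ar X (faa_cmp X (FArr (M, U) (N, V) s) (FArr (N, V) (L, T) t))"
proof -
  let ?h = "fseq (faa_cmp X (FArr (M, U) (N, V) s) (FArr (N, V) (L, T) t))"
  have "faa_ar X (FArr (M, U) (L, T) ?h)"
  proof (rule faa_arI[where \<Phi> = "\<lambda>G K b u. comp_sum G L s t K b u"])
    show "?h n \<in> Hom X (powprd X (carr M) n U) (carr L)" if "n \<noteq> 0" for n
      by (rule faa_cmp_Hom[OF f g that])
    show "?h 0 \<in> Hom X U T" using Cmp_Hom[OF faa_arD(5)[OF f] faa_arD(5)[OF g]] by simp
    fix G assume "G \<in> \<M>"
    then interpret cat_model X G by (rule cat_models)
    interpret L: comm_monoid "pmon G L" by (rule comm_monoid_pmon[OF faa_arD(2)[OF g]])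
    show "act G (?h (length ks)) (foldr (tup G) (map a ks) x) = comp_sum G L s t (set ks) a x"
      if "ks \<noteq> []" "distinct ks" "\<And>k. k \<in> set ks \<Longrightarrow> a k \<in> pts G (carr M)" "x \<in> pts G U" for ks a x
      by (rule act_faa_cmp[OF f g]) (use that in auto)
    fix K a x k
    assume K: "finite K" "k \<in> K" and a: "\<And>k. k \<in> K \<Longrightarrow> a k \<in> pts G (carr M)" and x: "x \<in> pts G U"
    note tm = comp_sum_term[OF f g K, of a, OF a x]
    show "comp_sum G L s t K (a(k := b \<otimes>\<^bsub>pmon G M\<^esub> c)) x =
        comp_sum G L s t K (a(k := b)) x \<otimes>\<^bsub>pmon G L\<^esub> comp_sum G L s t K (a(k := c)) x"
      if b: "b \<in> pts G (carr M)" and c: "c \<in> pts G (carr M)" for b c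
      unfolding comp_sum_def
      by (rule L.finprod_mult_eq)
        (use tm(1)[OF _ _ b] tm(1)[OF _ _ c] tm(2)[OF _ _ b c] in \<open>auto simp: carrier_pmon\<close>)
    show "comp_sum G L s t K (a(k := \<one>\<^bsub>pmon G M\<^esub>)) x = \<one>\<^bsub>pmon G L\<^esub>"
      unfolding comp_sum_def by (rule L.finprod_one_eqI) (use tm(3) in auto)
  qed (use faa_arD[OF f] faa_arD[OF g] in auto)
  then show ?thesis by simp
qed

context cat_model
begin

lemma prol_act_pts:
  assumes f: "faa_ar X (FArr (M, U) (N, V) s)" and J: "finite J" and a: "a \<in> pts (prol J G) (M, U)"
  shows "act (prol J G) (FArr (M, U) (N, V) s) a \<in> pts (prol J G) (N, V)"
proof -
  have "act (prol J G) (FArr (M, U) (N, V) s) a S \<in> pts G (carr N)" if S: "S \<subseteq> J" "S \<noteq> {}" for S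
    unfolding act_prol_fibre[OF S]
  proof (simp, rule finprod_pts[OF faa_arD(2)[OF f]])
    fix P assume "P \<in> partitions S"
    then have P: "partition_on S P" by simp
    have fin: "finite S" using S(1) J finite_subset by blast
    show "dm G s (image_mset a (mset_set P)) (a {}) \<in> pts G (carr N)"
      by (rule dm_closed[OF f prol_blocks_pts[OF a fin S(1) P] blocks_mset_nonempty[OF P S(2) fin]
            prol_pts_base[OF a]])
  qed
  moreover have "act G (s 0) (a {}) \<in> pts G V" using act_pts[OF faa_arD(5)[OF f] prol_pts_base[OF a]] .
  ultimately show ?thesis unfolding prol_pts_iff by (auto simp: act_prol)
qed

text \<open>The composite sequence gives a sum over partitions \<open>P\<close> of \<open>S\<close>
  and partitions \<open>R\<close> of \<open>P\<close>. Acting twice gives, after multilinear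
  expansion, a sum over partitions \<open>Q\<close> of \<open>S\<close> with a partition
  \<open>\<phi> B\<close> of each block \<open>B\<close>. \<open>bij_betw_refinements\<close>
  identifies the two index sets and preserves each summand.\<close>

lemma prol_act_cmp:
  assumes f: "faa_ar X (FArr (M, U) (N, V) s)" and g: "faa_ar X (FArr (N, V) (L, T) t)"
    and fg: "faa_ar X (faa_cmp X (FArr (M, U) (N, V) s) (FArr (N, V) (L, T) t))"
    and J: "finite J" and a: "a \<in> pts (prol J G) (M, U)"
  shows "act (prol J G) (faa_cmp X (FArr (M, U) (N, V) s) (FArr (N, V) (L, T) t)) a =
    act (prol J G) (FArr (N, V) (L, T) t) (act (prol J G) (FArr (M, U) (N, V) s) a)"
    (is "act _ ?fg a = act _ ?g (act _ ?f a)")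
proof (rule prol_eqI)
  interpret L: comm_monoid "pmon G L" by (rule comm_monoid_pmon[OF faa_arD(2)[OF g]])
  define h where "h = fseq ?fg"
  have fgh: "?fg = FArr (M, U) (L, T) h" by (simp add: h_def)
  note fg' = fg[unfolded fgh]
  have x: "a {} \<in> pts G U" by (rule prol_pts_base[OF a])
  have x0: "act G (s 0) (a {}) \<in> pts G V" by (rule act_pts[OF faa_arD(5)[OF f] x])
  fix S assume S: "S \<subseteq> J"
  show "act (prol J G) ?fg a S = act (prol J G) ?g (act (prol J G) ?f a) S"
  proof (cases "S = {}")
    case True
    then show ?thesis using act_Cmp[OF faa_arD(5)[OF f] faa_arD(5)[OF g] x] by simp
  next
    case ne: False
    have finS: "finite S" using S J finite_subset by blast
    let ?u = "act G (s 0) (a {})"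
    let ?D = "\<lambda>C. dm G s (image_mset a (mset_set C)) (a {})"
    have clo: "?D P \<in> pts G (carr N)" if "partition_on B P" and B: "B \<subseteq> S" "B \<noteq> {}" for B P
      by (rule dm_closed[OF f prol_blocks_pts[OF a _ _ that(1)] blocks_mset_nonempty[OF that(1) B(2)] x])
        (use B S finS finite_subset in auto)
    have clo2: "dm G t (image_mset (\<lambda>B. ?D (\<phi> B)) (mset_set Q)) ?u \<in> pts G (carr L)"
      if Q: "partition_on S Q" and \<phi>: "\<phi> \<in> Pi\<^sub>E Q partitions" for Q \<phi>
    proof (rule dm_closed[OF g _ blocks_mset_nonempty[OF Q ne finS] x0])
      have "?D (\<phi> B) \<in> pts G (carr N)" if "B \<in> Q" for B
        using clo[of B "\<phi> B"] partition_block[OF Q that] \<phi> that by (auto simp: PiE_iff)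
      then show "set_mset (image_mset (\<lambda>B. ?D (\<phi> B)) (mset_set Q)) \<subseteq> pts G (carr N)"
        using partition_finite(1)[OF finS Q] by auto
    qed
    let ?F = "\<lambda>(P, R). dm G t (image_mset ?D (mset_set R)) ?u"
    let ?E = "\<lambda>(Q, \<phi>). dm G t (image_mset (\<lambda>B. ?D (\<phi> B)) (mset_set Q)) ?u"
    let ?SF = "SIGMA P : partitions S. partitions P"
    let ?SE = "SIGMA Q : partitions S. Pi\<^sub>E Q partitions"
    have bij: "bij_betw (\<lambda>(Q, s). (\<Union>(s ` Q), s ` Q)) ?SE ?SF" by (rule bij_betw_refinements)
    have FE: "?E z = ?F ((\<lambda>(Q, s). (\<Union>(s ` Q), s ` Q)) z)" if z: "z \<in> ?SE" for z
    proof -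
      obtain Q \<phi> where z': "z = (Q, \<phi>)" "\<phi> \<in> Pi\<^sub>E Q partitions" using z by auto
      show ?thesis unfolding z'(1)
        by (simp add: image_mset_mset_set[OF inj_on_refinement[OF z'(2)], symmetric] multiset.map_comp comp_def)
    qed
    \<comment> \<open>A summand over \<open>(P, R)\<close> is closed because the bijection makes it
      a summand over some \<open>(Q, \<phi>)\<close>, whose arguments are visibly points of the
      carrier of \<open>N\<close>.\<close>
    have Fclo: "?F z \<in> carrier (pmon G L)" if "z \<in> ?SF" for z
    proof -
      have "z \<in> (\<lambda>(Q, s). (\<Union>(s ` Q), s ` Q)) ` ?SE" using bij_betw_imp_surj_on[OF bij] that by simp
      then obtain y where y: "z = (\<lambda>(Q, s). (\<Union>(s ` Q), s ` Q)) y" "y \<in> ?SE" by (rule imageE)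
      then have "?F z = ?E y" using FE[OF y(2)] by simp
      then show ?thesis using y(2) clo2 by (auto simp: carrier_pmon)
    qed
    have fP: "finite (partitions S)" by (rule finitely_many_partition_on[OF finS])
    have "act (prol J G) ?fg a S = finprod (pmon G L) (\<lambda>P. finprod (pmon G L)
        (\<lambda>R. dm G t (image_mset ?D (mset_set R)) ?u) (partitions P)) (partitions S)"
      unfolding fgh act_prol_fibre[OF S ne] faa_arr.sel fst_conv
    proof (rule L.finprod_cong')
      fix P assume "P \<in> partitions S"
      then have P: "partition_on S P" by simp
      have finP: "finite P" using partition_finite(1)[OF finS P] .
      then obtain ks where ks: "set ks = P" "distinct ks" using finite_distinct_list by blast
      have "P \<noteq> {}" using P ne by (auto simp: partition_on_def)
      then have nil: "ks \<noteq> []" using ks by auto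
      have b: "a k \<in> pts G (carr M)" if "k \<in> set ks" for k
        using partition_block[OF P, of k] ks that S by (intro prol_pts_fibre[OF a]) auto
      have "act G (h (length (map a ks))) (foldr (tup G) (map a ks) (a {})) = dm G h (mset (map a ks)) (a {})"
        by (rule dm_list[OF fg' _ x]) (use b in auto)
      then have "dm G h (image_mset a (mset_set P)) (a {}) = comp_sum G L s t P a (a {})"
        using act_faa_cmp[OF f g nil ks(2) b x] ks
        by (simp only: mset_map_distinct length_map h_def)
      then show "dm G h (image_mset a (mset_set P)) (a {}) =
          finprod (pmon G L) (\<lambda>R. dm G t (image_mset ?D (mset_set R)) ?u) (partitions P)"
        by (simp only: comp_sum_def)
    next
      show "(\<lambda>P. finprod (pmon G L) (\<lambda>R. dm G t (image_mset ?D (mset_set R)) ?u) (partitions P))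
          \<in> partitions S \<rightarrow> carrier (pmon G L)"
        using Fclo by (intro funcsetI L.finprod_closed) auto
    qed simp
    also have "\<dots> = finprod (pmon G L) ?F ?SF"
      using Fclo by (intro L.finprod_Sigma[OF fP] finitely_many_partition_on)
        (auto dest: partition_finite(1)[OF finS])
    also have "\<dots> = finprod (pmon G L) ?E ?SE"
      by (rule L.finprod_bij_betw[OF bij, symmetric]) (use Fclo FE in auto)
    also have "\<dots> = finprod (pmon G L) (\<lambda>Q. finprod (pmon G L)
        (\<lambda>\<phi>. dm G t (image_mset (\<lambda>B. ?D (\<phi> B)) (mset_set Q)) ?u) (Pi\<^sub>E Q partitions)) (partitions S)"
    proof (rule L.finprod_Sigma[OF fP, symmetric])
      fix Q assume "Q \<in> partitions S"
      then have Q: "partition_on S Q" by simp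
      show "finite (Pi\<^sub>E Q partitions)"
        using partition_finite[OF finS Q] finitely_many_partition_on by (intro finite_PiE) auto
      show "dm G t (image_mset (\<lambda>B. ?D (\<phi> B)) (mset_set Q)) ?u \<in> carrier (pmon G L)"
        if "\<phi> \<in> Pi\<^sub>E Q partitions" for \<phi>
        unfolding carrier_pmon by (rule clo2[OF Q that])
    qed
    also have "\<dots> = act (prol J G) ?g (act (prol J G) ?f a) S"
      unfolding act_prol_fibre[OF S ne] faa_arr.sel fst_conv act_prol_base
    proof (rule L.finprod_cong'[symmetric])
      fix Q assume "Q \<in> partitions S"
      then have Q: "partition_on S Q" by simp
      have fin: "finite Q" using partition_finite(1)[OF finS Q] .
      have eq: "image_mset (act (prol J G) ?f a) (mset_set Q) =
          image_mset (\<lambda>B. finprod (pmon G N) ?D (partitions B)) (mset_set Q)"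
      proof (rule image_mset_cong)
        fix B assume "B \<in># mset_set Q"
        then have "B \<subseteq> J" "B \<noteq> {}" using fin partition_block[OF Q, of B] S by auto
        then show "act (prol J G) ?f a B = finprod (pmon G N) ?D (partitions B)"
          by (simp add: act_prol_fibre)
      qed
      have "Q \<noteq> {}" using Q ne by (auto simp: partition_on_def)
      moreover have "finite (partitions B)" if "B \<in> Q" for B
        by (rule finitely_many_partition_on) (use partition_finite[OF finS Q] that in auto)
      moreover have "?D P \<in> pts G (carr N)" if "B \<in> Q" "P \<in> partitions B" for B P
        using clo[of B P] that partition_block[OF Q that(1)] by simp
      \<comment> \<open>The expansion starts without arguments already fixed, hence the empty
        multiset; it is admissible because \<open>Q\<close> is nonempty together with
        \<open>S\<close>.\<close>
      ultimately have "dm G t ({#} + image_mset (\<lambda>B. finprod (pmon G N) ?D (partitions B)) (mset_set Q)) ?u =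
        finprod (pmon G L) (\<lambda>\<phi>. dm G t ({#} + image_mset (\<lambda>B. ?D (\<phi> B)) (mset_set Q)) ?u) (Pi\<^sub>E Q partitions)"
        by (intro dm_finprod_PiE[OF g _ x0 fin]) auto
      then show "dm G t (image_mset (act (prol J G) ?f a) (mset_set Q)) ?u =
          finprod (pmon G L) (\<lambda>\<phi>. dm G t (image_mset (\<lambda>B. ?D (\<phi> B)) (mset_set Q)) ?u) (Pi\<^sub>E Q partitions)"
        unfolding eq by simp
    next
      show "(\<lambda>Q. finprod (pmon G L) (\<lambda>\<phi>. dm G t (image_mset (\<lambda>B. ?D (\<phi> B)) (mset_set Q)) ?u) (Pi\<^sub>E Q partitions))
          \<in> partitions S \<rightarrow> carrier (pmon G L)"
        using clo2 by (intro funcsetI L.finprod_closed) (auto simp: carrier_pmon)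
    qed simp
    finally show ?thesis .
  qed
qed (auto simp: act_prol)

end

section \<open>The Cartesian category of Faa di Bruno sequences\<close>

lemma prol_pts_at:
  "a \<in> pts (prol J G) (M, U) \<Longrightarrow> S \<subseteq> J \<Longrightarrow> a S \<in> pts G (if S = {} then U else carr M)"
  unfolding prol_pts_iff by blast

lemma dm_single [simp]: "dm G s {#b#} x = act G (s 1) (tup G b x)"
  by (simp add: dm_def)

context cat_model
begin

lemma pmon_closed:
  "cmon_in X M \<Longrightarrow> b \<in> pts G (carr M) \<Longrightarrow> c \<in> pts G (carr M) \<Longrightarrow> b \<otimes>\<^bsub>pmon G M\<^esub> c \<in> pts G (carr M)"
  "cmon_in X M \<Longrightarrow> \<one>\<^bsub>pmon G M\<^esub> \<in> pts G (carr M)"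
  using comm_monoid_pmon[of M] carrier_pmon
  by (metis comm_monoid.axioms(1) monoid.m_closed, metis comm_monoid.axioms(1) monoid.one_closed)

text \<open>The partition \<open>{S}\<close> is the only one with a single block; every other
  partition of \<open>S\<close> meets a zero component. Such a sequence thus acts on each
  coefficient separately, over the base point.\<close>

lemma act_first_order:
  assumes M: "cmon_in X M" and N: "cmon_in X N" and U: "U \<in> Obj X"
    and k: "k \<in> Hom X (Prd X (carr M) U) (carr N)"
    and J: "finite J" and a: "a \<in> pts (prol J G) (M, U)" and S: "S \<subseteq> J"
  shows "act (prol J G) (first_order X (M, U) (N, V) h k) a S =
    (if S = {} then act G h (a {}) else act G k (tup G (a S) (a {})))"
proof (cases "S = {}")
  case False
  interpret N: comm_monoid "pmon G N" by (rule comm_monoid_pmon[OF N])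
  have fin: "finite S" using S J finite_subset by blast
  have x: "a {} \<in> pts G U" by (rule prol_pts_base[OF a])
  have A: "carr M \<in> Obj X" using carr_Obj[OF M] .
  let ?s = "\<lambda>n. if n = 0 then h else if n = 1 then k else mzero X N (powprd X (carr M) n U)"
  have "act (prol J G) (first_order X (M, U) (N, V) h k) a S =
      finprod (pmon G N) (\<lambda>P. dm G ?s (image_mset a (mset_set P)) (a {})) (partitions S)"
    by (simp add: act_prol_fibre[OF S False])
  also have "\<dots> = dm G ?s (image_mset a (mset_set {S})) (a {})"
  proof (rule N.finprod_eq_single)
    show "finite (partitions S)" by (rule finitely_many_partition_on[OF fin])
    show "{S} \<in> partitions S" using partition_on_space[OF False] by simp
    have "act G k (tup G (a S) (a {})) \<in> pts G (carr N)"
      by (rule act_pts[OF k tup_pts[OF A U prol_pts_fibre[OF a S False] x]])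
    then show "dm G ?s (image_mset a (mset_set {S})) (a {}) \<in> carrier (pmon G N)"
      by (simp add: carrier_pmon)
    fix P assume P': "P \<in> partitions S" and ne: "P \<noteq> {S}"
    then have P: "partition_on S P" by simp
    let ?m = "image_mset a (mset_set P)"
    have finP: "finite P" by (rule partition_finite(1)[OF fin P])
    have "card P \<noteq> 0" using finP P False by (auto simp: partition_on_def)
    moreover have "card P \<noteq> 1"
    proof
      assume "card P = 1"
      then obtain B where "P = {B}" by (auto simp: card_1_singleton_iff)
      then show False using ne P by (auto simp: partition_on_def)
    qed
    moreover have sz: "size ?m = card P" by simp
    ultimately have eq: "?s (size ?m) = mzero X N (powprd X (carr M) (card P) U)" by simp
    let ?l = "SOME l. mset l = ?m"
    have len: "length ?l = card P" using some_mset[of ?m] sz by (metis size_mset)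
    have "set ?l \<subseteq> pts G (carr M)"
      using prol_blocks_pts[OF a fin S P] some_mset[of ?m] by (metis set_mset_mset)
    from tuple_pts[OF A U this x] show "dm G ?s ?m (a {}) = \<one>\<^bsub>pmon G N\<^esub>"
      unfolding dm_def eq len by (rule act_mzero[OF N powprd_Obj[OF A U]])
  qed
  finally show ?thesis using False by simp
qed simp

end

context separated
begin

text \<open>All components of index at least two are zero maps, so the conditions on the sequence
  come down to additivity of \<open>k\<close> in its vector argument.\<close>

lemma first_order_Hom:
  assumes M: "cmon_in X M" and N: "cmon_in X N" and U: "U \<in> Obj X" and V: "V \<in> Obj X"
    and h: "h \<in> Hom X U V" and k: "k \<in> Hom X (Prd X (carr M) U) (carr N)"
    and add: "\<And>G b c x. G \<in> \<M> \<Longrightarrow> b \<in> pts G (carr M) \<Longrightarrow> c \<in> pts G (carr M) \<Longrightarrow> x \<in> pts G U \<Longrightarrow>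
        act G k (tup G (b \<otimes>\<^bsub>pmon G M\<^esub> c) x) = act G k (tup G b x) \<otimes>\<^bsub>pmon G N\<^esub> act G k (tup G c x)"
    and zero: "\<And>G x. G \<in> \<M> \<Longrightarrow> x \<in> pts G U \<Longrightarrow> act G k (tup G \<one>\<^bsub>pmon G M\<^esub> x) = \<one>\<^bsub>pmon G N\<^esub>"
  shows "first_order X (M, U) (N, V) h k \<in> Hom (Faa X) (M, U) (N, V)"
proof -
  let ?s = "\<lambda>n. if n = 0 then h else if n = 1 then k else mzero X N (powprd X (carr M) n U)"
  have A: "carr M \<in> Obj X" using carr_Obj[OF M] .
  have "faa_ar X (FArr (M, U) (N, V) ?s)"
  proof (rule faa_arI[OF M U N V, where \<Phi> = "\<lambda>G K a x. if card K = 1 then act G k (tup G (a (the_elem K)) x) else \<one>\<^bsub>pmon G N\<^esub>"])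
    show "?s 0 \<in> Hom X U V" using h by simp
    show "?s n \<in> Hom X (powprd X (carr M) n U) (carr N)" if "n \<noteq> 0" for n
      using that k N powprd_Obj[OF A U] by (cases N) (auto intro: Cmp_Hom bang_Hom dest: cmon_in_Hom)
    fix G assume G: "G \<in> \<M>"
    interpret cat_model X G by (rule cat_models[OF G])
    interpret N: comm_monoid "pmon G N" by (rule comm_monoid_pmon[OF N])
    show "act G (?s (length ks)) (foldr (tup G) (map a ks) x) =
        (if card (set ks) = 1 then act G k (tup G (a (the_elem (set ks))) x) else \<one>\<^bsub>pmon G N\<^esub>)"
      if ks: "ks \<noteq> []" "distinct ks" and a: "\<And>k. k \<in> set ks \<Longrightarrow> a k \<in> pts G (carr M)" and x: "x \<in> pts G U" for ks a x
    proof (cases "length ks = 1")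
      case True
      then obtain k0 where "ks = [k0]" by (auto simp: length_Suc_conv)
      then show ?thesis by simp
    next
      case False
      have "foldr (tup G) (map a ks) x \<in> pts G (powprd X (carr M) (length (map a ks)) U)"
        by (rule tuple_pts[OF A U _ x]) (use a in auto)
      then show ?thesis using False ks distinct_card[OF ks(2)] act_mzero[OF N powprd_Obj[OF A U]] by simp
    qed
    fix K a x k' assume K: "finite K" "k' \<in> K" and x: "x \<in> pts G U"
    have K1: "the_elem K = k'" if "card K = 1"
      using that K(2) by (auto simp: card_1_singleton_iff)
    show "(if card K = 1 then act G k (tup G ((a(k' := b \<otimes>\<^bsub>pmon G M\<^esub> c)) (the_elem K)) x) else \<one>\<^bsub>pmon G N\<^esub>) =
      (if card K = 1 then act G k (tup G ((a(k' := b)) (the_elem K)) x) else \<one>\<^bsub>pmon G N\<^esub>) \<otimes>\<^bsub>pmon G N\<^esub>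
      (if card K = 1 then act G k (tup G ((a(k' := c)) (the_elem K)) x) else \<one>\<^bsub>pmon G N\<^esub>)"
      if "b \<in> pts G (carr M)" "c \<in> pts G (carr M)" for b c
      using K1 add[OF G that x] by simp
    show "(if card K = 1 then act G k (tup G ((a(k' := \<one>\<^bsub>pmon G M\<^esub>)) (the_elem K)) x) else \<one>\<^bsub>pmon G N\<^esub>) = \<one>\<^bsub>pmon G N\<^esub>"
      using K1 zero[OF G x] by simp
  qed
  then show ?thesis by (simp add: Hom_Faa_iff)
qed

text \<open>The case in which the linear part does not depend on the base point. Identities,
  projections and the structure maps of the monoid of \<open>\<delta>\<close> all have this form,
  and by \<open>act_linear\<close> they act coefficient by coefficient.\<close>

lemma linear_Hom:
  assumes M: "cmon_in X M" and N: "cmon_in X N" and U: "U \<in> Obj X" and V: "V \<in> Obj X"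
    and h: "h \<in> Hom X U V" and k: "k \<in> Hom X (carr M) (carr N)"
    and add: "\<And>G b c. G \<in> \<M> \<Longrightarrow> b \<in> pts G (carr M) \<Longrightarrow> c \<in> pts G (carr M) \<Longrightarrow>
        act G k (b \<otimes>\<^bsub>pmon G M\<^esub> c) = act G k b \<otimes>\<^bsub>pmon G N\<^esub> act G k c"
    and zero: "\<And>G. G \<in> \<M> \<Longrightarrow> act G k \<one>\<^bsub>pmon G M\<^esub> = \<one>\<^bsub>pmon G N\<^esub>"
  shows "first_order X (M, U) (N, V) h (Pr0 X (carr M) U \<cdot> k) \<in> Hom (Faa X) (M, U) (N, V)"
proof (rule first_order_Hom[OF M N U V h])
  have A: "carr M \<in> Obj X" using carr_Obj[OF M] .
  note P0 = Pr0_Hom[OF A U]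
  show "Pr0 X (carr M) U \<cdot> k \<in> Hom X (Prd X (carr M) U) (carr N)"
    by (rule Cmp_Hom[OF P0 k])
  fix G x assume G: "G \<in> \<M>" and x: "x \<in> pts G U"
  interpret cat_model X G by (rule cat_models[OF G])
  have ev: "act G (Pr0 X (carr M) U \<cdot> k) (tup G b x) = act G k b" if "b \<in> pts G (carr M)" for b
    using that x by (simp add: act_Cmp[OF P0 k] tup_pts A U act_Pr0)
  show "act G (Pr0 X (carr M) U \<cdot> k) (tup G \<one>\<^bsub>pmon G M\<^esub> x) = \<one>\<^bsub>pmon G N\<^esub>"
    using ev pmon_closed[OF M] zero[OF G] by simp
  fix b c assume "b \<in> pts G (carr M)" "c \<in> pts G (carr M)"
  then show "act G (Pr0 X (carr M) U \<cdot> k) (tup G (b \<otimes>\<^bsub>pmon G M\<^esub> c) x) =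
    act G (Pr0 X (carr M) U \<cdot> k) (tup G b x) \<otimes>\<^bsub>pmon G N\<^esub> act G (Pr0 X (carr M) U \<cdot> k) (tup G c x)"
    using ev pmon_closed[OF M] add[OF G] by simp
qed

end

lemma (in cat_model) act_linear:
  assumes M: "cmon_in X M" and N: "cmon_in X N" and U: "U \<in> Obj X"
    and k: "k \<in> Hom X (carr M) (carr N)" and J: "finite J" and a: "a \<in> pts (prol J G) (M, U)" and S: "S \<subseteq> J"
  shows "act (prol J G) (first_order X (M, U) (N, V) h (Pr0 X (carr M) U \<cdot> k)) a S =
    (if S = {} then act G h (a {}) else act G k (a S))"
proof -
  have A: "carr M \<in> Obj X" using carr_Obj[OF M] .
  note P0 = Pr0_Hom[OF A U]
  show ?thesis
    using act_first_order[OF M N U Cmp_Hom[OF P0 k] J a S, of V h] prol_pts_base[OF a] prol_pts_fibre[OF a S]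
    by (auto simp: act_Cmp[OF P0 k] tup_pts A U act_Pr0)
qed

section \<open>Products of commutative monoids and the structural arrows of
  \<open>Faa X\<close>\<close>

lemma carr_prod_cmon [simp]: "carr (prod_cmon X M N) = Prd X (carr M) (carr N)"
  by (cases M; cases N) (simp add: Let_def)

lemma carr_one_cmon [simp]: "carr (one_cmon X) = One X"
  by (simp add: one_cmon_def)

context cartesian_category
begin

lemma prod_cmon_Hom:
  assumes "cmon_in X M" "cmon_in X N"
  obtains p z where "prod_cmon X M N = (Prd X (carr M) (carr N), p, z)"
    "p \<in> Hom X (Prd X (Prd X (carr M) (carr N)) (Prd X (carr M) (carr N))) (Prd X (carr M) (carr N))"
    "z \<in> Hom X (One X) (Prd X (carr M) (carr N))"
proof -
  obtain A p z B q w where MN: "M = (A, p, z)" "N = (B, q, w)" by (metis prod_cases3)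
  note H = cmon_in_Hom[OF assms(1)[unfolded MN]] cmon_in_Hom[OF assms(2)[unfolded MN]]
  let ?P = "Prd X A B"
  have P: "?P \<in> Obj X" using H Prd_Obj by blast
  note l = Cmp_Hom[OF Pr0_Hom[OF P P]] and r = Cmp_Hom[OF Pr1_Hom[OF P P]]
  note a = Pr0_Hom[OF H(1,4)] and b = Pr1_Hom[OF H(1,4)]
  show thesis
    by (rule that) (use H in \<open>auto simp: MN Let_def intro!: pair_Hom Cmp_Hom[OF pair_Hom H(2)]
      Cmp_Hom[OF pair_Hom H(5)] l r a b\<close>)
qed

end

context cat_model
begin

lemma pmon_prod_cmon:
  assumes M: "cmon_in X M" and N: "cmon_in X N"
  shows "b \<in> pts G (Prd X (carr M) (carr N)) \<Longrightarrow> c \<in> pts G (Prd X (carr M) (carr N)) \<Longrightarrow>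
      b \<otimes>\<^bsub>pmon G (prod_cmon X M N)\<^esub> c =
      tup G (act G (Pr0 X (carr M) (carr N)) b \<otimes>\<^bsub>pmon G M\<^esub> act G (Pr0 X (carr M) (carr N)) c)
        (act G (Pr1 X (carr M) (carr N)) b \<otimes>\<^bsub>pmon G N\<^esub> act G (Pr1 X (carr M) (carr N)) c)"
    and "\<one>\<^bsub>pmon G (prod_cmon X M N)\<^esub> = tup G \<one>\<^bsub>pmon G M\<^esub> \<one>\<^bsub>pmon G N\<^esub>"
proof -
  obtain A p z B q w where MN: "M = (A, p, z)" "N = (B, q, w)" by (metis prod_cases3)
  note H = cmon_in_Hom[OF M[unfolded MN]] cmon_in_Hom[OF N[unfolded MN]]
  let ?P = "Prd X A B"
  have P: "?P \<in> Obj X" using H Prd_Obj by blast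
  let ?l = "Pr0 X ?P ?P" and ?r = "Pr1 X ?P ?P"
  note l = Pr0_Hom[OF P P] and r = Pr1_Hom[OF P P]
  note a = Pr0_Hom[OF H(1,4)] and b = Pr1_Hom[OF H(1,4)]
  note lr = Cmp_Hom[OF l a] Cmp_Hom[OF r a] Cmp_Hom[OF l b] Cmp_Hom[OF r b]
  show "\<one>\<^bsub>pmon G (prod_cmon X M N)\<^esub> = tup G \<one>\<^bsub>pmon G M\<^esub> \<one>\<^bsub>pmon G N\<^esub>"
    using H pt_pts by (simp add: MN Let_def act_pair)
  assume bc: "b \<in> pts G (Prd X (carr M) (carr N))" "c \<in> pts G (Prd X (carr M) (carr N))"
  then have bc': "b \<in> pts G ?P" "c \<in> pts G ?P" by (simp_all add: MN)
  have e: "tup G b c \<in> pts G (Prd X ?P ?P)" using bc' tup_pts[OF P P] by simp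
  have 1: "act G (pair X (?l \<cdot> Pr0 X A B) (?r \<cdot> Pr0 X A B) \<cdot> p) (tup G b c) =
      act G p (tup G (act G (Pr0 X A B) b) (act G (Pr0 X A B) c))"
    using bc' by (simp add: act_Cmp[OF pair_Hom[OF lr(1,2)] H(2) e] act_pair[OF lr(1,2) e]
        act_Cmp[OF l a e] act_Cmp[OF r a e] act_Pr0[OF P P] act_Pr1[OF P P])
  have 2: "act G (pair X (?l \<cdot> Pr1 X A B) (?r \<cdot> Pr1 X A B) \<cdot> q) (tup G b c) =
      act G q (tup G (act G (Pr1 X A B) b) (act G (Pr1 X A B) c))"
    using bc' by (simp add: act_Cmp[OF pair_Hom[OF lr(3,4)] H(5) e] act_pair[OF lr(3,4) e]
        act_Cmp[OF l b e] act_Cmp[OF r b e] act_Pr0[OF P P] act_Pr1[OF P P])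
  show "b \<otimes>\<^bsub>pmon G (prod_cmon X M N)\<^esub> c =
      tup G (act G (Pr0 X (carr M) (carr N)) b \<otimes>\<^bsub>pmon G M\<^esub> act G (Pr0 X (carr M) (carr N)) c)
        (act G (Pr1 X (carr M) (carr N)) b \<otimes>\<^bsub>pmon G N\<^esub> act G (Pr1 X (carr M) (carr N)) c)"
    using 1 2 by (simp add: MN Let_def act_pair[OF Cmp_Hom[OF pair_Hom[OF lr(1,2)] H(2)] Cmp_Hom[OF pair_Hom[OF lr(3,4)] H(5)] e])
qed

lemma pmon_prod_cmon_tup:
  assumes M: "cmon_in X M" and N: "cmon_in X N"
    and "b \<in> pts G (carr M)" "b' \<in> pts G (carr N)" "c \<in> pts G (carr M)" "c' \<in> pts G (carr N)"
  shows "tup G b b' \<otimes>\<^bsub>pmon G (prod_cmon X M N)\<^esub> tup G c c' =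
    tup G (b \<otimes>\<^bsub>pmon G M\<^esub> c) (b' \<otimes>\<^bsub>pmon G N\<^esub> c')"
  using assms by (simp add: pmon_prod_cmon(1)[OF M N] tup_pts act_Pr0 act_Pr1 carr_Obj)

lemma tup_cases:
  assumes "A \<in> Obj X" "B \<in> Obj X" "e \<in> pts G (Prd X A B)"
  obtains a b where "e = tup G a b" "a \<in> pts G A" "b \<in> pts G B"
  using tup_eta[OF assms] act_pts[OF Pr0_Hom[OF assms(1,2)] assms(3)]
    act_pts[OF Pr1_Hom[OF assms(1,2)] assms(3)] by metis

lemma comm_monoid_prod_cmon:
  assumes M: "cmon_in X M" and N: "cmon_in X N"
  shows "comm_monoid (pmon G (prod_cmon X M N))"
proof -
  interpret M: comm_monoid "pmon G M" by (rule comm_monoid_pmon[OF M])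
  interpret N: comm_monoid "pmon G N" by (rule comm_monoid_pmon[OF N])
  have A: "carr M \<in> Obj X" and B: "carr N \<in> Obj X" using carr_Obj[OF M] carr_Obj[OF N] by auto
  note cases = tup_cases[OF A B] and tt = pmon_prod_cmon_tup[OF M N] and one = pmon_prod_cmon(2)[OF M N]
    and M' = pmon_closed[OF M] and N' = pmon_closed[OF N] and TP = tup_pts[OF A B]
  note Mc = M.m_assoc[unfolded carrier_pmon] M.m_comm[unfolded carrier_pmon] M.l_one[unfolded carrier_pmon]
  note Nc = N.m_assoc[unfolded carrier_pmon] N.m_comm[unfolded carrier_pmon] N.l_one[unfolded carrier_pmon]
  show ?thesis
  proof (rule comm_monoidI; unfold carrier_pmon carr_prod_cmon)
    fix x y assume x: "x \<in> pts G (Prd X (carr M) (carr N))" and y: "y \<in> pts G (Prd X (carr M) (carr N))"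
    from x obtain a b where ab: "x = tup G a b" "a \<in> pts G (carr M)" "b \<in> pts G (carr N)" by (rule cases)
    from y obtain c d where cd: "y = tup G c d" "c \<in> pts G (carr M)" "d \<in> pts G (carr N)" by (rule cases)
    show "x \<otimes>\<^bsub>pmon G (prod_cmon X M N)\<^esub> y \<in> pts G (Prd X (carr M) (carr N))"
      using ab cd M' N' TP tt by simp
    show "x \<otimes>\<^bsub>pmon G (prod_cmon X M N)\<^esub> y = y \<otimes>\<^bsub>pmon G (prod_cmon X M N)\<^esub> x"
      using ab cd Mc(2) Nc(2) tt by simp
    show "\<one>\<^bsub>pmon G (prod_cmon X M N)\<^esub> \<otimes>\<^bsub>pmon G (prod_cmon X M N)\<^esub> x = x"
      using ab M' N' Mc(3) Nc(3) tt one by simp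
    fix z assume z: "z \<in> pts G (Prd X (carr M) (carr N))"
    from z obtain e f where ef: "z = tup G e f" "e \<in> pts G (carr M)" "f \<in> pts G (carr N)" by (rule cases)
    show "x \<otimes>\<^bsub>pmon G (prod_cmon X M N)\<^esub> y \<otimes>\<^bsub>pmon G (prod_cmon X M N)\<^esub> z =
        x \<otimes>\<^bsub>pmon G (prod_cmon X M N)\<^esub> (y \<otimes>\<^bsub>pmon G (prod_cmon X M N)\<^esub> z)"
      using ab cd ef M' N' Mc(1) Nc(1) tt by simp
  qed (use one M' N' TP in simp)
qed

lemma comm_monoid_one_cmon: "comm_monoid (pmon G (one_cmon X))"
proof -
  have t: "tup G (pt G) (pt G) \<in> pts G (Prd X (One X) (One X))"
    using tup_pts[OF One_Obj One_Obj] pt_pts by blast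
  show ?thesis
    by (rule comm_monoidI; unfold carrier_pmon carr_one_cmon)
      (use t pt_pts in \<open>auto simp: one_cmon_def pts_One act_bang Prd_Obj One_Obj\<close>)
qed

end

context separated
begin

lemma cmon_in_prod:
  assumes M: "cmon_in X M" and N: "cmon_in X N" shows "cmon_in X (prod_cmon X M N)"
proof -
  obtain p z where pz: "prod_cmon X M N = (Prd X (carr M) (carr N), p, z)"
    "p \<in> Hom X (Prd X (Prd X (carr M) (carr N)) (Prd X (carr M) (carr N))) (Prd X (carr M) (carr N))"
    "z \<in> Hom X (One X) (Prd X (carr M) (carr N))"
    by (rule prod_cmon_Hom[OF M N])
  show ?thesis unfolding pz(1)
    by (rule cmon_inI[OF cartesian_category_axioms models sep _ pz(2,3)])
      (use cat_model.comm_monoid_prod_cmon[OF cat_models M N] pz(1) in \<open>auto intro!: Prd_Obj carr_Obj M N\<close>)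
qed

lemma cmon_in_one: "cmon_in X (one_cmon X)"
  unfolding one_cmon_def
  by (rule cmon_inI[OF cartesian_category_axioms models sep One_Obj])
    (use cat_model.comm_monoid_one_cmon[OF cat_models] in \<open>auto intro!: bang_Hom Prd_Obj One_Obj simp: one_cmon_def\<close>)

lemma faa_ob_prd: "faa_ob X P \<Longrightarrow> faa_ob X Q \<Longrightarrow> faa_ob X (faa_prd X P Q)"
  by (cases P; cases Q) (auto intro: cmon_in_prod Prd_Obj)

lemma faa_ide_Hom: "faa_ob X P \<Longrightarrow> faa_ide X P \<in> Hom (Faa X) P P"
proof (cases P)
  case (Pair M U)
  assume "faa_ob X P"
  then have M: "cmon_in X M" and U: "U \<in> Obj X" by (auto simp: Pair)
  have A: "carr M \<in> Obj X" using carr_Obj[OF M] .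
  \<comment> \<open>Composing \<open>Pr0\<close> with an identity brings the identity sequence into
    the form required by \<open>linear_Hom\<close>.\<close>
  have "first_order X (M, U) (M, U) (Ide X U) (Pr0 X (carr M) U \<cdot> Ide X (carr M)) \<in> Hom (Faa X) (M, U) (M, U)"
    by (rule linear_Hom[OF M M U U Ide_Hom[OF U] Ide_Hom[OF A]])
      (use M A cat_model.pmon_closed[OF cat_models] set_model.act_Ide[OF models] in auto)
  then show ?thesis by (simp add: Pair Cmp_Ide[OF Pr0_Hom[OF A U]] del: first_order.simps)
qed

lemma faa_pr_Hom:
  assumes "faa_ob X P" "faa_ob X Q"
  shows "faa_pr0 X P Q \<in> Hom (Faa X) (faa_prd X P Q) P" "faa_pr1 X P Q \<in> Hom (Faa X) (faa_prd X P Q) Q"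
proof -
  obtain M U N V where PQ: "P = (M, U)" "Q = (N, V)" by (metis surj_pair)
  have M: "cmon_in X M" and U: "U \<in> Obj X" and N: "cmon_in X N" and V: "V \<in> Obj X"
    using assms by (auto simp: PQ)
  have A: "carr M \<in> Obj X" and B: "carr N \<in> Obj X" using carr_Obj[OF M] carr_Obj[OF N] by auto
  note MN = cmon_in_prod[OF M N] and UV = Prd_Obj[OF U V]
  have "first_order X (prod_cmon X M N, Prd X U V) (M, U) (Pr0 X U V)
      (Pr0 X (carr (prod_cmon X M N)) (Prd X U V) \<cdot> Pr0 X (carr M) (carr N))
      \<in> Hom (Faa X) (prod_cmon X M N, Prd X U V) (M, U)"
  proof (rule linear_Hom[OF MN M UV U Pr0_Hom[OF U V]]; (unfold carr_prod_cmon)?)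
    fix G b c assume G: "G \<in> \<M>"
    interpret cat_model X G by (rule cat_models[OF G])
    show "act G (Pr0 X (carr M) (carr N)) \<one>\<^bsub>pmon G (prod_cmon X M N)\<^esub> = \<one>\<^bsub>pmon G M\<^esub>"
      using pmon_closed[OF M] pmon_closed[OF N] by (simp add: pmon_prod_cmon[OF M N] act_Pr0 A B)
    assume "b \<in> pts G (Prd X (carr M) (carr N))" "c \<in> pts G (Prd X (carr M) (carr N))"
    then show "act G (Pr0 X (carr M) (carr N)) (b \<otimes>\<^bsub>pmon G (prod_cmon X M N)\<^esub> c) =
        act G (Pr0 X (carr M) (carr N)) b \<otimes>\<^bsub>pmon G M\<^esub> act G (Pr0 X (carr M) (carr N)) c"
      using pmon_closed[OF M] pmon_closed[OF N] act_pts[OF Pr0_Hom[OF A B]] act_pts[OF Pr1_Hom[OF A B]]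
      by (simp add: pmon_prod_cmon[OF M N] act_Pr0 A B)
  qed (use Pr0_Hom[OF A B] in simp)
  then show "faa_pr0 X P Q \<in> Hom (Faa X) (faa_prd X P Q) P"
    by (simp add: PQ del: first_order.simps)
  have "first_order X (prod_cmon X M N, Prd X U V) (N, V) (Pr1 X U V)
      (Pr0 X (carr (prod_cmon X M N)) (Prd X U V) \<cdot> Pr1 X (carr M) (carr N))
      \<in> Hom (Faa X) (prod_cmon X M N, Prd X U V) (N, V)"
  proof (rule linear_Hom[OF MN N UV V Pr1_Hom[OF U V]]; (unfold carr_prod_cmon)?)
    fix G b c assume G: "G \<in> \<M>"
    interpret cat_model X G by (rule cat_models[OF G])
    show "act G (Pr1 X (carr M) (carr N)) \<one>\<^bsub>pmon G (prod_cmon X M N)\<^esub> = \<one>\<^bsub>pmon G N\<^esub>"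
      using pmon_closed[OF M] pmon_closed[OF N] by (simp add: pmon_prod_cmon[OF M N] act_Pr1 A B)
    assume "b \<in> pts G (Prd X (carr M) (carr N))" "c \<in> pts G (Prd X (carr M) (carr N))"
    then show "act G (Pr1 X (carr M) (carr N)) (b \<otimes>\<^bsub>pmon G (prod_cmon X M N)\<^esub> c) =
        act G (Pr1 X (carr M) (carr N)) b \<otimes>\<^bsub>pmon G N\<^esub> act G (Pr1 X (carr M) (carr N)) c"
      using pmon_closed[OF M] pmon_closed[OF N] act_pts[OF Pr0_Hom[OF A B]] act_pts[OF Pr1_Hom[OF A B]]
      by (simp add: pmon_prod_cmon[OF M N] act_Pr1 A B)
  qed (use Pr1_Hom[OF A B] in simp)
  then show "faa_pr1 X P Q \<in> Hom (Faa X) (faa_prd X P Q) Q"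
    by (simp add: PQ del: first_order.simps)
qed

end

section \<open>Pairing of sequences and arrows to the terminal object\<close>

definition faa_pair :: "('o, 'm) ccat \<Rightarrow> ('o, 'm) faa_arr \<Rightarrow> ('o, 'm) faa_arr \<Rightarrow> ('o, 'm) faa_arr" where
  "faa_pair X f g = FArr (fdom f) (faa_prd X (fcod f) (fcod g)) (\<lambda>n. pair X (fseq f n) (fseq g n))"

definition faa_bang :: "('o, 'm) ccat \<Rightarrow> ('o, 'm) faa_obj \<Rightarrow> ('o, 'm) faa_arr" where
  "faa_bang X P = FArr P (one_cmon X, One X) (\<lambda>n. bang X (powprd X (carr (fst P)) n (snd P)))"

context cat_model
begin

lemma dm_pair:
  assumes f: "faa_ar X (FArr (L, W) (M, U) s)" and g: "faa_ar X (FArr (L, W) (N, V) t)"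
    and m: "set_mset m \<subseteq> pts G (carr L)" and x: "x \<in> pts G W"
  shows "dm G (\<lambda>n. pair X (s n) (t n)) m x = tup G (dm G s m x) (dm G t m x)"
proof -
  let ?l = "SOME l. mset l = m"
  have l: "mset ?l = m" by (rule some_mset)
  then have "set ?l \<subseteq> pts G (carr L)" using m by (metis set_mset_mset)
  then have e: "foldr (tup G) ?l x \<in> pts G (powprd X (carr L) (size m) W)"
    using tuple_pts[OF carr_Obj[OF faa_arD(1)[OF f]] faa_arD(3)[OF f] _ x] l by (metis size_mset)
  show ?thesis
  proof (cases "size m = 0")
    case True
    then show ?thesis using act_pair[OF faa_arD(5)[OF f] faa_arD(5)[OF g] x] by simp
  next
    case False
    then show ?thesis
      unfolding dm_def using act_pair[OF faa_arD(6)[OF f] faa_arD(6)[OF g] e] by simp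
  qed
qed

lemma finprod_prod_cmon:
  assumes M: "cmon_in X M" and N: "cmon_in X N"
    and f: "\<And>i. i \<in> I \<Longrightarrow> f i \<in> pts G (carr M)" and g: "\<And>i. i \<in> I \<Longrightarrow> g i \<in> pts G (carr N)"
  shows "finprod (pmon G (prod_cmon X M N)) (\<lambda>i. tup G (f i) (g i)) I =
    tup G (finprod (pmon G M) f I) (finprod (pmon G N) g I)"
proof -
  interpret M: comm_monoid "pmon G M" by (rule comm_monoid_pmon[OF M])
  interpret N: comm_monoid "pmon G N" by (rule comm_monoid_pmon[OF N])
  interpret MN: comm_monoid "pmon G (prod_cmon X M N)" by (rule comm_monoid_prod_cmon[OF M N])
  have A: "carr M \<in> Obj X" and B: "carr N \<in> Obj X" using carr_Obj[OF M] carr_Obj[OF N] by auto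
  show ?thesis
    using f g
  proof (induction I rule: infinite_finite_induct)
    case (insert i I)
    have 1: "finprod (pmon G M) f (insert i I) = f i \<otimes>\<^bsub>pmon G M\<^esub> finprod (pmon G M) f I"
      by (rule M.finprod_insert) (use insert in \<open>auto simp: carrier_pmon\<close>)
    have 2: "finprod (pmon G N) g (insert i I) = g i \<otimes>\<^bsub>pmon G N\<^esub> finprod (pmon G N) g I"
      by (rule N.finprod_insert) (use insert in \<open>auto simp: carrier_pmon\<close>)
    have "finprod (pmon G (prod_cmon X M N)) (\<lambda>i. tup G (f i) (g i)) (insert i I) =
      tup G (f i) (g i) \<otimes>\<^bsub>pmon G (prod_cmon X M N)\<^esub> finprod (pmon G (prod_cmon X M N)) (\<lambda>i. tup G (f i) (g i)) I"
      by (rule MN.finprod_insert) (use insert in \<open>auto simp: carrier_pmon intro!: tup_pts A B\<close>)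
    then show ?case
      unfolding 1 2 using insert
      by (simp add: pmon_prod_cmon_tup[OF M N] finprod_pts[OF M] finprod_pts[OF N])
  qed (simp_all add: pmon_prod_cmon(2)[OF M N])
qed

text \<open>Addition in the product monoid is componentwise, so the sum over partitions of pairs
  splits into a pair of sums. This supplies the existence part of the universal property of products
  in \<open>Faa X\<close>.\<close>

lemma act_faa_pair:
  assumes f: "faa_ar X (FArr (L, W) (M, U) s)" and g: "faa_ar X (FArr (L, W) (N, V) t)"
    and J: "finite J" and a: "a \<in> pts (prol J G) (L, W)"
  shows "act (prol J G) (faa_pair X (FArr (L, W) (M, U) s) (FArr (L, W) (N, V) t)) a =
    tup (prol J G) (act (prol J G) (FArr (L, W) (M, U) s) a) (act (prol J G) (FArr (L, W) (N, V) t) a)"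
proof (rule prol_eqI)
  fix S assume S: "S \<subseteq> J"
  note x = prol_pts_base[OF a]
  show "act (prol J G) (faa_pair X (FArr (L, W) (M, U) s) (FArr (L, W) (N, V) t)) a S =
    tup (prol J G) (act (prol J G) (FArr (L, W) (M, U) s) a) (act (prol J G) (FArr (L, W) (N, V) t) a) S"
  proof (cases "S = {}")
    case True
    then show ?thesis using act_pair[OF faa_arD(5)[OF f] faa_arD(5)[OF g] x] by (simp add: faa_pair_def)
  next
    case False
    have fin: "finite S" using S J finite_subset by blast
    let ?m = "\<lambda>P. image_mset a (mset_set P)"
    have m: "set_mset (?m P) \<subseteq> pts G (carr L)" "?m P \<noteq> {#}" if "partition_on S P" for P
      using prol_blocks_pts[OF a fin S that] blocks_mset_nonempty[OF that False fin] by auto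
    have "act (prol J G) (faa_pair X (FArr (L, W) (M, U) s) (FArr (L, W) (N, V) t)) a S =
      finprod (pmon G (prod_cmon X M N)) (\<lambda>P. dm G (\<lambda>n. pair X (s n) (t n)) (?m P) (a {})) (partitions S)"
      by (simp add: act_prol_fibre[OF S False] faa_pair_def)
    also have "\<dots> = finprod (pmon G (prod_cmon X M N)) (\<lambda>P. tup G (dm G s (?m P) (a {})) (dm G t (?m P) (a {}))) (partitions S)"
      by (rule comm_monoid.finprod_cong'[OF comm_monoid_prod_cmon[OF faa_arD(2)[OF f] faa_arD(2)[OF g]]])
        (use m dm_pair[OF f g _ x] dm_closed[OF f _ _ x] dm_closed[OF g _ _ x] in
          \<open>auto simp: carrier_pmon intro!: tup_pts carr_Obj[OF faa_arD(2)[OF f]] carr_Obj[OF faa_arD(2)[OF g]]\<close>)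
    also have "\<dots> = tup G (finprod (pmon G M) (\<lambda>P. dm G s (?m P) (a {})) (partitions S))
        (finprod (pmon G N) (\<lambda>P. dm G t (?m P) (a {})) (partitions S))"
      by (rule finprod_prod_cmon[OF faa_arD(2)[OF f] faa_arD(2)[OF g]])
        (use m dm_closed[OF f _ _ x] dm_closed[OF g _ _ x] in auto)
    finally show ?thesis using S False by (simp add: act_prol_fibre)
  qed
qed (auto simp: act_prol)

end

context separated
begin

lemma faa_pair_Hom:
  assumes f: "faa_ar X (FArr (L, W) (M, U) s)" and g: "faa_ar X (FArr (L, W) (N, V) t)"
  shows "faa_pair X (FArr (L, W) (M, U) s) (FArr (L, W) (N, V) t) \<in> Hom (Faa X) (L, W) (faa_prd X (M, U) (N, V))"
proof -
  have A: "carr L \<in> Obj X" using carr_Obj faa_arD(1)[OF f] by blast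
  have "faa_ar X (FArr (L, W) (prod_cmon X M N, Prd X U V) (\<lambda>n. pair X (s n) (t n)))"
  proof (rule faa_arI[where \<Phi> = "\<lambda>G K b x. tup G (dm G s (image_mset b (mset_set K)) x) (dm G t (image_mset b (mset_set K)) x)"])
    show "pair X (s n) (t n) \<in> Hom X (powprd X (carr L) n W) (carr (prod_cmon X M N))" if "n \<noteq> 0" for n
      using pair_Hom[OF faa_arD(6)[OF f that] faa_arD(6)[OF g that]] by simp
    fix G assume "G \<in> \<M>"
    then interpret cat_model X G by (rule cat_models)
    show "act G (pair X (s (length ks)) (t (length ks))) (foldr (tup G) (map a ks) x) =
        tup G (dm G s (image_mset a (mset_set (set ks))) x) (dm G t (image_mset a (mset_set (set ks))) x)"
      if ks: "ks \<noteq> []" "distinct ks" and a: "\<And>k. k \<in> set ks \<Longrightarrow> a k \<in> pts G (carr L)" and x: "x \<in> pts G W" for ks a x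
    proof -
      have sub: "set (map a ks) \<subseteq> pts G (carr L)" using a by auto
      have e: "foldr (tup G) (map a ks) x \<in> pts G (powprd X (carr L) (length ks) W)"
        using tuple_pts[OF A faa_arD(3)[OF f] sub x] by simp
      have "act G (s (length ks)) (foldr (tup G) (map a ks) x) = dm G s (image_mset a (mset_set (set ks))) x"
        "act G (t (length ks)) (foldr (tup G) (map a ks) x) = dm G t (image_mset a (mset_set (set ks))) x"
        using dm_list[OF f sub x] dm_list[OF g sub x] mset_map_distinct[OF ks(2), of a] by simp_all
      then show ?thesis using act_pair[OF faa_arD(6)[OF f] faa_arD(6)[OF g] e] ks by simp
    qed
    fix K :: "nat set" and a k x
    assume K: "finite K" "k \<in> K" and a: "\<And>k. k \<in> K \<Longrightarrow> a k \<in> pts G (carr L)" and x: "x \<in> pts G W"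
    have m: "set_mset (image_mset a (mset_set (K - {k}))) \<subseteq> pts G (carr L)" using K a by auto
    note up = image_mset_upd(1)[OF K]
    have dcs: "dm G s (add_mset v (image_mset a (mset_set (K - {k})))) x \<in> pts G (carr M)"
      "dm G t (add_mset v (image_mset a (mset_set (K - {k})))) x \<in> pts G (carr N)" if "v \<in> pts G (carr L)" for v
      by (rule dm_closed[OF f _ _ x] dm_closed[OF g _ _ x]; use m that in simp)+
    show "tup G (dm G s (image_mset (a(k := b \<otimes>\<^bsub>pmon G L\<^esub> c)) (mset_set K)) x) (dm G t (image_mset (a(k := b \<otimes>\<^bsub>pmon G L\<^esub> c)) (mset_set K)) x) =
      tup G (dm G s (image_mset (a(k := b)) (mset_set K)) x) (dm G t (image_mset (a(k := b)) (mset_set K)) x)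
      \<otimes>\<^bsub>pmon G (prod_cmon X M N)\<^esub>
      tup G (dm G s (image_mset (a(k := c)) (mset_set K)) x) (dm G t (image_mset (a(k := c)) (mset_set K)) x)"
      if b: "b \<in> pts G (carr L)" and c: "c \<in> pts G (carr L)" for b c
      unfolding up dm_mult[OF f m x b c] dm_mult[OF g m x b c]
      by (rule pmon_prod_cmon_tup[OF faa_arD(2)[OF f] faa_arD(2)[OF g], symmetric])
        (rule dcs b c)+
    show "tup G (dm G s (image_mset (a(k := \<one>\<^bsub>pmon G L\<^esub>)) (mset_set K)) x) (dm G t (image_mset (a(k := \<one>\<^bsub>pmon G L\<^esub>)) (mset_set K)) x)
      = \<one>\<^bsub>pmon G (prod_cmon X M N)\<^esub>"
      unfolding up dm_one[OF f m x] dm_one[OF g m x] pmon_prod_cmon(2)[OF faa_arD(2)[OF f] faa_arD(2)[OF g]] ..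
  qed (use faa_arD[OF f] faa_arD[OF g] in \<open>auto intro: cmon_in_prod Prd_Obj pair_Hom\<close>)
  then show ?thesis by (simp add: Hom_Faa_iff faa_pair_def)
qed

lemma faa_bang_Hom:
  assumes "faa_ob X P" shows "faa_bang X P \<in> Hom (Faa X) P (one_cmon X, One X)"
proof -
  obtain M U where P: "P = (M, U)" by (cases P)
  have M: "cmon_in X M" and U: "U \<in> Obj X" using assms by (auto simp: P)
  have A: "carr M \<in> Obj X" using carr_Obj[OF M] .
  have "faa_ar X (FArr (M, U) (one_cmon X, One X) (\<lambda>n. bang X (powprd X (carr M) n U)))"
  proof (rule faa_arI[OF M U cmon_in_one One_Obj, where \<Phi> = "\<lambda>G K b x. pt G"])
    fix G assume "G \<in> \<M>"
    then interpret cat_model X G by (rule cat_models)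
    have "\<one>\<^bsub>pmon G (one_cmon X)\<^esub> \<in> pts G (One X)" "pt G \<otimes>\<^bsub>pmon G (one_cmon X)\<^esub> pt G \<in> pts G (One X)"
      using pmon_closed[OF cmon_in_one] pt_pts by auto
    then show "pt G = pt G \<otimes>\<^bsub>pmon G (one_cmon X)\<^esub> pt G" "pt G = \<one>\<^bsub>pmon G (one_cmon X)\<^esub>"
      by (auto simp: pts_One)
    show "act G (bang X (powprd X (carr M) (length ks) U)) (foldr (tup G) (map a ks) x) = pt G"
      if "\<And>k. k \<in> set ks \<Longrightarrow> a k \<in> pts G (carr M)" "x \<in> pts G U" for ks :: "nat list" and a x
    proof (rule act_bang[OF powprd_Obj[OF A U]])
      have "set (map a ks) \<subseteq> pts G (carr M)" using that by auto
      from tuple_pts[OF A U this that(2)]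
      show "foldr (tup G) (map a ks) x \<in> pts G (powprd X (carr M) (length ks) U)" by simp
    qed
  qed (use bang_Hom powprd_Obj[OF A U] bang_Hom[OF U] in auto)
  then show ?thesis by (simp add: Hom_Faa_iff faa_bang_def P)
qed

section \<open>Prolongations as jointly faithful models of \<open>Faa X\<close>\<close>

lemma set_model_prol:
  assumes G: "set_model X G" and J: "finite J"
  shows "set_model (Faa X) (prol J G)"
proof -
  interpret cat_model X G using G by (simp add: cat_model_def cartesian_category_axioms)
  show ?thesis
  proof
    fix f P Q e assume f: "f \<in> Hom (Faa X) P Q" and e: "e \<in> pts (prol J G) P"
    obtain M U N V where PQ: "P = (M, U)" "Q = (N, V)" by (metis surj_pair)
    obtain s where s: "f = FArr (M, U) (N, V) s" "faa_ar X (FArr (M, U) (N, V) s)"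
      using f unfolding PQ by (rule Hom_FaaE)
    show "act (prol J G) f e \<in> pts (prol J G) Q"
      using prol_act_pts[OF s(2) J] e by (simp add: s PQ)
    fix g R assume g: "g \<in> Hom (Faa X) Q R"
    obtain L T where R: "R = (L, T)" by (cases R)
    obtain t where t: "g = FArr (N, V) (L, T) t" "faa_ar X (FArr (N, V) (L, T) t)"
      using g unfolding PQ R by (rule Hom_FaaE)
    show "act (prol J G) (f \<cdot>\<^bsub>Faa X\<^esub> g) e = act (prol J G) g (act (prol J G) f e)"
      using prol_act_cmp[OF s(2) t(2) faa_cmp_ar[OF s(2) t(2)] J] e by (simp add: s(1) t(1) PQ del: faa_cmp.simps)
  next
    fix P e assume P: "P \<in> Obj (Faa X)" and e: "e \<in> pts (prol J G) P"
    obtain M U where P': "P = (M, U)" by (cases P)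
    have M: "cmon_in X M" and U: "U \<in> Obj X" using P by (auto simp: P')
    have A: "carr M \<in> Obj X" using carr_Obj[OF M] .
    show "act (prol J G) (Ide (Faa X) P) e = e"
    proof (rule prol_eqI)
      fix S assume S: "S \<subseteq> J"
      have e': "e \<in> pts (prol J G) (M, U)" using e by (simp add: P')
      have "act (prol J G) (Ide (Faa X) P) e S =
          act (prol J G) (first_order X (M, U) (M, U) (Ide X U) (Pr0 X (carr M) U \<cdot> Ide X (carr M))) e S"
        by (simp add: P' Cmp_Ide[OF Pr0_Hom[OF A U]] del: first_order.simps)
      also have "\<dots> = e S"
        using act_linear[OF M M U Ide_Hom[OF A] J e' S, of U "Ide X U"] prol_pts_base[OF e'] prol_pts_fibre[OF e' S] A U
        by (simp add: act_Ide)
      finally show "act (prol J G) (Ide (Faa X) P) e S = e S" .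
    qed (use prol_ext[OF e] in \<open>auto simp: act_prol\<close>)
  next
    show "pts (prol J G) (One (Faa X)) = {pt (prol J G)}"
    proof (intro equalityI subsetI)
      fix a assume "a \<in> pts (prol J G) (One (Faa X))"
      then have a: "a \<in> pts (prol J G) (one_cmon X, One X)" by simp
      have "a S = pt G" if "S \<subseteq> J" for S
        using prol_pts_at[OF a that] by (cases "S = {}") (simp_all add: pts_One)
      then have "a = pt (prol J G)"
        by (intro prol_eqI[OF prol_ext[OF a]]) auto
      then show "a \<in> {pt (prol J G)}" by simp
    qed (auto simp: prol_pts_iff pts_One)
  next
    fix P Q assume PQ: "P \<in> Obj (Faa X)" "Q \<in> Obj (Faa X)"
    obtain M U N V where PQ': "P = (M, U)" "Q = (N, V)" by (metis surj_pair)
    have M: "cmon_in X M" and U: "U \<in> Obj X" and N: "cmon_in X N" and V: "V \<in> Obj X"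
      using PQ by (auto simp: PQ')
    have A: "carr M \<in> Obj X" and B: "carr N \<in> Obj X" using carr_Obj[OF M] carr_Obj[OF N] by auto
    note MN = cmon_in_prod[OF M N] and UV = Prd_Obj[OF U V]
    have pr: "act (prol J G) (Pr0 (Faa X) P Q) e S = act G (if S = {} then Pr0 X U V else Pr0 X (carr M) (carr N)) (e S)"
      "act (prol J G) (Pr1 (Faa X) P Q) e S = act G (if S = {} then Pr1 X U V else Pr1 X (carr M) (carr N)) (e S)"
      if e: "e \<in> pts (prol J G) (Prd (Faa X) P Q)" and S: "S \<subseteq> J" for e S
      using act_linear[OF MN M UV _ J _ S, of "Pr0 X (carr M) (carr N)" e U "Pr0 X U V"]
        act_linear[OF MN N UV _ J _ S, of "Pr1 X (carr M) (carr N)" e V "Pr1 X U V"]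
        Pr0_Hom[OF A B] Pr1_Hom[OF A B] e
      by (simp_all add: PQ' del: first_order.simps)
    have tp: "tup (prol J G) a b \<in> pts (prol J G) (Prd (Faa X) P Q)"
      if a: "a \<in> pts (prol J G) P" and b: "b \<in> pts (prol J G) Q" for a b
    proof -
      have "tup G (a {}) (b {}) \<in> pts G (Prd X U V)"
        by (rule tup_pts[OF U V prol_pts_base[OF a[unfolded PQ']] prol_pts_base[OF b[unfolded PQ']]])
      moreover have "tup G (a S) (b S) \<in> pts G (Prd X (carr M) (carr N))" if "S \<subseteq> J" "S \<noteq> {}" for S
        by (rule tup_pts[OF A B prol_pts_fibre[OF a[unfolded PQ'] that] prol_pts_fibre[OF b[unfolded PQ'] that]])
      ultimately show ?thesis by (simp add: PQ' prol_pts_iff)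
    qed
    have fib: "a S \<in> pts G (if S = {} then U else carr M)" "b S \<in> pts G (if S = {} then V else carr N)"
      if "a \<in> pts (prol J G) P" "b \<in> pts (prol J G) Q" "S \<subseteq> J" for a b S
      using that by (auto simp: PQ' prol_pts_iff)
    fix a b assume a: "a \<in> pts (prol J G) P" and b: "b \<in> pts (prol J G) Q"
    show "tup (prol J G) a b \<in> pts (prol J G) (Prd (Faa X) P Q)" by (rule tp[OF a b])
    show "act (prol J G) (Pr0 (Faa X) P Q) (tup (prol J G) a b) = a"
    proof (rule prol_eqI)
      fix S assume S: "S \<subseteq> J"
      show "act (prol J G) (Pr0 (Faa X) P Q) (tup (prol J G) a b) S = a S"
        unfolding pr(1)[OF tp[OF a b] S] using fib[OF a b S] S
        by (auto simp: act_Pr0 A B U V split: if_splits)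
    qed (use prol_ext[OF a] in \<open>auto simp: act_prol\<close>)
    show "act (prol J G) (Pr1 (Faa X) P Q) (tup (prol J G) a b) = b"
    proof (rule prol_eqI)
      fix S assume S: "S \<subseteq> J"
      show "act (prol J G) (Pr1 (Faa X) P Q) (tup (prol J G) a b) S = b S"
        unfolding pr(2)[OF tp[OF a b] S] using fib[OF a b S] S
        by (auto simp: act_Pr1 A B U V split: if_splits)
    qed (use prol_ext[OF b] in \<open>auto simp: act_prol\<close>)
  next
    fix P Q e assume PQ: "P \<in> Obj (Faa X)" "Q \<in> Obj (Faa X)" and e: "e \<in> pts (prol J G) (Prd (Faa X) P Q)"
    obtain M U N V where PQ': "P = (M, U)" "Q = (N, V)" by (metis surj_pair)
    have M: "cmon_in X M" and U: "U \<in> Obj X" and N: "cmon_in X N" and V: "V \<in> Obj X"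
      using PQ by (auto simp: PQ')
    have A: "carr M \<in> Obj X" and B: "carr N \<in> Obj X" using carr_Obj[OF M] carr_Obj[OF N] by auto
    note MN = cmon_in_prod[OF M N] and UV = Prd_Obj[OF U V]
    show "tup (prol J G) (act (prol J G) (Pr0 (Faa X) P Q) e) (act (prol J G) (Pr1 (Faa X) P Q) e) = e"
    proof (rule prol_eqI)
      fix S assume S: "S \<subseteq> J"
      have "e S \<in> pts G (if S = {} then Prd X U V else Prd X (carr M) (carr N))"
        using e S prol_pts_at[of e J G "prod_cmon X M N" "Prd X U V" S]
        by (cases "S = {}") (simp_all add: PQ')
      then show "tup (prol J G) (act (prol J G) (Pr0 (Faa X) P Q) e) (act (prol J G) (Pr1 (Faa X) P Q) e) S = e S"
        using act_linear[OF MN M UV _ J _ S, of "Pr0 X (carr M) (carr N)" e U "Pr0 X U V"]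
          act_linear[OF MN N UV _ J _ S, of "Pr1 X (carr M) (carr N)" e V "Pr1 X U V"]
          Pr0_Hom[OF A B] Pr1_Hom[OF A B] e S
        by (auto simp add: PQ' tup_eta[OF U V] tup_eta[OF A B] simp del: first_order.simps split: if_splits)
    qed (use prol_ext[OF e] in auto)
  qed
qed

text \<open>
  A sequence is recovered from its action on the families supported on singletons: there the only
  partition of \<open>J\<close> with a nonzero contribution is the one into singletons.
\<close>

lemma separating_prol:
  assumes "\<And>G n. G \<in> \<M> \<Longrightarrow> \<exists>J. finite J \<and> card J = n \<and> prol J G \<in> \<M>'"
  shows "separating (Faa X) \<M>'"
  unfolding separating_def
proof (intro allI ballI impI)
  fix P Q f g
  assume f: "f \<in> Hom (Faa X) P Q" and g: "g \<in> Hom (Faa X) P Q"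
    and eq: "\<forall>G \<in> \<M>'. \<forall>e \<in> pts G P. act G f e = act G g e"
  obtain M U N V where PQ: "P = (M, U)" "Q = (N, V)" by (metis surj_pair)
  obtain s where s: "f = FArr (M, U) (N, V) s" "faa_ar X (FArr (M, U) (N, V) s)"
    using f unfolding PQ by (rule Hom_FaaE)
  obtain t where t: "g = FArr (M, U) (N, V) t" "faa_ar X (FArr (M, U) (N, V) t)"
    using g unfolding PQ by (rule Hom_FaaE)
  note sD = faa_arD[OF s(2)] and tD = faa_arD[OF t(2)]
  have A: "carr M \<in> Obj X" using sD carr_Obj by blast
  have "s n = t n" for n
  proof (rule separatingD[OF sep, where A = "powprd X (carr M) n U" and B = "if n = 0 then V else carr N"])
    show "s n \<in> Hom X (powprd X (carr M) n U) (if n = 0 then V else carr N)" using sD by auto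
    show "t n \<in> Hom X (powprd X (carr M) n U) (if n = 0 then V else carr N)" using tD by auto
    fix G e assume G: "G \<in> \<M>" and e: "e \<in> pts G (powprd X (carr M) n U)"
    interpret cat_model X G by (rule cat_models[OF G])
    interpret N: comm_monoid "pmon G N" by (rule comm_monoid_pmon[OF sD(2)])
    \<comment> \<open>Only the cardinality of \<open>J\<close> is prescribed; this freedom is used
      later to choose index sets disjoint from given ones.\<close>
    obtain J where J: "finite J" "card J = n" "prol J G \<in> \<M>'" using assms[OF G] by blast
    from A sD(3) e obtain l x where l: "length l = n" "set l \<subseteq> pts G (carr M)" and x: "x \<in> pts G U"
      and e': "e = foldr (tup G) l x" by (rule tuple_cases)
    define js where "js = sorted_list_of_set J"
    have js: "set js = J" "distinct js" "length js = n" using J by (auto simp: js_def)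
    \<comment> \<open>\<open>js\<close> enumerates \<open>J\<close>, and \<open>b\<close> attaches
      to \<open>j\<close> the entry of \<open>l\<close> at the position of \<open>j\<close>.\<close>
    define b where "b j = l ! (THE i. i < n \<and> js ! i = j)" for j
    have bn: "b (js ! i) = l ! i" if "i < n" for i
    proof -
      have "(THE i'. i' < n \<and> js ! i' = js ! i) = i"
        using that js by (intro the_equality) (auto simp: nth_eq_iff_index_eq)
      then show ?thesis by (simp add: b_def)
    qed
    have bl: "map b js = l" using bn js l by (auto intro: nth_equalityI)
    \<comment> \<open>The coefficients at larger subsets are zero, so a partition with a block that
      is not a singleton feeds a zero into a multiadditive map.\<close>
    define a where "a = (\<lambda>S \<in> Pow J. if S = {} then x else if is_singleton S then b (the_elem S) else \<one>\<^bsub>pmon G M\<^esub>)"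
    have bJ: "b j \<in> pts G (carr M)" if "j \<in> J" for j using that js(1) bl l(2) by auto
    have a: "a \<in> pts (prol J G) (M, U)"
      using x bJ pmon_closed[OF sD(1)] by (auto simp: prol_pts_iff a_def is_singleton_def)
    have a0: "a {} = x" by (simp add: a_def)
    have val: "act G (r n) e = act (prol J G) (FArr (M, U) (N, V) r) a J" if r: "faa_ar X (FArr (M, U) (N, V) r)" for r
    \<comment> \<open>For \<open>n = 0\<close> the component sought is the base map, which the
      prolongation shows at the coefficient of the empty set.\<close>
    proof (cases "J = {}")
      case True
      then show ?thesis using J l e' by (simp add: a0)
    next
      case ne: False
      let ?Q = "(\<lambda>j. {j}) ` J"
      have Q: "partition_on J ?Q" by (rule partition_on_singletons)
      have "act (prol J G) (FArr (M, U) (N, V) r) a J =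
          finprod (pmon G N) (\<lambda>P. dm G r (image_mset a (mset_set P)) x) (partitions J)"
        using ne by (simp add: act_prol_fibre a0)
      also have "\<dots> = dm G r (image_mset a (mset_set ?Q)) x"
      proof (rule N.finprod_eq_single)
        show "finite (partitions J)" by (rule finitely_many_partition_on[OF J(1)])
        show "?Q \<in> partitions J" using Q by simp
        show "dm G r (image_mset a (mset_set ?Q)) x \<in> carrier (pmon G N)"
          unfolding carrier_pmon
          by (rule dm_closed[OF r prol_blocks_pts[OF a J(1) _ Q] blocks_mset_nonempty[OF Q ne J(1)] x]) simp
        fix P assume "P \<in> partitions J" and nP: "P \<noteq> ?Q"
        then have P: "partition_on J P" by simp
        have finP: "finite P" by (rule partition_finite(1)[OF J(1) P])
        have "\<exists>B \<in> P. \<not> is_singleton B"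
        proof (rule ccontr)
          assume "\<not> ?thesis"
          then have sing: "\<And>B. B \<in> P \<Longrightarrow> \<exists>j. B = {j}" by (auto simp: is_singleton_def)
          have "P = ?Q"
          proof (intro equalityI subsetI)
            fix B assume B: "B \<in> P"
            then obtain j where "B = {j}" using sing by blast
            then show "B \<in> ?Q" using partition_block[OF P B] by auto
          next
            fix B assume "B \<in> ?Q"
            then obtain j where j: "B = {j}" "j \<in> J" by blast
            then obtain C where "C \<in> P" "j \<in> C" using partition_onD1[OF P] by blast
            then show "B \<in> P" using sing[of C] j by auto
          qed
          then show False using nP by simp
        qed
        then obtain B where B: "B \<in> P" "\<not> is_singleton B" by blast
        then have aB: "a B = \<one>\<^bsub>pmon G M\<^esub>" using partition_block[OF P B(1)] by (auto simp: a_def)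
        have "image_mset a (mset_set P) = add_mset \<one>\<^bsub>pmon G M\<^esub> (image_mset a (mset_set (P - {B})))"
          using mset_set.remove[OF finP B(1)] aB by simp
        moreover have "set_mset (image_mset a (mset_set (P - {B}))) \<subseteq> pts G (carr M)"
          using prol_blocks_pts[OF a J(1) _ P] finP by auto
        ultimately show "dm G r (image_mset a (mset_set P)) x = \<one>\<^bsub>pmon G N\<^esub>"
          using dm_one[OF r _ x] by simp
      qed
      also have "image_mset a (mset_set ?Q) = mset l"
      proof -
        have "image_mset a (mset_set ?Q) = image_mset (\<lambda>j. a {j}) (mset_set J)"
          by (simp add: image_mset_mset_set[symmetric] inj_on_def multiset.map_comp comp_def)
        also have "\<dots> = image_mset b (mset_set J)"
          by (rule image_mset_cong) (use J(1) in \<open>auto simp: a_def\<close>)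
        also have "\<dots> = mset (map b js)" using mset_map_distinct[OF js(2), of b] js(1) by simp
        finally show ?thesis using bl by simp
      qed
      also have "dm G r (mset l) x = act G (r n) e" using dm_list[OF r l(2) x] l(1) e' by simp
      finally show ?thesis ..
    qed
    show "act G (s n) e = act G (t n) e"
      using val[OF s(2)] val[OF t(2)] eq J(3) a s(1) t(1) PQ by auto
  qed
  then show "f = g" by (simp add: s t fun_eq_iff)
qed

definition prols :: "(('o, 'm) faa_obj, ('o, 'm) faa_arr, nat set \<Rightarrow> 'e) interp set" where
  "prols = {prol J G | J G. finite J \<and> G \<in> \<M>}"

text \<open>The Cartesian category laws of \<open>Faa X\<close> are established here, by reflection
  from the prolongations. Having \<open>Faa X\<close> with a jointly faithful set of models again
  makes the construction repeatable.\<close>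

lemma separated_Faa: "separated (Faa X) prols"
proof -
  have sepF: "separating (Faa X) prols"
  proof (rule separating_prol)
    fix G n assume "G \<in> \<M>"
    then show "\<exists>J. finite J \<and> card J = n \<and> prol J G \<in> prols"
      by (intro exI[of _ "{..<n}"]) (auto simp: prols_def)
  qed
  have mod: "\<And>G. G \<in> prols \<Longrightarrow> set_model (Faa X) G" using set_model_prol models by (auto simp: prols_def)
  have "cartesian_category (Faa X)"
  proof (rule cartesian_category_if_separating[OF _ _ _ _ _ _ _ _ mod sepF])
    show "Dom (Faa X) f \<in> Obj (Faa X)" "Cod (Faa X) f \<in> Obj (Faa X)" if "f \<in> Arr (Faa X)" for f
      using that by (cases "(X, f)" rule: faa_ar.cases; simp)+
    show "Ide (Faa X) P \<in> Hom (Faa X) P P" if "P \<in> Obj (Faa X)" for P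
      using faa_ide_Hom that by simp
    show "One (Faa X) \<in> Obj (Faa X)" using cmon_in_one One_Obj by simp
    show "\<exists>h. h \<in> Hom (Faa X) P (One (Faa X))" if "P \<in> Obj (Faa X)" for P
      using faa_bang_Hom[of P] that by (intro exI[of _ "faa_bang X P"]) simp
    fix P Q R :: "('o, 'm) faa_obj" and f g
    show "Prd (Faa X) P Q \<in> Obj (Faa X)" "Pr0 (Faa X) P Q \<in> Hom (Faa X) (Prd (Faa X) P Q) P"
      "Pr1 (Faa X) P Q \<in> Hom (Faa X) (Prd (Faa X) P Q) Q" if "P \<in> Obj (Faa X)" "Q \<in> Obj (Faa X)"
      using that faa_ob_prd faa_pr_Hom by auto
    obtain M U N V L W where PQ: "P = (M, U)" "Q = (N, V)" "R = (L, W)" by (metis surj_pair)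
    show "f \<cdot>\<^bsub>Faa X\<^esub> g \<in> Hom (Faa X) P R" if f: "f \<in> Hom (Faa X) P Q" and g: "g \<in> Hom (Faa X) Q R"
    proof -
      obtain s where s: "f = FArr (M, U) (N, V) s" "faa_ar X (FArr (M, U) (N, V) s)"
        using f unfolding PQ by (rule Hom_FaaE)
      obtain t where t: "g = FArr (N, V) (L, W) t" "faa_ar X (FArr (N, V) (L, W) t)"
        using g unfolding PQ by (rule Hom_FaaE)
      show ?thesis using faa_cmp_ar[OF s(2) t(2)] by (simp add: Hom_def s(1) t(1) PQ)
    qed
    show "\<exists>h \<in> Hom (Faa X) R (Prd (Faa X) P Q). \<forall>G \<in> prols. \<forall>e \<in> pts G R. act G h e = tup G (act G f e) (act G g e)"
      if f: "f \<in> Hom (Faa X) R P" and g: "g \<in> Hom (Faa X) R Q"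
    proof -
      obtain s where s: "f = FArr (L, W) (M, U) s" "faa_ar X (FArr (L, W) (M, U) s)"
        using f unfolding PQ by (rule Hom_FaaE)
      obtain t where t: "g = FArr (L, W) (N, V) t" "faa_ar X (FArr (L, W) (N, V) t)"
        using g unfolding PQ by (rule Hom_FaaE)
      show ?thesis
      proof (intro bexI ballI)
        show "faa_pair X f g \<in> Hom (Faa X) R (Prd (Faa X) P Q)"
          using faa_pair_Hom[OF s(2) t(2)] by (simp add: s(1) t(1) PQ)
        fix G e assume G: "G \<in> prols" and e: "e \<in> pts G R"
        then obtain J G0 where J: "finite J" "G0 \<in> \<M>" "G = prol J G0" by (auto simp: prols_def)
        show "act G (faa_pair X f g) e = tup G (act G f e) (act G g e)"
          using cat_model.act_faa_pair[OF cat_models[OF J(2)] s(2) t(2) J(1)] e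
          unfolding s(1) t(1) PQ J(3) by blast
      qed
    qed
  qed
  then show ?thesis by (simp add: separated_def separated_axioms_def mod sepF)
qed

end

section \<open>Functoriality\<close>

lemma (in cartesian_category) separated_hom: "separated X (hom_interp X ` Obj X)"
  using set_model_hom_interp separating_hom_interp
  by (auto simp: separated_def separated_axioms_def cartesian_category_axioms)

lemma (in cartesian_category) cartesian_category_Faa: "cartesian_category (Faa X)"
  using separated.separated_Faa[OF separated_hom] by (simp add: separated_def)

lemma (in cartesian_category) set_model_prol:
  "set_model X G \<Longrightarrow> finite J \<Longrightarrow> set_model (Faa X) (prol J G)"
  by (rule separated.set_model_prol[OF separated_hom])

section \<open>Pulling back models along a functor\<close>

definition pull :: "('o, 'm, 'p, 'n) func \<Rightarrow> ('p, 'n, 'e) interp \<Rightarrow> ('o, 'm, 'e) interp" where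
  "pull F G = \<lparr>pts = \<lambda>A. pts G (on_obj F A), act = \<lambda>f. act G (on_arr F f), tup = tup G, pt = pt G\<rparr>"

lemma pull_simps [simp]:
  "pts (pull F G) A = pts G (on_obj F A)" "act (pull F G) f = act G (on_arr F f)"
  "tup (pull F G) = tup G" "pt (pull F G) = pt G"
  by (simp_all add: pull_def)

definition func_cmon :: "('o, 'm, 'p, 'n) func \<Rightarrow> ('o, 'm) cmon \<Rightarrow> ('p, 'n) cmon" where
  "func_cmon F M = (on_obj F (fst M), on_arr F (fst (snd M)), on_arr F (snd (snd M)))"

lemma carr_func_cmon [simp]: "carr (func_cmon F M) = on_obj F (carr M)"
  by (simp add: func_cmon_def)

lemma Faa_func_obj_eq: "Faa_func_obj F (M, U) = (func_cmon F M, on_obj F U)"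
  by (cases M) (simp add: func_cmon_def)

lemma pmon_pull [simp]: "pmon (pull F G) M = pmon G (func_cmon F M)"
  by (simp add: pmon_def func_cmon_def)

lemma dm_pull [simp]: "dm (pull F G) s = dm G (\<lambda>n. on_arr F (s n))"
  by (simp add: dm_def fun_eq_iff)

text \<open>\<open>Faa_func\<close> applies \<open>F\<close> to each component, and the action of a
  component under \<open>pull F G\<close> is the action of its image under \<open>G\<close>; both
  sides are thus the same sum.\<close>

lemma act_prol_Faa_func: "act (prol J G) (Faa_func_arr F f) = act (prol J (pull F G)) f"
proof (cases f)
  case (FArr P Q s)
  obtain N V where "Q = (N, V)" by (cases Q)
  then show ?thesis by (simp add: FArr act_prol fun_eq_iff Faa_func_obj_eq)
qed

text \<open>Prolongation commutes with pulling back. Questions about \<open>Faa_func F\<close> in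
  models of \<open>Faa Y\<close> are thereby questions about models of \<open>Faa X\<close>.\<close>

lemma pull_Faa_func: "pull (Faa_func F) (prol J G) = prol J (pull F G)"
proof -
  have "pts (prol J G) (Faa_func_obj F P) = pts (prol J (pull F G)) P" for P
  proof -
    obtain M U where P: "P = (M, U)" by (cases P)
    show ?thesis unfolding P
      by (rule Set.set_eqI)
        (simp only: Faa_func_obj_eq prol_pts_iff pull_simps if_distrib[of "on_obj F"] carr_func_cmon)
  qed
  moreover have "tup (prol J G) = tup (prol J (pull F G))" "pt (prol J G) = pt (prol J (pull F G))"
    by (simp_all add: fun_eq_iff)
  ultimately show ?thesis
    by (auto simp: pull_def Faa_func_def act_prol_Faa_func intro!: interp.equality)
qed

context cartesian_functor
begin

lemma func_pair:
  assumes f: "f \<in> Hom X W A" and g: "g \<in> Hom X W B"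
  shows "on_arr F (pair X f g) = pair Y (on_arr F f) (on_arr F g)"
proof (rule target.pair_unique)
  have A: "A \<in> Obj X" and B: "B \<in> Obj X" using f g source.Hom_Obj by auto
  note p = source.pair_universal[OF f g]
  show "on_arr F (pair X f g) \<in> Hom Y (on_obj F W) (Prd Y (on_obj F A) (on_obj F B))"
    using on_arr_Hom[of "pair X f g"] p on_obj_Prd[OF A B] by metis
  show "on_obj F A \<in> Obj Y" "on_obj F B \<in> Obj Y" using on_obj_Obj A B by auto
  show "on_arr F (pair X f g) \<cdot>\<^bsub>Y\<^esub> Pr0 Y (on_obj F A) (on_obj F B) = on_arr F f"
    using on_arr_Cmp[of "pair X f g" W _ "Pr0 X A B"] p source.Pr0_Hom[OF A B] on_arr_Pr0[OF A B] by metis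
  show "on_arr F (pair X f g) \<cdot>\<^bsub>Y\<^esub> Pr1 Y (on_obj F A) (on_obj F B) = on_arr F g"
    using on_arr_Cmp[of "pair X f g" W _ "Pr1 X A B"] p source.Pr1_Hom[OF A B] on_arr_Pr1[OF A B] by metis
qed

lemma func_bang: "A \<in> Obj X \<Longrightarrow> on_arr F (bang X A) = bang Y (on_obj F A)"
  using on_arr_Hom[OF source.bang_Hom] target.bang_unique on_obj_One by metis

lemma func_mzero:
  assumes "cmon_in X M" "W \<in> Obj X"
  shows "on_arr F (mzero X M W) = mzero Y (func_cmon F M) (on_obj F W)"
proof -
  obtain A p z where M: "M = (A, p, z)" by (metis prod_cases3)
  show ?thesis
    using on_arr_Cmp[OF source.bang_Hom[OF assms(2)] cmon_in_Hom(3)] assms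
    by (simp add: M func_cmon_def func_bang)
qed

lemma func_powprd:
  assumes "A \<in> Obj X" "U \<in> Obj X"
  shows "on_obj F (powprd X A n U) = powprd Y (on_obj F A) n (on_obj F U)"
  by (induction n) (use assms in \<open>simp_all add: on_obj_Prd source.powprd_Obj\<close>)

lemma set_model_pull:
  assumes "set_model Y G" shows "set_model X (pull F G)"
proof -
  interpret G: set_model Y G by fact
  note H = on_arr_Hom
  show ?thesis
  proof
    fix A B a b assume AB: "A \<in> Obj X" "B \<in> Obj X"
    note F = on_obj_Obj[OF AB(1)] on_obj_Obj[OF AB(2)]
    show "tup (pull F G) a b \<in> pts (pull F G) (Prd X A B)"
      "act (pull F G) (Pr0 X A B) (tup (pull F G) a b) = a"
      "act (pull F G) (Pr1 X A B) (tup (pull F G) a b) = b"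
      if "a \<in> pts (pull F G) A" "b \<in> pts (pull F G) B"
      using that F AB by (simp_all add: on_obj_Prd on_arr_Pr0 on_arr_Pr1 G.tup_pts G.act_Pr0 G.act_Pr1)
    fix e assume "e \<in> pts (pull F G) (Prd X A B)"
    then show "tup (pull F G) (act (pull F G) (Pr0 X A B) e) (act (pull F G) (Pr1 X A B) e) = e"
      using F AB by (simp add: on_obj_Prd on_arr_Pr0 on_arr_Pr1 G.tup_eta)
  qed (auto simp: on_arr_Ide on_arr_Cmp on_obj_One on_obj_Obj G.act_Ide G.pts_One
      G.act_Cmp[OF H H] intro: G.act_pts[OF H])
qed

lemma cat_model_pull: "set_model Y G \<Longrightarrow> cat_model X (pull F G)"
  by (simp add: cat_model_def set_model_pull source.cartesian_category_axioms)

text \<open>In a model of \<open>Y\<close> the points of the image monoid are those of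
  \<open>M\<close> in the pulled-back model of \<open>X\<close>, where the axioms are known.\<close>

lemma func_cmon_in:
  assumes M: "cmon_in X M" shows "cmon_in Y (func_cmon F M)"
proof -
  obtain A p z where M': "M = (A, p, z)" by (metis prod_cases3)
  note H = cmon_in_Hom[OF M[unfolded M']]
  interpret Y: separated Y "hom_interp Y ` Obj Y" by (rule target.separated_hom)
  have "cmon_in Y (on_obj F A, on_arr F p, on_arr F z)"
  proof (rule cmon_inI[OF target.cartesian_category_axioms Y.models Y.sep])
    show "on_obj F A \<in> Obj Y" using H on_obj_Obj by blast
    show "on_arr F p \<in> Hom Y (Prd Y (on_obj F A) (on_obj F A)) (on_obj F A)"
      using on_arr_Hom[OF H(2)] on_obj_Prd H(1) by simp
    show "on_arr F z \<in> Hom Y (One Y) (on_obj F A)"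
      using on_arr_Hom[OF H(3)] on_obj_One by simp
    fix G assume "G \<in> hom_interp Y ` Obj Y"
    then interpret cat_model X "pull F G" using cat_model_pull Y.models by blast
    show "comm_monoid (pmon G (on_obj F A, on_arr F p, on_arr F z))"
      using comm_monoid_pmon[OF M] by (simp add: M' func_cmon_def)
  qed
  then show ?thesis by (simp add: M' func_cmon_def)
qed

lemma func_faa_ob: "faa_ob X P \<Longrightarrow> faa_ob Y (Faa_func_obj F P)"
  by (cases P) (auto simp: Faa_func_obj_eq simp del: Faa_func_obj.simps intro: func_cmon_in on_obj_Obj)

text \<open>Symmetry and additivity in \<open>Y\<close> quantify over all objects \<open>W\<close>
  of \<open>Y\<close>, also those that are not images under \<open>F\<close>. Hence the detour
  through points: in a model of \<open>Y\<close> the image of \<open>s\<close> acts as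
  \<open>s\<close> does in the pulled-back model.\<close>

lemma func_faa_ar:
  assumes f: "faa_ar X (FArr (M, U) (N, V) s)"
  shows "faa_ar Y (FArr (func_cmon F M, on_obj F U) (func_cmon F N, on_obj F V) (\<lambda>n. on_arr F (s n)))"
proof -
  note D = faa_arD[OF f]
  interpret Y: separated Y "hom_interp Y ` Obj Y" by (rule target.separated_hom)
  have A: "carr M \<in> Obj X" using carr_Obj[OF D(1)] .
  show ?thesis
  proof (rule Y.faa_arI[where \<Phi> = "\<lambda>G K b u. dm G (\<lambda>n. on_arr F (s n)) (image_mset b (mset_set K)) u"])
    show "on_arr F (s n) \<in> Hom Y (powprd Y (carr (func_cmon F M)) n (on_obj F U)) (carr (func_cmon F N))" if "n \<noteq> 0" for n
      using on_arr_Hom[OF D(6)[OF that]] func_powprd[OF A D(3)] by simp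
    fix G assume G: "G \<in> hom_interp Y ` Obj Y"
    then interpret P: cat_model X "pull F G" using cat_model_pull Y.models by blast
    show "act G (on_arr F (s (length ks))) (foldr (tup G) (map a ks) x) =
        dm G (\<lambda>n. on_arr F (s n)) (image_mset a (mset_set (set ks))) x"
      if ks: "ks \<noteq> []" "distinct ks" and a: "\<And>k. k \<in> set ks \<Longrightarrow> a k \<in> pts G (carr (func_cmon F M))"
        and x: "x \<in> pts G (on_obj F U)" for ks :: "nat list" and a x
    proof -
      have "set (map a ks) \<subseteq> pts (pull F G) (carr M)" using a by auto
      from P.dm_list[OF f this] x show ?thesis using mset_map_distinct[OF ks(2), of a] by simp
    qed
    fix K :: "nat set" and a k x
    assume K: "finite K" "k \<in> K" and a: "\<And>k. k \<in> K \<Longrightarrow> a k \<in> pts G (carr (func_cmon F M))"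
      and x: "x \<in> pts G (on_obj F U)"
    have m: "set_mset (image_mset a (mset_set (K - {k}))) \<subseteq> pts (pull F G) (carr M)" using K a by auto
    have x': "x \<in> pts (pull F G) U" using x by simp
    show "dm G (\<lambda>n. on_arr F (s n)) (image_mset (a(k := b \<otimes>\<^bsub>pmon G (func_cmon F M)\<^esub> c)) (mset_set K)) x =
        dm G (\<lambda>n. on_arr F (s n)) (image_mset (a(k := b)) (mset_set K)) x \<otimes>\<^bsub>pmon G (func_cmon F N)\<^esub>
        dm G (\<lambda>n. on_arr F (s n)) (image_mset (a(k := c)) (mset_set K)) x"
      if "b \<in> pts G (carr (func_cmon F M))" "c \<in> pts G (carr (func_cmon F M))" for b c
      using P.dm_mult[OF f m x', of b c] that by (simp add: image_mset_upd(1)[OF K])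
    show "dm G (\<lambda>n. on_arr F (s n)) (image_mset (a(k := \<one>\<^bsub>pmon G (func_cmon F M)\<^esub>)) (mset_set K)) x =
        \<one>\<^bsub>pmon G (func_cmon F N)\<^esub>"
      using P.dm_one[OF f m x'] by (simp add: image_mset_upd(1)[OF K])
  qed (use D on_arr_Hom[OF D(5)] in \<open>auto intro: func_cmon_in on_obj_Obj\<close>)
qed

lemma Faa_func_arr_Hom:
  assumes "f \<in> Hom (Faa X) P Q"
  shows "Faa_func_arr F f \<in> Hom (Faa Y) (Faa_func_obj F P) (Faa_func_obj F Q)"
proof -
  obtain M U N V where PQ: "P = (M, U)" "Q = (N, V)" by (metis surj_pair)
  obtain s where s: "f = FArr (M, U) (N, V) s" "faa_ar X (FArr (M, U) (N, V) s)"
    using assms unfolding PQ by (rule Hom_FaaE)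
  show ?thesis
    using func_faa_ar[OF s(2)] by (simp only: s(1) PQ Faa_func_arr.simps Faa_func_obj_eq Hom_Faa_iff)
qed

lemma func_first_order:
  assumes "faa_ob X (M, U)" "faa_ob X (N, V)"
  shows "Faa_func_arr F (first_order X (M, U) (N, V) h k) =
    first_order Y (Faa_func_obj F (M, U)) (Faa_func_obj F (N, V)) (on_arr F h) (on_arr F k)"
  using assms
  by (auto simp: Faa_func_obj_eq fun_eq_iff func_mzero func_powprd source.powprd_Obj carr_Obj
      simp del: Faa_func_obj.simps)

lemma func_prod_cmon:
  assumes M: "cmon_in X M" and N: "cmon_in X N"
  shows "func_cmon F (prod_cmon X M N) = prod_cmon Y (func_cmon F M) (func_cmon F N)"
proof -
  obtain A p z B q w where MN: "M = (A, p, z)" "N = (B, q, w)" by (metis prod_cases3)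
  note H = cmon_in_Hom[OF M[unfolded MN]] cmon_in_Hom[OF N[unfolded MN]]
  let ?P = "Prd X A B"
  have P: "?P \<in> Obj X" using H source.Prd_Obj by blast
  let ?l = "Pr0 X ?P ?P" and ?r = "Pr1 X ?P ?P"
  note l = source.Pr0_Hom[OF P P] and r = source.Pr1_Hom[OF P P]
  note a = source.Pr0_Hom[OF H(1,4)] and b = source.Pr1_Hom[OF H(1,4)]
  note la = source.Cmp_Hom[OF l a] and ra = source.Cmp_Hom[OF r a]
    and lb = source.Cmp_Hom[OF l b] and rb = source.Cmp_Hom[OF r b]
  note pp = source.Cmp_Hom[OF source.pair_Hom[OF la ra] H(2)]
    and qq = source.Cmp_Hom[OF source.pair_Hom[OF lb rb] H(5)]
  have FP: "on_obj F ?P = Prd Y (on_obj F A) (on_obj F B)" using on_obj_Prd H by blast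
  show ?thesis
    using H P
    by (simp add: MN func_cmon_def Let_def func_pair[OF pp qq] func_pair[OF H(3,6)]
        on_arr_Cmp[OF source.pair_Hom[OF la ra] H(2)] on_arr_Cmp[OF source.pair_Hom[OF lb rb] H(5)]
        func_pair[OF la ra] func_pair[OF lb rb] on_arr_Cmp[OF l a] on_arr_Cmp[OF r a]
        on_arr_Cmp[OF l b] on_arr_Cmp[OF r b] on_arr_Pr0 on_arr_Pr1 FP)
qed

lemma func_faa_prd:
  assumes "faa_ob X P" "faa_ob X Q"
  shows "Faa_func_obj F (faa_prd X P Q) = faa_prd Y (Faa_func_obj F P) (Faa_func_obj F Q)"
  using assms
  by (cases P; cases Q) (simp add: Faa_func_obj_eq func_prod_cmon on_obj_Prd del: Faa_func_obj.simps prod_cmon.simps)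

lemma cartesian_functor_Faa: "cartesian_functor (Faa X) (Faa Y) (Faa_func F)"
proof -
  interpret SX: separated X "hom_interp X ` Obj X" by (rule source.separated_hom)
  interpret SY: separated Y "hom_interp Y ` Obj Y" by (rule target.separated_hom)
  interpret FX: cartesian_category "Faa X" by (rule source.cartesian_category_Faa)
  interpret FY: separated "Faa Y" SY.prols by (rule SY.separated_Faa)
  have fo: "on_obj (Faa_func F) = Faa_func_obj F" "on_arr (Faa_func F) = Faa_func_arr F"
    by (simp_all add: Faa_func_def)
  show ?thesis
  proof (intro cartesian_functor.intro cartesian_functor_axioms.intro FX.cartesian_category_axioms
      FY.cartesian_category_axioms; unfold fo)
    show "Faa_func_obj F P \<in> Obj (Faa Y)" if "P \<in> Obj (Faa X)" for P using func_faa_ob that by simp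
    show "Faa_func_arr F f \<in> Hom (Faa Y) (Faa_func_obj F P) (Faa_func_obj F Q)" if "f \<in> Hom (Faa X) P Q" for f P Q
      by (rule Faa_func_arr_Hom[OF that])
    show "Faa_func_obj F (One (Faa X)) = One (Faa Y)"
      by (simp add: one_cmon_def func_bang source.One_Obj source.Prd_Obj on_obj_One on_obj_Prd)
    show "Faa_func_arr F (Ide (Faa X) P) = Ide (Faa Y) (Faa_func_obj F P)" if "P \<in> Obj (Faa X)" for P
    proof -
      obtain M U where P: "P = (M, U)" by (cases P)
      have ob: "faa_ob X (M, U)" using that by (simp add: P)
      then have "carr M \<in> Obj X" "U \<in> Obj X" using carr_Obj[of X M] by auto
      then show ?thesis
        using func_first_order[OF ob ob]
        by (simp add: P Faa_func_obj_eq on_arr_Ide on_arr_Pr0 del: Faa_func_obj.simps first_order.simps)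
    qed
    fix P Q assume PQ: "P \<in> Obj (Faa X)" "Q \<in> Obj (Faa X)"
    obtain M U N V where PQ': "P = (M, U)" "Q = (N, V)" by (metis surj_pair)
    have ob: "faa_ob X (M, U)" "faa_ob X (N, V)" using PQ by (simp_all add: PQ')
    then have O: "carr M \<in> Obj X" "U \<in> Obj X" "carr N \<in> Obj X" "V \<in> Obj X"
      using carr_Obj[of X M] carr_Obj[of X N] by auto
    have ob2: "faa_ob X (prod_cmon X M N, Prd X U V)" using SX.faa_ob_prd[OF ob] by simp
    show "Faa_func_obj F (Prd (Faa X) P Q) = Prd (Faa Y) (Faa_func_obj F P) (Faa_func_obj F Q)"
      using func_faa_prd[OF ob] by (simp add: PQ')
    have AB: "Prd X (carr M) (carr N) \<in> Obj X" "Prd X U V \<in> Obj X" using O source.Prd_Obj by auto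
    note c = on_arr_Cmp[OF source.Pr0_Hom[OF AB]]
    have prd: "func_cmon F (prod_cmon X M N) = prod_cmon Y (func_cmon F M) (func_cmon F N)"
      using func_prod_cmon ob by simp
    show "Faa_func_arr F (Pr0 (Faa X) P Q) = Pr0 (Faa Y) (Faa_func_obj F P) (Faa_func_obj F Q)"
      using func_first_order[OF ob2 ob(1)] O AB
      by (simp add: PQ' Faa_func_obj_eq prd on_obj_Prd on_arr_Pr0 c[OF source.Pr0_Hom[OF O(1,3)]]
          del: Faa_func_obj.simps first_order.simps)
    show "Faa_func_arr F (Pr1 (Faa X) P Q) = Pr1 (Faa Y) (Faa_func_obj F P) (Faa_func_obj F Q)"
      using func_first_order[OF ob2 ob(2)] O AB
      by (simp add: PQ' Faa_func_obj_eq prd on_obj_Prd on_arr_Pr0 on_arr_Pr1 c[OF source.Pr1_Hom[OF O(1,3)]]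
          del: Faa_func_obj.simps first_order.simps)
  next
    fix f g P Q R assume f: "f \<in> Hom (Faa X) P Q" and g: "g \<in> Hom (Faa X) Q R"
    note fg = FX.Cmp_Hom[OF f g]
    \<comment> \<open>In \<open>prol J G\<close> both sides act as they do in
      \<open>prol J (pull F G)\<close>, a model of \<open>Faa X\<close>, in which composites act as
      composites of functions.\<close>
    show "Faa_func_arr F (f \<cdot>\<^bsub>Faa X\<^esub> g) = Faa_func_arr F f \<cdot>\<^bsub>Faa Y\<^esub> Faa_func_arr F g"
    proof (rule FY.arr_eqI[OF Faa_func_arr_Hom[OF fg] FY.Cmp_Hom[OF Faa_func_arr_Hom[OF f] Faa_func_arr_Hom[OF g]]])
      fix G' e assume "G' \<in> SY.prols" and e: "e \<in> pts G' (Faa_func_obj F P)"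
      then obtain J G where J: "finite J" "G \<in> hom_interp Y ` Obj Y" "G' = prol J G" by (auto simp: SY.prols_def)
      have mY: "set_model Y G" using SY.models J(2) by blast
      interpret M: set_model "Faa Y" "prol J G" by (rule target.set_model_prol[OF mY J(1)])
      interpret N: set_model "Faa X" "prol J (pull F G)"
        by (rule source.set_model_prol[OF set_model_pull[OF mY] J(1)])
      have "pts (pull (Faa_func F) (prol J G)) P = pts (prol J (pull F G)) P" by (simp only: pull_Faa_func)
      then have e': "e \<in> pts (prol J (pull F G)) P" using e J(3) by (simp add: fo)
      show "act G' (Faa_func_arr F (f \<cdot>\<^bsub>Faa X\<^esub> g)) e = act G' (Faa_func_arr F f \<cdot>\<^bsub>Faa Y\<^esub> Faa_func_arr F g) e"
        unfolding J(3) M.act_Cmp[OF Faa_func_arr_Hom[OF f] Faa_func_arr_Hom[OF g] e[unfolded J(3)]]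
        unfolding act_prol_Faa_func by (rule N.act_Cmp[OF f g e'])
    qed
  qed
qed

end

text \<open>Agreement on \<open>X\<close> is enough because the components of an arrow of
  \<open>Faa X\<close> and the structure maps of its monoids are arrows of \<open>X\<close>.\<close>

lemma Faa_func_cong:
  assumes "cartesian_category X" "func_eq X F F'"
  shows "func_eq (Faa X) (Faa_func F) (Faa_func F')"
proof -
  interpret cartesian_category X by fact
  have o: "A \<in> Obj X \<Longrightarrow> on_obj F A = on_obj F' A" and a: "f \<in> Hom X A B \<Longrightarrow> on_arr F f = on_arr F' f" for A B f
    using assms(2) by (auto simp: func_eq_def Hom_def)
  have ob: "Faa_func_obj F P = Faa_func_obj F' P" if "faa_ob X P" for P
  proof -
    obtain A p z U where P: "P = ((A, p, z), U)" by (metis prod_cases3 surj_pair)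
    then have "cmon_in X (A, p, z)" "U \<in> Obj X" using that by auto
    then show ?thesis using o a cmon_in_Hom[of X A p z] by (simp add: P)
  qed
  have "Faa_func_arr F f = Faa_func_arr F' f" if "faa_ar X f" for f
  proof -
    obtain M U N V s where f: "f = FArr (M, U) (N, V) s" by (metis faa_arr.exhaust surj_pair)
    note D = faa_arD[OF that[unfolded f]]
    have "on_arr F (s n) = on_arr F' (s n)" for n
      using a[OF D(5)] a[OF D(6)] by (cases "n = 0") auto
    then show ?thesis using ob D by (simp add: f)
  qed
  then show ?thesis using ob by (simp add: func_eq_def Faa_func_def)
qed

lemma Faa_func_id: "Faa_func id_func = id_func"
proof -
  have o: "Faa_func_obj id_func = (\<lambda>P. P)" by (auto simp: fun_eq_iff id_func_def)
  have a: "Faa_func_arr id_func = (\<lambda>f. f)"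
  proof
    show "Faa_func_arr id_func f = f" for f by (cases f) (simp add: o, simp add: id_func_def)
  qed
  have "Faa_func id_func = \<lparr>on_obj = \<lambda>P. P, on_arr = \<lambda>f. f\<rparr>" unfolding Faa_func_def o a ..
  also have "\<dots> = id_func" by (simp only: id_func_def)
  finally show ?thesis .
qed

lemma Faa_func_comp: "Faa_func (F \<Zsemi> G) = Faa_func F \<Zsemi> Faa_func G"
proof -
  have o: "Faa_func_obj (F \<Zsemi> G) P = Faa_func_obj G (Faa_func_obj F P)" for P
    by (cases "(F, P)" rule: Faa_func_obj.cases) (simp add: comp_func_def)
  have "Faa_func_arr (F \<Zsemi> G) f = Faa_func_arr G (Faa_func_arr F f)" for f
    by (cases f) (simp add: o, simp add: comp_func_def)
  then show ?thesis by (simp add: Faa_func_def comp_func_def o fun_eq_iff)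
qed

section \<open>The counit\<close>

lemma (in cartesian_category) cartesian_functor_counit: "cartesian_functor (Faa X) X (counit X)"
proof -
  interpret F: cartesian_category "Faa X" by (rule cartesian_category_Faa)
  have arr: "fseq f 0 \<in> Hom X (snd P) (snd Q)" if "f \<in> Hom (Faa X) P Q" for f P Q
    by (cases P; cases Q; use that in \<open>force elim: Hom_FaaE\<close>)
  show ?thesis
  proof (intro cartesian_functor.intro cartesian_functor_axioms.intro F.cartesian_category_axioms
      cartesian_category_axioms)
    fix f g P Q R assume f: "f \<in> Hom (Faa X) P Q" and g: "g \<in> Hom (Faa X) Q R"
    show "on_arr (counit X) (f \<cdot>\<^bsub>Faa X\<^esub> g) = on_arr (counit X) f \<cdot> on_arr (counit X) g"
      by (cases P; cases Q; cases R; use f g in \<open>force elim!: Hom_FaaE simp: counit_def\<close>)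
  qed (use arr in \<open>auto simp: counit_def Let_def\<close>)
qed

lemma counit_natural: "func_eq (Faa X) (Faa_func F \<Zsemi> counit Y) (counit X \<Zsemi> F)"
proof -
  have "snd (Faa_func_obj F P) = on_obj F (snd P)" for P by (cases P) (simp add: Faa_func_obj_eq)
  moreover have "fseq (Faa_func_arr F f) 0 = on_arr F (fseq f 0)" for f by (cases f) simp
  ultimately show ?thesis by (simp add: func_eq_def comp_func_def counit_def Faa_func_def)
qed

declare prod_cmon.simps [simp del] first_order.simps [simp del]


section \<open>Matchings and partial injections\<close>

lemma match_mset_cong:
  assumes R: "R \<in> matchings P K" and fin: "finite P" "finite K"
    and "\<And>p k. p \<in> P \<Longrightarrow> k \<in> K \<Longrightarrow> v p k = v' p k" "\<And>k. k \<in> K \<Longrightarrow> a k = a' k" "\<And>p. p \<in> P \<Longrightarrow> w p = w' p"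
  shows "match_mset v a w P K R = match_mset v' a' w' P K R"
proof -
  have finR: "finite R" by (rule finite_matching[OF R fin])
  have "image_mset (\<lambda>(p, k). v p k) (mset_set R) = image_mset (\<lambda>(p, k). v' p k) (mset_set R)"
    by (rule image_mset_cong) (use matching_sub[OF R] assms finR in auto)
  moreover have "image_mset a (mset_set (K - snd ` R)) = image_mset a' (mset_set (K - snd ` R))"
    by (rule image_mset_cong) (use assms in auto)
  moreover have "image_mset w (mset_set (P - fst ` R)) = image_mset w' (mset_set (P - fst ` R))"
    by (rule image_mset_cong) (use assms in auto)
  ultimately show ?thesis by (simp add: match_mset_def)
qed

lemma match_mset_subset:
  assumes R: "R \<in> matchings P K" and fin: "finite P" "finite K"
    and "\<And>p k. p \<in> P \<Longrightarrow> k \<in> K \<Longrightarrow> v p k \<in> C" "\<And>k. k \<in> K \<Longrightarrow> a k \<in> C" "\<And>p. p \<in> P \<Longrightarrow> w p \<in> C"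
  shows "set_mset (match_mset v a w P K R) \<subseteq> C"
  using finite_matching[OF R fin] matching_sub[OF R] assms(2-) by (fastforce simp: match_mset_def)

lemma match_mset_nonempty:
  assumes R: "R \<in> matchings P K" and fin: "finite P" "finite K" and "K \<noteq> {}"
  shows "match_mset v a w P K R \<noteq> {#}"
proof
  assume e: "match_mset v a w P K R = {#}"
  then have "R = {}" "K - snd ` R = {}"
    using finite_matching[OF R fin] fin by (auto simp: match_mset_def mset_set_empty_iff)
  then show False using assms(4) by auto
qed

lemma converse_matching: "R \<in> matchings P K \<Longrightarrow> R\<inverse> \<in> matchings K P"
  unfolding matchings_def inj_on_def by fastforce

text \<open>Exchanges the roles of the two index sets. \<open>match_mset_upd\<close> varies an entry
  over \<open>P\<close>, which is what additivity in the vectors requires; with the converse it also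
  serves additivity in the slots \<open>K\<close>.\<close>

lemma match_mset_converse:
  "match_mset v a w P K R = match_mset (\<lambda>k p. v p k) w a K P (R\<inverse>)"
proof -
  have "R\<inverse> = prod.swap ` R" by force
  then have "mset_set (R\<inverse>) = image_mset prod.swap (mset_set R)"
    by (simp add: image_mset_mset_set)
  then have "image_mset (\<lambda>(k, p). v p k) (mset_set (R\<inverse>)) = image_mset (\<lambda>(p, k). v p k) (mset_set R)"
    by (simp add: multiset.map_comp comp_def case_prod_unfold)
  moreover have "fst ` (R\<inverse>) = snd ` R" "snd ` (R\<inverse>) = fst ` R" by force+
  ultimately show ?thesis by (simp add: match_mset_def)
qed

text \<open>In each term, an argument \<open>d p\<close> occurs in exactly one component.\<close>

lemma match_mset_upd:
  assumes R: "R \<in> matchings P K" and fin: "finite P" "finite K" and p: "p \<in> P"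
  obtains m g where
    "\<And>b. match_mset (\<lambda>p' k. vv k ((d(p := b)) p')) a (\<lambda>p'. ww ((d(p := b)) p')) P K R = add_mset (g b) m"
    "g = ww \<or> (\<exists>k \<in> K. g = vv k)"
    "set_mset m \<subseteq> set_mset (match_mset (\<lambda>p' k. vv k (d p')) a (\<lambda>p'. ww (d p')) P K R)"
proof -
  have finR: "finite R" by (rule finite_matching[OF R fin])
  show thesis
  proof (cases "p \<in> fst ` R")
    case True
    then obtain k where k: "(p, k) \<in> R" by force
    let ?m = "image_mset (\<lambda>(p', k). vv k (d p')) (mset_set (R - {(p, k)})) +
      image_mset a (mset_set (K - snd ` R)) + image_mset (\<lambda>p'. ww (d p')) (mset_set (P - fst ` R))"
    have r: "mset_set R = add_mset (p, k) (mset_set (R - {(p, k)}))" by (rule mset_set.remove[OF finR k])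
    show thesis
    proof (rule that[of "vv k" ?m])
      fix b
      have "image_mset (\<lambda>(p', k). vv k ((d(p := b)) p')) (mset_set (R - {(p, k)})) =
          image_mset (\<lambda>(p', k). vv k (d p')) (mset_set (R - {(p, k)}))"
      proof (rule image_mset_cong)
        fix z assume "z \<in># mset_set (R - {(p, k)})"
        then have "z \<in> R" "z \<noteq> (p, k)" using finR by auto
        then have "fst z \<noteq> p" using matching_fst[OF R k, of "snd z"] by (cases z) auto
        then show "(case z of (p', k) \<Rightarrow> vv k ((d(p := b)) p')) = (case z of (p', k) \<Rightarrow> vv k (d p'))"
          by (cases z) simp
      qed
      moreover have "image_mset (\<lambda>p'. ww ((d(p := b)) p')) (mset_set (P - fst ` R)) =
          image_mset (\<lambda>p'. ww (d p')) (mset_set (P - fst ` R))"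
        by (rule image_mset_cong) (use True fin in auto)
      ultimately show "match_mset (\<lambda>p' k. vv k ((d(p := b)) p')) a (\<lambda>p'. ww ((d(p := b)) p')) P K R = add_mset (vv k b) ?m"
        unfolding match_mset_def r by simp
    next
      show "set_mset ?m \<subseteq> set_mset (match_mset (\<lambda>p' k. vv k (d p')) a (\<lambda>p'. ww (d p')) P K R)"
        unfolding match_mset_def r by auto
    qed (use matching_sub[OF R k] in auto)
  next
    case False
    then have pP: "p \<in> P - fst ` R" using p by simp
    let ?m = "image_mset (\<lambda>(p', k). vv k (d p')) (mset_set R) +
      image_mset a (mset_set (K - snd ` R)) + image_mset (\<lambda>p'. ww (d p')) (mset_set (P - fst ` R - {p}))"
    have r: "mset_set (P - fst ` R) = add_mset p (mset_set (P - fst ` R - {p}))"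
      by (rule mset_set.remove) (use fin pP in auto)
    show thesis
    proof (rule that[of ww ?m])
      fix b
      have "image_mset (\<lambda>(p', k). vv k ((d(p := b)) p')) (mset_set R) =
          image_mset (\<lambda>(p', k). vv k (d p')) (mset_set R)"
        by (rule image_mset_cong) (use False finR in force)
      moreover have "image_mset (\<lambda>p'. ww ((d(p := b)) p')) (mset_set (P - fst ` R - {p})) =
          image_mset (\<lambda>p'. ww (d p')) (mset_set (P - fst ` R - {p}))"
        by (rule image_mset_cong) (use fin in auto)
      ultimately show "match_mset (\<lambda>p' k. vv k ((d(p := b)) p')) a (\<lambda>p'. ww ((d(p := b)) p')) P K R = add_mset (ww b) ?m"
        unfolding match_mset_def r by simp
    next
      show "set_mset ?m \<subseteq> set_mset (match_mset (\<lambda>p' k. vv k (d p')) a (\<lambda>p'. ww (d p')) P K R)"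
        unfolding match_mset_def r by auto
    qed simp
  qed
qed

lemma partial_injectionD:
  assumes "(S, \<phi>) \<in> partial_injections r n"
  shows "S \<subseteq> {..<r}" "\<And>j. j \<in> S \<Longrightarrow> \<phi> j < n" "inj_on \<phi> S" "\<phi> \<in> extensional S" "finite S"
  using assms by (auto simp: partial_injections_def PiE_iff intro: finite_subset)

context
  fixes ps :: "'p list" and ks :: "'k list" and r n :: nat
  assumes ps: "distinct ps" "length ps = r" and ks: "distinct ks" "length ks = n"
begin

lemma nth_ps_inj: "inj_on ((!) ps) {..<r}" and nth_ks_inj: "inj_on ((!) ks) {..<n}"
  using ps ks by (auto simp: inj_on_def nth_eq_iff_index_eq)

lemma nth_ps_image: "(!) ps ` {..<r} = set ps" and nth_ks_image: "(!) ks ` {..<n} = set ks"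
  using ps ks by (auto simp: set_conv_nth)

text \<open>A partial injection is determined by its graph since \<open>\<phi>\<close> is
  extensional on \<open>S\<close>. The lists \<open>ps\<close> and \<open>ks\<close> turn positions
  into labels, which in the applications include blocks of partitions.\<close>

lemma bij_betw_partial_injections:
  "bij_betw (\<lambda>(S, \<phi>). (\<lambda>j. (ps ! j, ks ! \<phi> j)) ` S) (partial_injections r n) (matchings (set ps) (set ks))"
proof (rule bij_betw_imageI)
  show "inj_on (\<lambda>(S, \<phi>). (\<lambda>j. (ps ! j, ks ! \<phi> j)) ` S) (partial_injections r n)"
  proof (rule inj_onI, clarify)
    fix S \<phi> S' \<phi>'
    assume 1: "(S, \<phi>) \<in> partial_injections r n" and 2: "(S', \<phi>') \<in> partial_injections r n"
      and eq: "(\<lambda>j. (ps ! j, ks ! \<phi> j)) ` S = (\<lambda>j. (ps ! j, ks ! \<phi>' j)) ` S'"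
    note D1 = partial_injectionD[OF 1] and D2 = partial_injectionD[OF 2]
    have sub: "j \<in> S' \<and> \<phi> j = \<phi>' j"
      if "j \<in> S" and S: "S \<subseteq> {..<r}" "S' \<subseteq> {..<r}" and b: "\<And>j. j \<in> S \<Longrightarrow> \<phi> j < n" "\<And>j. j \<in> S' \<Longrightarrow> \<phi>' j < n"
        and eq: "(\<lambda>j. (ps ! j, ks ! \<phi> j)) ` S = (\<lambda>j. (ps ! j, ks ! \<phi>' j)) ` S'"
      for j S S' and \<phi> \<phi>' :: "nat \<Rightarrow> nat"
    proof -
      have "(ps ! j, ks ! \<phi> j) \<in> (\<lambda>j. (ps ! j, ks ! \<phi>' j)) ` S'" using eq \<open>j \<in> S\<close> by blast
      then obtain j' where j': "j' \<in> S'" "ps ! j = ps ! j'" "ks ! \<phi> j = ks ! \<phi>' j'" by auto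
      have "j = j'" using inj_onD[OF nth_ps_inj j'(2)] S \<open>j \<in> S\<close> j'(1) by auto
      moreover have "\<phi> j = \<phi>' j'" using inj_onD[OF nth_ks_inj j'(3)] b(1)[OF \<open>j \<in> S\<close>] b(2)[OF j'(1)] by auto
      ultimately show ?thesis using j'(1) by simp
    qed
    have SS: "S = S'"
      using sub[OF _ D1(1) D2(1) D1(2) D2(2) eq] sub[OF _ D2(1) D1(1) D2(2) D1(2) eq[symmetric]] by blast
    moreover have "\<phi> = \<phi>'"
      by (rule extensionalityI[OF D1(4)])
        (use D2(4) SS sub[OF _ D1(1) D2(1) D1(2) D2(2) eq] in auto)
    ultimately show "S = S' \<and> \<phi> = \<phi>'" by simp
  qed
  show "(\<lambda>(S, \<phi>). (\<lambda>j. (ps ! j, ks ! \<phi> j)) ` S) ` partial_injections r n = matchings (set ps) (set ks)"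
  proof (intro equalityI subsetI)
    fix R assume "R \<in> (\<lambda>(S, \<phi>). (\<lambda>j. (ps ! j, ks ! \<phi> j)) ` S) ` partial_injections r n"
    then obtain S \<phi> where S: "(S, \<phi>) \<in> partial_injections r n" and R: "R = (\<lambda>j. (ps ! j, ks ! \<phi> j)) ` S" by auto
    note D = partial_injectionD[OF S]
    have "j = j'" if "j \<in> S" "j' \<in> S" "ps ! j = ps ! j'" for j j'
      using inj_onD[OF nth_ps_inj that(3)] D(1) that by auto
    moreover have "j = j'" if "j \<in> S" "j' \<in> S" "ks ! \<phi> j = ks ! \<phi> j'" for j j'
      using inj_onD[OF nth_ks_inj that(3)] inj_onD[OF D(3)] D(2) that by auto
    moreover have "ps ! j \<in> set ps" "ks ! \<phi> j \<in> set ks" if "j \<in> S" for j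
      using D(1,2) that ps ks by auto
    ultimately show "R \<in> matchings (set ps) (set ks)"
      unfolding R matchings_def by (auto simp: inj_on_def)
  next
    fix R assume R: "R \<in> matchings (set ps) (set ks)"
    define S where "S = {j. j < r \<and> ps ! j \<in> fst ` R}"
    \<comment> \<open>The position in \<open>ks\<close> of the partner of \<open>ps ! j\<close>,
      unique since \<open>R\<close> is functional and \<open>ks\<close> has distinct entries;
      restricting to \<open>S\<close> gives the extensionality demanded of the functions
      counted.\<close>
    define \<phi> where "\<phi> = (\<lambda>j \<in> S. THE i. i < n \<and> (ps ! j, ks ! i) \<in> R)"
    have \<phi>: "\<phi> j < n \<and> (ps ! j, ks ! \<phi> j) \<in> R" if j: "j \<in> S" for j
    proof -
      obtain k where k: "(ps ! j, k) \<in> R" using j by (auto simp: S_def)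
      then have "k \<in> set ks" using matching_sub[OF R] by blast
      then obtain i where i: "i < n" "ks ! i = k" using ks by (auto simp: in_set_conv_nth)
      have "(THE i. i < n \<and> (ps ! j, ks ! i) \<in> R) = i"
      proof (rule the_equality)
        show "i < n \<and> (ps ! j, ks ! i) \<in> R" using i k by simp
        fix i' assume "i' < n \<and> (ps ! j, ks ! i') \<in> R"
        then show "i' = i" using matching_fst[OF R k] i ks nth_eq_iff_index_eq by metis
      qed
      then show ?thesis using i k j by (simp add: \<phi>_def)
    qed
    have "inj_on \<phi> S"
    proof (rule inj_onI)
      fix j j' assume jj: "j \<in> S" "j' \<in> S" "\<phi> j = \<phi> j'"
      then have "ps ! j = ps ! j'" using \<phi>[OF jj(1)] \<phi>[OF jj(2)] matching_snd[OF R] by metis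
      then show "j = j'" using inj_onD[OF nth_ps_inj] jj by (auto simp: S_def)
    qed
    then have "(S, \<phi>) \<in> partial_injections r n"
      using \<phi> by (auto simp: partial_injections_def PiE_iff S_def \<phi>_def)
    moreover have "R = (\<lambda>j. (ps ! j, ks ! \<phi> j)) ` S"
    proof (intro equalityI subsetI)
      fix z assume z: "z \<in> R"
      obtain p k where pk: "z = (p, k)" by (cases z)
      have "p \<in> set ps" using matching_sub[OF R] z pk by blast
      then obtain j where j: "j < r" "ps ! j = p" using ps by (auto simp: in_set_conv_nth)
      then have "j \<in> S" using z pk by (force simp: S_def)
      then show "z \<in> (\<lambda>j. (ps ! j, ks ! \<phi> j)) ` S"
        using \<phi>[of j] matching_fst[OF R, of p k "ks ! \<phi> j"] z pk j by auto
    qed (use \<phi> in auto)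
    ultimately show "R \<in> (\<lambda>(S, \<phi>). (\<lambda>j. (ps ! j, ks ! \<phi> j)) ` S) ` partial_injections r n"
      by (intro image_eqI[where x = "(S, \<phi>)"]) auto
  qed
qed

text \<open>The defining formula runs through the slots and asks which of them are hit by
  \<open>\<phi>\<close>. The slots that are hit get reindexed by \<open>S\<close> along
  \<open>\<phi>\<close>, after which the pairs of the graph appear.\<close>

lemma partial_injection_mset:
  assumes S: "(S, \<phi>) \<in> partial_injections r n"
  shows "image_mset (\<lambda>i. if i \<in> \<phi> ` S then v (ps ! the_inv_into S \<phi> i) (ks ! i) else a (ks ! i)) (mset_set {..<n}) +
      image_mset (\<lambda>j. w (ps ! j)) (mset_set ({..<r} - S)) =
    match_mset v a w (set ps) (set ks) ((\<lambda>j. (ps ! j, ks ! \<phi> j)) ` S)"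
proof -
  note D = partial_injectionD[OF S]
  have sub: "\<phi> ` S \<subseteq> {..<n}" using D(2) by auto
  have "inj_on (\<lambda>j. (ps ! j, ks ! \<phi> j)) S"
    using nth_ps_inj D(1) by (auto simp: inj_on_def)
  then have 1: "image_mset (\<lambda>(p, k). v p k) (mset_set ((\<lambda>j. (ps ! j, ks ! \<phi> j)) ` S)) =
      image_mset (\<lambda>j. v (ps ! j) (ks ! \<phi> j)) (mset_set S)"
    by (simp add: image_mset_mset_set[symmetric] multiset.map_comp comp_def)
  let ?t = "\<lambda>i. if i \<in> \<phi> ` S then v (ps ! the_inv_into S \<phi> i) (ks ! i) else a (ks ! i)"
  have "{..<n} = \<phi> ` S \<union> ({..<n} - \<phi> ` S)" using sub by blast
  then have "mset_set {..<n} = mset_set (\<phi> ` S) + mset_set ({..<n} - \<phi> ` S)"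
    using D(5) by (metis Diff_disjoint finite_Diff finite_imageI finite_lessThan mset_set_Union)
  moreover have "image_mset ?t (mset_set (\<phi> ` S)) = image_mset (\<lambda>j. v (ps ! j) (ks ! \<phi> j)) (mset_set S)"
  proof -
    have "image_mset ?t (mset_set (\<phi> ` S)) = image_mset (\<lambda>j. ?t (\<phi> j)) (mset_set S)"
      by (simp add: image_mset_mset_set[OF D(3), symmetric] multiset.map_comp comp_def)
    also have "\<dots> = image_mset (\<lambda>j. v (ps ! j) (ks ! \<phi> j)) (mset_set S)"
      by (rule image_mset_cong) (use D(3,5) in \<open>auto simp: the_inv_into_f_f\<close>)
    finally show ?thesis .
  qed
  moreover have "image_mset ?t (mset_set ({..<n} - \<phi> ` S)) = image_mset (\<lambda>i. a (ks ! i)) (mset_set ({..<n} - \<phi> ` S))"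
    by (rule image_mset_cong) auto
  moreover have "image_mset a (mset_set (set ks - snd ` ((\<lambda>j. (ps ! j, ks ! \<phi> j)) ` S))) =
      image_mset (\<lambda>i. a (ks ! i)) (mset_set ({..<n} - \<phi> ` S))"
  proof -
    have "set ks - snd ` ((\<lambda>j. (ps ! j, ks ! \<phi> j)) ` S) = (!) ks ` ({..<n} - \<phi> ` S)"
    proof -
      have "(!) ks ` ({..<n} - \<phi> ` S) = (!) ks ` {..<n} - (!) ks ` (\<phi> ` S)"
        by (rule inj_on_image_set_diff[OF nth_ks_inj]) (use sub in auto)
      moreover have "snd ` ((\<lambda>j. (ps ! j, ks ! \<phi> j)) ` S) = (!) ks ` (\<phi> ` S)" by (simp only: image_image snd_conv)
      ultimately show ?thesis by (simp only: nth_ks_image)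
    qed
    then show ?thesis
      by (simp only: image_mset_mset_set[OF inj_on_diff[OF nth_ks_inj], symmetric] multiset.map_comp comp_def)
  qed
  moreover have "image_mset w (mset_set (set ps - fst ` ((\<lambda>j. (ps ! j, ks ! \<phi> j)) ` S))) =
      image_mset (\<lambda>j. w (ps ! j)) (mset_set ({..<r} - S))"
  proof -
    have "set ps - fst ` ((\<lambda>j. (ps ! j, ks ! \<phi> j)) ` S) = (!) ps ` ({..<r} - S)"
    proof -
      have "(!) ps ` ({..<r} - S) = (!) ps ` {..<r} - (!) ps ` S"
        by (rule inj_on_image_set_diff[OF nth_ps_inj]) (use D(1) in auto)
      moreover have "fst ` ((\<lambda>j. (ps ! j, ks ! \<phi> j)) ` S) = (!) ps ` S" by (simp only: image_image fst_conv)
      ultimately show ?thesis by (simp only: nth_ps_image)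
    qed
    then show ?thesis
      by (simp only: image_mset_mset_set[OF inj_on_diff[OF nth_ps_inj], symmetric] multiset.map_comp comp_def)
  qed
  ultimately show ?thesis unfolding match_mset_def 1 by simp
qed

end


section \<open>The monoid of \<open>\<delta>\<close>\<close>

text \<open>The monoid part of \<open>delta_obj\<close>; it depends on \<open>M\<close> only. In a
  prolongation its operation is addition coefficient by coefficient, as \<open>delta_mult\<close>
  shows.\<close>

definition delta_cmon :: "('o, 'm) ccat \<Rightarrow> ('o, 'm) cmon \<Rightarrow> (('o, 'm) faa_obj, ('o, 'm) faa_arr) cmon" where
  "delta_cmon X M =
     ((M, carr M),
      first_order X (prod_cmon X M M, Prd X (carr M) (carr M)) (M, carr M) (fst (snd M))
        (Pr0 X (Prd X (carr M) (carr M)) (Prd X (carr M) (carr M)) \<cdot>\<^bsub>X\<^esub> fst (snd M)),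
      first_order X (one_cmon X, One X) (M, carr M) (snd (snd M))
        (Pr0 X (One X) (One X) \<cdot>\<^bsub>X\<^esub> snd (snd M)))"

lemma carr_delta_cmon [simp]: "carr (delta_cmon X M) = (M, carr M)"
  by (simp add: delta_cmon_def)

lemma delta_obj_eq: "delta_obj X (M, U) = (delta_cmon X M, (M, U))"
  by (cases M) (simp add: delta_cmon_def Let_def)

context separated
begin

text \<open>The addition of a commutative monoid is itself additive, by the interchange
  \<open>(b1 + b2) + (c1 + c2) = (b1 + c1) + (b2 + c2)\<close>; so it is a legitimate linear
  part.\<close>

lemma delta_add_Hom:
  assumes M: "cmon_in X M"
  shows "fst (snd (delta_cmon X M)) \<in> Hom (Faa X) (Prd (Faa X) (M, carr M) (M, carr M)) (M, carr M)"
proof -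
  obtain A p z where M': "M = (A, p, z)" by (metis prod_cases3)
  note H = cmon_in_Hom[OF M[unfolded M']]
  have AA: "Prd X A A \<in> Obj X" using H Prd_Obj by blast
  have "first_order X (prod_cmon X M M, Prd X A A) (M, A) p (Pr0 X (carr (prod_cmon X M M)) (Prd X A A) \<cdot> p)
    \<in> Hom (Faa X) (prod_cmon X M M, Prd X A A) (M, A)"
  proof (rule linear_Hom[OF cmon_in_prod[OF M M] M AA H(1) H(2)])
    show "p \<in> Hom X (carr (prod_cmon X M M)) (carr M)" using H by (simp add: M')
    fix G b c assume "G \<in> \<M>"
    then interpret cat_model X G by (rule cat_models)
    interpret comm_monoid "pmon G M" by (rule comm_monoid_pmon[OF M])
    have add: "act G p (tup G b c) = b \<otimes>\<^bsub>pmon G M\<^esub> c" for b c by (simp add: M')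
    show "act G p \<one>\<^bsub>pmon G (prod_cmon X M M)\<^esub> = \<one>\<^bsub>pmon G M\<^esub>"
      unfolding pmon_prod_cmon(2)[OF M M] add by simp
    assume "b \<in> pts G (carr (prod_cmon X M M))" and "c \<in> pts G (carr (prod_cmon X M M))"
    then have b: "b \<in> pts G (Prd X A A)" and c: "c \<in> pts G (Prd X A A)" by (simp_all add: M')
    from b obtain b1 b2 where b': "b = tup G b1 b2" "b1 \<in> pts G A" "b2 \<in> pts G A" by (rule tup_cases[OF H(1,1)])
    from c obtain c1 c2 where c': "c = tup G c1 c2" "c1 \<in> pts G A" "c2 \<in> pts G A" by (rule tup_cases[OF H(1,1)])
    have car: "carr M = A" by (simp add: M')
    show "act G p (b \<otimes>\<^bsub>pmon G (prod_cmon X M M)\<^esub> c) = act G p b \<otimes>\<^bsub>pmon G M\<^esub> act G p c"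
      using b'(2,3) c'(2,3) m_ac[unfolded carrier_pmon car]
      by (simp add: b'(1) c'(1) pmon_prod_cmon_tup[OF M M, unfolded car] add pmon_closed[OF M, unfolded car])
  qed
  then show ?thesis by (simp add: delta_cmon_def M' )
qed

lemma delta_zero_Hom:
  assumes M: "cmon_in X M"
  shows "snd (snd (delta_cmon X M)) \<in> Hom (Faa X) (One (Faa X)) (M, carr M)"
proof -
  obtain A p z where M': "M = (A, p, z)" by (metis prod_cases3)
  note H = cmon_in_Hom[OF M[unfolded M']]
  have "first_order X (one_cmon X, One X) (M, A) z (Pr0 X (carr (one_cmon X)) (One X) \<cdot> z)
    \<in> Hom (Faa X) (one_cmon X, One X) (M, A)"
  proof (rule linear_Hom[OF cmon_in_one M One_Obj H(1) H(3)])
    show "z \<in> Hom X (carr (one_cmon X)) (carr M)" using H by (simp add: M')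
    fix G b c assume "G \<in> \<M>"
    then interpret cat_model X G by (rule cat_models)
    interpret comm_monoid "pmon G M" by (rule comm_monoid_pmon[OF M])
    have z: "act G z (pt G) = \<one>\<^bsub>pmon G M\<^esub>" by (simp add: M')
    have one: "e = pt G" if "e \<in> pts G (carr (one_cmon X))" for e using that by (simp add: pts_One)
    show "act G z \<one>\<^bsub>pmon G (one_cmon X)\<^esub> = \<one>\<^bsub>pmon G M\<^esub>"
      using one[OF pmon_closed(2)[OF cmon_in_one]] z by simp
    assume "b \<in> pts G (carr (one_cmon X))" and "c \<in> pts G (carr (one_cmon X))"
    then have "b = pt G" "c = pt G" "b \<otimes>\<^bsub>pmon G (one_cmon X)\<^esub> c = pt G"
      using one pmon_closed(1)[OF cmon_in_one, of b c] by blast+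
    then show "act G z (b \<otimes>\<^bsub>pmon G (one_cmon X)\<^esub> c) = act G z b \<otimes>\<^bsub>pmon G M\<^esub> act G z c"
      by (simp only: z) simp
  qed
  then show ?thesis by (simp add: delta_cmon_def M')
qed

end

context cartesian_category
begin

context
  fixes J :: "nat set" and G :: "('o, 'm, 'e) interp" and M
  assumes J: "finite J" and G: "set_model X G" and M: "cmon_in X M"
begin

interpretation cat_model X G using G by (simp add: cat_model_def cartesian_category_axioms)

text \<open>The addition arrow has a linear part that ignores the base, so by
  \<open>act_linear\<close> it adds the coefficients at each subset, the empty one included.\<close>

lemma delta_mult:
  assumes b: "b \<in> pts (prol J G) (M, carr M)" and c: "c \<in> pts (prol J G) (M, carr M)" and S: "S \<subseteq> J"
  shows "(b \<otimes>\<^bsub>pmon (prol J G) (delta_cmon X M)\<^esub> c) S = b S \<otimes>\<^bsub>pmon G M\<^esub> c S"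
proof -
  obtain A p z where M': "M = (A, p, z)" by (metis prod_cases3)
  note H = cmon_in_Hom[OF M[unfolded M']]
  interpret sp: separated X "hom_interp X ` Obj X" by (rule separated_hom)
  have AA: "Prd X A A \<in> Obj X" using H Prd_Obj by blast
  have bc: "b S \<in> pts G A" "c S \<in> pts G A" if "S \<subseteq> J" for S
    using prol_pts_at[OF b that] prol_pts_at[OF c that] by (simp_all add: M')
  have t: "tup (prol J G) b c \<in> pts (prol J G) (prod_cmon X M M, Prd X A A)"
    using bc tup_pts[OF H(1,1)] by (auto simp: prol_pts_iff M')
  have pH: "p \<in> Hom X (carr (prod_cmon X M M)) (carr M)" using H by (simp add: M')
  have "(b \<otimes>\<^bsub>pmon (prol J G) (delta_cmon X M)\<^esub> c) S =
    act (prol J G) (first_order X (prod_cmon X M M, Prd X A A) (M, A) p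
      (Pr0 X (carr (prod_cmon X M M)) (Prd X A A) \<cdot> p)) (tup (prol J G) b c) S"
    by (simp add: pmon_def delta_cmon_def M')
  also have "\<dots> = b S \<otimes>\<^bsub>pmon G M\<^esub> c S"
    unfolding act_linear[OF sp.cmon_in_prod[OF M M] M AA pH J t S] using S by (simp add: M')
  finally show ?thesis .
qed

lemma delta_one: "S \<subseteq> J \<Longrightarrow> \<one>\<^bsub>pmon (prol J G) (delta_cmon X M)\<^esub> S = \<one>\<^bsub>pmon G M\<^esub>"
proof -
  assume S: "S \<subseteq> J"
  obtain A p z where M': "M = (A, p, z)" by (metis prod_cases3)
  note H = cmon_in_Hom[OF M[unfolded M']]
  interpret sp: separated X "hom_interp X ` Obj X" by (rule separated_hom)
  have t: "pt (prol J G) \<in> pts (prol J G) (one_cmon X, One X)"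
    by (auto simp: prol_pts_iff pts_One)
  have zH: "z \<in> Hom X (carr (one_cmon X)) (carr M)" using H by (simp add: M')
  have "\<one>\<^bsub>pmon (prol J G) (delta_cmon X M)\<^esub> S =
    act (prol J G) (first_order X (one_cmon X, One X) (M, A) z
      (Pr0 X (carr (one_cmon X)) (One X) \<cdot> z)) (pt (prol J G)) S"
    by (simp add: pmon_def delta_cmon_def M')
  also have "\<dots> = \<one>\<^bsub>pmon G M\<^esub>"
    unfolding act_linear[OF sp.cmon_in_one M One_Obj zH J t S] using S by (simp add: M')
  finally show ?thesis .
qed

lemma delta_mult_ext: "b \<otimes>\<^bsub>pmon (prol J G) (delta_cmon X M)\<^esub> c \<in> extensional (Pow J)"
  "\<one>\<^bsub>pmon (prol J G) (delta_cmon X M)\<^esub> \<in> extensional (Pow J)"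
  by (simp_all add: pmon_def act_prol)

lemma comm_monoid_delta: "comm_monoid (pmon (prol J G) (delta_cmon X M))"
proof -
  interpret M: comm_monoid "pmon G M" by (rule comm_monoid_pmon[OF M])
  let ?D = "pmon (prol J G) (delta_cmon X M)"
  have car: "carrier ?D = pts (prol J G) (M, carr M)" by (simp add: carrier_pmon)
  have at: "b S \<in> carrier (pmon G M)" if "b \<in> pts (prol J G) (M, carr M)" "S \<subseteq> J" for b S
    using prol_pts_at[OF that] by (simp add: carrier_pmon)
  have clo: "b \<otimes>\<^bsub>?D\<^esub> c \<in> pts (prol J G) (M, carr M)" "\<one>\<^bsub>?D\<^esub> \<in> pts (prol J G) (M, carr M)"
    if "b \<in> pts (prol J G) (M, carr M)" "c \<in> pts (prol J G) (M, carr M)" for b c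
    using delta_mult_ext delta_mult[OF that] delta_one at[OF that(1)] at[OF that(2)] pmon_closed[OF M]
    by (auto simp: prol_pts_iff carrier_pmon)
  have one: "\<one>\<^bsub>?D\<^esub> \<in> pts (prol J G) (M, carr M)"
    using delta_mult_ext delta_one pmon_closed[OF M] by (auto simp: prol_pts_iff)
  show ?thesis
  proof (rule comm_monoidI; unfold car)
    fix x y z assume x: "x \<in> pts (prol J G) (M, carr M)" and y: "y \<in> pts (prol J G) (M, carr M)"
    show "x \<otimes>\<^bsub>?D\<^esub> y \<in> pts (prol J G) (M, carr M)" by (rule clo[OF x y])
    show "x \<otimes>\<^bsub>?D\<^esub> y = y \<otimes>\<^bsub>?D\<^esub> x"
      by (rule prol_eqI[OF delta_mult_ext(1) delta_mult_ext(1)])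
        (simp add: delta_mult x y M.m_comm at)
    show "\<one>\<^bsub>?D\<^esub> \<otimes>\<^bsub>?D\<^esub> x = x"
      by (rule prol_eqI[OF delta_mult_ext(1) prol_ext[OF x]])
        (simp add: delta_mult delta_one one x at)
    assume z: "z \<in> pts (prol J G) (M, carr M)"
    show "x \<otimes>\<^bsub>?D\<^esub> y \<otimes>\<^bsub>?D\<^esub> z = x \<otimes>\<^bsub>?D\<^esub> (y \<otimes>\<^bsub>?D\<^esub> z)"
      by (rule prol_eqI[OF delta_mult_ext(1) delta_mult_ext(1)])
        (simp add: delta_mult x y z clo M.m_assoc at)
  qed (rule one)
qed

lemma delta_finprod:
  assumes "\<And>i. i \<in> I \<Longrightarrow> t i \<in> pts (prol J G) (M, carr M)" and S: "S \<subseteq> J"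
  shows "finprod (pmon (prol J G) (delta_cmon X M)) t I S = finprod (pmon G M) (\<lambda>i. t i S) I"
proof (rule finprod_hom[OF comm_monoid_delta comm_monoid_pmon[OF M]])
  show "a S \<in> carrier (pmon G M)" if "a \<in> carrier (pmon (prol J G) (delta_cmon X M))" for a
    using prol_pts_at[of a J G M "carr M", OF _ S] that by (simp add: carrier_pmon)
qed (use assms delta_mult delta_one in \<open>auto simp: carrier_pmon\<close>)

end

end

lemma (in separated) cmon_in_delta:
  assumes M: "cmon_in X M" shows "cmon_in (Faa X) (delta_cmon X M)"
proof -
  interpret F: separated "Faa X" prols by (rule separated_Faa)
  obtain P p z where D: "delta_cmon X M = (P, p, z)" by (metis prod_cases3)
  have P: "P = (M, carr M)" using carr_delta_cmon[of X M] by (simp add: D)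
  have "cmon_in (Faa X) (P, p, z)"
  proof (rule cmon_inI[OF F.cartesian_category_axioms F.models F.sep])
    show "P \<in> Obj (Faa X)" using M carr_Obj[OF M] by (simp add: P)
    show "p \<in> Hom (Faa X) (Prd (Faa X) P P) P" using delta_add_Hom[OF M] by (simp only: D P fst_conv snd_conv)
    show "z \<in> Hom (Faa X) (One (Faa X)) P" using delta_zero_Hom[OF M] by (simp only: D P fst_conv snd_conv)
    fix G assume "G \<in> prols"
    then show "comm_monoid (pmon G (P, p, z))"
      using comm_monoid_delta[OF _ models M] by (auto simp: prols_def D)
  qed
  then show ?thesis by (simp add: D)
qed

lemma powprd_Faa: "powprd (Faa X) (M, A) n (M', U) = ((prod_cmon X M ^^ n) M', powprd X A n U)"
  by (induction n) auto

lemma carr_prod_pow [simp]: "carr ((prod_cmon X M ^^ n) M') = powprd X (carr M) n (carr M')"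
  by (induction n) auto

lemma (in separated) cmon_in_prod_pow: "cmon_in X M \<Longrightarrow> cmon_in X M' \<Longrightarrow> cmon_in X ((prod_cmon X M ^^ n) M')"
  by (induction n) (auto intro: cmon_in_prod)

context separated
begin

text \<open>The index \<open>i = n\<close> is included: the innermost factor is also a copy of
  \<open>M\<close>. The projections of index below \<open>n\<close> give the entries substituted
  into slots in the formula for \<open>\<delta>(f)\<close>, the last one gives the appended
  vectors.\<close>

lemma proj_prod_pow:
  assumes G: "set_model X G" and M: "cmon_in X M"
  defines "Mn \<equiv> \<lambda>n. (prod_cmon X M ^^ n) M"
  shows "b \<in> pts G (powprd X (carr M) n (carr M)) \<Longrightarrow> c \<in> pts G (powprd X (carr M) n (carr M)) \<Longrightarrow> i \<le> n \<Longrightarrow>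
      act G (proj X (carr M) n (carr M) i) (b \<otimes>\<^bsub>pmon G (Mn n)\<^esub> c) =
      act G (proj X (carr M) n (carr M) i) b \<otimes>\<^bsub>pmon G M\<^esub> act G (proj X (carr M) n (carr M) i) c"
    and "i \<le> n \<Longrightarrow> act G (proj X (carr M) n (carr M) i) \<one>\<^bsub>pmon G (Mn n)\<^esub> = \<one>\<^bsub>pmon G M\<^esub>"
proof -
  interpret cat_model X G using G by (simp add: cat_model_def cartesian_category_axioms)
  let ?A = "carr M"
  have A: "?A \<in> Obj X" by (rule carr_Obj[OF M])
  have Mn: "cmon_in X (Mn n)" for n unfolding Mn_def by (rule cmon_in_prod_pow[OF M M])
  have car: "carr (Mn n) = powprd X ?A n ?A" for n by (simp add: Mn_def)
  have P: "powprd X ?A n ?A \<in> Obj X" for n by (rule powprd_Obj[OF A A])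
  have MnS: "Mn (Suc n) = prod_cmon X M (Mn n)" for n by (simp add: Mn_def)
  note cl = pmon_closed[OF Mn, unfolded car] pmon_closed[OF M]
  have prH: "proj X ?A n ?A i \<in> Hom X (powprd X ?A n ?A) ?A" if "i \<le> n" for i n
    using proj_Hom[OF A A that] by simp
  have s1: "act G (proj X ?A (Suc n) ?A 0) (tup G d e) = d"
    "i \<le> n \<Longrightarrow> act G (proj X ?A (Suc n) ?A (Suc i)) (tup G d e) = act G (proj X ?A n ?A i) e"
    if "d \<in> pts G ?A" "e \<in> pts G (powprd X ?A n ?A)" for d e i n
    using that act_Cmp[OF Pr1_Hom[OF A P] prH] tup_pts[OF A P]
    by (simp_all add: act_Pr0[OF A P] act_Pr1[OF A P])
  show "act G (proj X ?A n ?A i) (b \<otimes>\<^bsub>pmon G (Mn n)\<^esub> c) =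
      act G (proj X ?A n ?A i) b \<otimes>\<^bsub>pmon G M\<^esub> act G (proj X ?A n ?A i) c"
    if "b \<in> pts G (powprd X ?A n ?A)" "c \<in> pts G (powprd X ?A n ?A)" "i \<le> n"
    using that
  proof (induction n arbitrary: i b c)
    case 0
    then show ?case using pmon_closed[OF M] by (simp add: Mn_def act_Ide A)
  next
    case (Suc n)
    have b: "b \<in> pts G (Prd X ?A (powprd X ?A n ?A))" and c: "c \<in> pts G (Prd X ?A (powprd X ?A n ?A))" using Suc by auto
    from b obtain b1 b2 where b': "b = tup G b1 b2" "b1 \<in> pts G ?A" "b2 \<in> pts G (powprd X ?A n ?A)"
      by (rule tup_cases[OF A P])
    from c obtain c1 c2 where c': "c = tup G c1 c2" "c1 \<in> pts G ?A" "c2 \<in> pts G (powprd X ?A n ?A)"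
      by (rule tup_cases[OF A P])
    have "b \<otimes>\<^bsub>pmon G (Mn (Suc n))\<^esub> c = tup G (b1 \<otimes>\<^bsub>pmon G M\<^esub> c1) (b2 \<otimes>\<^bsub>pmon G (Mn n)\<^esub> c2)"
      unfolding MnS b'(1) c'(1) by (rule pmon_prod_cmon_tup[OF M Mn b'(2) _ c'(2)]) (use b' c' car in auto)
    then show ?case
      using Suc.IH[OF b'(3) c'(3)] Suc.prems(3) b' c' cl by (cases i) (simp_all add: s1 del: proj.simps)
  qed
  show "act G (proj X ?A n ?A i) \<one>\<^bsub>pmon G (Mn n)\<^esub> = \<one>\<^bsub>pmon G M\<^esub>" if "i \<le> n"
    using that
  proof (induction n arbitrary: i)
    case 0
    then show ?case using pmon_closed[OF M] by (simp add: Mn_def act_Ide A)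
  next
    case (Suc n)
    have "\<one>\<^bsub>pmon G (Mn (Suc n))\<^esub> = tup G \<one>\<^bsub>pmon G M\<^esub> \<one>\<^bsub>pmon G (Mn n)\<^esub>"
      unfolding MnS by (rule pmon_prod_cmon(2)[OF M Mn])
    then show ?case using Suc.IH Suc.prems cl by (cases i) (simp_all add: s1 del: proj.simps)
  qed
qed

end

section \<open>The arrows \<open>\<delta>(f)\<close>\<close>

text \<open>The argument list of the summand \<open>(S, \<phi>)\<close> of
  \<open>delta_comp\<close>, separated from the sum.\<close>

definition delta_args :: "('o, 'm) ccat \<Rightarrow> 'o \<Rightarrow> 'o \<Rightarrow> nat \<Rightarrow> nat \<Rightarrow> nat set \<Rightarrow> (nat \<Rightarrow> nat) \<Rightarrow> 'm list" where
  "delta_args X A U n r S \<phi> =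
     map (\<lambda>i. if i \<in> \<phi> ` S
         then proj X (powprd X A n A) r (powprd X A n U) (the_inv_into S \<phi> i) \<cdot>\<^bsub>X\<^esub> proj X A n A i
         else proj X (powprd X A n A) r (powprd X A n U) r \<cdot>\<^bsub>X\<^esub> proj X A n U i) [0..<n] @
     map (\<lambda>j. proj X (powprd X A n A) r (powprd X A n U) j \<cdot>\<^bsub>X\<^esub> proj X A n A n)
       (filter (\<lambda>j. j \<notin> S) [0..<r])"

lemma delta_comp_eq:
  "delta_comp X (FArr (M, U) (N, V) s) n r =
     msum X (powprd X (powprd X (carr M) n (carr M)) r (powprd X (carr M) n U)) N
       (\<lambda>(S, \<phi>). app X (s (n + r - card S)) (delta_args X (carr M) U n r S \<phi>)
         (proj X (powprd X (carr M) n (carr M)) r (powprd X (carr M) n U) r \<cdot>\<^bsub>X\<^esub> proj X (carr M) n U n))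
       (partial_injections r n)"
  by (simp add: delta_args_def Let_def)

declare delta_comp.simps [simp del]

text \<open>There are \<open>n\<close> slots and \<open>r - card S\<close> appended vectors. Since
  \<open>card S \<le> r\<close>, the truncated subtraction in the index of the component agrees with
  this number.\<close>

lemma length_delta_args:
  assumes "(S, \<phi>) \<in> partial_injections r n" shows "length (delta_args X A U n r S \<phi>) = n + r - card S"
proof -
  note D = partial_injectionD[OF assms]
  have "length (filter (\<lambda>j. j \<notin> S) [0..<r]) = card (set (filter (\<lambda>j. j \<notin> S) [0..<r]))"
    by (rule distinct_card[symmetric]) simp
  also have "set (filter (\<lambda>j. j \<notin> S) [0..<r]) = {..<r} - S" by auto
  also have "card ({..<r} - S) = r - card S" using D by (simp add: card_Diff_subset)
  finally have "length (delta_args X A U n r S \<phi>) = n + (r - card S)" by (simp add: delta_args_def)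
  moreover have "card S \<le> r" using D(1) card_mono[of "{..<r}" S] by simp
  ultimately show ?thesis by simp
qed

context cartesian_category
begin

context
  fixes M U n r S \<phi>
  assumes M: "cmon_in X M" and U: "U \<in> Obj X" and S: "(S, \<phi>) \<in> partial_injections r n"
begin

lemma the_inv_lt: "i \<in> \<phi> ` S \<Longrightarrow> the_inv_into S \<phi> i < r"
  using partial_injectionD[OF S] the_inv_into_into[of \<phi> S i S] by auto

lemma delta_args_Hom:
  "set (delta_args X (carr M) U n r S \<phi>)
    \<subseteq> Hom X (powprd X (powprd X (carr M) n (carr M)) r (powprd X (carr M) n U)) (carr M)"
proof -
  have A: "carr M \<in> Obj X" by (rule carr_Obj[OF M])
  have D: "powprd X (carr M) n (carr M) \<in> Obj X" and E: "powprd X (carr M) n U \<in> Obj X"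
    using powprd_Obj A U by auto
  note p = Cmp_Hom[OF proj_Hom_arg[OF D E]] and q = Cmp_Hom[OF proj_Hom_last[OF D E]]
  show ?thesis
    unfolding delta_args_def
    using the_inv_lt
    by (auto intro!: p q proj_Hom_arg[OF A A] proj_Hom_last[OF A A] proj_Hom_arg[OF A U])
qed

end

lemma delta_term_Hom:
  assumes f: "faa_ar X (FArr (M, U) (N, V) s)" and n: "n \<noteq> 0" and S: "(S, \<phi>) \<in> partial_injections r n"
  shows "app X (s (n + r - card S)) (delta_args X (carr M) U n r S \<phi>)
      (proj X (powprd X (carr M) n (carr M)) r (powprd X (carr M) n U) r \<cdot> proj X (carr M) n U n)
    \<in> Hom X (powprd X (powprd X (carr M) n (carr M)) r (powprd X (carr M) n U)) (carr N)"
    and "s (n + r - card S) \<in> Hom X (powprd X (carr M) (length (delta_args X (carr M) U n r S \<phi>)) U) (carr N)"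
proof -
  note fD = faa_arD[OF f]
  have A: "carr M \<in> Obj X" by (rule carr_Obj[OF fD(1)])
  have D: "powprd X (carr M) n (carr M) \<in> Obj X" and E: "powprd X (carr M) n U \<in> Obj X"
    using powprd_Obj A fD(3) by auto
  have "card S \<le> r" using partial_injectionD(1)[OF S] card_mono[of "{..<r}" S] by simp
  then have nz: "n + r - card S \<noteq> 0" using n by simp
  show 1: "s (n + r - card S) \<in> Hom X (powprd X (carr M) (length (delta_args X (carr M) U n r S \<phi>)) U) (carr N)"
    unfolding length_delta_args[OF S] by (rule fD(6)[OF nz])
  show "app X (s (n + r - card S)) (delta_args X (carr M) U n r S \<phi>)
      (proj X (powprd X (carr M) n (carr M)) r (powprd X (carr M) n U) r \<cdot> proj X (carr M) n U n)
    \<in> Hom X (powprd X (powprd X (carr M) n (carr M)) r (powprd X (carr M) n U)) (carr N)"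
    by (rule app_Hom[OF 1 delta_args_Hom[OF fD(1,3) S] Cmp_Hom[OF proj_Hom_last[OF D E] proj_Hom_last[OF A fD(3)]]])
qed

lemma delta_comp_Hom:
  assumes f: "faa_ar X (FArr (M, U) (N, V) s)" and n: "n \<noteq> 0"
  shows "delta_comp X (FArr (M, U) (N, V) s) n r
    \<in> Hom X (powprd X (powprd X (carr M) n (carr M)) r (powprd X (carr M) n U)) (carr N)"
  unfolding delta_comp_eq
  by (rule msum_Hom)
    (use delta_term_Hom(1)[OF f n] faa_arD[OF f] carr_Obj[OF faa_arD(1)[OF f]] in \<open>auto intro!: powprd_Obj\<close>)

end

context cat_model
begin

text \<open>The parameters \<open>v\<close>, \<open>w\<close>, \<open>a\<close>, \<open>x\<close>
  name the components of the vectors and of the base tuple, so that each summand becomes a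
  \<open>match_mset\<close> and the sum over partial injections one over matchings of arbitrary
  labels.\<close>

lemma act_delta_comp:
  fixes ps :: "'p list" and ks :: "'k list"
  assumes f: "faa_ar X (FArr (M, U) (N, V) s)" and n: "n \<noteq> 0"
    and ps: "distinct ps" "length ps = r" and ks: "distinct ks" "length ks = n"
    and d: "\<And>p. p \<in> set ps \<Longrightarrow> d p \<in> pts G (powprd X (carr M) n (carr M))"
    and e: "e \<in> pts G (powprd X (carr M) n U)"
    and v: "\<And>p i. p \<in> set ps \<Longrightarrow> i < n \<Longrightarrow> act G (proj X (carr M) n (carr M) i) (d p) = v p (ks ! i)"
    and w: "\<And>p. p \<in> set ps \<Longrightarrow> act G (proj X (carr M) n (carr M) n) (d p) = w p"
    and a: "\<And>i. i < n \<Longrightarrow> act G (proj X (carr M) n U i) e = a (ks ! i)"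
    and x: "act G (proj X (carr M) n U n) e = x"
  shows "act G (delta_comp X (FArr (M, U) (N, V) s) n r) (foldr (tup G) (map d ps) e) =
    finprod (pmon G N) (\<lambda>R. dm G s (match_mset v a w (set ps) (set ks) R) x) (matchings (set ps) (set ks))"
proof -
  note fD = faa_arD[OF f]
  interpret N: comm_monoid "pmon G N" by (rule comm_monoid_pmon[OF fD(2)])
  let ?A = "carr M"
  let ?D = "powprd X ?A n ?A" and ?E = "powprd X ?A n U"
  let ?W = "powprd X ?D r ?E" and ?t = "foldr (tup G) (map d ps) e"
  have A: "?A \<in> Obj X" by (rule carr_Obj[OF fD(1)])
  have D: "?D \<in> Obj X" and E: "?E \<in> Obj X" using powprd_Obj A fD(3) by auto
  have W: "?W \<in> Obj X" by (rule powprd_Obj[OF D E])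
  have dl: "set (map d ps) \<subseteq> pts G ?D" using d by auto
  have t: "?t \<in> pts G ?W" using tuple_pts[OF D E dl e] ps by simp
  have pj: "act G (proj X ?D r ?E j) ?t = d (ps ! j)" if "j < r" for j
    using act_proj_arg[OF D E dl e, of r j] ps that by simp
  have pl: "act G (proj X ?D r ?E r) ?t = e"
    using act_proj_last[OF D E dl e, of r] ps by simp
  have psi: "ps ! j \<in> set ps" if "j < r" for j using ps that by simp
  have av: "act G (proj X ?D r ?E j \<cdot> proj X ?A n ?A i) ?t = v (ps ! j) (ks ! i)" if "j < r" "i < n" for i j
    using act_Cmp[OF proj_Hom_arg[OF D E that(1)] proj_Hom_arg[OF A A that(2)] t] pj[OF that(1)] v[OF psi[OF that(1)] that(2)]
    by simp
  have aw: "act G (proj X ?D r ?E j \<cdot> proj X ?A n ?A n) ?t = w (ps ! j)" if "j < r" for j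
    using act_Cmp[OF proj_Hom_arg[OF D E that] proj_Hom_last[OF A A] t] pj[OF that] w[OF psi[OF that]] by simp
  have aa: "act G (proj X ?D r ?E r \<cdot> proj X ?A n U i) ?t = a (ks ! i)" if "i < n" for i
    using act_Cmp[OF proj_Hom_last[OF D E] proj_Hom_arg[OF A fD(3) that] t] pl a[OF that] by simp
  have ax: "act G (proj X ?D r ?E r \<cdot> proj X ?A n U n) ?t = x"
    using act_Cmp[OF proj_Hom_last[OF D E] proj_Hom_last[OF A fD(3)] t] pl x by simp
  have xU: "x \<in> pts G U" using act_pts[OF proj_Hom_last[OF A fD(3)] e] x by simp
  let ?y = "proj X ?D r ?E r \<cdot> proj X ?A n U n"
  have y: "?y \<in> Hom X ?W U" by (rule Cmp_Hom[OF proj_Hom_last[OF D E] proj_Hom_last[OF A fD(3)]])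
  let ?T = "\<lambda>(S, \<phi>). app X (s (n + r - card S)) (delta_args X ?A U n r S \<phi>) ?y"
  let ?g = "\<lambda>(S, \<phi>). (\<lambda>j. (ps ! j, ks ! \<phi> j)) ` S"
  have bij: "bij_betw ?g (partial_injections r n) (matchings (set ps) (set ks))"
    by (rule bij_betw_partial_injections[OF ps ks])
  have tm: "act G (?T z) ?t = dm G s (match_mset v a w (set ps) (set ks) (?g z)) x" if "z \<in> partial_injections r n" for z
  proof -
    obtain S \<phi> where z: "z = (S, \<phi>)" by (cases z)
    have S: "(S, \<phi>) \<in> partial_injections r n" using that z by simp
    note H = delta_term_Hom(2)[OF f n S] delta_args_Hom[OF fD(1,3) S]
    let ?l = "map (\<lambda>h. act G h ?t) (delta_args X ?A U n r S \<phi>)"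
    have 1: "?l = map (\<lambda>i. if i \<in> \<phi> ` S then v (ps ! the_inv_into S \<phi> i) (ks ! i) else a (ks ! i)) [0..<n] @
        map (\<lambda>j. w (ps ! j)) (filter (\<lambda>j. j \<notin> S) [0..<r])"
      unfolding delta_args_def using the_inv_lt[OF fD(1,3) S] by (auto simp: av aa aw)
    have fs: "set (filter (\<lambda>j. j \<notin> S) [0..<r]) = {..<r} - S" by auto
    have "mset ?l = match_mset v a w (set ps) (set ks) ((\<lambda>j. (ps ! j, ks ! \<phi> j)) ` S)"
      unfolding 1 mset_append partial_injection_mset[OF ps ks S, symmetric]
      by (simp only: mset_map_distinct[OF distinct_upt] mset_map_distinct[OF distinct_filter[OF distinct_upt]] fs
          set_upt atLeast0LessThan)
    moreover have "set ?l \<subseteq> pts G ?A" using act_pts[OF _ t] H(2) by auto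
    ultimately have "act G (s (length ?l)) (foldr (tup G) ?l x) =
        dm G s (match_mset v a w (set ps) (set ks) ((\<lambda>j. (ps ! j, ks ! \<phi> j)) ` S)) x"
      using dm_list[OF f _ xU, of ?l] by (simp only:)
    then show ?thesis
      by (simp only: z prod.case act_app[OF H y t] ax length_map length_delta_args[OF S])
  qed
  have "act G (delta_comp X (FArr (M, U) (N, V) s) n r) ?t =
      finprod (pmon G N) (\<lambda>z. act G (?T z) ?t) (partial_injections r n)"
    unfolding delta_comp_eq
    by (rule act_msum[OF fD(2) W _ t]) (use delta_term_Hom(1)[OF f n] in auto)
  also have "\<dots> = finprod (pmon G N) (\<lambda>R. dm G s (match_mset v a w (set ps) (set ks) R) x) (matchings (set ps) (set ks))"
  proof (rule N.finprod_bij_betw[OF bij])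
    show "act G (?T z) ?t = dm G s (match_mset v a w (set ps) (set ks) (?g z)) x" if "z \<in> partial_injections r n" for z
      by (rule tm[OF that])
    \<comment> \<open>Every matching comes from a partial injection, and the corresponding summand
      is the value of an arrow; closure needs no separate calculation.\<close>
    show "(\<lambda>R. dm G s (match_mset v a w (set ps) (set ks) R) x) \<in> matchings (set ps) (set ks) \<rightarrow> carrier (pmon G N)"
    proof
      fix R assume "R \<in> matchings (set ps) (set ks)"
      then have "R \<in> ?g ` partial_injections r n" using bij_betw_imp_surj_on[OF bij] by simp
      then obtain z where z: "R = ?g z" "z \<in> partial_injections r n" by (rule imageE)
      have "act G (?T z) ?t \<in> pts G (carr N)"
        using z(2) by (cases z) (simp add: act_pts[OF delta_term_Hom(1)[OF f n] t])
      then show "dm G s (match_mset v a w (set ps) (set ks) R) x \<in> carrier (pmon G N)"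
        unfolding tm[OF z(2)] z(1) carrier_pmon .
    qed
  qed
  finally show ?thesis .
qed

end

text \<open>The sequence inside \<open>\<delta>(f)\<close>, apart from its domain and codomain.
  Index \<open>0\<close> holds \<open>f\<close> itself; for \<open>n > 0\<close> each entry is again
  a sequence, whose base component is \<open>s n\<close>.\<close>

definition delta_seq :: "('o, 'm) ccat \<Rightarrow> ('o, 'm) faa_obj \<Rightarrow> ('o, 'm) faa_obj \<Rightarrow> (nat \<Rightarrow> 'm) \<Rightarrow>
    nat \<Rightarrow> ('o, 'm) faa_arr" where
  "delta_seq X P Q s n =
     (if n = 0 then FArr P Q s
      else FArr (powprd (Faa X) (fst P, carr (fst P)) n P) (fst Q, carr (fst Q))
        (\<lambda>r. if r = 0 then s n else delta_comp X (FArr P Q s) n r))"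

lemma delta_arr_eq: "delta_arr X (FArr P Q s) = FArr (delta_obj X P) (delta_obj X Q) (delta_seq X P Q s)"
  by (cases P; cases Q) (simp add: delta_seq_def fun_eq_iff)

declare delta_arr.simps [simp del]

context separated
begin

text \<open>Additivity of \<open>(\<delta>(f)\<^sub>n)\<^sub>r\<close> in one of its
  \<open>r\<close> vectors: under each matching that vector is used through exactly one of its
  components, the slot it is matched with or the last one. Projections are additive by
  \<open>proj_prod_pow\<close>, and so is \<open>f\<close> in that argument.\<close>

lemma delta_seq_Hom:
  assumes f: "faa_ar X (FArr (M, U) (N, V) s)" and n: "n \<noteq> 0"
  shows "delta_seq X (M, U) (N, V) s n \<in> Hom (Faa X) (powprd (Faa X) (M, carr M) n (M, U)) (N, carr N)"
proof -
  note fD = faa_arD[OF f]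
  let ?A = "carr M" and ?Mn = "(prod_cmon X M ^^ n) M"
  let ?D = "powprd X ?A n ?A" and ?E = "powprd X ?A n U"
  have A: "?A \<in> Obj X" by (rule carr_Obj[OF fD(1)])
  have D: "?D \<in> Obj X" and E: "?E \<in> Obj X" using powprd_Obj A fD(3) by auto
  let ?vv = "\<lambda>G i d. act G (proj X ?A n ?A i) d" and ?ww = "\<lambda>G d. act G (proj X ?A n ?A n) d"
  let ?a = "\<lambda>G e i. act G (proj X ?A n U i) e" and ?x = "\<lambda>G e. act G (proj X ?A n U n) e"
  let ?m = "\<lambda>G P d e R. match_mset (\<lambda>p i. ?vv G i (d p)) (?a G e) (\<lambda>p. ?ww G (d p)) P {..<n} R"
  let ?\<Phi> = "\<lambda>G P d e. finprod (pmon G N) (\<lambda>R. dm G s (?m G P d e R) (?x G e)) (matchings P {..<n})"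
  have Mn: "cmon_in X ?Mn" by (rule cmon_in_prod_pow[OF fD(1,1)])
  have "faa_ar X (FArr (?Mn, ?E) (N, carr N) (\<lambda>r. if r = 0 then s n else delta_comp X (FArr (M, U) (N, V) s) n r))"
  proof (rule faa_arI[OF Mn E fD(2) carr_Obj[OF fD(2)], where \<Phi> = ?\<Phi>])
    show "(if 0 = 0 then s n else delta_comp X (FArr (M, U) (N, V) s) n 0) \<in> Hom X ?E (carr N)"
      using fD(6)[OF n] by simp
    show "(if r = 0 then s n else delta_comp X (FArr (M, U) (N, V) s) n r) \<in> Hom X (powprd X (carr ?Mn) r ?E) (carr N)"
      if "r \<noteq> 0" for r
      using that delta_comp_Hom[OF f n] by simp
    fix G assume G: "G \<in> \<M>"
    interpret cat_model X G by (rule cat_models[OF G])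
    interpret N: comm_monoid "pmon G N" by (rule comm_monoid_pmon[OF fD(2)])
    show "act G (if length ps = 0 then s n else delta_comp X (FArr (M, U) (N, V) s) n (length ps))
        (foldr (tup G) (map d ps) e) = ?\<Phi> G (set ps) d e"
      if ps: "ps \<noteq> []" "distinct ps" and d: "\<And>p. p \<in> set ps \<Longrightarrow> d p \<in> pts G (carr ?Mn)" and e: "e \<in> pts G ?E"
      for ps :: "nat list" and d e
    proof -
      have "act G (delta_comp X (FArr (M, U) (N, V) s) n (length ps)) (foldr (tup G) (map d ps) e) = finprod (pmon G N)
        (\<lambda>R. dm G s (match_mset (\<lambda>p i. ?vv G i (d p)) (?a G e) (\<lambda>p. ?ww G (d p)) (set ps) (set [0..<n]) R) (?x G e))
        (matchings (set ps) (set [0..<n]))"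
        by (rule act_delta_comp[OF f n ps(2)]) (use d e in auto)
      then show ?thesis using ps(1) by (simp add: atLeast0LessThan)
    qed
    fix P :: "nat set" and d e p
    assume P: "finite P" "p \<in> P" and d: "\<And>p. p \<in> P \<Longrightarrow> d p \<in> pts G (carr ?Mn)" and e: "e \<in> pts G ?E"
    have d': "d p \<in> pts G ?D" if "p \<in> P" for p using d[OF that] by simp
    have x: "?x G e \<in> pts G U" by (rule act_pts[OF proj_Hom_last[OF A fD(3)] e])
    have proj_pts: "?vv G i b \<in> pts G ?A" if "i \<le> n" "b \<in> pts G ?D" for i b
      using act_pts[OF proj_Hom[OF A A that(1)] that(2)] by simp
    have a: "?a G e i \<in> pts G ?A" if "i < n" for i
      by (rule act_pts[OF proj_Hom_arg[OF A fD(3) that] e])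
    \<comment> \<open>For each matching \<open>R\<close>, \<open>gg R\<close> is the projection
      through which the updated vector enters and \<open>mm R\<close> collects the other
      arguments.\<close>
    obtain mm gg where up: "\<And>b R. R \<in> matchings P {..<n} \<Longrightarrow> ?m G P (d(p := b)) e R = add_mset (gg R b) (mm R)"
      and gg: "\<And>R. R \<in> matchings P {..<n} \<Longrightarrow> \<exists>i \<le> n. gg R = ?vv G i"
      and mm: "\<And>R. R \<in> matchings P {..<n} \<Longrightarrow> set_mset (mm R) \<subseteq> pts G ?A"
    proof -
      have "\<exists>m g. (\<forall>b. ?m G P (d(p := b)) e R = add_mset (g b) m) \<and> (\<exists>i \<le> n. g = ?vv G i) \<and> set_mset m \<subseteq> pts G ?A"
        if R: "R \<in> matchings P {..<n}" for R
      proof -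
        obtain m g where
          1: "\<And>b. match_mset (\<lambda>p' k. ?vv G k ((d(p := b)) p')) (?a G e) (\<lambda>p'. ?ww G ((d(p := b)) p')) P {..<n} R = add_mset (g b) m"
          and 2: "g = ?ww G \<or> (\<exists>k \<in> {..<n}. g = ?vv G k)"
          and 3: "set_mset m \<subseteq> set_mset (match_mset (\<lambda>p' k. ?vv G k (d p')) (?a G e) (\<lambda>p'. ?ww G (d p')) P {..<n} R)"
          by (rule match_mset_upd[OF R P(1) finite_lessThan P(2), where vv = "?vv G" and d = d and a = "?a G e" and ww = "?ww G"]) blast
        have "set_mset (match_mset (\<lambda>p' k. ?vv G k (d p')) (?a G e) (\<lambda>p'. ?ww G (d p')) P {..<n} R) \<subseteq> pts G ?A"
          by (rule match_mset_subset[OF R P(1)]) (use a proj_pts d' in auto)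
        \<comment> \<open>The last projection is the one of index \<open>n\<close>, so both
          alternatives fit the bound \<open>i \<le> n\<close>.\<close>
        moreover have "\<exists>i \<le> n. g = ?vv G i" using 2 by (metis lessThan_iff less_imp_le order_refl)
        ultimately show ?thesis using 1 3 by blast
      qed
      then show thesis using that by metis
    qed
    have gp: "gg R b \<in> pts G ?A" if "R \<in> matchings P {..<n}" "b \<in> pts G ?D" for R b
      using gg[OF that(1)] proj_pts[OF _ that(2)] by auto
    show "?\<Phi> G P (d(p := b \<otimes>\<^bsub>pmon G ?Mn\<^esub> c)) e = ?\<Phi> G P (d(p := b)) e \<otimes>\<^bsub>pmon G N\<^esub> ?\<Phi> G P (d(p := c)) e"
      if "b \<in> pts G (carr ?Mn)" "c \<in> pts G (carr ?Mn)" for b c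
    proof (rule N.finprod_mult_eq)
      fix R assume R: "R \<in> matchings P {..<n}"
      have b: "b \<in> pts G ?D" and c: "c \<in> pts G ?D" using that by simp_all
      show "dm G s (?m G P (d(p := b)) e R) (?x G e) \<in> carrier (pmon G N)"
        "dm G s (?m G P (d(p := c)) e R) (?x G e) \<in> carrier (pmon G N)"
        unfolding carrier_pmon up[OF R]
        by (rule dm_closed[OF f _ _ x]; use mm[OF R] gp[OF R b] gp[OF R c] in simp)+
      have "gg R (b \<otimes>\<^bsub>pmon G ?Mn\<^esub> c) = gg R b \<otimes>\<^bsub>pmon G M\<^esub> gg R c"
        using gg[OF R] proj_prod_pow(1)[OF models[OF G] fD(1) b c] by auto
      then show "dm G s (?m G P (d(p := b \<otimes>\<^bsub>pmon G ?Mn\<^esub> c)) e R) (?x G e) =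
          dm G s (?m G P (d(p := b)) e R) (?x G e) \<otimes>\<^bsub>pmon G N\<^esub> dm G s (?m G P (d(p := c)) e R) (?x G e)"
        unfolding up[OF R] using dm_mult[OF f mm[OF R] x gp[OF R b] gp[OF R c]] by simp
    qed
    show "?\<Phi> G P (d(p := \<one>\<^bsub>pmon G ?Mn\<^esub>)) e = \<one>\<^bsub>pmon G N\<^esub>"
    proof (rule N.finprod_one_eqI)
      fix R assume R: "R \<in> matchings P {..<n}"
      have "gg R \<one>\<^bsub>pmon G ?Mn\<^esub> = \<one>\<^bsub>pmon G M\<^esub>"
        using gg[OF R] proj_prod_pow(2)[OF models[OF G] fD(1)] by auto
      then show "dm G s (?m G P (d(p := \<one>\<^bsub>pmon G ?Mn\<^esub>)) e R) (?x G e) = \<one>\<^bsub>pmon G N\<^esub>"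
        unfolding up[OF R] using dm_one[OF f mm[OF R] x] by simp
    qed
  qed
  then show ?thesis using n by (simp add: delta_seq_def Hom_Faa_iff powprd_Faa)
qed

end

section \<open>The action of the components of \<open>\<delta>(f)\<close> in a prolongation\<close>

lemma prol_tuple_at:
  assumes "y \<in> extensional (Pow J)" "S \<subseteq> J"
  shows "foldr (tup (prol J G)) l y S = foldr (tup G) (map (\<lambda>a. a S) l) (y S)"
  using assms by (induction l) auto

text \<open>The coefficient at \<open>T\<close> of the action of \<open>\<delta>(f)\<^sub>n\<close>,
  with slots labelled by \<open>K\<close>, vector arguments \<open>a k\<close> and base family
  \<open>y\<close>. The set \<open>T\<close> may be empty; then only the empty matching remains and
  the sum is \<open>f\<^sub>n\<close> at the base coefficients.\<close>

definition delta_sum :: "('o, 'm, 'e) interp \<Rightarrow> ('o, 'm) cmon \<Rightarrow> (nat \<Rightarrow> 'm) \<Rightarrow> nat set \<Rightarrow>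
    'k set \<Rightarrow> ('k \<Rightarrow> nat set \<Rightarrow> 'e) \<Rightarrow> (nat set \<Rightarrow> 'e) \<Rightarrow> 'e" where
  "delta_sum G N s T K a y = finprod (pmon G N)
     (\<lambda>(P, R). dm G s (match_mset (\<lambda>p k. a k p) (\<lambda>k. a k {}) y P K R) (y {}))
     (SIGMA P : partitions T. matchings P K)"

context cartesian_category
begin

context
  fixes J :: "nat set" and G :: "('o, 'm, 'e) interp" and M U N V s
  assumes J: "finite J" and G: "set_model X G" and f: "faa_ar X (FArr (M, U) (N, V) s)"
begin

interpretation cat_model X G using G by (simp add: cat_model_def cartesian_category_axioms)

lemma delta_sum_term_sub:
  assumes a: "\<And>k. k \<in> K \<Longrightarrow> a k \<in> pts (prol J G) (M, carr M)" and y: "y \<in> pts (prol J G) (M, U)"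
    and K: "finite K" and T: "T \<subseteq> J" and P: "partition_on T P" and R: "R \<in> matchings P K"
  shows "set_mset (match_mset (\<lambda>p k. a k p) (\<lambda>k. a k {}) y P K R) \<subseteq> pts G (carr M)"
proof (rule match_mset_subset[OF R])
  show "finite P" using partition_finite(1)[OF finite_subset[OF T J] P] .
  show "finite K" by fact
  show "a k p \<in> pts G (carr M)" if "p \<in> P" "k \<in> K" for p k
    using prol_pts_at[OF a[OF that(2)], of p] partition_block[OF P that(1)] T by auto
  show "a k {} \<in> pts G (carr M)" if "k \<in> K" for k using prol_pts_base[OF a[OF that]] .
  show "y p \<in> pts G (carr M)" if "p \<in> P" for p
    using prol_pts_fibre[OF y, of p] partition_block[OF P that] T by auto
qed

lemma delta_sum_term_closed:
  assumes a: "\<And>k. k \<in> K \<Longrightarrow> a k \<in> pts (prol J G) (M, carr M)" and y: "y \<in> pts (prol J G) (M, U)"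
    and K: "finite K" "K \<noteq> {}" and T: "T \<subseteq> J" and P: "partition_on T P" and R: "R \<in> matchings P K"
  shows "dm G s (match_mset (\<lambda>p k. a k p) (\<lambda>k. a k {}) y P K R) (y {}) \<in> pts G (carr N)"
  by (rule dm_closed[OF f delta_sum_term_sub[where a = a, OF a y K(1) T P R] match_mset_nonempty[OF R _ K] prol_pts_base[OF y]])
    (use partition_finite(1)[OF finite_subset[OF T J] P] in auto)

text \<open>A partition \<open>P\<close> of \<open>T\<close> with \<open>r\<close> blocks calls for
  the component of index \<open>r\<close>, applied to the coefficients of the tuple at the blocks.
  The coefficient at \<open>p\<close> has slots \<open>a k p\<close> and last entry
  \<open>y p\<close>, and the base coefficient has slots \<open>a k {}\<close>; these are the data
  of \<open>act_delta_comp\<close>.\<close>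

lemma act_delta_seq:
  fixes ks :: "'k list"
  assumes ks: "ks \<noteq> []" "distinct ks" and a: "\<And>k. k \<in> set ks \<Longrightarrow> a k \<in> pts (prol J G) (M, carr M)"
    and y: "y \<in> pts (prol J G) (M, U)" and T: "T \<subseteq> J"
  shows "act (prol J G) (delta_seq X (M, U) (N, V) s (length ks)) (foldr (tup (prol J G)) (map a ks) y) T =
    delta_sum G N s T (set ks) a y"
proof -
  note fD = faa_arD[OF f]
  interpret sp: separated X "hom_interp X ` Obj X" by (rule separated_hom)
  interpret N: comm_monoid "pmon G N" by (rule comm_monoid_pmon[OF fD(2)])
  let ?n = "length ks" and ?A = "carr M"
  let ?D = "powprd X ?A ?n ?A" and ?E = "powprd X ?A ?n U"
  have A: "?A \<in> Obj X" by (rule carr_Obj[OF fD(1)])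
  have D: "?D \<in> Obj X" and E: "?E \<in> Obj X" using powprd_Obj A fD(3) by auto
  have n: "?n \<noteq> 0" using ks by simp
  let ?t = "foldr (tup (prol J G)) (map a ks) y"
  let ?s = "\<lambda>r. if r = 0 then s ?n else delta_comp X (FArr (M, U) (N, V) s) ?n r"
  have ds: "delta_seq X (M, U) (N, V) s ?n = FArr ((prod_cmon X M ^^ ?n) M, ?E) (N, carr N) ?s"
    using n by (simp add: delta_seq_def powprd_Faa)
  have ar: "faa_ar X (FArr ((prod_cmon X M ^^ ?n) M, ?E) (N, carr N) ?s)"
    using sp.delta_seq_Hom[OF f n] unfolding ds by (simp add: Hom_Faa_iff)
  have yx: "y \<in> extensional (Pow J)" by (rule prol_ext[OF y])
  have t: "?t S = foldr (tup G) (map (\<lambda>k. a k S) ks) (y S)" if "S \<subseteq> J" for S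
    using prol_tuple_at[OF yx that, of G "map a ks"] by (simp add: comp_def)
  have x: "y {} \<in> pts G U" by (rule prol_pts_base[OF y])
  have a0: "set (map (\<lambda>k. a k {}) ks) \<subseteq> pts G ?A" using prol_pts_base[OF a] by auto
  have t0: "?t {} \<in> pts G ?E" using tuple_pts[OF A fD(3) a0 x] t[of "{}"] by simp
  have aS: "set (map (\<lambda>k. a k S) ks) \<subseteq> pts G ?A" if "S \<subseteq> J" for S
    using prol_pts_at[OF a that] by auto
  have yS: "y S \<in> pts G ?A" if "S \<subseteq> J" "S \<noteq> {}" for S using prol_pts_fibre[OF y that] .
  have tS: "?t S \<in> pts G ?D" if "S \<subseteq> J" "S \<noteq> {}" for S
    using tuple_pts[OF A A aS[OF that(1)] yS[OF that]] t[OF that(1)] by simp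
  have tp: "?t \<in> pts (prol J G) ((prod_cmon X M ^^ ?n) M, ?E)"
  proof -
    have "?t \<in> extensional (Pow J)" using yx by (cases "map a ks") auto
    then show ?thesis using t0 tS by (simp add: prol_pts_iff)
  qed
  show ?thesis
  proof (cases "T = {}")
    case True
    have "act G (s ?n) (?t {}) = dm G s (image_mset (\<lambda>k. a k {}) (mset_set (set ks))) (y {})"
      using dm_list[OF f a0 x] t[of "{}"] mset_map_distinct[OF ks(2), of "\<lambda>k. a k {}"] by simp
    moreover have I: "(SIGMA P : partitions {}. matchings P (set ks)) = {({}, {})}"
      by (auto simp: partition_on_empty matchings_empty)
    have clo: "dm G s (image_mset (\<lambda>k. a k {}) (mset_set (set ks))) (y {}) \<in> carrier (pmon G N)"
      unfolding carrier_pmon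
      by (rule dm_closed[OF f _ _ x]) (use a0 ks in \<open>auto simp: mset_set_empty_iff\<close>)
    have "delta_sum G N s {} (set ks) a y = dm G s (image_mset (\<lambda>k. a k {}) (mset_set (set ks))) (y {})"
      unfolding delta_sum_def I using clo by (simp add: match_mset_def)
    ultimately show ?thesis
      using True n by (simp add: ds)
  next
    case False
    have finT: "finite T" using T J finite_subset by blast
    have fP: "finite (partitions T)" by (rule finitely_many_partition_on[OF finT])
    let ?d = "\<lambda>P R. dm G s (match_mset (\<lambda>p k. a k p) (\<lambda>k. a k {}) y P (set ks) R) (y {})"
    have clo: "?d P R \<in> carrier (pmon G N)" if "P \<in> partitions T" "R \<in> matchings P (set ks)" for P R
      unfolding carrier_pmon
      by (rule delta_sum_term_closed[where a = a, OF a y _ _ T]) (use ks that in auto)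
    have "act (prol J G) (delta_seq X (M, U) (N, V) s ?n) ?t T =
      finprod (pmon G N) (\<lambda>P. dm G ?s (image_mset ?t (mset_set P)) (?t {})) (partitions T)"
      using False T by (simp add: ds act_prol_fibre)
    also have "\<dots> = finprod (pmon G N) (\<lambda>P. finprod (pmon G N) (?d P) (matchings P (set ks))) (partitions T)"
    proof (rule N.finprod_cong')
      show "(\<lambda>P. finprod (pmon G N) (?d P) (matchings P (set ks))) \<in> partitions T \<rightarrow> carrier (pmon G N)"
        by (intro funcsetI N.finprod_closed) (rule clo)
      fix P assume "P \<in> partitions T"
      then have P: "partition_on T P" by simp
      have finP: "finite P" by (rule partition_finite(1)[OF finT P])
      then obtain ps where ps: "set ps = P" "distinct ps" using finite_distinct_list by blast
      have "P \<noteq> {}" using P False by (auto simp: partition_on_def)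
      then have nil: "length ps \<noteq> 0" using ps by auto
      have blk: "p \<subseteq> J \<and> p \<noteq> {}" if "p \<in> set ps" for p
        using partition_block[OF P, of p] that ps T by auto
      have "dm G ?s (image_mset ?t (mset_set P)) (?t {}) = act G (?s (length (map ?t ps))) (foldr (tup G) (map ?t ps) (?t {}))"
      proof -
        have "set (map ?t ps) \<subseteq> pts G (carr ((prod_cmon X M ^^ ?n) M))" using tS blk by auto
        from dm_list[OF ar this t0] show ?thesis
          by (simp only: mset_map_distinct[OF ps(2), of ?t] ps(1))
      qed
      also have "\<dots> = act G (delta_comp X (FArr (M, U) (N, V) s) ?n (length ps)) (foldr (tup G) (map ?t ps) (?t {}))"
        using nil by simp
      also have "\<dots> = finprod (pmon G N) (?d P) (matchings P (set ks))"
        unfolding ps(1)[symmetric]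
      proof (rule act_delta_comp[OF f n ps(2) refl ks(2) refl])
        show "?t p \<in> pts G ?D" if "p \<in> set ps" for p using tS blk[OF that] by blast
        show "?t {} \<in> pts G ?E" by (rule t0)
        show "act G (proj X ?A ?n ?A i) (?t p) = a (ks ! i) p" if "p \<in> set ps" "i < ?n" for p i
        proof -
          have "p \<subseteq> J" "p \<noteq> {}" using blk[OF that(1)] by auto
          then show ?thesis using act_proj_arg[OF A A aS yS, of p p ?n i] that(2) t[of p] by simp
        qed
        show "act G (proj X ?A ?n ?A ?n) (?t p) = y p" if "p \<in> set ps" for p
        proof -
          have "p \<subseteq> J" "p \<noteq> {}" using blk[OF that] by auto
          then show ?thesis using act_proj_last[OF A A aS yS, of p p ?n] t[of p] by simp
        qed
        show "act G (proj X ?A ?n U i) (?t {}) = a (ks ! i) {}" if "i < ?n" for i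
          using act_proj_arg[OF A fD(3) a0 x, of ?n i] that t[of "{}"] by simp
        show "act G (proj X ?A ?n U ?n) (?t {}) = y {}"
          using act_proj_last[OF A fD(3) a0 x, of ?n] t[of "{}"] by simp
      qed
      finally show "dm G ?s (image_mset ?t (mset_set P)) (?t {}) = finprod (pmon G N) (?d P) (matchings P (set ks))" .
    qed simp
    also have "\<dots> = delta_sum G N s T (set ks) a y"
      unfolding delta_sum_def
      by (rule N.finprod_Sigma[OF fP _ clo])
        (use partition_finite(1)[OF finT] finite_matchings in auto)
    finally show ?thesis .
  qed
qed

text \<open>Each summand uses the family in slot \<open>k\<close> at one coefficient only: at
  \<open>p\<close> if \<open>k\<close> is matched with \<open>p\<close>, at \<open>{}\<close>
  otherwise. As the monoid of \<open>\<delta>\<close> adds coefficientwise, additivity of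
  \<open>f\<close> in that single argument suffices.\<close>

lemma delta_sum_upd:
  fixes K :: "'k set"
  assumes K: "finite K" "k \<in> K" and a: "\<And>k. k \<in> K \<Longrightarrow> a k \<in> pts (prol J G) (M, carr M)"
    and y: "y \<in> pts (prol J G) (M, U)" and T: "T \<subseteq> J"
  shows "b \<in> pts (prol J G) (M, carr M) \<Longrightarrow> c \<in> pts (prol J G) (M, carr M) \<Longrightarrow>
      delta_sum G N s T K (a(k := b \<otimes>\<^bsub>pmon (prol J G) (delta_cmon X M)\<^esub> c)) y =
      delta_sum G N s T K (a(k := b)) y \<otimes>\<^bsub>pmon G N\<^esub> delta_sum G N s T K (a(k := c)) y"
    and "delta_sum G N s T K (a(k := \<one>\<^bsub>pmon (prol J G) (delta_cmon X M)\<^esub>)) y = \<one>\<^bsub>pmon G N\<^esub>"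
proof -
  note fD = faa_arD[OF f]
  interpret N: comm_monoid "pmon G N" by (rule comm_monoid_pmon[OF fD(2)])
  let ?I = "SIGMA P : partitions T. matchings P K"
  let ?m = "\<lambda>a (P, R). match_mset (\<lambda>p k. a k p) (\<lambda>k. a k {}) y P K R"
  have x: "y {} \<in> pts G U" by (rule prol_pts_base[OF y])
  have finT: "finite T" using T J finite_subset by blast
  have ex: "\<exists>m q. (\<forall>b. ?m (a(k := b)) z = add_mset (b q) m) \<and> q \<subseteq> J \<and> set_mset m \<subseteq> pts G (carr M)" if "z \<in> ?I" for z
  proof -
    obtain P R where z: "z = (P, R)" and P: "partition_on T P" and R: "R \<in> matchings P K" using \<open>z \<in> ?I\<close> by auto
    have finP: "finite P" by (rule partition_finite(1)[OF finT P])
    obtain m g where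
      1: "\<And>b. match_mset (\<lambda>k' p. (\<lambda>p b. b p) p ((a(k := b)) k')) y (\<lambda>k'. (\<lambda>b. b {}) ((a(k := b)) k')) K P (R\<inverse>) = add_mset (g b) m"
      and 2: "g = (\<lambda>b. b {}) \<or> (\<exists>p \<in> P. g = (\<lambda>b. b p))"
      and 3: "set_mset m \<subseteq> set_mset (match_mset (\<lambda>k' p. (\<lambda>p b. b p) p (a k')) y (\<lambda>k'. (\<lambda>b. b {}) (a k')) K P (R\<inverse>))"
      by (rule match_mset_upd[OF converse_matching[OF R] K(1) finP K(2), where vv = "\<lambda>p b. b p" and d = a and a = y and ww = "\<lambda>b. b {}"])
        (rule that; assumption)
    \<comment> \<open>The two cases of \<open>match_mset_upd\<close>, evaluation at a block of
      \<open>P\<close> and evaluation at the empty set, are both evaluations at a subset of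
      \<open>J\<close>.\<close>
    have "\<exists>q \<subseteq> J. g = (\<lambda>b. b q)" using 2 partition_block[OF P] T by blast
    then obtain q where q: "q \<subseteq> J" "g = (\<lambda>b. b q)" by blast
    have "set_mset m \<subseteq> pts G (carr M)"
      using 3 delta_sum_term_sub[where a = a, OF a y K(1) T P R] unfolding match_mset_converse[of _ _ _ P K R] by simp
    moreover have "?m (a(k := b)) z = add_mset (b q) m" for b
      using 1[of b] q(2) unfolding z prod.case match_mset_converse[of _ _ _ P K R] by simp
    ultimately show ?thesis using q(1) by blast
  qed
  then obtain mm qq where up: "\<And>z b. z \<in> ?I \<Longrightarrow> ?m (a(k := b)) z = add_mset (b (qq z)) (mm z)"
    and qq: "\<And>z. z \<in> ?I \<Longrightarrow> qq z \<subseteq> J" and mm: "\<And>z. z \<in> ?I \<Longrightarrow> set_mset (mm z) \<subseteq> pts G (carr M)"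
    by metis
  have ds: "delta_sum G N s T K a' y = finprod (pmon G N) (\<lambda>z. dm G s (?m a' z) (y {})) ?I" for a' :: "'k \<Rightarrow> nat set \<Rightarrow> 'e"
    unfolding delta_sum_def by (simp add: case_prod_unfold)
  have bq: "b q \<in> pts G (carr M)" if "b \<in> pts (prol J G) (M, carr M)" "q \<subseteq> J" for b q
    using prol_pts_at[OF that] by simp
  show "delta_sum G N s T K (a(k := b \<otimes>\<^bsub>pmon (prol J G) (delta_cmon X M)\<^esub> c)) y =
      delta_sum G N s T K (a(k := b)) y \<otimes>\<^bsub>pmon G N\<^esub> delta_sum G N s T K (a(k := c)) y"
    if b: "b \<in> pts (prol J G) (M, carr M)" and c: "c \<in> pts (prol J G) (M, carr M)"
    unfolding ds
  proof (rule N.finprod_mult_eq)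
    fix z assume z: "z \<in> ?I"
    show "dm G s (?m (a(k := b)) z) (y {}) \<in> carrier (pmon G N)" "dm G s (?m (a(k := c)) z) (y {}) \<in> carrier (pmon G N)"
      unfolding carrier_pmon up[OF z]
      by (rule dm_closed[OF f _ _ x]; use mm[OF z] bq[OF b qq[OF z]] bq[OF c qq[OF z]] in simp)+
    show "dm G s (?m (a(k := b \<otimes>\<^bsub>pmon (prol J G) (delta_cmon X M)\<^esub> c)) z) (y {}) =
        dm G s (?m (a(k := b)) z) (y {}) \<otimes>\<^bsub>pmon G N\<^esub> dm G s (?m (a(k := c)) z) (y {})"
      unfolding up[OF z] delta_mult[OF J G fD(1) b c qq[OF z]]
      by (rule dm_mult[OF f mm[OF z] x bq[OF b qq[OF z]] bq[OF c qq[OF z]]])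
  qed
  show "delta_sum G N s T K (a(k := \<one>\<^bsub>pmon (prol J G) (delta_cmon X M)\<^esub>)) y = \<one>\<^bsub>pmon G N\<^esub>"
    unfolding ds
  proof (rule N.finprod_one_eqI)
    fix z assume z: "z \<in> ?I"
    show "dm G s (?m (a(k := \<one>\<^bsub>pmon (prol J G) (delta_cmon X M)\<^esub>)) z) (y {}) = \<one>\<^bsub>pmon G N\<^esub>"
      unfolding up[OF z] delta_one[OF J G fD(1) qq[OF z]] by (rule dm_one[OF f mm[OF z] x])
  qed
qed

end

end

text \<open>Here symmetry and additivity are those in the slots of
  \<open>\<delta>(f)\<^sub>n\<close>, as arrows of \<open>Faa X\<close>. They are checked
  coefficient by coefficient in the prolongations, where \<open>delta_sum\<close> is independent of
  any order and additive by \<open>delta_sum_upd\<close>.\<close>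

lemma (in separated) delta_arr_Hom:
  assumes "f \<in> Hom (Faa X) P Q"
  shows "delta_arr X f \<in> Hom (Faa (Faa X)) (delta_obj X P) (delta_obj X Q)"
proof -
  obtain M U N V where PQ: "P = (M, U)" "Q = (N, V)" by (metis surj_pair)
  obtain s where s: "f = FArr (M, U) (N, V) s" and f: "faa_ar X (FArr (M, U) (N, V) s)"
    using assms unfolding PQ by (rule Hom_FaaE)
  note fD = faa_arD[OF f]
  interpret F: separated "Faa X" prols by (rule separated_Faa)
  let ?t = "delta_seq X (M, U) (N, V) s"
  \<comment> \<open>The intrinsic function is obtained by listing \<open>K\<close> in increasing
    order; any other enumeration gives the same value because both have the coefficients
    \<open>delta_sum\<close>.\<close>
  let ?val = "\<lambda>G' (K :: nat set) a y. act G' (?t (card K)) (foldr (tup G') (map a (sorted_list_of_set K)) y)"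
  have "faa_ar (Faa X) (FArr (delta_cmon X M, (M, U)) (delta_cmon X N, (N, V)) ?t)"
  proof (rule F.faa_arI[OF cmon_in_delta[OF fD(1)] _ cmon_in_delta[OF fD(2)], where \<Phi> = ?val])
    show "(M, U) \<in> Obj (Faa X)" "(N, V) \<in> Obj (Faa X)" using fD by auto
    show "?t 0 \<in> Hom (Faa X) (M, U) (N, V)" using f by (simp add: delta_seq_def Hom_Faa_iff del: faa_ar.simps)
    show "?t n \<in> Hom (Faa X) (powprd (Faa X) (carr (delta_cmon X M)) n (M, U)) (carr (delta_cmon X N))" if "n \<noteq> 0" for n
      using delta_seq_Hom[OF f that] by simp
    fix G' assume G': "G' \<in> prols"
    then obtain J G where J: "finite J" and G: "G \<in> \<M>" and GJ: "G' = prol J G" by (auto simp: prols_def)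
    note mG = models[OF G]
    interpret cat_model "Faa X" G' by (rule F.cat_models[OF G'])
    have val: "?val G' K a y T = delta_sum G N s T K a y"
      if "finite K" "K \<noteq> {}" "\<And>k. k \<in> K \<Longrightarrow> a k \<in> pts G' (M, carr M)" "y \<in> pts G' (M, U)" "T \<subseteq> J" for K a y T
      using act_delta_seq[OF J mG f, of "sorted_list_of_set K" a y T] that by (simp add: GJ)
    have tH: "foldr (tup G') (map a ks) y \<in> pts G' (powprd (Faa X) (M, carr M) (length ks) (M, U))"
      if "\<And>k. k \<in> set ks \<Longrightarrow> a k \<in> pts G' (M, carr M)" "y \<in> pts G' (M, U)" for ks :: "nat list" and a y
    proof -
      have "set (map a ks) \<subseteq> pts G' (M, carr M)" using that by auto
      from tuple_pts[OF _ _ this that(2)] show ?thesis using fD carr_Obj[OF fD(1)] by simp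
    qed
    have clo: "?val G' K a y \<in> pts G' (N, carr N)"
      if "finite K" "K \<noteq> {}" "\<And>k. k \<in> K \<Longrightarrow> a k \<in> pts G' (M, carr M)" "y \<in> pts G' (M, U)" for K a y
      by (rule act_pts[OF delta_seq_Hom[OF f]])
        (use that tH[of "sorted_list_of_set K" a y] in auto)
    show "act G' (?t (length ks)) (foldr (tup G') (map a ks) y) = ?val G' (set ks) a y"
      if ks: "ks \<noteq> []" "distinct ks" and a: "\<And>k. k \<in> set ks \<Longrightarrow> a k \<in> pts G' (carr (delta_cmon X M))" and y: "y \<in> pts G' (M, U)" for ks a y
    proof -
      have a': "a k \<in> pts G' (M, carr M)" if "k \<in> set ks" for k using a[OF that] by simp
      have "act G' (?t (length ks)) (foldr (tup G') (map a ks) y) \<in> pts G' (N, carr N)"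
        by (rule act_pts[OF delta_seq_Hom[OF f] tH[OF a' y]]) (use ks in auto)
      moreover have "?val G' (set ks) a y \<in> pts G' (N, carr N)" by (rule clo) (use ks a' y in auto)
      moreover have "act G' (?t (length ks)) (foldr (tup G') (map a ks) y) T = ?val G' (set ks) a y T" if "T \<subseteq> J" for T
        using val[OF _ _ a' y that] act_delta_seq[OF J mG f ks, of a y T] a' y that ks by (simp add: GJ)
      ultimately show ?thesis unfolding GJ by (intro prol_eqI) (auto dest: prol_ext)
    qed
    fix K :: "nat set" and a y k
    assume K: "finite K" "k \<in> K" and a: "\<And>k. k \<in> K \<Longrightarrow> a k \<in> pts G' (carr (delta_cmon X M))" and y: "y \<in> pts G' (M, U)"
    have a': "a k \<in> pts G' (M, carr M)" if "k \<in> K" for k using a[OF that] by simp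
    have ne: "K \<noteq> {}" using K by auto
    have up: "(a(k := b)) k' \<in> pts G' (M, carr M)" if "b \<in> pts G' (M, carr M)" "k' \<in> K" for b k' using a' that by simp
    have clo_up: "?val G' K (a(k := b)) y \<in> pts G' (N, carr N)" if "b \<in> pts G' (M, carr M)" for b
      by (rule clo[OF K(1) ne _ y]) (rule up[OF that])
    have val_up: "?val G' K (a(k := b)) y T = delta_sum G N s T K (a(k := b)) y"
      if "b \<in> pts G' (M, carr M)" "T \<subseteq> J" for b T
      by (rule val[OF K(1) ne _ y that(2)]) (rule up[OF that(1)])
    let ?M = "pmon G' (delta_cmon X M)" and ?N = "pmon G' (delta_cmon X N)"
    interpret N: comm_monoid ?N by (rule comm_monoid_pmon[OF cmon_in_delta[OF fD(2)]])
    have upd: "delta_sum G N s T K (a(k := b \<otimes>\<^bsub>?M\<^esub> c)) y =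
        delta_sum G N s T K (a(k := b)) y \<otimes>\<^bsub>pmon G N\<^esub> delta_sum G N s T K (a(k := c)) y"
      "delta_sum G N s T K (a(k := \<one>\<^bsub>?M\<^esub>)) y = \<one>\<^bsub>pmon G N\<^esub>"
      if "T \<subseteq> J" "b \<in> pts G' (M, carr M)" "c \<in> pts G' (M, carr M)" for T b c
      using delta_sum_upd[OF J mG f K a'[unfolded GJ] y[unfolded GJ] that(1)] that(2,3) unfolding GJ by auto
    have Mc: "b \<otimes>\<^bsub>?M\<^esub> c \<in> pts G' (M, carr M)" "\<one>\<^bsub>?M\<^esub> \<in> pts G' (M, carr M)"
      if "b \<in> pts G' (M, carr M)" "c \<in> pts G' (M, carr M)" for b c
      using pmon_closed[OF cmon_in_delta[OF fD(1)]] that by simp_all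
    show "?val G' K (a(k := b \<otimes>\<^bsub>?M\<^esub> c)) y = ?val G' K (a(k := b)) y \<otimes>\<^bsub>?N\<^esub> ?val G' K (a(k := c)) y"
      if "b \<in> pts G' (carr (delta_cmon X M))" "c \<in> pts G' (carr (delta_cmon X M))" for b c
    proof -
      have b: "b \<in> pts G' (M, carr M)" and c: "c \<in> pts G' (M, carr M)" using that by simp_all
      note vb = clo_up[OF b] and vc = clo_up[OF c]
        and vbc = clo_up[OF Mc(1)[OF b c]]
      have "?val G' K (a(k := b)) y \<otimes>\<^bsub>?N\<^esub> ?val G' K (a(k := c)) y \<in> pts G' (N, carr N)"
        using N.m_closed vb vc by (simp add: carrier_pmon)
      then have ext: "?val G' K (a(k := b)) y \<otimes>\<^bsub>?N\<^esub> ?val G' K (a(k := c)) y \<in> extensional (Pow J)"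
        unfolding GJ by (rule prol_ext)
      show ?thesis
      proof (rule prol_eqI[OF prol_ext[OF vbc[unfolded GJ], folded GJ] ext])
        fix T assume T: "T \<subseteq> J"
        show "?val G' K (a(k := b \<otimes>\<^bsub>?M\<^esub> c)) y T = (?val G' K (a(k := b)) y \<otimes>\<^bsub>?N\<^esub> ?val G' K (a(k := c)) y) T"
          using delta_mult[OF J mG fD(2) vb[unfolded GJ] vc[unfolded GJ] T, folded GJ]
            val_up[OF Mc(1)[OF b c] T] val_up[OF b T] val_up[OF c T]
            upd(1)[OF T b c] by simp
      qed
    qed
    show "?val G' K (a(k := \<one>\<^bsub>?M\<^esub>)) y = \<one>\<^bsub>?N\<^esub>"
    proof -
      have o: "\<one>\<^bsub>?M\<^esub> \<in> pts G' (M, carr M)" using pmon_closed(2)[OF cmon_in_delta[OF fD(1)]] by simp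
      note vo = clo_up[OF o]
      have "\<one>\<^bsub>?N\<^esub> \<in> pts G' (N, carr N)" using N.one_closed by (simp add: carrier_pmon)
      then have ext: "\<one>\<^bsub>?N\<^esub> \<in> extensional (Pow J)" unfolding GJ by (rule prol_ext)
      show ?thesis
      proof (rule prol_eqI[OF prol_ext[OF vo[unfolded GJ], folded GJ] ext])
        fix T assume T: "T \<subseteq> J"
        show "?val G' K (a(k := \<one>\<^bsub>?M\<^esub>)) y T = \<one>\<^bsub>?N\<^esub> T"
          using delta_one[OF J mG fD(2) T, folded GJ] val_up[OF o T] upd(2)[OF T o o] by simp
      qed
    qed
  qed
  then show ?thesis by (simp add: s PQ delta_arr_eq delta_obj_eq Hom_Faa_iff del: faa_ar.simps delta_obj.simps)
qed

section \<open>The comultiplication as a functor\<close>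

text \<open>
  A double prolongation by disjoint \<open>I\<close> and \<open>J\<close> is a single prolongation by \<open>I \<union> J\<close>; the
  comultiplication becomes the identity under this identification.
\<close>

definition flat :: "nat set \<Rightarrow> nat set \<Rightarrow> (nat set \<Rightarrow> nat set \<Rightarrow> 'e) \<Rightarrow> nat set \<Rightarrow> 'e" where
  "flat I J a = (\<lambda>R \<in> Pow (I \<union> J). a (R \<inter> I) (R \<inter> J))"

lemma flat_at: "R \<subseteq> I \<union> J \<Longrightarrow> flat I J a R = a (R \<inter> I) (R \<inter> J)"
  by (simp add: flat_def)

lemma flat_Un:
  assumes "I \<inter> J = {}" "S \<subseteq> I" "T \<subseteq> J" shows "flat I J a (S \<union> T) = a S T"
proof -
  have "(S \<union> T) \<inter> I = S" "(S \<union> T) \<inter> J = T" "S \<union> T \<subseteq> I \<union> J" using assms by auto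
  then show ?thesis by (simp add: flat_at)
qed

lemma flat_ext: "flat I J a \<in> extensional (Pow (I \<union> J))"
  by (simp add: flat_def)

lemma prol2_ptsD:
  assumes "a \<in> pts (prol I (prol J G)) (delta_obj X (M, U))" "S \<subseteq> I"
  shows "a S \<in> pts (prol J G) (M, if S = {} then U else carr M)"
  using prol_pts_at[OF assms[unfolded delta_obj_eq]] by (cases "S = {}") simp_all

lemma flat_pts:
  assumes a: "a \<in> pts (prol I (prol J G)) (delta_obj X (M, U))"
  shows "flat I J a \<in> pts (prol (I \<union> J) G) (M, U)"
  unfolding prol_pts_iff
proof (intro conjI allI impI flat_ext)
  fix R assume R: "R \<subseteq> I \<union> J"
  have 1: "a (R \<inter> I) \<in> pts (prol J G) (M, if R \<inter> I = {} then U else carr M)"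
    by (rule prol2_ptsD[OF a]) simp
  have 2: "a (R \<inter> I) (R \<inter> J) \<in> pts G (if R \<inter> J = {} then (if R \<inter> I = {} then U else carr M) else carr M)"
    by (rule prol_pts_at[OF 1]) simp
  have "R = {} \<longleftrightarrow> R \<inter> I = {} \<and> R \<inter> J = {}" using R by blast
  then show "flat I J a R \<in> pts G (if R = {} then U else carr M)"
    using 2 by (simp add: flat_at[OF R] split: if_splits)
qed

text \<open>For disjoint \<open>I\<close> and \<open>J\<close> the union \<open>S \<union> T\<close>
  determines the pair \<open>(S, T)\<close>, so every coefficient of the double family can be read
  off after flattening.\<close>

lemma flat_inject:
  assumes dis: "I \<inter> J = {}" and a: "a \<in> pts (prol I (prol J G)) (delta_obj X P)"
    and b: "b \<in> pts (prol I (prol J G)) (delta_obj X P)" and eq: "flat I J a = flat I J b"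
  shows "a = b"
proof (rule prol_eqI[OF prol_ext[OF a] prol_ext[OF b]])
  obtain M U where P: "P = (M, U)" by (cases P)
  fix S assume S: "S \<subseteq> I"
  show "a S = b S"
  proof (rule prol_eqI)
    show "a S \<in> extensional (Pow J)" "b S \<in> extensional (Pow J)"
      using prol_ext[OF prol2_ptsD[OF a[unfolded P] S]] prol_ext[OF prol2_ptsD[OF b[unfolded P] S]] by auto
    fix T assume "T \<subseteq> J"
    then show "a S T = b S T" using flat_Un[OF dis S, of T a] flat_Un[OF dis S, of T b] eq by simp
  qed
qed

lemma flat_tup:
  "flat I J (tup (prol I (prol J G)) a b) = tup (prol (I \<union> J) G) (flat I J a) (flat I J b)"
  by (auto simp: flat_def fun_eq_iff restrict_def)

text \<open>Compare coefficients at \<open>R0 = S \<union> T\<close>. Prolonging by \<open>I\<close>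
  sums over partitions \<open>K\<close> of \<open>S\<close>, and the coefficient at \<open>T\<close>
  of each term is a \<open>delta_sum\<close> over partitions of \<open>T\<close> and matchings with
  \<open>K\<close>. Together these triples are the partitions of \<open>R0\<close> by
  \<open>bij_betw_glue\<close>, and the summands agree because \<open>flat\<close> gives a merged
  block \<open>p \<union> k\<close> the coefficient \<open>a k p\<close>.\<close>

lemma (in cartesian_category) act_delta_arr:
  assumes I: "finite I" and J: "finite J" and dis: "I \<inter> J = {}" and G: "set_model X G"
    and fH: "f \<in> Hom (Faa X) P Q" and a: "a \<in> pts (prol I (prol J G)) (delta_obj X P)"
  shows "flat I J (act (prol I (prol J G)) (delta_arr X f) a) = act (prol (I \<union> J) G) f (flat I J a)"
proof (rule prol_eqI[OF flat_ext])
  obtain M U N V where PQ: "P = (M, U)" "Q = (N, V)" by (metis surj_pair)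
  obtain s where s: "f = FArr (M, U) (N, V) s" and f: "faa_ar X (FArr (M, U) (N, V) s)"
    using fH unfolding PQ by (rule Hom_FaaE)
  note fD = faa_arD[OF f]
  note a = a[unfolded PQ]
  interpret cat_model X G using G by (simp add: cat_model_def cartesian_category_axioms)
  interpret sp: separated X "hom_interp X ` Obj X" by (rule separated_hom)
  interpret F: cat_model "Faa X" "prol J G"
    by (simp add: cat_model_def cartesian_category_Faa set_model_prol[OF G J])
  interpret N: comm_monoid "pmon G N" by (rule comm_monoid_pmon[OF fD(2)])
  let ?t = "delta_seq X (M, U) (N, V) s"
  have df: "delta_arr X f = FArr (delta_cmon X M, (M, U)) (delta_cmon X N, (N, V)) ?t"
    by (simp add: s delta_arr_eq delta_obj_eq)
  have dar: "faa_ar (Faa X) (FArr (delta_cmon X M, (M, U)) (delta_cmon X N, (N, V)) ?t)"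
    using sp.delta_arr_Hom[OF fH] unfolding df Hom_Faa_iff by blast
  have a0: "a {} \<in> pts (prol J G) (M, U)" using prol2_ptsD[OF a, of "{}"] by simp
  have aS: "a S \<in> pts (prol J G) (M, carr M)" if "S \<subseteq> I" "S \<noteq> {}" for S
    using prol2_ptsD[OF a that(1)] that(2) by simp
  have x: "a {} {} \<in> pts G U" by (rule prol_pts_base[OF a0])
  have fl0: "flat I J a {} = a {} {}" by (simp add: flat_at)
  show "act (prol (I \<union> J) G) f (flat I J a) \<in> extensional (Pow (I \<union> J))" by (simp add: act_prol)
  fix R0 assume R0: "R0 \<subseteq> I \<union> J"
  let ?S = "R0 \<inter> I" and ?T = "R0 \<inter> J"
  have ST: "R0 = ?S \<union> ?T" using R0 by blast
  have L: "flat I J (act (prol I (prol J G)) (delta_arr X f) a) R0 = act (prol I (prol J G)) (delta_arr X f) a ?S ?T"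
    by (rule flat_at[OF R0])
  show "flat I J (act (prol I (prol J G)) (delta_arr X f) a) R0 = act (prol (I \<union> J) G) f (flat I J a) R0"
  \<comment> \<open>At the empty subset of \<open>I\<close> the action is that of the base component
    of \<open>\<delta>(f)\<close>, which is \<open>f\<close> itself, and no sum over partitions of a
    subset of \<open>I\<close> occurs.\<close>
  proof (cases "?S = {}")
    case True
    have l: "act (prol I (prol J G)) (delta_arr X f) a ?S ?T = act (prol J G) f (a {}) ?T"
      unfolding True act_prol_base df by (simp add: delta_seq_def s)
    show ?thesis
    proof (cases "?T = {}")
      case T: True
      then have "R0 = {}" using ST True by simp
      then show ?thesis unfolding L l by (simp add: fl0 s)
    next
      case T: False
      have R0T: "R0 = ?T" using ST True by simp
      have TIJ: "?T \<subseteq> I \<union> J" by blast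
      have "finite ?T" using J by simp
      have eq: "image_mset (flat I J a) (mset_set Q) = image_mset (a {}) (mset_set Q)" if Q: "partition_on ?T Q" for Q
      proof (rule image_mset_cong)
        fix q assume "q \<in># mset_set Q"
        then have "q \<in> Q" using partition_finite(1)[OF \<open>finite ?T\<close> Q] by simp
        then have q: "q \<subseteq> ?T" using partition_block[OF Q] by blast
        then have "q \<inter> I = {}" "q \<inter> J = q" "q \<subseteq> I \<union> J" using dis by auto
        then show "flat I J a q = a {} q" by (simp add: flat_at)
      qed
      have "act (prol J G) f (a {}) ?T =
          finprod (pmon G N) (\<lambda>Q. dm G s (image_mset (a {}) (mset_set Q)) (a {} {})) (partitions ?T)"
        using T by (simp add: s act_prol_fibre)
      also have "\<dots> = finprod (pmon G N) (\<lambda>Q. dm G s (image_mset (flat I J a) (mset_set Q)) (flat I J a {})) (partitions ?T)"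
        by (rule N.finprod_cong')
          (use eq dm_closed[OF f prol_blocks_pts[OF flat_pts[OF a] \<open>finite ?T\<close> TIJ] blocks_mset_nonempty[OF _ T \<open>finite ?T\<close>]] x in
            \<open>auto simp: carrier_pmon fl0\<close>)
      also have "\<dots> = act (prol (I \<union> J) G) f (flat I J a) R0"
        using T R0 R0T by (simp add: s act_prol_fibre)
      finally show ?thesis unfolding L l .
    qed
  next
    case S: False
    have finS: "finite ?S" and finT: "finite ?T" and finR: "finite R0"
      using I J R0 finite_subset[OF R0] by auto
    have R0ne: "R0 \<noteq> {}" using S by blast
    let ?d = "\<lambda>K P R. dm G s (match_mset (\<lambda>p k. a k p) (\<lambda>k. a k {}) (a {}) P K R) (a {} {})"
    have Kblk: "k \<subseteq> I \<and> k \<noteq> {}" if "partition_on ?S K" "k \<in> K" for K k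
      using partition_block[OF that] by auto
    have clo: "?d K P R \<in> carrier (pmon G N)"
      if "partition_on ?S K" "partition_on ?T P" "R \<in> matchings P K" for K P R
      unfolding carrier_pmon
    proof (rule delta_sum_term_closed[OF J G f _ a0 _ _ _ that(2,3)])
      show "a k \<in> pts (prol J G) (M, carr M)" if "k \<in> K" for k
        using aS Kblk[OF \<open>partition_on ?S K\<close> that] by blast
      show "finite K" by (rule partition_finite(1)[OF finS that(1)])
      show "K \<noteq> {}" using that(1) S by (auto simp: partition_on_def)
    qed simp
    have l: "act (prol I (prol J G)) (delta_arr X f) a ?S ?T =
        finprod (pmon G N) (\<lambda>K. delta_sum G N s ?T K a (a {})) (partitions ?S)"
    proof -
      let ?D = "\<lambda>K. dm (prol J G) ?t (image_mset a (mset_set K)) (a {})"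
      \<comment> \<open>For a partition \<open>K\<close> of \<open>S\<close> with \<open>n\<close>
        blocks, the component \<open>\<delta>(f)\<^sub>n\<close> is applied to the families at the
        blocks, so the members of \<open>K\<close> become the slots.\<close>
      have KD: "?D K \<in> pts (prol J G) (N, carr N) \<and> ?D K ?T = delta_sum G N s ?T K a (a {})"
        if K: "partition_on ?S K" for K
      proof -
        have finK: "finite K" by (rule partition_finite(1)[OF finS K])
        then obtain ks where ks: "set ks = K" "distinct ks" using finite_distinct_list by blast
        have "K \<noteq> {}" using K S by (auto simp: partition_on_def)
        then have nil: "ks \<noteq> []" using ks by auto
        have ak: "a k \<in> pts (prol J G) (M, carr M)" if "k \<in> set ks" for k
          using aS Kblk[OF K] that ks by blast
        then have sub: "set (map a ks) \<subseteq> pts (prol J G) (carr (delta_cmon X M))" by auto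
        have d: "act (prol J G) (?t (length ks)) (foldr (tup (prol J G)) (map a ks) (a {})) = ?D K"
          using F.dm_list[OF dar sub a0] by (simp only: mset_map_distinct[OF ks(2)] ks(1) length_map)
        have "?D K \<in> pts (prol J G) (carr (delta_cmon X N))"
          by (rule F.dm_closed[OF dar _ _ a0]) (use sub ks \<open>K \<noteq> {}\<close> finK in \<open>auto simp: mset_set_empty_iff\<close>)
        moreover have "?D K ?T = delta_sum G N s ?T (set ks) a (a {})"
          unfolding d[symmetric] by (rule act_delta_seq[OF J G f nil ks(2) _ a0]) (rule ak, assumption, simp)
        ultimately show ?thesis by (simp add: ks(1))
      qed
      have "act (prol I (prol J G)) (delta_arr X f) a ?S = finprod (pmon (prol J G) (delta_cmon X N)) ?D (partitions ?S)"
        unfolding df by (subst act_prol_fibre) (use S in auto)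
      then have "act (prol I (prol J G)) (delta_arr X f) a ?S ?T = finprod (pmon G N) (\<lambda>K. ?D K ?T) (partitions ?S)"
        using delta_finprod[OF J G fD(2), of "partitions ?S" ?D ?T] KD by simp
      also have "\<dots> = finprod (pmon G N) (\<lambda>K. delta_sum G N s ?T K a (a {})) (partitions ?S)"
      proof (rule N.finprod_cong')
        show "(\<lambda>K. delta_sum G N s ?T K a (a {})) \<in> partitions ?S \<rightarrow> carrier (pmon G N)"
          unfolding delta_sum_def by (intro funcsetI N.finprod_closed) (use clo in auto)
      qed (use KD in auto)
      finally show ?thesis .
    qed
    also have "\<dots> = finprod (pmon G N) (\<lambda>(K, P, R). ?d K P R)
        (SIGMA K : partitions ?S. SIGMA P : partitions ?T. matchings P K)"
    proof -
      have "finprod (pmon G N) (\<lambda>K. finprod (pmon G N) (\<lambda>(P, R). ?d K P R) (SIGMA P : partitions ?T. matchings P K)) (partitions ?S)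
        = finprod (pmon G N) (\<lambda>(K, z). (\<lambda>(P, R). ?d K P R) z) (SIGMA K : partitions ?S. SIGMA P : partitions ?T. matchings P K)"
        by (rule N.finprod_Sigma[OF finitely_many_partition_on[OF finS]])
          (use clo in \<open>auto intro!: finite_SigmaI finitely_many_partition_on[OF finT] finite_matchings
              dest: partition_finite(1)[OF finT] partition_finite(1)[OF finS]\<close>)
      then show ?thesis by (simp add: delta_sum_def)
    qed
    also have "\<dots> = finprod (pmon G N) (\<lambda>Q. dm G s (image_mset (flat I J a) (mset_set Q)) (flat I J a {})) (partitions (?S \<union> ?T))"
    proof (rule N.finprod_bij_betw)
      have dST: "?S \<inter> ?T = {}" using dis by auto
      show "bij_betw (\<lambda>(K, P, R). glue P K R)
          (SIGMA K : partitions ?S. SIGMA P : partitions ?T. matchings P K) (partitions (?S \<union> ?T))"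
        by (rule bij_betw_glue[OF dST])
      show "(\<lambda>Q. dm G s (image_mset (flat I J a) (mset_set Q)) (flat I J a {})) \<in> partitions (?S \<union> ?T) \<rightarrow> carrier (pmon G N)"
        unfolding ST[symmetric]
        using dm_closed[OF f prol_blocks_pts[OF flat_pts[OF a] finR R0] blocks_mset_nonempty[OF _ R0ne finR] x]
        by (auto simp: carrier_pmon fl0)
      fix z assume "z \<in> (SIGMA K : partitions ?S. SIGMA P : partitions ?T. matchings P K)"
      then obtain K P R where z: "z = (K, P, R)" and K: "partition_on ?S K" and P: "partition_on ?T P"
        and R: "R \<in> matchings P K" by auto
      have "image_mset (flat I J a) (mset_set (glue P K R)) = match_mset (\<lambda>p k. flat I J a (p \<union> k)) (flat I J a) (flat I J a) P K R"
        by (rule image_mset_glue[OF dST K P R finS finT])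
      also have "\<dots> = match_mset (\<lambda>p k. a k p) (\<lambda>k. a k {}) (a {}) P K R"
      proof (rule match_mset_cong[OF R partition_finite(1)[OF finT P] partition_finite(1)[OF finS K]])
        show "flat I J a (p \<union> k) = a k p" if "p \<in> P" "k \<in> K" for p k
          using flat_Un[OF dis, of k p a] partition_block[OF K that(2)] partition_block[OF P that(1)]
          by (simp add: Un_commute)
        show "flat I J a k = a k {}" if "k \<in> K" for k
          using flat_Un[OF dis, of k "{}" a] partition_block[OF K that] by simp
        show "flat I J a p = a {} p" if "p \<in> P" for p
          using flat_Un[OF dis, of "{}" p a] partition_block[OF P that] by simp
      qed
      finally show "(case z of (K, P, R) \<Rightarrow> ?d K P R) =
          dm G s (image_mset (flat I J a) (mset_set ((\<lambda>(K, P, R). glue P K R) z))) (flat I J a {})"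
        by (simp add: z fl0)
    qed
    also have "\<dots> = act (prol (I \<union> J) G) f (flat I J a) R0"
      using R0ne R0 by (simp add: s act_prol_fibre ST[symmetric])
    finally show ?thesis unfolding L .
  qed
qed

section \<open>Joint faithfulness of double and triple prolongations\<close>

lemma ex_disjoint_card:
  assumes "finite J" shows "\<exists>I :: nat set. finite I \<and> card I = n \<and> I \<inter> J = {}"
proof -
  have "infinite (UNIV - J)" using assms by simp
  then obtain I where "finite I" "card I = n" "I \<subseteq> UNIV - J" using infinite_arbitrarily_large by metis
  then show ?thesis by blast
qed

context cartesian_category
begin

definition prols2 :: "((('o, 'm) faa_obj, ('o, 'm) faa_arr) faa_obj, (('o, 'm) faa_obj, ('o, 'm) faa_arr) faa_arr,
    nat set \<Rightarrow> nat set \<Rightarrow> 'm) interp set" where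
  "prols2 = {prol I (prol J G) | I J G. finite I \<and> finite J \<and> I \<inter> J = {} \<and> G \<in> hom_interp X ` Obj X}"

definition prols3 :: "((((('o, 'm) faa_obj, ('o, 'm) faa_arr) faa_obj, (('o, 'm) faa_obj, ('o, 'm) faa_arr) faa_arr) faa_obj),
    ((('o, 'm) faa_obj, ('o, 'm) faa_arr) faa_obj, (('o, 'm) faa_obj, ('o, 'm) faa_arr) faa_arr) faa_arr,
    nat set \<Rightarrow> nat set \<Rightarrow> nat set \<Rightarrow> 'm) interp set" where
  "prols3 = {prol I (prol J (prol K G)) | I J K G. finite I \<and> finite J \<and> finite K \<and>
     I \<inter> J = {} \<and> (I \<union> J) \<inter> K = {} \<and> G \<in> hom_interp X ` Obj X}"

lemma set_model_hom: "G \<in> hom_interp X ` Obj X \<Longrightarrow> set_model X G"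
  using set_model_hom_interp by blast

text \<open>The criterion \<open>separating_prol\<close> needs, over a given inner prolongation by
  \<open>J\<close>, one outer index set of each finite cardinality. It is taken outside
  \<open>J\<close>, so restricting to disjoint index sets keeps the family jointly faithful.\<close>

lemma separated2: "separated (Faa (Faa X)) prols2"
proof -
  interpret S: separated X "hom_interp X ` Obj X" by (rule separated_hom)
  interpret F: separated "Faa X" S.prols by (rule S.separated_Faa)
  interpret FF: cartesian_category "Faa (Faa X)" by (rule F.cartesian_category_Faa)
  have "separating (Faa (Faa X)) prols2"
  proof (rule F.separating_prol)
    fix G n assume "G \<in> S.prols"
    then obtain J G0 where J: "finite J" "G0 \<in> hom_interp X ` Obj X" "G = prol J G0"
      by (auto simp: S.prols_def)
    obtain I :: "nat set" where "finite I" "card I = n" "I \<inter> J = {}" using ex_disjoint_card[OF J(1)] by blast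
    then show "\<exists>J. finite J \<and> card J = n \<and> prol J G \<in> prols2"
      using J unfolding prols2_def by blast
  qed
  moreover have "set_model (Faa (Faa X)) G" if "G \<in> prols2" for G
    using that F.set_model_prol[OF set_model_prol[OF set_model_hom]] by (auto simp: prols2_def)
  ultimately show ?thesis by (simp add: separated_def separated_axioms_def FF.cartesian_category_axioms)
qed

lemma separated3: "separated (Faa (Faa (Faa X))) prols3"
proof -
  interpret F: cartesian_category "Faa X" by (rule cartesian_category_Faa)
  interpret FF: separated "Faa (Faa X)" prols2 by (rule separated2)
  interpret FFF: cartesian_category "Faa (Faa (Faa X))" by (rule FF.cartesian_category_Faa)
  have "separating (Faa (Faa (Faa X))) prols3"
  proof (rule FF.separating_prol)
    fix G n assume "G \<in> prols2"
    then obtain J K G0 where J: "finite J" "finite K" "J \<inter> K = {}" "G0 \<in> hom_interp X ` Obj X" "G = prol J (prol K G0)"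
      unfolding prols2_def by blast
    have "finite (J \<union> K)" using J by simp
    then obtain I :: "nat set" where I: "finite I" "card I = n" "I \<inter> (J \<union> K) = {}" using ex_disjoint_card[of "J \<union> K" n] by blast
    then have "I \<inter> J = {}" "(I \<union> J) \<inter> K = {}" using J(3) by auto
    then have "prol I G \<in> prols3" using J I(1) unfolding prols3_def by blast
    then show "\<exists>I. finite I \<and> card I = n \<and> prol I G \<in> prols3" using I(1,2) by blast
  qed
  moreover have "set_model (Faa (Faa (Faa X))) G" if "G \<in> prols3" for G
    using that FF.set_model_prol[OF F.set_model_prol[OF set_model_prol[OF set_model_hom]]] by (auto simp: prols3_def)
  ultimately show ?thesis by (simp add: separated_def separated_axioms_def FFF.cartesian_category_axioms)
qed

text \<open>Only the codomain has to be of the form \<open>delta_obj X Q\<close>: its points embed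
  into those of the single prolongation by \<open>flat_inject\<close>, so two arrows into it may be
  compared after flattening their values.\<close>

lemma delta_eqI:
  assumes h: "h \<in> Hom (Faa (Faa X)) P (delta_obj X Q)" and h': "h' \<in> Hom (Faa (Faa X)) P (delta_obj X Q)"
    and eq: "\<And>I J G a. finite I \<Longrightarrow> finite J \<Longrightarrow> I \<inter> J = {} \<Longrightarrow> set_model X G \<Longrightarrow>
      a \<in> pts (prol I (prol J (G :: ('o, 'm, 'm) interp))) P \<Longrightarrow>
      flat I J (act (prol I (prol J G)) h a) = flat I J (act (prol I (prol J G)) h' a)"
  shows "h = h'"
proof -
  interpret FF: separated "Faa (Faa X)" prols2 by (rule separated2)
  show ?thesis
  proof (rule FF.arr_eqI[OF h h'])
    fix G' a assume G': "G' \<in> prols2" and a: "a \<in> pts G' P"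
    obtain I J G where IJ: "finite I" "finite J" "I \<inter> J = {}" "G \<in> hom_interp X ` Obj X" "G' = prol I (prol J G)"
      using G' unfolding prols2_def by blast
    interpret m: set_model "Faa (Faa X)" G' by (rule FF.models[OF G'])
    show "act G' h a = act G' h' a"
      using flat_inject[OF IJ(3) m.act_pts[OF h a, unfolded IJ(5)] m.act_pts[OF h' a, unfolded IJ(5)]
          eq[OF IJ(1-3) set_model_hom[OF IJ(4)] a[unfolded IJ(5)]]] by (simp add: IJ(5))
  qed
qed

section \<open>Compatibility of \<open>\<delta>\<close> with the chosen products\<close>

lemma delta_cmon_one: "delta_cmon X (one_cmon X) = one_cmon (Faa X)"
proof -
  interpret S: separated X "hom_interp X ` Obj X" by (rule separated_hom)
  interpret F: cartesian_category "Faa X" by (rule cartesian_category_Faa)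
  \<comment> \<open>Both structure maps end in the terminal object of \<open>Faa X\<close>, so
    uniqueness identifies them with the chosen arrows.\<close>
  have "fst (snd (delta_cmon X (one_cmon X))) = bang (Faa X) (Prd (Faa X) (One (Faa X)) (One (Faa X)))"
    by (rule F.bang_unique) (use S.delta_add_Hom[OF S.cmon_in_one] in simp)
  moreover have "snd (snd (delta_cmon X (one_cmon X))) = bang (Faa X) (One (Faa X))"
    by (rule F.bang_unique) (use S.delta_zero_Hom[OF S.cmon_in_one] in simp)
  moreover have "fst (delta_cmon X (one_cmon X)) = One (Faa X)" by simp
  ultimately show ?thesis by (metis one_cmon_def prod.collapse)
qed

text \<open>Chosen products must be preserved on the nose, so the structure maps of the two monoids
  have to be equal arrows. Their carriers coincide, and in every prolongation both operations add
  coefficient by coefficient in each of the two factors.\<close>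

lemma delta_cmon_prod:
  assumes M: "cmon_in X M" and N: "cmon_in X N"
  shows "delta_cmon X (prod_cmon X M N) = prod_cmon (Faa X) (delta_cmon X M) (delta_cmon X N)"
proof -
  interpret S: separated X "hom_interp X ` Obj X" by (rule separated_hom)
  interpret F: separated "Faa X" S.prols by (rule S.separated_Faa)
  let ?d = "delta_cmon X (prod_cmon X M N)" and ?e = "prod_cmon (Faa X) (delta_cmon X M) (delta_cmon X N)"
  let ?A = "carr M" and ?B = "carr N"
  have A: "?A \<in> Obj X" and B: "?B \<in> Obj X" using carr_Obj[OF M] carr_Obj[OF N] by auto
  note MN = S.cmon_in_prod[OF M N] and dM = S.cmon_in_delta[OF M] and dN = S.cmon_in_delta[OF N]
  note dMN = S.cmon_in_delta[OF MN] and ddMN = F.cmon_in_prod[OF dM dN]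
  let ?C = "faa_prd X (M, ?A) (N, ?B)"
  have C: "?C = (prod_cmon X M N, Prd X ?A ?B)" by simp
  have cd: "carr ?d = ?C" and ce: "carr ?e = ?C" by simp_all
  have CO: "?C \<in> Obj (Faa X)" using carr_Obj[OF dMN] by simp
  obtain p z where d: "?d = (?C, p, z)" using cd by (metis prod.collapse)
  obtain p' z' where e: "?e = (?C, p', z')" using ce by (metis prod.collapse)
  note dH = cmon_in_Hom[OF dMN[unfolded d]] and eH = cmon_in_Hom[OF ddMN[unfolded e]]
  have mult: "b \<otimes>\<^bsub>pmon G' ?d\<^esub> c = b \<otimes>\<^bsub>pmon G' ?e\<^esub> c" and one: "\<one>\<^bsub>pmon G' ?d\<^esub> = \<one>\<^bsub>pmon G' ?e\<^esub>"
    if G': "G' \<in> S.prols" and b: "b \<in> pts G' ?C" and c: "c \<in> pts G' ?C" for G' b c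
  proof -
    obtain J G where J: "finite J" "G \<in> hom_interp X ` Obj X" "G' = prol J G" using G' by (auto simp: S.prols_def)
    note mG = set_model_hom[OF J(2)]
    interpret G: cat_model X G by (rule S.cat_models[OF J(2)])
    interpret G': cat_model "Faa X" G' by (rule F.cat_models[OF G'])
    interpret dm: comm_monoid "pmon G' ?d" by (rule G'.comm_monoid_pmon[OF dMN])
    interpret em: comm_monoid "pmon G' ?e" by (rule G'.comm_monoid_pmon[OF ddMN])
    have O: "(M, ?A) \<in> Obj (Faa X)" "(N, ?B) \<in> Obj (Faa X)" using M N A B by auto
    from b obtain b1 b2 where b': "b = tup G' b1 b2" "b1 \<in> pts G' (M, ?A)" "b2 \<in> pts G' (N, ?B)"
      using G'.tup_cases[OF O] by (metis Faa_simps(8))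
    from c obtain c1 c2 where c': "c = tup G' c1 c2" "c1 \<in> pts G' (M, ?A)" "c2 \<in> pts G' (N, ?B)"
      using G'.tup_cases[OF O] by (metis Faa_simps(8))
    have at: "e1 S \<in> pts G ?A" "e2 S \<in> pts G ?B"
      if "e1 \<in> pts G' (M, ?A)" "e2 \<in> pts G' (N, ?B)" "S \<subseteq> J" for e1 e2 S
      using prol_pts_at[OF that(1)[unfolded J(3)] that(3)] prol_pts_at[OF that(2)[unfolded J(3)] that(3)] by simp_all
    have carC: "?C = (prod_cmon X M N, carr (prod_cmon X M N))" by simp
    note bc = b[unfolded J(3) carC] c[unfolded J(3) carC]
    have r: "b \<otimes>\<^bsub>pmon G' ?e\<^esub> c = tup G' (b1 \<otimes>\<^bsub>pmon G' (delta_cmon X M)\<^esub> c1) (b2 \<otimes>\<^bsub>pmon G' (delta_cmon X N)\<^esub> c2)"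
      unfolding b'(1) c'(1) by (rule G'.pmon_prod_cmon_tup[OF dM dN]) (use b' c' in simp_all)
    have "b \<otimes>\<^bsub>pmon (prol J G) ?d\<^esub> c =
        tup (prol J G) (b1 \<otimes>\<^bsub>pmon (prol J G) (delta_cmon X M)\<^esub> c1) (b2 \<otimes>\<^bsub>pmon (prol J G) (delta_cmon X N)\<^esub> c2)"
    proof (rule prol_eqI[where J = J])
      fix S assume S: "S \<subseteq> J"
      have "(b \<otimes>\<^bsub>pmon (prol J G) ?d\<^esub> c) S = b S \<otimes>\<^bsub>pmon G (prod_cmon X M N)\<^esub> c S"
        by (rule delta_mult[OF J(1) mG MN bc S])
      also have "\<dots> = tup G (b1 S) (b2 S) \<otimes>\<^bsub>pmon G (prod_cmon X M N)\<^esub> tup G (c1 S) (c2 S)"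
        using S by (simp add: b'(1) c'(1) J(3))
      also have "\<dots> = tup G (b1 S \<otimes>\<^bsub>pmon G M\<^esub> c1 S) (b2 S \<otimes>\<^bsub>pmon G N\<^esub> c2 S)"
        by (rule G.pmon_prod_cmon_tup[OF M N at(1)[OF b'(2,3) S] at(2)[OF b'(2,3) S] at(1)[OF c'(2,3) S] at(2)[OF c'(2,3) S]])
      also have "\<dots> = tup (prol J G) (b1 \<otimes>\<^bsub>pmon (prol J G) (delta_cmon X M)\<^esub> c1) (b2 \<otimes>\<^bsub>pmon (prol J G) (delta_cmon X N)\<^esub> c2) S"
        using S delta_mult[OF J(1) mG M b'(2)[unfolded J(3)] c'(2)[unfolded J(3)] S]
          delta_mult[OF J(1) mG N b'(3)[unfolded J(3)] c'(3)[unfolded J(3)] S] by simp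
      finally show "(b \<otimes>\<^bsub>pmon (prol J G) ?d\<^esub> c) S =
        tup (prol J G) (b1 \<otimes>\<^bsub>pmon (prol J G) (delta_cmon X M)\<^esub> c1) (b2 \<otimes>\<^bsub>pmon (prol J G) (delta_cmon X N)\<^esub> c2) S" .
    qed (simp_all add: delta_mult_ext[OF J(1) mG MN])
    then show "b \<otimes>\<^bsub>pmon G' ?d\<^esub> c = b \<otimes>\<^bsub>pmon G' ?e\<^esub> c" unfolding r by (simp only: J(3))
    show "\<one>\<^bsub>pmon G' ?d\<^esub> = \<one>\<^bsub>pmon G' ?e\<^esub>"
      unfolding G'.pmon_prod_cmon(2)[OF dM dN] unfolding J(3)
    proof (rule prol_eqI[where J = J])
      fix S assume S: "S \<subseteq> J"
      show "\<one>\<^bsub>pmon (prol J G) ?d\<^esub> S = tup (prol J G) \<one>\<^bsub>pmon (prol J G) (delta_cmon X M)\<^esub> \<one>\<^bsub>pmon (prol J G) (delta_cmon X N)\<^esub> S"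
        using S delta_one[OF J(1) mG MN S] delta_one[OF J(1) mG M S] delta_one[OF J(1) mG N S]
          G.pmon_prod_cmon(2)[OF M N] by simp
    qed (simp_all add: delta_mult_ext[OF J(1) mG MN])
  qed
  \<comment> \<open>Every point of a product is a tuple, and on tuples the addition arrow is the
    multiplication of \<open>pmon\<close>; equality of the operations on points is therefore
    equality of the arrows.\<close>
  have "p = p'"
  proof (rule F.arr_eqI[OF dH(2) eH(2)])
    fix G' e assume G': "G' \<in> S.prols" and e: "e \<in> pts G' (Prd (Faa X) ?C ?C)"
    interpret G': cat_model "Faa X" G' by (rule F.cat_models[OF G'])
    from CO CO e obtain b c where bc: "e = tup G' b c" "b \<in> pts G' ?C" "c \<in> pts G' ?C" by (rule G'.tup_cases)
    show "act G' p e = act G' p' e" using mult[OF G' bc(2,3)] by (simp add: bc(1) d \<open>?e = _\<close>)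
  qed
  moreover have "z = z'"
  proof (rule F.arr_eqI[OF dH(3) eH(3)])
    fix G' e assume G': "G' \<in> S.prols" and e: "e \<in> pts G' (One (Faa X))"
    interpret G': cat_model "Faa X" G' by (rule F.cat_models[OF G'])
    have e': "e = pt G'" using e by (simp only: G'.pts_One singleton_iff)
    have "act G' z e \<in> pts G' ?C" by (rule G'.act_pts[OF dH(3) e])
    from one[OF G' this this] show "act G' z e = act G' z' e" by (simp add: e' d \<open>?e = _\<close>)
  qed
  ultimately show ?thesis unfolding d e by simp
qed

lemma delta_obj_prd:
  assumes "faa_ob X P" "faa_ob X Q"
  shows "delta_obj X (faa_prd X P Q) = faa_prd (Faa X) (delta_obj X P) (delta_obj X Q)"
proof -
  obtain M U N V where PQ: "P = (M, U)" "Q = (N, V)" by (metis surj_pair)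
  then show ?thesis using delta_cmon_prod[of M N] assms by (simp add: delta_obj_eq)
qed

lemma delta_obj_Obj: "P \<in> Obj (Faa X) \<Longrightarrow> delta_obj X P \<in> Obj (Faa (Faa X))"
proof -
  interpret S: separated X "hom_interp X ` Obj X" by (rule separated_hom)
  show "P \<in> Obj (Faa X) \<Longrightarrow> delta_obj X P \<in> Obj (Faa (Faa X))"
    by (cases P) (auto simp: delta_obj_eq simp del: delta_obj.simps intro: S.cmon_in_delta)
qed

lemma delta_Hom: "f \<in> Hom (Faa X) P Q \<Longrightarrow> delta_arr X f \<in> Hom (Faa (Faa X)) (delta_obj X P) (delta_obj X Q)"
  by (rule separated.delta_arr_Hom[OF separated_hom])

text \<open>\<open>delta_eqI\<close> and \<open>act_delta_arr\<close> reduce the equations for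
  identities, composites and projections to the corresponding laws of the model
  \<open>prol (I \<union> J) G\<close> of \<open>Faa X\<close>; for projections,
  \<open>flat_tup\<close> identifies the tuples.\<close>

lemma cartesian_functor_comult: "cartesian_functor (Faa X) (Faa (Faa X)) (comult X)"
proof -
  interpret F: cartesian_category "Faa X" by (rule cartesian_category_Faa)
  interpret FF: cartesian_category "Faa (Faa X)" by (rule F.cartesian_category_Faa)
  have co: "on_obj (comult X) = delta_obj X" "on_arr (comult X) = delta_arr X" by (simp_all add: comult_def)
  have m1: "set_model (Faa X) (prol J G)" if "finite J" "set_model X G" for J and G :: "('o, 'm, 'm) interp"
    by (rule set_model_prol[OF that(2,1)])
  have m2: "set_model (Faa (Faa X)) (prol I (prol J G))" if "finite I" "finite J" "set_model X G" for I J and G :: "('o, 'm, 'm) interp"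
    by (rule F.set_model_prol[OF m1[OF that(2,3)] that(1)])
  have fp: "flat I J a \<in> pts (prol (I \<union> J) G) P" if "a \<in> pts (prol I (prol J G)) (delta_obj X P)"
    for I J P and a and G :: "('o, 'm, 'm) interp"
    using flat_pts[of a I J G X] that by (cases P) simp
  show ?thesis
  proof (intro cartesian_functor.intro cartesian_functor_axioms.intro F.cartesian_category_axioms
      FF.cartesian_category_axioms; unfold co)
    show "delta_obj X P \<in> Obj (Faa (Faa X))" if "P \<in> Obj (Faa X)" for P by (rule delta_obj_Obj[OF that])
    show "delta_arr X f \<in> Hom (Faa (Faa X)) (delta_obj X P) (delta_obj X Q)" if "f \<in> Hom (Faa X) P Q" for f P Q
      by (rule delta_Hom[OF that])
    show "delta_arr X (Ide (Faa X) P) = Ide (Faa (Faa X)) (delta_obj X P)" if P: "P \<in> Obj (Faa X)" for P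
    proof (rule delta_eqI[OF delta_Hom[OF F.Ide_Hom[OF P]] FF.Ide_Hom[OF delta_obj_Obj[OF P]]])
      fix I J a and G :: "('o, 'm, 'm) interp" assume IJ: "finite I" "finite J" "I \<inter> J = {}" "set_model X G"
        and a: "a \<in> pts (prol I (prol J G)) (delta_obj X P)"
      have fIJ: "finite (I \<union> J)" using IJ by simp
      show "flat I J (act (prol I (prol J G)) (delta_arr X (Ide (Faa X) P)) a) =
          flat I J (act (prol I (prol J G)) (Ide (Faa (Faa X)) (delta_obj X P)) a)"
        unfolding act_delta_arr[OF IJ F.Ide_Hom[OF P] a] set_model.act_Ide[OF m1[OF fIJ IJ(4)] P fp[OF a]]
          set_model.act_Ide[OF m2[OF IJ(1,2,4)] delta_obj_Obj[OF P] a] ..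
    qed
    show "delta_arr X (f \<cdot>\<^bsub>Faa X\<^esub> g) = delta_arr X f \<cdot>\<^bsub>Faa (Faa X)\<^esub> delta_arr X g"
      if f: "f \<in> Hom (Faa X) P Q" and g: "g \<in> Hom (Faa X) Q R" for f g P Q R
    proof (rule delta_eqI[OF delta_Hom[OF F.Cmp_Hom[OF f g]] FF.Cmp_Hom[OF delta_Hom[OF f] delta_Hom[OF g]]])
      fix I J a and G :: "('o, 'm, 'm) interp" assume IJ: "finite I" "finite J" "I \<inter> J = {}" "set_model X G"
        and a: "a \<in> pts (prol I (prol J G)) (delta_obj X P)"
      have fIJ: "finite (I \<union> J)" using IJ by simp
      show "flat I J (act (prol I (prol J G)) (delta_arr X (f \<cdot>\<^bsub>Faa X\<^esub> g)) a) =
          flat I J (act (prol I (prol J G)) (delta_arr X f \<cdot>\<^bsub>Faa (Faa X)\<^esub> delta_arr X g) a)"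
        unfolding act_delta_arr[OF IJ F.Cmp_Hom[OF f g] a] set_model.act_Cmp[OF m1[OF fIJ IJ(4)] f g fp[OF a]]
          set_model.act_Cmp[OF m2[OF IJ(1,2,4)] delta_Hom[OF f] delta_Hom[OF g] a]
          act_delta_arr[OF IJ g set_model.act_pts[OF m2[OF IJ(1,2,4)] delta_Hom[OF f] a]] act_delta_arr[OF IJ f a] ..
    qed
    show "delta_obj X (One (Faa X)) = One (Faa (Faa X))"
      by (simp add: delta_obj_eq delta_cmon_one del: delta_obj.simps)
    fix P Q assume P: "P \<in> Obj (Faa X)" and Q: "Q \<in> Obj (Faa X)"
    show prd: "delta_obj X (Prd (Faa X) P Q) = Prd (Faa (Faa X)) (delta_obj X P) (delta_obj X Q)"
      using delta_obj_prd P Q by simp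
    note dP = delta_obj_Obj[OF P] and dQ = delta_obj_Obj[OF Q]
    show "delta_arr X (Pr0 (Faa X) P Q) = Pr0 (Faa (Faa X)) (delta_obj X P) (delta_obj X Q)"
    proof (rule delta_eqI[OF delta_Hom[OF F.Pr0_Hom[OF P Q]] FF.Pr0_Hom[OF dP dQ, folded prd]])
      fix I J a and G :: "('o, 'm, 'm) interp" assume IJ: "finite I" "finite J" "I \<inter> J = {}" "set_model X G"
        and a: "a \<in> pts (prol I (prol J G)) (delta_obj X (Prd (Faa X) P Q))"
      have fIJ: "finite (I \<union> J)" using IJ by simp
      interpret m: cat_model "Faa (Faa X)" "prol I (prol J G)"
        using m2[OF IJ(1,2,4)] by (simp add: cat_model_def FF.cartesian_category_axioms)
      from dP dQ a[unfolded prd] obtain b c where bc: "a = tup (prol I (prol J G)) b c"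
        "b \<in> pts (prol I (prol J G)) (delta_obj X P)" "c \<in> pts (prol I (prol J G)) (delta_obj X Q)" by (rule m.tup_cases)
      show "flat I J (act (prol I (prol J G)) (delta_arr X (Pr0 (Faa X) P Q)) a) =
          flat I J (act (prol I (prol J G)) (Pr0 (Faa (Faa X)) (delta_obj X P) (delta_obj X Q)) a)"
        unfolding act_delta_arr[OF IJ F.Pr0_Hom[OF P Q] a] unfolding bc(1) flat_tup
          set_model.act_Pr0[OF m1[OF fIJ IJ(4)] P Q fp[OF bc(2)] fp[OF bc(3)]] m.act_Pr0[OF dP dQ bc(2,3)] ..
    qed
    show "delta_arr X (Pr1 (Faa X) P Q) = Pr1 (Faa (Faa X)) (delta_obj X P) (delta_obj X Q)"
    proof (rule delta_eqI[OF delta_Hom[OF F.Pr1_Hom[OF P Q]] FF.Pr1_Hom[OF dP dQ, folded prd]])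
      fix I J a and G :: "('o, 'm, 'm) interp" assume IJ: "finite I" "finite J" "I \<inter> J = {}" "set_model X G"
        and a: "a \<in> pts (prol I (prol J G)) (delta_obj X (Prd (Faa X) P Q))"
      have fIJ: "finite (I \<union> J)" using IJ by simp
      interpret m: cat_model "Faa (Faa X)" "prol I (prol J G)"
        using m2[OF IJ(1,2,4)] by (simp add: cat_model_def FF.cartesian_category_axioms)
      from dP dQ a[unfolded prd] obtain b c where bc: "a = tup (prol I (prol J G)) b c"
        "b \<in> pts (prol I (prol J G)) (delta_obj X P)" "c \<in> pts (prol I (prol J G)) (delta_obj X Q)" by (rule m.tup_cases)
      show "flat I J (act (prol I (prol J G)) (delta_arr X (Pr1 (Faa X) P Q)) a) =
          flat I J (act (prol I (prol J G)) (Pr1 (Faa (Faa X)) (delta_obj X P) (delta_obj X Q)) a)"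
        unfolding act_delta_arr[OF IJ F.Pr1_Hom[OF P Q] a] unfolding bc(1) flat_tup
          set_model.act_Pr1[OF m1[OF fIJ IJ(4)] P Q fp[OF bc(2)] fp[OF bc(3)]] m.act_Pr1[OF dP dQ bc(2,3)] ..
    qed
  qed
qed

end

section \<open>Naturality and coassociativity\<close>

text \<open>The structure maps are first-order sequences built from the operations of
  \<open>M\<close>, chosen projections and zeros, all of which \<open>F\<close> preserves
  exactly.\<close>

lemma (in cartesian_functor) func_delta_cmon:
  assumes M: "cmon_in X M"
  shows "delta_cmon Y (func_cmon F M) = func_cmon (Faa_func F) (delta_cmon X M)"
proof -
  interpret S: separated X "hom_interp X ` Obj X" by (rule source.separated_hom)
  obtain A p z where M': "M = (A, p, z)" by (metis prod_cases3)
  note H = cmon_in_Hom[OF M[unfolded M']]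
  have AA: "Prd X A A \<in> Obj X" using H source.Prd_Obj by blast
  have ob: "faa_ob X (prod_cmon X M M, Prd X A A)" "faa_ob X (one_cmon X, One X)" "faa_ob X (M, A)"
    using S.cmon_in_prod[OF M M] S.cmon_in_one M H(1) AA source.One_Obj by auto
  have o: "on_obj (Faa_func F) = Faa_func_obj F" "on_arr (Faa_func F) = Faa_func_arr F"
    by (simp_all add: Faa_func_def)
  have one: "func_cmon F (one_cmon X) = one_cmon Y"
    using func_bang source.Prd_Obj source.One_Obj by (simp add: func_cmon_def one_cmon_def on_obj_One on_obj_Prd)
  have MA: "carr M = A" "fst (snd M) = p" "snd (snd M) = z" by (simp_all add: M')
  have FM: "carr (func_cmon F M) = on_obj F A" "fst (snd (func_cmon F M)) = on_arr F p" "snd (snd (func_cmon F M)) = on_arr F z"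
    by (simp_all add: M' func_cmon_def)
  have 1: "on_arr F (Pr0 X (Prd X A A) (Prd X A A) \<cdot>\<^bsub>X\<^esub> p) =
      Pr0 Y (Prd Y (on_obj F A) (on_obj F A)) (Prd Y (on_obj F A) (on_obj F A)) \<cdot>\<^bsub>Y\<^esub> on_arr F p"
    using on_arr_Cmp[OF source.Pr0_Hom[OF AA AA] H(2)] AA H(1) by (simp add: on_arr_Pr0 on_obj_Prd)
  have 2: "on_arr F (Pr0 X (One X) (One X) \<cdot>\<^bsub>X\<^esub> z) = Pr0 Y (One Y) (One Y) \<cdot>\<^bsub>Y\<^esub> on_arr F z"
    using on_arr_Cmp[OF source.Pr0_Hom[OF source.One_Obj source.One_Obj] H(3)] source.One_Obj
    by (simp add: on_arr_Pr0 on_obj_One)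
  show ?thesis
    unfolding func_cmon_def[of "Faa_func F"] o
    unfolding delta_cmon_def fst_conv snd_conv MA FM
      func_first_order[OF ob(1,3)] func_first_order[OF ob(2,3)] Faa_func_obj_eq func_prod_cmon[OF M M] one 1 2
      on_obj_Prd[OF H(1,1)] on_obj_One ..
qed

text \<open>Evaluate in \<open>prol I (prol J G)\<close> for a model \<open>G\<close> of
  \<open>Y\<close>. Prolongation commutes with pulling back, so after flattening both sides are the
  action of \<open>f\<close> in \<open>prol (I \<union> J) (pull F G)\<close>.\<close>

lemma (in cartesian_functor) comult_natural:
  "func_eq (Faa X) (Faa_func F \<Zsemi> comult Y) (comult X \<Zsemi> Faa_func (Faa_func F))"
proof -
  interpret FF: cartesian_functor "Faa X" "Faa Y" "Faa_func F" by (rule cartesian_functor_Faa)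
  have o: "on_obj (Faa_func F) = Faa_func_obj F" "on_arr (Faa_func F) = Faa_func_arr F"
    by (simp_all add: Faa_func_def)
  have ob: "delta_obj Y (Faa_func_obj F P) = Faa_func_obj (Faa_func F) (delta_obj X P)" if P: "P \<in> Obj (Faa X)" for P
  proof -
    obtain M U where PM: "P = (M, U)" by (cases P)
    then have M: "cmon_in X M" using P by simp
    show ?thesis using func_delta_cmon[OF M]
      by (simp add: PM delta_obj_eq Faa_func_obj_eq o del: delta_obj.simps Faa_func_obj.simps)
  qed
  have "delta_arr Y (Faa_func_arr F f) = Faa_func_arr (Faa_func F) (delta_arr X f)" if f: "f \<in> Arr (Faa X)" for f
  proof -
    obtain P Q where fH: "f \<in> Hom (Faa X) P Q" using f by (simp add: Hom_def)
    have P: "P \<in> Obj (Faa X)" and Q: "Q \<in> Obj (Faa X)" using FF.source.Hom_Obj[OF fH] by auto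
    note dfH = source.delta_Hom[OF fH]
    have h: "delta_arr Y (Faa_func_arr F f) \<in> Hom (Faa (Faa Y)) (delta_obj Y (Faa_func_obj F P)) (delta_obj Y (Faa_func_obj F Q))"
      by (rule target.delta_Hom[OF Faa_func_arr_Hom[OF fH]])
    have h': "Faa_func_arr (Faa_func F) (delta_arr X f) \<in> Hom (Faa (Faa Y)) (delta_obj Y (Faa_func_obj F P)) (delta_obj Y (Faa_func_obj F Q))"
      unfolding ob[OF P] ob[OF Q] by (rule FF.Faa_func_arr_Hom[OF dfH])
    show ?thesis
    proof (rule target.delta_eqI[OF h h'])
      fix I J a and G :: "('p, 'n, 'n) interp" assume IJ: "finite I" "finite J" "I \<inter> J = {}" and G: "set_model Y G"
        and a: "a \<in> pts (prol I (prol J G)) (delta_obj Y (Faa_func_obj F P))"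
      have "pull (Faa_func (Faa_func F)) (prol I (prol J G)) = prol I (prol J (pull F G))"
        by (simp only: pull_Faa_func)
      then have "pts (prol I (prol J (pull F G))) (delta_obj X P) =
          pts (pull (Faa_func (Faa_func F)) (prol I (prol J G))) (delta_obj X P)" by simp
      also have "\<dots> = pts (prol I (prol J G)) (delta_obj Y (Faa_func_obj F P))"
        unfolding ob[OF P] by (simp add: Faa_func_def)
      finally have a': "a \<in> pts (prol I (prol J (pull F G))) (delta_obj X P)" using a by simp
      show "flat I J (act (prol I (prol J G)) (delta_arr Y (Faa_func_arr F f)) a) =
          flat I J (act (prol I (prol J G)) (Faa_func_arr (Faa_func F) (delta_arr X f)) a)"
        unfolding target.act_delta_arr[OF IJ G Faa_func_arr_Hom[OF fH] a]
        unfolding act_prol_Faa_func pull_Faa_func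
        unfolding source.act_delta_arr[OF IJ set_model_pull[OF G] fH a'] ..
    qed
  qed
  then show ?thesis using ob by (simp add: func_eq_def comp_func_def comult_def Faa_func_def del: Faa_simps)
qed

text \<open>Prolongation is functorial in the model: a natural map of points that respects tuples
  also respects zero and addition, hence the sums over partitions. It serves to flatten the two
  inner levels of a triple prolongation.\<close>

lemma (in cartesian_category) act_prol_morphism:
  assumes G1: "set_model X G1" and G2: "set_model X G2"
    and pts: "\<And>A e. e \<in> pts G1 A \<Longrightarrow> \<theta> e \<in> pts G2 A"
    and act: "\<And>h A B e. h \<in> Hom X A B \<Longrightarrow> e \<in> pts G1 A \<Longrightarrow> \<theta> (act G1 h e) = act G2 h (\<theta> e)"
    and tup: "\<And>b c. \<theta> (tup G1 b c) = tup G2 (\<theta> b) (\<theta> c)"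
    and I: "finite I" and fH: "f \<in> Hom (Faa X) P Q" and a: "a \<in> pts (prol I G1) P" and S: "S \<subseteq> I"
  shows "\<theta> (act (prol I G1) f a S) = act (prol I G2) f (\<lambda>S \<in> Pow I. \<theta> (a S)) S"
proof -
  interpret G1: cat_model X G1 using G1 by (simp add: cat_model_def cartesian_category_axioms)
  interpret G2: cat_model X G2 using G2 by (simp add: cat_model_def cartesian_category_axioms)
  obtain M U N V where PQ: "P = (M, U)" "Q = (N, V)" by (metis surj_pair)
  obtain s where s: "f = FArr (M, U) (N, V) s" and f: "faa_ar X (FArr (M, U) (N, V) s)"
    using fH unfolding PQ by (rule Hom_FaaE)
  note fD = faa_arD[OF f] and a = a[unfolded PQ]
  let ?a = "\<lambda>S \<in> Pow I. \<theta> (a S)"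
  have x: "a {} \<in> pts G1 U" by (rule prol_pts_base[OF a])
  show ?thesis
  proof (cases "S = {}")
    case True
    then show ?thesis using act[OF fD(5) x] by (simp add: s)
  next
    case False
    have fin: "finite S" using S I finite_subset by blast
    have tuple: "\<theta> (foldr (tup G1) l y) = foldr (tup G2) (map \<theta> l) (\<theta> y)" for l y
      by (induction l) (simp_all add: tup)
    have dm: "\<theta> (dm G1 s m y) = dm G2 s (image_mset \<theta> m) (\<theta> y)"
      if m: "set_mset m \<subseteq> pts G1 (carr M)" "m \<noteq> {#}" and y: "y \<in> pts G1 U" for m y
    proof -
      obtain l where l: "mset l = m" using ex_mset by blast
      then have sl: "set l \<subseteq> pts G1 (carr M)" and nz: "length l \<noteq> 0" using m by auto
      have sl2: "set (map \<theta> l) \<subseteq> pts G2 (carr M)" using sl pts by auto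
      have "\<theta> (dm G1 s (mset l) y) = act G2 (s (length l)) (foldr (tup G2) (map \<theta> l) (\<theta> y))"
        using act[OF fD(6)[OF nz] G1.tuple_pts[OF carr_Obj[OF fD(1)] fD(3) sl y]] G1.dm_list[OF f sl y] tuple by simp
      also have "\<dots> = dm G2 s (mset (map \<theta> l)) (\<theta> y)"
        using G2.dm_list[OF f sl2 pts[OF y]] by simp
      finally show ?thesis by (simp add: l)
    qed
    have hom: "\<theta> (finprod (pmon G1 N) t K) = finprod (pmon G2 N) (\<lambda>k. \<theta> (t k)) K"
      if "\<And>k. k \<in> K \<Longrightarrow> t k \<in> pts G1 (carr N)" for t and K :: "nat set set set"
    proof (rule finprod_hom[OF G1.comm_monoid_pmon[OF fD(2)] G2.comm_monoid_pmon[OF fD(2)]])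
      obtain B p z where N: "N = (B, p, z)" by (metis prod_cases3)
      note H = cmon_in_Hom[OF fD(2)[unfolded N]]
      show "\<theta> (b \<otimes>\<^bsub>pmon G1 N\<^esub> c) = \<theta> b \<otimes>\<^bsub>pmon G2 N\<^esub> \<theta> c"
        if "b \<in> carrier (pmon G1 N)" "c \<in> carrier (pmon G1 N)" for b c
        using that act[OF H(2) G1.tup_pts[OF H(1,1)], of b c] by (simp add: N tup)
      \<comment> \<open>The terminal object has only one point in each model, so the hypothesis on
        tuples need not be supplemented by one on \<open>pt\<close>.\<close>
      have "\<theta> (pt G1) = pt G2" using pts[OF G1.pt_pts] G2.pts_One by blast
      then show "\<theta> \<one>\<^bsub>pmon G1 N\<^esub> = \<one>\<^bsub>pmon G2 N\<^esub>"
        using act[OF H(3) G1.pt_pts] by (simp add: N)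
    qed (use that pts in \<open>auto simp: carrier_pmon\<close>)
    let ?m = "\<lambda>P. image_mset a (mset_set P)"
    have m: "set_mset (?m P) \<subseteq> pts G1 (carr M)" "?m P \<noteq> {#}" if "partition_on S P" for P
      using prol_blocks_pts[OF a fin S that] blocks_mset_nonempty[OF that False fin] by auto
    have "\<theta> (act (prol I G1) f a S) = finprod (pmon G2 N) (\<lambda>P. \<theta> (dm G1 s (?m P) (a {}))) (partitions S)"
      using hom[of "partitions S" "\<lambda>P. dm G1 s (?m P) (a {})"] G1.dm_closed[OF f m x] S False
      by (simp add: s act_prol_fibre)
    also have "\<dots> = finprod (pmon G2 N) (\<lambda>P. dm G2 s (image_mset ?a (mset_set P)) (?a {})) (partitions S)"
    proof (rule comm_monoid.finprod_cong'[OF G2.comm_monoid_pmon[OF fD(2)], symmetric])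
      show eq: "dm G2 s (image_mset ?a (mset_set P)) (?a {}) = \<theta> (dm G1 s (?m P) (a {}))" if "P \<in> partitions S" for P
      proof -
        have P: "partition_on S P" using that by simp
        have "image_mset ?a (mset_set P) = image_mset \<theta> (?m P)"
          unfolding multiset.map_comp
        proof (rule image_mset_cong)
          fix B assume "B \<in># mset_set P"
          then have "B \<subseteq> I" using partition_finite(1)[OF fin P] partition_block[OF P, of B] S by auto
          then show "?a B = (\<theta> \<circ> a) B" by simp
        qed
        then show ?thesis using dm[OF m[OF P] x] by simp
      qed
      show "(\<lambda>P. \<theta> (dm G1 s (?m P) (a {}))) \<in> partitions S \<rightarrow> carrier (pmon G2 N)"
        using pts G1.dm_closed[OF f m x] by (auto simp: carrier_pmon)
    qed simp
    also have "\<dots> = act (prol I G2) f ?a S" using S False by (simp add: s act_prol_fibre)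
    finally show ?thesis .
  qed
qed

section \<open>Coassociativity\<close>

context cartesian_category
begin

text \<open>Coassociativity for the monoid part of an object. On the left \<open>delta_mult\<close>
  applies at both levels; on the right flattening leads to one application in the prolongation by
  \<open>I \<union> J\<close>. In both cases the result is coefficientwise addition in
  \<open>M\<close>.\<close>

lemma comult_delta_cmon:
  assumes M: "cmon_in X M"
  shows "delta_cmon (Faa X) (delta_cmon X M) = func_cmon (comult X) (delta_cmon X M)"
proof -
  interpret S: separated X "hom_interp X ` Obj X" by (rule separated_hom)
  interpret F: separated "Faa X" S.prols by (rule S.separated_Faa)
  interpret FF: cartesian_category "Faa (Faa X)" by (rule F.cartesian_category_Faa)
  interpret C: cartesian_functor "Faa X" "Faa (Faa X)" "comult X" by (rule cartesian_functor_comult)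
  let ?D = "delta_cmon X M" and ?A = "(M, carr M)"
  let ?L = "delta_cmon (Faa X) ?D"
  note D = S.cmon_in_delta[OF M] and DD = F.cmon_in_delta[OF S.cmon_in_delta[OF M]]
  have A: "?A \<in> Obj (Faa X)" using carr_Obj[OF D] by simp
  have dA: "delta_obj X ?A = (?D, ?A)" by (simp add: delta_obj_eq del: delta_obj.simps)
  have co: "on_obj (comult X) = delta_obj X" "on_arr (comult X) = delta_arr X" by (simp_all add: comult_def)
  obtain p z where Dpz: "?D = (?A, p, z)" using carr_delta_cmon[of X M] by (metis prod.collapse)
  obtain p' z' where Lpz: "?L = ((?D, ?A), p', z')" using carr_delta_cmon[of "Faa X" ?D] by (metis prod.collapse carr_delta_cmon)
  note H = cmon_in_Hom[OF D[unfolded Dpz]] and LH = cmon_in_Hom[OF DD[unfolded Lpz]]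
  have prd: "delta_obj X (Prd (Faa X) ?A ?A) = Prd (Faa (Faa X)) (?D, ?A) (?D, ?A)"
    using C.on_obj_Prd[OF A A] unfolding co dA .
  have one: "delta_obj X (One (Faa X)) = One (Faa (Faa X))" using C.on_obj_One unfolding co .
  have "p' = delta_arr X p"
  proof (rule delta_eqI[where Q = ?A and P = "delta_obj X (Prd (Faa X) ?A ?A)"])
    show "p' \<in> Hom (Faa (Faa X)) (delta_obj X (Prd (Faa X) ?A ?A)) (delta_obj X ?A)"
      unfolding prd dA by (rule LH(2))
    show "delta_arr X p \<in> Hom (Faa (Faa X)) (delta_obj X (Prd (Faa X) ?A ?A)) (delta_obj X ?A)"
      by (rule delta_Hom[OF H(2)])
    fix I J a and G :: "('o, 'm, 'm) interp" assume IJ: "finite I" "finite J" "I \<inter> J = {}" and G: "set_model X G"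
      and a: "a \<in> pts (prol I (prol J G)) (delta_obj X (Prd (Faa X) ?A ?A))"
    have fIJ: "finite (I \<union> J)" using IJ by simp
    note GJ = set_model_prol[OF G IJ(2)]
    interpret m: cat_model "Faa (Faa X)" "prol I (prol J G)"
      using F.set_model_prol[OF GJ IJ(1)] by (simp add: cat_model_def FF.cartesian_category_axioms)
    from LH(1) LH(1) a[unfolded prd] obtain b c where bc: "a = tup (prol I (prol J G)) b c"
      "b \<in> pts (prol I (prol J G)) (?D, ?A)" "c \<in> pts (prol I (prol J G)) (?D, ?A)" by (rule m.tup_cases)
    have b: "b \<in> pts (prol I (prol J G)) (?D, carr ?D)" and c: "c \<in> pts (prol I (prol J G)) (?D, carr ?D)"
      using bc by simp_all
    have fb: "flat I J e \<in> pts (prol (I \<union> J) G) ?A" if "e \<in> pts (prol I (prol J G)) (?D, ?A)" for e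
      by (rule flat_pts[where X = X]) (simp only: dA that)
    have "act (prol I (prol J G)) p' a = b \<otimes>\<^bsub>pmon (prol I (prol J G)) ?L\<^esub> c" by (simp add: Lpz bc(1))
    moreover have "act (prol (I \<union> J) G) p (flat I J a) = flat I J b \<otimes>\<^bsub>pmon (prol (I \<union> J) G) ?D\<^esub> flat I J c"
      unfolding bc(1) flat_tup by (simp add: Dpz)
    moreover have "flat I J (b \<otimes>\<^bsub>pmon (prol I (prol J G)) ?L\<^esub> c) = flat I J b \<otimes>\<^bsub>pmon (prol (I \<union> J) G) ?D\<^esub> flat I J c"
    proof (rule prol_eqI[OF flat_ext delta_mult_ext(1)[OF fIJ G M]])
      fix R assume R: "R \<subseteq> I \<union> J"
      have RI: "R \<inter> I \<subseteq> I" and RJ: "R \<inter> J \<subseteq> J" by auto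
      have e: "e (R \<inter> I) \<in> pts (prol J G) ?A" if "e \<in> pts (prol I (prol J G)) (?D, carr ?D)" for e
        using prol_pts_at[OF that RI] by simp
      show "flat I J (b \<otimes>\<^bsub>pmon (prol I (prol J G)) ?L\<^esub> c) R = (flat I J b \<otimes>\<^bsub>pmon (prol (I \<union> J) G) ?D\<^esub> flat I J c) R"
        unfolding flat_at[OF R] F.delta_mult[OF IJ(1) GJ D b c RI] delta_mult[OF IJ(2) G M e[OF b] e[OF c] RJ]
          delta_mult[OF fIJ G M fb[OF bc(2)] fb[OF bc(3)] R] ..
    qed
    ultimately show "flat I J (act (prol I (prol J G)) p' a) = flat I J (act (prol I (prol J G)) (delta_arr X p) a)"
      unfolding act_delta_arr[OF IJ G H(2) a] by simp
  qed
  moreover have "z' = delta_arr X z"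
  proof (rule delta_eqI[where Q = ?A and P = "delta_obj X (One (Faa X))"])
    show "z' \<in> Hom (Faa (Faa X)) (delta_obj X (One (Faa X))) (delta_obj X ?A)"
      unfolding one dA by (rule LH(3))
    show "delta_arr X z \<in> Hom (Faa (Faa X)) (delta_obj X (One (Faa X))) (delta_obj X ?A)"
      by (rule delta_Hom[OF H(3)])
    fix I J a and G :: "('o, 'm, 'm) interp" assume IJ: "finite I" "finite J" "I \<inter> J = {}" and G: "set_model X G"
      and a: "a \<in> pts (prol I (prol J G)) (delta_obj X (One (Faa X)))"
    have fIJ: "finite (I \<union> J)" using IJ by simp
    note GJ = set_model_prol[OF G IJ(2)]
    interpret m: set_model "Faa (Faa X)" "prol I (prol J G)" by (rule F.set_model_prol[OF GJ IJ(1)])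
    interpret m': set_model "Faa X" "prol (I \<union> J) G" by (rule set_model_prol[OF G fIJ])
    have "a = pt (prol I (prol J G))" using a unfolding one m.pts_One by simp
    then have "act (prol I (prol J G)) z' a = \<one>\<^bsub>pmon (prol I (prol J G)) ?L\<^esub>" by (simp add: Lpz)
    moreover have "flat I J a \<in> pts (prol (I \<union> J) G) (One (Faa X))"
      using flat_pts[of a I J G X "one_cmon X" "One X"] a by simp
    then have "flat I J a = pt (prol (I \<union> J) G)" unfolding m'.pts_One by simp
    then have "act (prol (I \<union> J) G) z (flat I J a) = \<one>\<^bsub>pmon (prol (I \<union> J) G) ?D\<^esub>" by (simp add: Dpz)
    moreover have "flat I J \<one>\<^bsub>pmon (prol I (prol J G)) ?L\<^esub> = \<one>\<^bsub>pmon (prol (I \<union> J) G) ?D\<^esub>"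
    proof (rule prol_eqI[OF flat_ext delta_mult_ext(2)[OF fIJ G M]])
      fix R assume R: "R \<subseteq> I \<union> J"
      have RI: "R \<inter> I \<subseteq> I" and RJ: "R \<inter> J \<subseteq> J" by auto
      show "flat I J \<one>\<^bsub>pmon (prol I (prol J G)) ?L\<^esub> R = \<one>\<^bsub>pmon (prol (I \<union> J) G) ?D\<^esub> R"
        unfolding flat_at[OF R] F.delta_one[OF IJ(1) GJ D RI] delta_one[OF IJ(2) G M RJ] delta_one[OF fIJ G M R] ..
    qed
    ultimately show "flat I J (act (prol I (prol J G)) z' a) = flat I J (act (prol I (prol J G)) (delta_arr X z) a)"
      unfolding act_delta_arr[OF IJ G H(3) a] by simp
  qed
  moreover have "func_cmon (comult X) ?D = (delta_obj X ?A, delta_arr X p, delta_arr X z)"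
    unfolding func_cmon_def co by (simp add: Dpz del: delta_obj.simps)
  ultimately show ?thesis by (simp only: Lpz dA)
qed

lemma comult_coassoc_obj:
  assumes "P \<in> Obj (Faa X)"
  shows "delta_obj (Faa X) (delta_obj X P) = Faa_func_obj (comult X) (delta_obj X P)"
proof -
  obtain M U where P: "P = (M, U)" by (cases P)
  then have M: "cmon_in X M" using assms by simp
  have "on_obj (comult X) = delta_obj X" by (simp add: comult_def)
  then show ?thesis
    unfolding P delta_obj_eq[of X] delta_obj_eq[of "Faa X"] Faa_func_obj_eq comult_delta_cmon[OF M]
    by (simp add: delta_obj_eq del: delta_obj.simps)
qed

text \<open>In \<open>prol I (prol J (prol K G))\<close> the left side is flattened by merging
  \<open>I\<close> with \<open>J\<close> and the result with \<open>K\<close>. On the right the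
  functor \<open>comult X\<close> is applied inside the outer prolongation, so \<open>J\<close> is
  merged with \<open>K\<close> before \<open>I\<close> joins. Both give \<open>f\<close> acting in
  the prolongation by \<open>I \<union> J \<union> K\<close>.\<close>

lemma comult_coassoc_arr:
  assumes fH: "f \<in> Hom (Faa X) P Q"
  shows "delta_arr (Faa X) (delta_arr X f) = Faa_func_arr (comult X) (delta_arr X f)"
proof -
  interpret F: cartesian_category "Faa X" by (rule cartesian_category_Faa)
  interpret FFF: separated "Faa (Faa (Faa X))" prols3 by (rule separated3)
  interpret C: cartesian_functor "Faa X" "Faa (Faa X)" "comult X" by (rule cartesian_functor_comult)
  have P: "P \<in> Obj (Faa X)" and Q: "Q \<in> Obj (Faa X)" using F.Hom_Obj[OF fH] by auto
  have co: "on_obj (comult X) = delta_obj X" "on_arr (comult X) = delta_arr X" by (simp_all add: comult_def)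
  note ob = comult_coassoc_obj
  note d = delta_Hom[OF fH]
  have l: "delta_arr (Faa X) (delta_arr X f) \<in> Hom (Faa (Faa (Faa X))) (delta_obj (Faa X) (delta_obj X P)) (delta_obj (Faa X) (delta_obj X Q))"
    by (rule F.delta_Hom[OF d])
  have r: "Faa_func_arr (comult X) (delta_arr X f) \<in> Hom (Faa (Faa (Faa X))) (delta_obj (Faa X) (delta_obj X P)) (delta_obj (Faa X) (delta_obj X Q))"
    unfolding ob[OF P] ob[OF Q] by (rule C.Faa_func_arr_Hom[OF d])
  show ?thesis
  proof (rule FFF.arr_eqI[OF l r])
    fix G' a assume G': "G' \<in> prols3" and a: "a \<in> pts G' (delta_obj (Faa X) (delta_obj X P))"
    obtain I J K G where IJ: "finite I" "finite J" "finite K" "I \<inter> J = {}" "(I \<union> J) \<inter> K = {}"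
      and G: "G \<in> hom_interp X ` Obj X" and G'eq: "G' = prol I (prol J (prol K G))"
      using G' unfolding prols3_def by blast
    note mG = set_model_hom[OF G]
    note mK = set_model_prol[OF mG IJ(3)]
    interpret m: set_model "Faa (Faa (Faa X))" G' by (rule FFF.models[OF G'])
    have fIJ: "finite (I \<union> J)" and fJK: "finite (J \<union> K)" using IJ by auto
    have dJK: "J \<inter> K = {}" "I \<inter> (J \<union> K) = {}" using IJ by auto
    note a' = a[unfolded G'eq]
    let ?f3 = "\<lambda>e. flat (I \<union> J) K (flat I J e)"
    let ?\<theta> = "\<lambda>e. \<lambda>S \<in> Pow I. flat J K (e S)"
    \<comment> \<open>The two orders of flattening agree: each sends a subset of the union to the
      coefficient at its three traces.\<close>
    have f3: "?f3 e = flat I (J \<union> K) (?\<theta> e)" for e :: "nat set \<Rightarrow> nat set \<Rightarrow> nat set \<Rightarrow> 'm"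
    proof (rule prol_eqI[where J = "I \<union> J \<union> K"])
      fix R assume R: "R \<subseteq> I \<union> J \<union> K"
      have "R \<inter> (I \<union> J) \<inter> I = R \<inter> I" "R \<inter> (I \<union> J) \<inter> J = R \<inter> J" "R \<inter> (J \<union> K) \<inter> J = R \<inter> J"
        "R \<inter> (J \<union> K) \<inter> K = R \<inter> K" by auto
      then show "?f3 e R = flat I (J \<union> K) (?\<theta> e) R"
        using R by (simp add: flat_def Un_assoc)
    qed (simp_all add: flat_def Un_assoc)
    have fl: "flat I J e \<in> pts (prol (I \<union> J) (prol K G)) (delta_obj X R)"
      if "e \<in> pts G' (delta_obj (Faa X) (delta_obj X R))" for e R
      using flat_pts[of e I J "prol K G" "Faa X" "fst (delta_obj X R)" "snd (delta_obj X R)"] that by (simp add: G'eq)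
    \<comment> \<open>Flattening twice is injective on these points because the three index sets are
      pairwise disjoint.\<close>
    have inj: "e = e'" if e: "e \<in> pts G' (delta_obj (Faa X) (delta_obj X Q))"
      and e': "e' \<in> pts G' (delta_obj (Faa X) (delta_obj X Q))" and eq: "?f3 e = ?f3 e'" for e e'
      using flat_inject[OF IJ(4) e[unfolded G'eq] e'[unfolded G'eq] flat_inject[OF IJ(5) fl[OF e] fl[OF e'] eq]] .
    have L: "?f3 (act G' (delta_arr (Faa X) (delta_arr X f)) a) = act (prol (I \<union> J \<union> K) G) f (?f3 a)"
      unfolding G'eq F.act_delta_arr[OF IJ(1,2,4) mK d a'] by (rule act_delta_arr[OF fIJ IJ(3,5) mG fH fl[OF a]])
    let ?G1 = "pull (comult X) (prol J (prol K G))" and ?G2 = "prol (J \<union> K) G"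
    have mJK: "set_model (Faa (Faa X)) (prol J (prol K G))" by (rule F.set_model_prol[OF mK IJ(2)])
    have ae: "a \<in> pts (prol I ?G1) (delta_obj X P)"
    proof -
      have "pts (pull (Faa_func (comult X)) (prol I (prol J (prol K G)))) (delta_obj X P) = pts (prol I ?G1) (delta_obj X P)"
        by (simp only: pull_Faa_func)
      then show ?thesis using a'[unfolded ob[OF P]] by (simp add: Faa_func_def)
    qed
    \<comment> \<open>By \<open>act_delta_arr\<close>, flattening \<open>J\<close> and
      \<open>K\<close> is a natural map of models of \<open>Faa X\<close> from the pulled-back
      double prolongation to the prolongation by the union. It can therefore be carried through the
      prolongation by \<open>I\<close>.\<close>
    have \<theta>: "flat J K (act (prol I ?G1) (delta_arr X f) a S) = act (prol I ?G2) (delta_arr X f) (?\<theta> a) S" if "S \<subseteq> I" for S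
    proof (rule F.act_prol_morphism[OF C.set_model_pull[OF mJK] set_model_prol[OF mG fJK] _ _ _ IJ(1) d ae that])
      show "flat J K e \<in> pts ?G2 R" if "e \<in> pts ?G1 R" for R e
        using flat_pts[of e J K G X "fst R" "snd R"] that by (simp add: co)
      show "flat J K (act ?G1 h e) = act ?G2 h (flat J K e)" if h: "h \<in> Hom (Faa X) R T" and e: "e \<in> pts ?G1 R" for h R T e
        using act_delta_arr[OF IJ(2,3) dJK(1) mG h, of e] e by (simp add: co)
      show "flat J K (tup ?G1 b c) = tup ?G2 (flat J K b) (flat J K c)" for b c
        unfolding pull_simps by (rule flat_tup)
    qed
    have \<theta>a: "?\<theta> a \<in> pts (prol I ?G2) (delta_obj X P)"
    proof -
      obtain M U where PM: "P = (M, U)" by (cases P)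
      have aS: "a S \<in> pts (prol J (prol K G)) (delta_obj X (if S = {} then (M, U) else (M, carr M)))" if "S \<subseteq> I" for S
        using prol_pts_at[OF ae[unfolded PM delta_obj_eq] that] by (cases "S = {}") (simp_all add: co del: delta_obj.simps)
      have "?\<theta> a S \<in> pts ?G2 (if S = {} then (M, U) else carr (delta_cmon X M))" if S: "S \<subseteq> I" for S
      proof (cases "S = {}")
        case True
        then show ?thesis using flat_pts[of "a S" J K G X M U] aS[OF S] by simp
      next
        case False
        then show ?thesis using flat_pts[of "a S" J K G X M "carr M"] aS[OF S] S by simp
      qed
      then show ?thesis unfolding PM delta_obj_eq prol_pts_iff by auto
    qed
    have "?f3 (act G' (Faa_func_arr (comult X) (delta_arr X f)) a) =
        flat I (J \<union> K) (?\<theta> (act (prol I ?G1) (delta_arr X f) a))"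
      unfolding f3 G'eq act_prol_Faa_func ..
    also have "?\<theta> (act (prol I ?G1) (delta_arr X f) a) = act (prol I ?G2) (delta_arr X f) (?\<theta> a)"
      by (rule prol_eqI[where J = I]) (use \<theta> in \<open>auto simp: act_prol\<close>)
    also have "flat I (J \<union> K) (act (prol I ?G2) (delta_arr X f) (?\<theta> a)) = act (prol (I \<union> (J \<union> K)) G) f (flat I (J \<union> K) (?\<theta> a))"
      by (rule act_delta_arr[OF IJ(1) fJK dJK(2) mG fH \<theta>a])
    also have "\<dots> = act (prol (I \<union> J \<union> K) G) f (?f3 a)" unfolding f3 by (simp only: Un_assoc)
    finally have R: "?f3 (act G' (Faa_func_arr (comult X) (delta_arr X f)) a) = act (prol (I \<union> J \<union> K) G) f (?f3 a)" .
    show "act G' (delta_arr (Faa X) (delta_arr X f)) a = act G' (Faa_func_arr (comult X) (delta_arr X f)) a"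
      by (rule inj[OF m.act_pts[OF l a] m.act_pts[OF r a]]) (simp only: L R)
  qed
qed

lemma comult_coassoc: "func_eq (Faa X) (comult X \<Zsemi> comult (Faa X)) (comult X \<Zsemi> Faa_func (comult X))"
proof -
  have "delta_arr (Faa X) (delta_arr X f) = Faa_func_arr (comult X) (delta_arr X f)" if "f \<in> Arr (Faa X)" for f
    by (rule comult_coassoc_arr[OF HomI[OF that refl refl]])
  then show ?thesis
    using comult_coassoc_obj by (simp add: func_eq_def comp_func_def comult_def Faa_func_def del: Faa_simps)
qed

section \<open>Counit laws\<close>

lemma comult_counit: "func_eq (Faa X) (comult X \<Zsemi> counit (Faa X)) id_func"
proof -
  have "fseq (delta_arr X f) 0 = f" for f by (cases f) (simp add: delta_arr_eq delta_seq_def)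
  moreover have "snd (delta_obj X P) = P" for P by (cases P) (simp add: delta_obj_eq del: delta_obj.simps)
  ultimately show ?thesis
    by (simp add: func_eq_def comp_func_def comult_def counit_def id_func_def del: Faa_simps)
qed

text \<open>The base component of \<open>\<delta>(f)\<^sub>n\<close> is \<open>f\<^sub>n\<close> for
  every \<open>n\<close>, the index \<open>0\<close> included. On objects, the base components of
  the two structure maps are the original addition and zero.\<close>

lemma comult_Faa_counit: "func_eq (Faa X) (comult X \<Zsemi> Faa_func (counit X)) id_func"
proof -
  have co: "on_obj (counit X) = snd" "on_arr (counit X) = (\<lambda>f. fseq f 0)" by (simp_all add: counit_def)
  have 1: "Faa_func_obj (counit X) (delta_obj X P) = P" for P
  proof -
    obtain A p z U where P: "P = ((A, p, z), U)" by (metis prod_cases3 surj_pair)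
    show ?thesis by (simp add: P co Let_def first_order.simps prod_cmon.simps)
  qed
  have "fseq (delta_seq X P Q s n) 0 = s n" for P Q s n by (simp add: delta_seq_def)
  then have "Faa_func_arr (counit X) (delta_arr X f) = f" for f
    by (cases f) (simp add: delta_arr_eq 1 co del: delta_obj.simps)
  then show ?thesis using 1
    by (simp add: func_eq_def comp_func_def comult_def Faa_func_def id_func_def del: Faa_simps delta_obj.simps)
qed

end

text \<open>\<open>Faa X\<close> has other types of objects and arrows than \<open>X\<close>, so no
  single type of Cartesian categories is closed under the endofunctor. The comonad is therefore
  given by its components and laws, polymorphic in the types, with equality of functors read as
  \<open>func_eq\<close>.\<close>

theorem theorem2p11:
  shows
    \<comment> \<open>\<open>Faa\<close> is an endofunctor\<close>
    "(\<forall>X :: ('o1, 'm1) ccat. cartesian_category X \<longrightarrow> cartesian_category (Faa X)) \<and>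
     (\<forall>(X :: ('o1, 'm1) ccat) (Y :: ('o2, 'm2) ccat) F.
        cartesian_functor X Y F \<longrightarrow> cartesian_functor (Faa X) (Faa Y) (Faa_func F)) \<and>
     (\<forall>(X :: ('o1, 'm1) ccat) (Y :: ('o2, 'm2) ccat) F F'.
        cartesian_functor X Y F \<and> cartesian_functor X Y F' \<and> func_eq X F F' \<longrightarrow>
        func_eq (Faa X) (Faa_func F) (Faa_func F')) \<and>
     (\<forall>X :: ('o1, 'm1) ccat. cartesian_category X \<longrightarrow>
        func_eq (Faa X) (Faa_func id_func) id_func) \<and>
     (\<forall>(X :: ('o1, 'm1) ccat) (Y :: ('o2, 'm2) ccat) (Z :: ('o3, 'm3) ccat) F G.
        cartesian_functor X Y F \<and> cartesian_functor Y Z G \<longrightarrow>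
        func_eq (Faa X) (Faa_func (F \<Zsemi> G)) (Faa_func F \<Zsemi> Faa_func G)) \<and>
     \<comment> \<open>the counit and the comultiplication are natural, with components in \<open>cartCat\<close>\<close>
     (\<forall>X :: ('o1, 'm1) ccat. cartesian_category X \<longrightarrow> cartesian_functor (Faa X) X (counit X)) \<and>
     (\<forall>(X :: ('o1, 'm1) ccat) (Y :: ('o2, 'm2) ccat) F.
        cartesian_functor X Y F \<longrightarrow>
        func_eq (Faa X) (Faa_func F \<Zsemi> counit Y) (counit X \<Zsemi> F)) \<and>
     (\<forall>X :: ('o1, 'm1) ccat. cartesian_category X \<longrightarrow>
        cartesian_functor (Faa X) (Faa (Faa X)) (comult X)) \<and>
     (\<forall>(X :: ('o1, 'm1) ccat) (Y :: ('o2, 'm2) ccat) F.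
        cartesian_functor X Y F \<longrightarrow>
        func_eq (Faa X) (Faa_func F \<Zsemi> comult Y) (comult X \<Zsemi> Faa_func (Faa_func F))) \<and>
     \<comment> \<open>the counit laws and coassociativity\<close>
     (\<forall>X :: ('o1, 'm1) ccat. cartesian_category X \<longrightarrow>
        func_eq (Faa X) (comult X \<Zsemi> counit (Faa X)) id_func \<and>
        func_eq (Faa X) (comult X \<Zsemi> Faa_func (counit X)) id_func \<and>
        func_eq (Faa X) (comult X \<Zsemi> comult (Faa X)) (comult X \<Zsemi> Faa_func (comult X)))"
proof (intro conjI allI impI)
  fix X :: "('o1, 'm1) ccat" assume X: "cartesian_category X"
  show "cartesian_category (Faa X)"
    by (rule cartesian_category.cartesian_category_Faa[OF X])
  show "func_eq (Faa X) (Faa_func id_func) id_func"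
    by (simp only: Faa_func_id func_eq_def) simp
  show "cartesian_functor (Faa X) X (counit X)"
    by (rule cartesian_category.cartesian_functor_counit[OF X])
  show "cartesian_functor (Faa X) (Faa (Faa X)) (comult X)"
    by (rule cartesian_category.cartesian_functor_comult[OF X])
  show "func_eq (Faa X) (comult X \<Zsemi> counit (Faa X)) id_func"
    by (rule cartesian_category.comult_counit[OF X])
  show "func_eq (Faa X) (comult X \<Zsemi> Faa_func (counit X)) id_func"
    by (rule cartesian_category.comult_Faa_counit[OF X])
  show "func_eq (Faa X) (comult X \<Zsemi> comult (Faa X)) (comult X \<Zsemi> Faa_func (comult X))"
    by (rule cartesian_category.comult_coassoc[OF X])
next
  fix X :: "('o1, 'm1) ccat" and Y :: "('o2, 'm2) ccat" and F assume F: "cartesian_functor X Y F"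
  show "cartesian_functor (Faa X) (Faa Y) (Faa_func F)"
    by (rule cartesian_functor.cartesian_functor_Faa[OF F])
  show "func_eq (Faa X) (Faa_func F \<Zsemi> counit Y) (counit X \<Zsemi> F)"
    by (rule counit_natural)
  show "func_eq (Faa X) (Faa_func F \<Zsemi> comult Y) (comult X \<Zsemi> Faa_func (Faa_func F))"
    by (rule cartesian_functor.comult_natural[OF F])
next
  fix X :: "('o1, 'm1) ccat" and Y :: "('o2, 'm2) ccat" and F F'
  assume "cartesian_functor X Y F \<and> cartesian_functor X Y F' \<and> func_eq X F F'"
  then show "func_eq (Faa X) (Faa_func F) (Faa_func F')"
    using Faa_func_cong by (auto simp: cartesian_functor_def)
next
  fix X :: "('o1, 'm1) ccat" and F :: "('o1, 'm1, 'o2, 'm2) func" and G :: "('o2, 'm2, 'o3, 'm3) func"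
  show "func_eq (Faa X) (Faa_func (F \<Zsemi> G)) (Faa_func F \<Zsemi> Faa_func G)"
    by (simp only: Faa_func_comp func_eq_def) simp
qed

end
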